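(* Let $\mathscr B$ be a normal QBF space on $\mathbf R^{2d}$ with respect to $r_0\in(0,1]$ and a submultiplicative $v_0\in\mathscr P_E(\mathbf R^{2d})$, let $\omega_1,\omega_2\in\mathscr P_E(\mathbf R^{2d})$, and let $i$ denote the inclusion map $M(\omega_1,\mathscr B)\to M(\omega_2,\mathscr B)$. Then: (1) if $\omega_2\lesssim\omega_1$, then $M(\omega_1,\mathscr B)\subseteq M(\omega_2,\mathscr B)$ and $i$ is continuous; (2) if $\lim_{|X|\to\infty}\omega_2(X)/\omega_1(X)=0$, then $M(\omega_1,\mathscr B)\subseteq M(\omega_2,\mathscr B)$ and $i$ is compact; (3) if in addition $v_0$ is bounded, then $\omega_2\lesssim\omega_1$ if and only if $M(\omega_1,\mathscr B)\subseteq M(\omega_2,\mathscr B)$ with $i$ continuous; (4) if in addition $v_0$ is bounded, then $\lim_{|X|\to\infty}\omega_2(X)/\omega_1(X)=0$ if and only if $M(\omega_1,\mathscr B)\subseteq M(\omega_2,\mathscr B)$ with $i$ compact.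
   Context: Weights: a weight on $\mathbf R^n$ is a positive $\omega\in L^\infty_{loc}$ with $1/\omega\in L^\infty_{loc}$; $\omega$ is $v$-moderate if $\omega(x+y)\le C\omega(x)v(y)$; $\mathscr P_E(\mathbf R^n)$ = weights moderate w.r.t. some weight; $v$ submultiplicative if $v(x+y)\le v(x)v(y)$, $v(-x)=v(x)$. $A\lesssim B$: $A\le cB$ with $c$ independent of the variables. $\Sigma_1(\mathbf R^d)$: $f\in C^\infty$ with $\sup_{\alpha,\beta}\|x^\alpha\partial^\beta f\|_{L^\infty}/(r^{|\alpha+\beta|}\alpha!\beta!)<\infty$ for all $r>0$; $\Sigma_1'$ its dual. $V_\phi f(x,\xi)=(2\pi)^{-d/2}(f,\phi(\cdot-x)e^{i\langle\cdot,\xi\rangle})$. QBF spaces: a quasi-Banach space of order $r_0\in(0,1]$ satisfies $\|f+g\|^{r_0}\le\|f\|^{r_0}+\|g\|^{r_0}$. A solid QBF space on $\mathbf R^n$: such a space of (classes of) measurable functions with (i) $|f|\le|g|\in\mathscr B\Rightarrow f\in\mathscr B$, $\|f\|\le C\|g\|$; (ii) for each $x$ some $f\in\mathscr B$ has $|f|>c>0$ on a convex non-null set containing $x$. Invariant QBF space w.r.t. $r_0$ and submultiplicative $v_0$: solid QBF of order $r_0$ with $\|f(\cdot-x)\|\le Cv_0(x)\|f\|$; invariant BF space: such a Banach space. Normal QBF space (w.r.t. $r_0,v_0$): there is an invariant BF space $\mathscr B_0$ w.r.t. $v_0^{r_0}$ with $\mathscr B=\{f:|f|^{r_0}\in\mathscr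 B_0\}$ and $\|f\|_{\mathscr B}=\||f|^{r_0}\|_{\mathscr B_0}^{1/r_0}$. $M(\omega,\mathscr B)$: $f\in\Sigma_1'(\mathbf R^d)$ with $\|f\|_{M(\omega,\mathscr B)}=\|V_\phi f\cdot\omega\|_{\mathscr B}<\infty$ for a fixed $\phi\in\Sigma_1(\mathbf R^d)\setminus0$. *)

theory Defs
  imports "HOL-Analysis.Analysis"
begin

definition weight :: "('a::euclidean_space \<Rightarrow> real) \<Rightarrow> bool" where
  "weight w \<longleftrightarrow> w \<in> borel_measurable lborel \<and> (\<forall>x. 0 < w x) \<and>
     (\<forall>K. compact K \<longrightarrow>
        (\<exists>M. AE x in lborel. x \<in> K \<longrightarrow> w x \<le> M) \<and>
        (\<exists>M. AE x in lborel. x \<in> K \<longrightarrow> 1 / w x \<le> M))"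

definition moderate :: "('a::euclidean_space \<Rightarrow> real) \<Rightarrow> ('a \<Rightarrow> real) \<Rightarrow> bool" where
  "moderate w v \<longleftrightarrow> (\<exists>C. \<forall>x y. w (x + y) \<le> C * w x * v y)"

definition PE :: "('a::euclidean_space \<Rightarrow> real) \<Rightarrow> bool" where
  "PE w \<longleftrightarrow> weight w \<and> (\<exists>v. weight v \<and> moderate w v)"

definition submultiplicative :: "('a::euclidean_space \<Rightarrow> real) \<Rightarrow> bool" where
  "submultiplicative v \<longleftrightarrow> (\<forall>x y. v (x + y) \<le> v x * v y) \<and> (\<forall>x. v (- x) = v x)"

text \<open>A space is a set B of measurable complex functions together with a (quasi-)norm N
  (only meaningful on B). Classes modulo null functions are represented by their members.\<close>

definition invariant_BF_space ::
  "('a::euclidean_space \<Rightarrow> complex) set \<Rightarrow> (('a \<Rightarrow> complex) \<Rightarrow> real) \<Rightarrow> ('a \<Rightarrow> real) \<Rightarrow> bool" where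
  "invariant_BF_space B N v \<longleftrightarrow>
     B \<subseteq> borel_measurable lborel \<and>
     (\<forall>f\<in>B. \<forall>g\<in>B. (\<lambda>x. f x + g x) \<in> B) \<and> (\<forall>c. \<forall>f\<in>B. (\<lambda>x. c * f x) \<in> B) \<and>
     (\<forall>f\<in>B. 0 \<le> N f) \<and>
     (\<forall>f\<in>B. \<forall>g\<in>B. N (\<lambda>x. f x + g x) \<le> N f + N g) \<and>
     (\<forall>c. \<forall>f\<in>B. N (\<lambda>x. c * f x) = norm c * N f) \<and>
     (\<forall>f\<in>B. N f = 0 \<longleftrightarrow> (AE x in lborel. f x = 0)) \<and>
     (\<forall>F. (\<forall>n. F n \<in> B) \<and> (\<forall>e>0. \<exists>M. \<forall>m\<ge>M. \<forall>n\<ge>M. N (\<lambda>x. F m x - F n x) < e)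
          \<longrightarrow> (\<exists>g\<in>B. (\<lambda>n. N (\<lambda>x. F n x - g x)) \<longlonglongrightarrow> 0)) \<and>
     (\<exists>C. \<forall>f g. f \<in> borel_measurable lborel \<and> g \<in> B \<and> (AE x in lborel. norm (f x) \<le> norm (g x))
          \<longrightarrow> f \<in> B \<and> N f \<le> C * N g) \<and>
     (\<forall>x. \<exists>f\<in>B. \<exists>c>0. \<exists>S. S \<in> sets lborel \<and> convex S \<and> x \<in> S \<and> emeasure lborel S \<noteq> 0 \<and>
          (\<forall>y\<in>S. c < norm (f y))) \<and>
     (\<exists>C. \<forall>f\<in>B. \<forall>x. (\<lambda>y. f (y - x)) \<in> B \<and> N (\<lambda>y. f (y - x)) \<le> C * v x * N f)"

definition normal_QBF_space ::
  "('a::euclidean_space \<Rightarrow> complex) set \<Rightarrow> (('a \<Rightarrow> complex) \<Rightarrow> real) \<Rightarrow> real \<Rightarrow> ('a \<Rightarrow> real) \<Rightarrow> bool" where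
  "normal_QBF_space B N r0 v0 \<longleftrightarrow>
     (\<exists>B0 N0. invariant_BF_space B0 N0 (\<lambda>x. v0 x powr r0) \<and>
        B = {f. f \<in> borel_measurable lborel \<and> (\<lambda>x. complex_of_real (norm (f x) powr r0)) \<in> B0} \<and>
        (\<forall>f\<in>B. N f = N0 (\<lambda>x. complex_of_real (norm (f x) powr r0)) powr (1 / r0)))"

definition partial_dir :: "'n::finite \<Rightarrow> (real^'n \<Rightarrow> complex) \<Rightarrow> real^'n \<Rightarrow> complex" where
  "partial_dir i f x = vector_derivative (\<lambda>t. f (x + t *\<^sub>R axis i 1)) (at 0)"

fun iter_partial :: "'n::finite list \<Rightarrow> (real^'n \<Rightarrow> complex) \<Rightarrow> real^'n \<Rightarrow> complex" where
  "iter_partial [] f = f"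
| "iter_partial (i # ds) f = partial_dir i (iter_partial ds f)"

definition smooth_fun :: "(real^'n::finite \<Rightarrow> complex) \<Rightarrow> bool" where
  "smooth_fun f \<longleftrightarrow> (\<forall>ds x. iter_partial ds f differentiable (at x))"

definition monom :: "('n::finite \<Rightarrow> nat) \<Rightarrow> real^'n \<Rightarrow> real" where
  "monom \<alpha> x = (\<Prod>i\<in>UNIV. (x $ i) ^ \<alpha> i)"

text \<open>The quantity bounded by C: |x^alpha d^beta f| \<le> C r^{|alpha+beta|} alpha! beta!,
  where beta is the multi-index counting the directions in the list ds.\<close>
definition sigma1_bound :: "real \<Rightarrow> real \<Rightarrow> (real^'n::finite \<Rightarrow> complex) \<Rightarrow> bool" where
  "sigma1_bound r C f \<longleftrightarrow>
     (\<forall>\<alpha> ds x. norm (complex_of_real (monom \<alpha> x) * iter_partial ds f x)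
        \<le> C * r ^ (sum \<alpha> UNIV + length ds) * (\<Prod>i\<in>UNIV. fact (\<alpha> i))
            * (\<Prod>i\<in>UNIV. fact (count_list ds i)))"

definition Sigma1 :: "(real^'n::finite \<Rightarrow> complex) set" where
  "Sigma1 = {f. smooth_fun f \<and> (\<forall>r>0. \<exists>C. sigma1_bound r C f)}"

text \<open>Continuous linear functionals on Sigma_1 (the topology of Sigma_1 is given by the
  directed family of seminorms p_r, r > 0).\<close>
definition Sigma1_dual :: "((real^'n::finite \<Rightarrow> complex) \<Rightarrow> complex) set" where
  "Sigma1_dual = {u.
     (\<forall>f\<in>Sigma1. \<forall>g\<in>Sigma1. u (\<lambda>x. f x + g x) = u f + u g) \<and>
     (\<forall>c. \<forall>f\<in>Sigma1. u (\<lambda>x. c * f x) = c * u f) \<and>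
     (\<exists>r>0. \<exists>C. \<forall>f\<in>Sigma1. \<forall>C'. sigma1_bound r C' f \<longrightarrow> norm (u f) \<le> C * C')}"

text \<open>V_phi f(x,xi) = (2 pi)^(-d/2) (f, phi(.-x) e^{i<.,xi>}), with the pairing
  (f,g) = f(conj g) (conjugate linear in the second argument).\<close>
definition stft :: "((real^'n::finite \<Rightarrow> complex) \<Rightarrow> complex) \<Rightarrow> (real^'n \<Rightarrow> complex)
    \<Rightarrow> (real^'n) \<times> (real^'n) \<Rightarrow> complex" where
  "stft u \<phi> X = complex_of_real ((2 * pi) powr (- real CARD('n) / 2)) *
     u (\<lambda>y. cnj (\<phi> (y - fst X)) * exp (- \<i> * complex_of_real (inner y (snd X))))"

definition modsp :: "(real^'n::finite \<Rightarrow> complex) \<Rightarrow> ((real^'n) \<times> (real^'n) \<Rightarrow> real)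
    \<Rightarrow> ((real^'n) \<times> (real^'n) \<Rightarrow> complex) set \<Rightarrow> ((real^'n \<Rightarrow> complex) \<Rightarrow> complex) set" where
  "modsp \<phi> w B = {u \<in> Sigma1_dual. (\<lambda>X. stft u \<phi> X * complex_of_real (w X)) \<in> B}"

definition modnorm :: "(real^'n::finite \<Rightarrow> complex) \<Rightarrow> ((real^'n) \<times> (real^'n) \<Rightarrow> real)
    \<Rightarrow> (((real^'n) \<times> (real^'n) \<Rightarrow> complex) \<Rightarrow> real) \<Rightarrow> ((real^'n \<Rightarrow> complex) \<Rightarrow> complex) \<Rightarrow> real" where
  "modnorm \<phi> w N u = N (\<lambda>X. stft u \<phi> X * complex_of_real (w X))"

definition incl_continuous :: "('c \<Rightarrow> complex) set \<Rightarrow> (('c \<Rightarrow> complex) \<Rightarrow> real) \<Rightarrow> ('c \<Rightarrow> complex) set \<Rightarrow> (('c \<Rightarrow> complex) \<Rightarrow> real) \<Rightarrow> bool" where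
  "incl_continuous M1 N1 M2 N2 \<longleftrightarrow>
     M1 \<subseteq> M2 \<and> (\<forall>f\<in>M1. \<forall>e>0. \<exists>\<delta>>0. \<forall>g\<in>M1. N1 (\<lambda>x. g x - f x) < \<delta> \<longrightarrow> N2 (\<lambda>x. g x - f x) < e)"

definition incl_compact :: "('c \<Rightarrow> complex) set \<Rightarrow> (('c \<Rightarrow> complex) \<Rightarrow> real) \<Rightarrow> ('c \<Rightarrow> complex) set \<Rightarrow> (('c \<Rightarrow> complex) \<Rightarrow> real) \<Rightarrow> bool" where
  "incl_compact M1 N1 M2 N2 \<longleftrightarrow>
     M1 \<subseteq> M2 \<and> (\<forall>F::nat \<Rightarrow> 'c \<Rightarrow> complex. (\<forall>n. F n \<in> M1) \<and> (\<exists>K. \<forall>n. N1 (F n) \<le> K) \<longrightarrow>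
        (\<exists>(h::nat \<Rightarrow> nat) g. strict_mono h \<and> g \<in> M2 \<and> (\<lambda>n. N2 (\<lambda>x. F (h n) x - g x)) \<longlonglongrightarrow> 0))"

end

(* Write e_X for the time-frequency shifts of the conjugated window, so that up to a constant
   V_phi u(X) = u(e_X).  Fourier inversion gives psi = c * int b_psi(Y) e_Y dY with
   b_psi(Y) = int psi * cnj e_Y, and continuous functionals can be pulled under the integral:
   u(psi) = c * int b_psi(Y) u(e_Y) dY.  Here b_psi decays faster than every exponential, while
   moderate weights grow at most exponentially.

   For (2), applying this formula to psi = e_X bounds the transform F = V_phi u by the convolution
   of |F| with a rapidly decreasing kernel.  Peetre's maximal function trick turns this into a
   bound of |F|^r0 by an exponentially weighted integral of |F|^r0, which is controlled by the norm
   because averages of translates stay in the invariant BF space.  A bounded sequence in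
   M(omega_1, B) therefore has locally equicontinuous transforms of a common exponential growth;
   a subsequence converges locally uniformly, the reproducing formula yields the limit functional,
   and the vanishing of omega_2 / omega_1 at infinity upgrades this to convergence in M(omega_2, B).

   For the converses in (3) and (4) take u_X(psi) = b_psi(X): its transform is concentrated at X,
   so for bounded v_0 its norm in M(omega, B) is comparable to omega(X). *)
theory Submission
  imports Defs "HOL-Complex_Analysis.Great_Picard"
begin

subsection \<open>Exponentially weighted bounds on derivatives\<close>

text \<open>About B only solidity, translation invariance, completeness and local indicators are
  known, so there is no Minkowski inequality for integrals: averages of translates enter as finite
  Riemann sums, infinite sums through completeness. The quasi-norm is avoided by working with r0-th
  powers of moduli, whose norm in \<open>B0\<close> is subadditive. No integral with values in
  \<open>Sigma1\<close> is formed either: pulling a functional under the integral means that Riemann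
  sums of the inversion formula converge in a norm of \<open>Sigma1\<close>, tested derivative by
  derivative. Every functional has its own order of growth, hence the constant in Peetre's argument
  depends at first on the functional; a second pass removes this dependence, which is what makes
  bounded sequences uniformly bounded on balls. The defining seminorms of \<open>Sigma1\<close> are
  traded for exponential weights combined with factorial bounds on the derivatives, because these
  are stable under products, translations and modulations.\<close>

lemma has_derivative_axis_line:
  fixes f :: "'a::real_normed_vector \<Rightarrow> complex"
  assumes "(f has_derivative D) (at (x + t *\<^sub>R v))"
  shows "((\<lambda>s. f (x + s *\<^sub>R v)) has_vector_derivative D v) (at t)"
proof -
  have 1: "((\<lambda>s. x + s *\<^sub>R v) has_derivative (\<lambda>s. s *\<^sub>R v)) (at t)"
    by (auto intro!: derivative_eq_intros)
  have "((\<lambda>s. f (x + s *\<^sub>R v)) has_derivative (\<lambda>s. D (s *\<^sub>R v))) (at t)"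
    using has_derivative_compose[OF 1 assms] .
  moreover have "D (s *\<^sub>R v) = s *\<^sub>R D v" for s
    using assms by (simp add: has_derivative_def bounded_linear.linear linear_scale)
  ultimately show ?thesis by (simp add: has_vector_derivative_def)
qed

lemma partial_dir_eq:
  assumes "(f has_derivative D) (at x)"
  shows "partial_dir i f x = D (axis i 1)"
  unfolding partial_dir_def
  by (rule vector_derivative_at, rule has_derivative_axis_line) (use assms in simp)

lemma partial_dir_add:
  assumes "f differentiable (at x)" "g differentiable (at x)"
  shows "partial_dir i (\<lambda>y. f y + g y) x = partial_dir i f x + partial_dir i g x"
proof -
  obtain D E where D: "(f has_derivative D) (at x)" and E: "(g has_derivative E) (at x)"
    using assms by (auto simp: differentiable_def)
  show ?thesis
    using partial_dir_eq[OF has_derivative_add[OF D E]] partial_dir_eq[OF D] partial_dir_eq[OF E] by simp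
qed

lemma partial_dir_mult:
  assumes "f differentiable (at x)" "g differentiable (at x)"
  shows "partial_dir i (\<lambda>y. f y * g y) x = partial_dir i f x * g x + f x * partial_dir i g x"
proof -
  obtain D E where D: "(f has_derivative D) (at x)" and E: "(g has_derivative E) (at x)"
    using assms by (auto simp: differentiable_def)
  show ?thesis
    using partial_dir_eq[OF has_derivative_mult[OF D E]] partial_dir_eq[OF D] partial_dir_eq[OF E] by simp
qed

lemma partial_dir_bounded_linear:
  assumes "f differentiable (at x)" "bounded_linear h"
  shows "partial_dir i (\<lambda>y. h (f y)) x = h (partial_dir i f x)"
proof -
  obtain D where D: "(f has_derivative D) (at x)"
    using assms by (auto simp: differentiable_def)
  show ?thesis
    using partial_dir_eq[OF bounded_linear.has_derivative[OF assms(2) D]] partial_dir_eq[OF D] by simp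
qed

lemma partial_dir_translate: "partial_dir i (\<lambda>y. f (y - a)) = (\<lambda>y. partial_dir i f (y - a))"
  by (auto simp: partial_dir_def fun_eq_iff algebra_simps)

lemma iter_partial_translate: "iter_partial ds (\<lambda>y. f (y - a)) = (\<lambda>y. iter_partial ds f (y - a))"
  by (induction ds) (simp_all add: partial_dir_translate)

lemma iter_partial_append: "iter_partial (as @ bs) f = iter_partial as (iter_partial bs f)"
  by (induction as) simp_all

lemma smooth_funD: "smooth_fun f \<Longrightarrow> iter_partial ds f differentiable (at x)"
  by (simp add: smooth_fun_def)

lemma smooth_fun_differentiable: "smooth_fun f \<Longrightarrow> f differentiable (at x)"
  using smooth_funD[of f "[]"] by simp

lemma smooth_fun_iter_partial: "smooth_fun f \<Longrightarrow> smooth_fun (iter_partial ds f)"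
  unfolding smooth_fun_def by (metis iter_partial_append)

lemma smooth_fun_partial_dir: "smooth_fun f \<Longrightarrow> smooth_fun (partial_dir i f)"
  using smooth_fun_iter_partial[of f "[i]"] by simp

lemma smooth_fun_continuous: "smooth_fun f \<Longrightarrow> continuous_on S f"
  by (meson continuous_at_imp_continuous_on differentiable_imp_continuous_within smooth_fun_differentiable)

lemma iter_partial_add:
  assumes "smooth_fun f" "smooth_fun g"
  shows "iter_partial ds (\<lambda>y. f y + g y) = (\<lambda>y. iter_partial ds f y + iter_partial ds g y)"
proof (induction ds)
  case (Cons i ds)
  show ?case unfolding iter_partial.simps Cons.IH
    using assms by (intro ext) (simp add: partial_dir_add smooth_funD)
qed simp

lemma smooth_fun_add: "smooth_fun f \<Longrightarrow> smooth_fun g \<Longrightarrow> smooth_fun (\<lambda>y. f y + g y)"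
  by (auto simp: smooth_fun_def iter_partial_add[unfolded smooth_fun_def])

lemma iter_partial_bounded_linear:
  assumes "smooth_fun f" "bounded_linear h"
  shows "iter_partial ds (\<lambda>y. h (f y)) = (\<lambda>y. h (iter_partial ds f y))"
proof (induction ds)
  case (Cons i ds)
  show ?case unfolding iter_partial.simps Cons.IH
    using assms by (intro ext) (simp add: partial_dir_bounded_linear smooth_funD)
qed simp

lemma smooth_fun_bounded_linear:
  assumes "smooth_fun f" "bounded_linear h" shows "smooth_fun (\<lambda>y. h (f y))"
  using assms unfolding smooth_fun_def iter_partial_bounded_linear[OF assms]
  by (metis bounded_linear_imp_differentiable differentiable_compose)

lemma smooth_fun_translate:
  assumes "smooth_fun f" shows "smooth_fun (\<lambda>y. f (y - a))"
  unfolding smooth_fun_def iter_partial_translate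
proof (intro allI)
  fix ds x
  have "iter_partial ds f differentiable (at (x - a))" using assms by (simp add: smooth_funD)
  then show "(\<lambda>y. iter_partial ds f (y - a)) differentiable (at x)"
    by (intro differentiable_compose[of "iter_partial ds f" "\<lambda>y. y - a"]) auto
qed

text \<open>The derivative of a product is a sum of products, so an induction over iterated
  derivatives needs a class of functions that contains both and is closed under
  differentiation.\<close>

inductive product_span :: "(real^'n::finite \<Rightarrow> complex) \<Rightarrow> bool" where
  mult: "smooth_fun f \<Longrightarrow> smooth_fun g \<Longrightarrow> product_span (\<lambda>x. f x * g x)"
| add: "product_span f \<Longrightarrow> product_span g \<Longrightarrow> product_span (\<lambda>x. f x + g x)"

lemma product_span_differentiable: "product_span h \<Longrightarrow> h differentiable (at x)"
  by (induction rule: product_span.induct)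
    (simp_all add: differentiable_mult differentiable_add smooth_fun_differentiable)

lemma product_span_partial_dir: "product_span h \<Longrightarrow> product_span (partial_dir i h)"
proof (induction rule: product_span.induct)
  case (mult f g)
  have eq: "partial_dir i (\<lambda>y. f y * g y) = (\<lambda>y. partial_dir i f y * g y + f y * partial_dir i g y)"
    using mult by (intro ext) (simp add: partial_dir_mult smooth_fun_differentiable)
  show ?case unfolding eq
    using product_span.add[OF product_span.mult[OF smooth_fun_partial_dir[OF mult(1)] mult(2)]
        product_span.mult[OF mult(1) smooth_fun_partial_dir[OF mult(2)]]] .
next
  case (add f g)
  have eq: "partial_dir i (\<lambda>y. f y + g y) = (\<lambda>y. partial_dir i f y + partial_dir i g y)"
    using add by (intro ext) (simp add: partial_dir_add product_span_differentiable)
  show ?case unfolding eq using product_span.add[OF add.IH] .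
qed

lemma smooth_fun_product_span: 
  assumes "product_span h" shows "smooth_fun h"
proof -
  have "product_span (iter_partial ds h)" for ds
    by (induction ds) (simp_all add: assms product_span_partial_dir)
  then show ?thesis by (simp add: smooth_fun_def product_span_differentiable)
qed

lemma smooth_fun_mult: "smooth_fun f \<Longrightarrow> smooth_fun g \<Longrightarrow> smooth_fun (\<lambda>x. f x * g x)"
  by (rule smooth_fun_product_span, rule product_span.mult)

lemma partial_dir_const [simp]: "partial_dir i (\<lambda>x. c) = (\<lambda>x. 0)"
  by (simp add: partial_dir_def fun_eq_iff)

lemma iter_partial_const: "iter_partial ds (\<lambda>x. c) = (if ds = [] then (\<lambda>x. c) else (\<lambda>x. 0))"
  by (induction ds) (auto split: if_splits)

lemma smooth_fun_const: "smooth_fun (\<lambda>x. c)"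
  by (auto simp: smooth_fun_def iter_partial_const)

lemma smooth_fun_cmult: "smooth_fun f \<Longrightarrow> smooth_fun (\<lambda>x. c * f x)"
  using smooth_fun_mult[OF smooth_fun_const] .

lemma iter_partial_cmult: "smooth_fun f \<Longrightarrow> iter_partial ds (\<lambda>x. c * f x) = (\<lambda>x. c * iter_partial ds f x)"
  by (rule iter_partial_bounded_linear[OF _ bounded_linear_mult_right])

lemma smooth_fun_minus: "smooth_fun f \<Longrightarrow> smooth_fun (\<lambda>x. - f x)"
  using smooth_fun_cmult[of f "-1"] by simp

lemma smooth_fun_diff: "smooth_fun f \<Longrightarrow> smooth_fun g \<Longrightarrow> smooth_fun (\<lambda>x. f x - g x)"
  using smooth_fun_add[of f "\<lambda>x. - g x"] smooth_fun_minus[of g] by simp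

lemma iter_partial_diff: "smooth_fun f \<Longrightarrow> smooth_fun g \<Longrightarrow>
    iter_partial ds (\<lambda>y. f y - g y) = (\<lambda>y. iter_partial ds f y - iter_partial ds g y)"
  using iter_partial_add[of f "\<lambda>x. - g x" ds] smooth_fun_minus[of g] iter_partial_cmult[of g ds "-1"] by simp

section \<open>Factorials of multi-indices and exponentially weighted norms\<close>

definition dfact :: "'n::finite list \<Rightarrow> real" where
  "dfact ds = (\<Prod>i\<in>UNIV. fact (count_list ds i))"

lemma dfact_ge_1: "1 \<le> dfact ds"
  unfolding dfact_def by (rule prod_ge_1) (simp add: fact_ge_1)

lemma dfact_pos: "0 < dfact ds" using dfact_ge_1[of ds] by linarith

lemma dfact_Nil [simp]: "dfact [] = 1" by (simp add: dfact_def)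

lemma dfact_cong: "mset as = mset bs \<Longrightarrow> dfact as = dfact bs"
  unfolding dfact_def by (metis count_mset)

lemma dfact_append: "dfact as * dfact bs \<le> dfact (as @ bs)"
proof -
  have "fact m * fact n \<le> (fact (m + n) :: real)" for m n :: nat
  proof -
    have "fact m * fact n dvd (fact (m + n) :: nat)" by (rule fact_fact_dvd_fact)
    then have "fact m * fact n \<le> (fact (m + n) :: nat)" by (rule dvd_imp_le) simp
    then have "real (fact m * fact n) \<le> real (fact (m + n))" by (subst of_nat_le_iff)
    then show ?thesis by simp
  qed
  then show ?thesis unfolding dfact_def prod.distrib[symmetric]
    by (intro prod_mono) (auto simp: count_list_append)
qed

lemma count_list_le_length: "count_list xs x \<le> length xs"
  by (induction xs) auto

text \<open>One more derivative costs a factor that is only geometric in the order, so that a larger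
  radius r absorbs it.\<close>

lemma dfact_Cons_le: "dfact (i # ds) \<le> 2 ^ length ds * dfact ds"
proof -
  have "dfact (i # ds) = (\<Prod>j\<in>UNIV. (if j = i then real (count_list ds i) + 1 else 1) * fact (count_list ds j))"
    unfolding dfact_def by (intro prod.cong) auto
  also have "\<dots> = (real (count_list ds i) + 1) * dfact ds"
    by (simp add: prod.distrib dfact_def)
  also have "real (count_list ds i) + 1 \<le> 2 ^ length ds"
  proof -
    have "count_list ds i + 1 \<le> length ds + 1" by (simp add: count_list_le_length)
    also have "\<dots> \<le> 2 ^ length ds" by (induction ds) auto
    finally have "real (count_list ds i + 1) \<le> real (2 ^ length ds)" by (subst of_nat_le_iff)
    then show ?thesis by simp
  qed
  finally show ?thesis using dfact_pos[of ds] by (simp add: mult_right_mono)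
qed

text \<open>A is an exponential rate in space, negative for decay and positive for growth; r is the
  radius in the factorial bounds. \<open>Sigma1\<close> consists of the functions that satisfy such
  a bound for every A and every r > 0, see \<open>Sigma1_exp_bounded\<close> and
  \<open>Sigma1I\<close>.\<close>

definition exp_bounded :: "real \<Rightarrow> real \<Rightarrow> real \<Rightarrow> (real^'n::finite \<Rightarrow> complex) \<Rightarrow> bool" where
  "exp_bounded A r C f \<longleftrightarrow> smooth_fun f \<and>
    (\<forall>ds x. norm (iter_partial ds f x) \<le> C * exp (A * norm x) * r ^ length ds * dfact ds)"

lemma exp_boundedD:
  "exp_bounded A r C f \<Longrightarrow> norm (iter_partial ds f x) \<le> C * exp (A * norm x) * r ^ length ds * dfact ds"
  by (simp add: exp_bounded_def)

lemma exp_bounded_smooth: "exp_bounded A r C f \<Longrightarrow> smooth_fun f"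
  by (simp add: exp_bounded_def)

lemma exp_bounded_nonneg: 
  assumes "exp_bounded A r C f" shows "0 \<le> C"
proof -
  have "0 \<le> C * exp (A * norm (0::real^'a))"
    using exp_boundedD[OF assms, of "[]" 0] by (simp add: order_trans[OF norm_ge_zero])
  then show ?thesis by simp
qed

lemma exp_bounded_norm: "exp_bounded A r C f \<Longrightarrow> norm (f x) \<le> C * exp (A * norm x)"
  using exp_boundedD[of A r C f "[]" x] by simp

lemma exp_bounded_mono:
  assumes "exp_bounded A r C f" "A \<le> A'" "0 \<le> r" "r \<le> r'" "C \<le> C'"
  shows "exp_bounded A' r' C' f"
  unfolding exp_bounded_def
proof (intro conjI allI)
  fix ds x
  have C: "0 \<le> C" by (rule exp_bounded_nonneg[OF assms(1)])
  have "norm (iter_partial ds f x) \<le> C * exp (A * norm x) * r ^ length ds * dfact ds"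
    by (rule exp_boundedD[OF assms(1)])
  also have "\<dots> \<le> C' * exp (A' * norm x) * r' ^ length ds * dfact ds"
    using assms C dfact_pos[of ds] by (intro mult_mono power_mono) (auto intro: mult_right_mono)
  finally show "norm (iter_partial ds f x) \<le> C' * exp (A' * norm x) * r' ^ length ds * dfact ds" .
qed (rule exp_bounded_smooth[OF assms(1)])

lemma exp_bounded_add:
  assumes "exp_bounded A r C f" "exp_bounded A r C' g"
  shows "exp_bounded A r (C + C') (\<lambda>x. f x + g x)"
  unfolding exp_bounded_def
proof (intro conjI allI)
  note sm = exp_bounded_smooth[OF assms(1)] exp_bounded_smooth[OF assms(2)]
  show "smooth_fun (\<lambda>x. f x + g x)" using sm by (rule smooth_fun_add)
  fix ds x
  show "norm (iter_partial ds (\<lambda>x. f x + g x) x) \<le> (C + C') * exp (A * norm x) * r ^ length ds * dfact ds"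
    unfolding iter_partial_add[OF sm]
    using norm_triangle_ineq[of "iter_partial ds f x" "iter_partial ds g x"]
      exp_boundedD[OF assms(1), of ds x] exp_boundedD[OF assms(2), of ds x]
    by (simp add: algebra_simps)
qed

lemma exp_bounded_cmult:
  assumes "exp_bounded A r C f"
  shows "exp_bounded A r (norm c * C) (\<lambda>x. c * f x)"
  unfolding exp_bounded_def
proof (intro conjI allI)
  note sm = exp_bounded_smooth[OF assms(1)]
  show "smooth_fun (\<lambda>x. c * f x)" using sm by (rule smooth_fun_cmult)
  fix ds x
  show "norm (iter_partial ds (\<lambda>x. c * f x) x) \<le> (norm c * C) * exp (A * norm x) * r ^ length ds * dfact ds"
    unfolding iter_partial_cmult[OF sm]
    using mult_left_mono[OF exp_boundedD[OF assms(1), of ds x], of "norm c"]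
    by (simp add: norm_mult mult.assoc)
qed

text \<open>Leibniz's rule without binomial coefficients: each of the \<open>2 ^ length ds\<close>
  ways to distribute the derivatives over the two factors obeys the same bound, which doubles the
  radius.\<close>

lemma exp_bounded_mult:
  fixes f g :: "real^'n::finite \<Rightarrow> complex"
  assumes f: "exp_bounded A r C f" and g: "exp_bounded A' r C' g" and r: "0 \<le> r"
  shows "exp_bounded (A + A') (2 * r) (C * C') (\<lambda>x. f x * g x)"
proof -
  note sm = exp_bounded_smooth[OF f] exp_bounded_smooth[OF g]
  have C: "0 \<le> C" "0 \<le> C'" using exp_bounded_nonneg f g by auto
  define E where "E x = C * C' * exp ((A + A') * norm x)" for x :: "real^'n"
  have E: "0 \<le> E x" for x using C by (simp add: E_def)
  \<comment> \<open>The innermost direction is split off first. It falls on one of the two factors,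
    and both summands are again products of derivatives, to which the hypothesis for
    \<open>ds\<close> applies with a longer \<open>as\<close> or \<open>bs\<close>. The order of the
    directions does not affect \<open>dfact\<close>.\<close>
  have key: "norm (iter_partial ds (\<lambda>x. iter_partial as f x * iter_partial bs g x) x)
      \<le> 2 ^ length ds * E x * r ^ (length as + length bs + length ds) * dfact (as @ bs @ ds)" for ds as bs x
  proof (induction ds arbitrary: as bs rule: rev_induct)
    case Nil
    have "norm (iter_partial as f x * iter_partial bs g x) \<le>
      (C * exp (A * norm x) * r ^ length as * dfact as) * (C' * exp (A' * norm x) * r ^ length bs * dfact bs)"
      unfolding norm_mult using C r dfact_pos[of as] dfact_pos[of bs]
      by (intro mult_mono exp_boundedD[OF f] exp_boundedD[OF g]) (auto intro!: mult_nonneg_nonneg)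
    also have "\<dots> = E x * r ^ (length as + length bs) * (dfact as * dfact bs)"
      by (simp add: E_def power_add exp_add algebra_simps)
    also have "\<dots> \<le> E x * r ^ (length as + length bs) * dfact (as @ bs)"
      using E r by (intro mult_left_mono dfact_append) auto
    finally show ?case by simp
  next
    case (snoc i ds)
    let ?n = "length as + length bs + length ds + 1"
    have d: "partial_dir i (\<lambda>x. iter_partial as f x * iter_partial bs g x) =
      (\<lambda>x. iter_partial (i # as) f x * iter_partial bs g x + iter_partial as f x * iter_partial (i # bs) g x)"
      using sm by (intro ext) (simp add: partial_dir_mult smooth_funD)
    have "iter_partial (ds @ [i]) (\<lambda>x. iter_partial as f x * iter_partial bs g x) x =
      iter_partial ds (\<lambda>x. iter_partial (i # as) f x * iter_partial bs g x) x +
      iter_partial ds (\<lambda>x. iter_partial as f x * iter_partial (i # bs) g x) x"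
      using iter_partial_add[of "\<lambda>x. iter_partial (i # as) f x * iter_partial bs g x"
            "\<lambda>x. iter_partial as f x * iter_partial (i # bs) g x" ds] sm
      unfolding iter_partial_append by (simp only: iter_partial.simps(1) iter_partial.simps(2)[of i "[]"] d smooth_fun_mult smooth_fun_iter_partial)
    then have "norm (iter_partial (ds @ [i]) (\<lambda>x. iter_partial as f x * iter_partial bs g x) x) \<le>
      norm (iter_partial ds (\<lambda>x. iter_partial (i # as) f x * iter_partial bs g x) x) +
      norm (iter_partial ds (\<lambda>x. iter_partial as f x * iter_partial (i # bs) g x) x)"
      by (simp only: norm_triangle_ineq)
    also have "\<dots> \<le>
      2 ^ length ds * E x * r ^ ?n * dfact ((i # as) @ bs @ ds) +
      2 ^ length ds * E x * r ^ ?n * dfact (as @ (i # bs) @ ds)"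
    proof -
      have l: "length (i # as) + length bs + length ds = ?n" "length as + length (i # bs) + length ds = ?n" by simp_all
      show ?thesis by (rule add_mono[OF snoc[of "i # as" bs, unfolded l] snoc[of as "i # bs", unfolded l]])
    qed
    also have "dfact (as @ (i # bs) @ ds) = dfact (as @ bs @ ds @ [i])" by (rule dfact_cong) simp
    also have "dfact ((i # as) @ bs @ ds) = dfact (as @ bs @ ds @ [i])" by (rule dfact_cong) simp
    finally show ?case by (simp add: mult_ac)
  qed
  show ?thesis unfolding exp_bounded_def
  proof (intro conjI allI smooth_fun_mult sm)
    show "norm (iter_partial ds (\<lambda>x. f x * g x) x)
       \<le> C * C' * exp ((A + A') * norm x) * (2 * r) ^ length ds * dfact ds" for ds x
      using key[of ds "[]" "[]" x] by (simp add: E_def power_mult_distrib algebra_simps)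
  qed
qed

lemma exp_bounded_cnj:
  assumes "exp_bounded A r C f" shows "exp_bounded A r C (\<lambda>x. cnj (f x))"
  unfolding exp_bounded_def iter_partial_bounded_linear[OF exp_bounded_smooth[OF assms] bounded_linear_cnj]
  using assms exp_bounded_smooth[OF assms]
  by (auto simp: exp_boundedD intro: smooth_fun_bounded_linear bounded_linear_cnj)

lemma exp_bounded_translate:
  fixes f :: "real^'n::finite \<Rightarrow> complex"
  assumes "exp_bounded A r C f" and "0 \<le> r" shows "exp_bounded A r (C * exp (\<bar>A\<bar> * norm a)) (\<lambda>x. f (x - a))"
  unfolding exp_bounded_def iter_partial_translate
proof (intro conjI allI)
  show "smooth_fun (\<lambda>x. f (x - a))" using exp_bounded_smooth[OF assms(1)] by (rule smooth_fun_translate)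
  fix ds :: "'n list" and x :: "real^'n"
  have "A * norm (x - a) \<le> A * norm x + \<bar>A\<bar> * norm a"
  proof -
    have "A * (norm (x - a) - norm x) \<le> \<bar>A\<bar> * \<bar>norm (x - a) - norm x\<bar>"
      by (metis abs_ge_self abs_mult)
    also have "\<dots> \<le> \<bar>A\<bar> * norm a"
      using norm_triangle_ineq3[of "x - a" x] by (intro mult_left_mono) auto
    finally show ?thesis by (simp add: algebra_simps)
  qed
  then have "exp (A * norm (x - a)) \<le> exp (\<bar>A\<bar> * norm a) * exp (A * norm x)"
    by (simp add: exp_add[symmetric])
  then have "C * exp (A * norm (x - a)) * r ^ length ds * dfact ds \<le>
      C * (exp (\<bar>A\<bar> * norm a) * exp (A * norm x)) * r ^ length ds * dfact ds"
    using exp_bounded_nonneg[OF assms(1)] dfact_pos[of ds] assms(2)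
    by (intro mult_right_mono mult_left_mono) auto
  then show "norm (iter_partial ds f (x - a)) \<le> C * exp (\<bar>A\<bar> * norm a) * exp (A * norm x) * r ^ length ds * dfact ds"
    using exp_boundedD[OF assms(1), of ds "x - a"] by (simp add: mult.assoc)
qed

text \<open>The power, divided by \<open>fact k * s ^ k\<close>, is a single term of the exponential
  series at x / s.\<close>

lemma power_le_fact_exp:
  fixes x s :: real assumes "0 \<le> x" "0 < s" shows "x ^ k \<le> fact k * s ^ k * exp (x / s)"
proof -
  have "(x / s) ^ k /\<^sub>R fact k \<le> exp (x / s)"
    unfolding exp_def using assms
    by (intro order_trans[OF _ sum_le_suminf[OF summable_exp_generic, of "{k}"]]) auto
  then have "inverse (fact k) * (x / s) ^ k \<le> exp (x / s)" by simp
  then have "fact k * (inverse (fact k) * (x / s) ^ k) \<le> fact k * exp (x / s)"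
    by (rule mult_left_mono) simp
  then have "(x / s) ^ k \<le> fact k * exp (x / s)"
    by (simp add: mult.assoc[symmetric])
  then have "(x / s) ^ k * s ^ k \<le> fact k * exp (x / s) * s ^ k"
    using assms by (intro mult_right_mono) auto
  then show ?thesis using assms by (simp add: power_divide mult_ac)
qed

section \<open>Modulations and differences of translates\<close>

definition modul :: "real^'n::finite \<Rightarrow> real^'n \<Rightarrow> complex" where
  "modul \<xi> y = exp (- \<i> * complex_of_real (inner y \<xi>))"

lemma norm_modul [simp]: "norm (modul \<xi> y) = 1"
  by (simp add: modul_def norm_exp_eq_Re)

lemma modul_has_derivative:
  "(modul \<xi> has_derivative (\<lambda>v. (- \<i> * complex_of_real (inner v \<xi>)) * modul \<xi> y)) (at y)"
  unfolding modul_def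
proof -
  have "((\<lambda>y. - \<i> * complex_of_real (inner y \<xi>)) has_derivative (\<lambda>v. - \<i> * complex_of_real (inner v \<xi>))) (at y)"
    by (auto intro!: derivative_eq_intros)
  from has_derivative_compose[OF this DERIV_exp[unfolded has_field_derivative_def]]
  show "((\<lambda>y. exp (- \<i> * complex_of_real (inner y \<xi>))) has_derivative
     (\<lambda>v. - \<i> * complex_of_real (inner v \<xi>) * exp (- \<i> * complex_of_real (inner y \<xi>)))) (at y)"
    by (simp add: mult_ac)
qed

lemma iter_partial_modul: 
  "iter_partial ds (modul \<xi>) = (\<lambda>y. prod_list (map (\<lambda>i. - \<i> * complex_of_real (\<xi> $ i)) ds) * modul \<xi> y)"
proof (induction ds)
  case (Cons i ds)
  show ?case unfolding iter_partial.simps Cons.IH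
  proof
    fix y
    show "partial_dir i (\<lambda>y. prod_list (map (\<lambda>i. - \<i> * complex_of_real (\<xi> $ i)) ds) * modul \<xi> y) y =
      prod_list (map (\<lambda>i. - \<i> * complex_of_real (\<xi> $ i)) (i # ds)) * modul \<xi> y"
      by (subst partial_dir_eq[OF has_derivative_mult_right[OF modul_has_derivative]])
        (simp add: inner_axis' algebra_simps)
  qed
qed simp

lemma smooth_fun_modul: "smooth_fun (modul \<xi>)"
  unfolding smooth_fun_def iter_partial_modul
  by (auto simp: differentiable_def intro!: has_derivative_mult_right modul_has_derivative)

lemma norm_iter_partial_modul: "norm (iter_partial ds (modul \<xi>) y) \<le> norm \<xi> ^ length ds"
proof -
  have "norm (prod_list (map (\<lambda>i. - \<i> * complex_of_real (\<xi> $ i)) ds)) \<le> norm \<xi> ^ length ds"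
    by (induction ds) (auto simp: norm_mult intro!: mult_mono component_le_norm_cart)
  then show ?thesis by (simp add: iter_partial_modul norm_mult)
qed

text \<open>The power is distributed over the coordinates according to the multi-index, and each
  part is compared with its own factorial; every coordinate contributes one factor
  \<open>exp (x / r)\<close>.\<close>

lemma power_length_le_dfact:
  fixes ds :: "'n::finite list" and x r :: real
  assumes "0 \<le> x" "0 < r"
  shows "x ^ length ds \<le> exp (CARD('n) * x / r) * r ^ length ds * dfact ds"
proof -
  have len: "length ds = (\<Sum>i\<in>UNIV. count_list ds i)" by (simp add: sum_count_set)
  have "x ^ length ds = (\<Prod>i\<in>UNIV. x ^ count_list ds i)" by (simp add: len power_sum)
  also have "\<dots> \<le> (\<Prod>i\<in>UNIV. fact (count_list ds i) * r ^ count_list ds i * exp (x / r))"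
    using assms by (intro prod_mono) (auto intro: power_le_fact_exp)
  also have "\<dots> = exp (CARD('n) * x / r) * r ^ length ds * dfact ds"
    by (simp add: prod.distrib dfact_def len power_sum exp_of_nat_mult[symmetric])
  finally show ?thesis .
qed

lemma exp_bounded_modul:
  fixes \<xi> :: "real^'n::finite"
  assumes "0 < r" shows "exp_bounded 0 r (exp (CARD('n) * norm \<xi> / r)) (modul \<xi>)"
  unfolding exp_bounded_def
  using order_trans[OF norm_iter_partial_modul power_length_le_dfact[OF norm_ge_zero assms]] smooth_fun_modul
  by auto

lemma norm_modul_minus_one: "norm (1 - modul \<eta> y) \<le> norm \<eta> * norm y"
proof -
  have "norm (1 - modul \<eta> y) \<le> \<bar>inner y \<eta>\<bar>"
  proof -
    have eq: "modul \<eta> y = exp (\<i> * complex_of_real (- inner y \<eta>))" by (simp add: modul_def)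
    have "norm (1 - modul \<eta> y) = 2 * \<bar>sin (- inner y \<eta> / 2)\<bar>"
      unfolding norm_minus_commute[of 1] eq by (rule dist_exp_i_1)
    also have "\<dots> \<le> \<bar>inner y \<eta>\<bar>" using abs_sin_le_one abs_sin_x_le_abs_x[of "- inner y \<eta> / 2"] by simp
    finally show ?thesis .
  qed
  also have "\<dots> \<le> norm \<eta> * norm y" using Cauchy_Schwarz_ineq2[of y \<eta>] by (simp add: mult.commute)
  finally show ?thesis .
qed

text \<open>A derivative brings down a factor of size at most the norm of \<eta>, whereas the
  function itself is only bounded by this norm times that of y. The growth rate 1 pays for the
  latter.\<close>

lemma exp_bounded_modul_minus_one:
  fixes \<eta> :: "real^'n::finite"
  assumes r: "0 < r" and \<eta>: "norm \<eta> \<le> 1"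
  shows "exp_bounded 1 r (exp (CARD('n) / r) * norm \<eta>) (\<lambda>y. 1 - modul \<eta> y)"
  unfolding exp_bounded_def
proof (intro conjI allI smooth_fun_diff smooth_fun_const smooth_fun_modul)
  fix ds :: "'n list" and x :: "real^'n"
  have e: "1 \<le> exp (norm x)" "1 \<le> exp (real CARD('n) / r)" using r by auto
  show "norm (iter_partial ds (\<lambda>y. 1 - modul \<eta> y) x)
      \<le> exp (CARD('n) / r) * norm \<eta> * exp (1 * norm x) * r ^ length ds * dfact ds"
  proof (cases ds)
    case Nil
    have "norm x \<le> exp (norm x)" using exp_ge_add_one_self[of "norm x"] by linarith
    then have "norm (1 - modul \<eta> x) \<le> norm \<eta> * exp (norm x)"
      using norm_modul_minus_one[of \<eta> x] by (meson mult_left_mono norm_ge_zero order_trans)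
    also have "\<dots> \<le> exp (real CARD('n) / r) * (norm \<eta> * exp (norm x))"
      using mult_right_mono[OF e(2), of "norm \<eta> * exp (norm x)"] by simp
    finally show ?thesis using Nil by (simp add: mult_ac)
  next
    case (Cons i es)
    have "iter_partial ds (\<lambda>y. 1 - modul \<eta> y) x = - iter_partial ds (modul \<eta>) x"
      using Cons iter_partial_diff[OF smooth_fun_const smooth_fun_modul, of ds 1 \<eta>]
      by (simp add: iter_partial_const)
    then have "norm (iter_partial ds (\<lambda>y. 1 - modul \<eta> y) x) \<le> norm \<eta> ^ length ds"
      using norm_iter_partial_modul[of ds \<eta> x] by simp
    also have "\<dots> \<le> norm \<eta>"
      using Cons \<eta> by (simp add: mult_left_le power_le_one)
    also have "\<dots> \<le> norm \<eta> * (exp (real CARD('n) / r) * r ^ length ds * dfact ds)"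
      using power_length_le_dfact[of 1 r ds] r by (intro mult_left_le_one_le[THEN order_trans] mult_le_cancel_left1[THEN iffD2]) auto
    also have "\<dots> \<le> norm \<eta> * (exp (real CARD('n) / r) * r ^ length ds * dfact ds) * exp (norm x)"
      using e(1) r dfact_pos[of ds] mult_left_mono[OF e(1), of "norm \<eta> * (exp (real CARD('n) / r) * r ^ length ds * dfact ds)"] by simp
    finally show ?thesis by (simp add: mult_ac)
  qed
qed

lemma has_derivative_eq_sum_partial_dir:
  fixes f :: "real^'n::finite \<Rightarrow> complex"
  assumes "f differentiable (at x)"
  shows "(f has_derivative (\<lambda>v. \<Sum>i\<in>UNIV. (v $ i) *\<^sub>R partial_dir i f x)) (at x)"
proof -
  obtain D where D: "(f has_derivative D) (at x)" using assms by (auto simp: differentiable_def)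
  interpret D: bounded_linear D using D by (rule has_derivative_bounded_linear)
  have "D v = (\<Sum>i\<in>UNIV. (v $ i) *\<^sub>R partial_dir i f x)" for v
  proof -
    have "D v = D (\<Sum>i\<in>UNIV. (v $ i) *\<^sub>R axis i 1)"
      using basis_expansion[of v] by (simp add: scalar_mult_eq_scaleR)
    also have "\<dots> = (\<Sum>i\<in>UNIV. (v $ i) *\<^sub>R D (axis i 1))"
      by (simp add: D.sum D.scaleR)
    finally show ?thesis by (simp add: partial_dir_eq[OF D])
  qed
  then have "D = (\<lambda>v. \<Sum>i\<in>UNIV. (v $ i) *\<^sub>R partial_dir i f x)" by blast
  with D show ?thesis by simp
qed

lemma norm_sum_partial_dir_le:
  fixes v :: "real^'n::finite" and M :: real
  assumes "\<And>i. norm (partial_dir i f x) \<le> M"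
  shows "norm (\<Sum>i\<in>UNIV. (v $ i) *\<^sub>R partial_dir i f x) \<le> CARD('n) * M * norm v"
proof -
  have "0 \<le> M" using assms norm_ge_zero order_trans by blast
  then have "norm (\<Sum>i\<in>UNIV. (v $ i) *\<^sub>R partial_dir i f x) \<le> (\<Sum>i\<in>(UNIV::'n set). norm v * M)"
    by (intro sum_norm_le) (auto intro!: mult_mono assms component_le_norm_cart)
  then show ?thesis by (simp add: mult_ac)
qed

text \<open>Mean value estimate along the segment between the two shifted points. The extra
  derivative is the source of the factor r and of the doubled radius.\<close>

lemma exp_bounded_translate_diff:
  fixes f :: "real^'n::finite \<Rightarrow> complex" and A r C :: real
  assumes f: "exp_bounded A r C f" and r: "0 \<le> r"
  shows "exp_bounded A (2 * r) (CARD('n) * C * r * exp (\<bar>A\<bar> * (norm a + norm b)) * norm (a - b))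
     (\<lambda>x. f (x - a) - f (x - b))"
  unfolding exp_bounded_def
proof (intro conjI allI)
  note sm = exp_bounded_smooth[OF f]
  have C: "0 \<le> C" by (rule exp_bounded_nonneg[OF f])
  show "smooth_fun (\<lambda>x. f (x - a) - f (x - b))"
    by (rule smooth_fun_diff[OF smooth_fun_translate[OF sm] smooth_fun_translate[OF sm]])
  fix ds :: "'n list" and x :: "real^'n"
  let ?g = "iter_partial ds f"
  define M where "M = C * exp (A * norm x) * exp (\<bar>A\<bar> * (norm a + norm b)) * r ^ Suc (length ds) * (2 ^ length ds * dfact ds)"
  have bd: "norm (partial_dir i ?g z) \<le> M" if z: "z \<in> closed_segment (x - b) (x - a)" for z i
  proof -
    obtain u where u: "0 \<le> u" "u \<le> 1" "z = x - ((1 - u) *\<^sub>R b + u *\<^sub>R a)"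
      using z by (auto simp: in_segment algebra_simps)
    have "norm ((1 - u) *\<^sub>R b + u *\<^sub>R a) \<le> norm a + norm b"
    proof -
      have "norm ((1 - u) *\<^sub>R b + u *\<^sub>R a) \<le> (1 - u) * norm b + u * norm a"
        using u norm_triangle_ineq[of "(1 - u) *\<^sub>R b" "u *\<^sub>R a"] by simp
      also have "\<dots> \<le> 1 * norm b + 1 * norm a" using u by (intro add_mono mult_right_mono) auto
      finally show ?thesis by simp
    qed
    moreover have "\<bar>norm z - norm x\<bar> \<le> norm ((1 - u) *\<^sub>R b + u *\<^sub>R a)"
      using norm_triangle_ineq3[of x z] unfolding u(3) by (simp add: abs_minus_commute)
    ultimately have d: "\<bar>norm z - norm x\<bar> \<le> norm a + norm b" by linarith
    have "A * (norm z - norm x) \<le> \<bar>A\<bar> * \<bar>norm z - norm x\<bar>"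
      by (metis abs_ge_self abs_mult)
    also have "\<dots> \<le> \<bar>A\<bar> * (norm a + norm b)" using d by (intro mult_left_mono) auto
    finally have "A * norm z \<le> A * norm x + \<bar>A\<bar> * (norm a + norm b)" by (simp add: right_diff_distrib)
    then have e: "exp (A * norm z) \<le> exp (A * norm x) * exp (\<bar>A\<bar> * (norm a + norm b))"
      by (simp add: exp_add[symmetric])
    have "norm (partial_dir i ?g z) \<le> C * exp (A * norm z) * r ^ Suc (length ds) * dfact (i # ds)"
      using exp_boundedD[OF f, of "i # ds" z] by simp
    also have "\<dots> \<le> C * (exp (A * norm x) * exp (\<bar>A\<bar> * (norm a + norm b))) * r ^ Suc (length ds) * (2 ^ length ds * dfact ds)"
      using C r e dfact_pos[of "i # ds"] dfact_Cons_le by (intro mult_mono) auto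
    finally show ?thesis by (simp add: M_def mult_ac)
  qed
  have "norm (?g (x - a) - ?g (x - b)) \<le> CARD('n) * M * norm ((x - a) - (x - b))"
  proof (rule differentiable_bound[of "closed_segment (x - b) (x - a)" ?g "\<lambda>z v. \<Sum>i\<in>UNIV. (v $ i) *\<^sub>R partial_dir i ?g z"])
    fix z assume z: "z \<in> closed_segment (x - b) (x - a)"
    show "(?g has_derivative (\<lambda>v. \<Sum>i\<in>UNIV. (v $ i) *\<^sub>R partial_dir i ?g z)) (at z within closed_segment (x - b) (x - a))"
      by (rule has_derivative_at_withinI[OF has_derivative_eq_sum_partial_dir[OF smooth_funD[OF sm]]])
    show "onorm (\<lambda>v. \<Sum>i\<in>UNIV. (v $ i) *\<^sub>R partial_dir i ?g z) \<le> real CARD('n) * M"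
      by (rule onorm_le) (rule norm_sum_partial_dir_le[OF bd[OF z]])
  qed auto
  also have "norm ((x - a) - (x - b)) = norm (a - b)" by (simp add: norm_minus_commute)
  finally show "norm (iter_partial ds (\<lambda>x. f (x - a) - f (x - b)) x)
      \<le> CARD('n) * C * r * exp (\<bar>A\<bar> * (norm a + norm b)) * norm (a - b) * exp (A * norm x) * (2 * r) ^ length ds * dfact ds"
    unfolding iter_partial_diff[OF smooth_fun_translate[OF sm] smooth_fun_translate[OF sm]] iter_partial_translate
    by (simp add: M_def power_mult_distrib mult_ac)
qed

text \<open>By \<open>power_le_fact_exp\<close> in each coordinate a monomial is at most its
  admissible factorial bound times \<open>exp (CARD('n) * norm x / r)\<close>; the decay rate a
  absorbs this exponential.\<close>

lemma exp_bounded_imp_sigma1_bound: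
  fixes f :: "real^'n::finite \<Rightarrow> complex"
  assumes f: "exp_bounded (- a) r' C f" and r: "0 < r" "0 \<le> r'" "r' \<le> r" "CARD('n) / r \<le> a"
  shows "sigma1_bound r C f"
  unfolding sigma1_bound_def
proof (intro allI)
  fix \<alpha> :: "'n \<Rightarrow> nat" and ds :: "'n list" and x :: "real^'n"
  have C: "0 \<le> C" by (rule exp_bounded_nonneg[OF f])
  have "\<bar>monom \<alpha> x\<bar> \<le> (\<Prod>i\<in>UNIV. fact (\<alpha> i) * r ^ \<alpha> i * exp (norm x / r))"
    unfolding monom_def abs_prod
  proof (rule prod_mono, intro conjI)
    fix i
    have "\<bar>(x $ i) ^ \<alpha> i\<bar> \<le> norm x ^ \<alpha> i" by (simp add: power_abs component_le_norm_cart power_mono)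
    also have "\<dots> \<le> fact (\<alpha> i) * r ^ \<alpha> i * exp (norm x / r)" by (rule power_le_fact_exp) (use r in auto)
    finally show "\<bar>(x $ i) ^ \<alpha> i\<bar> \<le> fact (\<alpha> i) * r ^ \<alpha> i * exp (norm x / r)" .
  qed auto
  also have "\<dots> = (\<Prod>i\<in>UNIV. fact (\<alpha> i)) * r ^ sum \<alpha> UNIV * exp (CARD('n) * norm x / r)"
    by (simp add: prod.distrib power_sum exp_of_nat_mult[symmetric])
  also have "\<dots> \<le> (\<Prod>i\<in>UNIV. fact (\<alpha> i)) * r ^ sum \<alpha> UNIV * exp (a * norm x)"
    using r mult_right_mono[OF r(4), of "norm x"] by (intro mult_left_mono) (auto simp: prod_nonneg)
  finally have 1: "\<bar>monom \<alpha> x\<bar> \<le> (\<Prod>i\<in>UNIV. fact (\<alpha> i)) * r ^ sum \<alpha> UNIV * exp (a * norm x)" .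
  have "norm (iter_partial ds f x) \<le> C * exp (- a * norm x) * r' ^ length ds * dfact ds"
    by (rule exp_boundedD[OF f])
  also have "\<dots> \<le> C * exp (- a * norm x) * r ^ length ds * dfact ds"
    using C r dfact_pos[of ds] by (intro mult_right_mono mult_left_mono power_mono) auto
  finally have 2: "norm (iter_partial ds f x) \<le> C * exp (- a * norm x) * r ^ length ds * dfact ds" .
  have "norm (complex_of_real (monom \<alpha> x) * iter_partial ds f x) \<le>
    ((\<Prod>i\<in>UNIV. fact (\<alpha> i)) * r ^ sum \<alpha> UNIV * exp (a * norm x)) * (C * exp (- a * norm x) * r ^ length ds * dfact ds)"
    unfolding norm_mult norm_of_real using r by (intro mult_mono 1 2) (auto simp: prod_nonneg)
  also have "\<dots> = C * r ^ (sum \<alpha> UNIV + length ds) * (\<Prod>i\<in>UNIV. fact (\<alpha> i)) * dfact ds * (exp (a * norm x) * exp (- a * norm x))"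
    by (simp add: power_add mult_ac)
  also have "exp (a * norm x) * exp (- a * norm x) = 1" by (simp add: exp_add[symmetric])
  finally show "norm (complex_of_real (monom \<alpha> x) * iter_partial ds f x)
        \<le> C * r ^ (sum \<alpha> UNIV + length ds) * (\<Prod>i\<in>UNIV. fact (\<alpha> i)) * (\<Prod>i\<in>UNIV. fact (count_list ds i))"
    by (simp add: dfact_def)
qed

text \<open>Dividing the k-th moment by \<open>fact k * (2 * r) ^ k\<close> and summing over k
  yields an exponential on the left and a geometric series of value 2 on the right. It is applied to
  a coordinate of largest modulus, which is at least \<open>norm x / CARD('n)\<close>. Both
  functions in \<open>Sigma1\<close> and their Fourier transforms get their decay in this
  way.\<close>

lemma exp_decay_of_moments:
  fixes x :: "real^'n::finite" and B D r :: real
  assumes m: "\<And>j k. \<bar>x $ j\<bar> ^ k * D \<le> B * r ^ k * fact k" and r: "0 < r" and D: "0 \<le> D"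
  shows "D \<le> 2 * B * exp (- (1 / (2 * r * CARD('n))) * norm x)"
proof -
  have comp: "exp (\<bar>x $ j\<bar> / (2 * r)) * D \<le> 2 * B" for j
  proof -
    have tm: "(\<bar>x $ j\<bar> / (2 * r)) ^ k /\<^sub>R fact k * D \<le> B * (1/2)^k" for k
    proof -
      have "inverse (fact k * (2 * r) ^ k) * (\<bar>x $ j\<bar> ^ k * D) \<le> inverse (fact k * (2 * r) ^ k) * (B * r ^ k * fact k)"
        using r m[of j k] by (intro mult_left_mono) auto
      also have "\<dots> = B * (1/2)^k" using r by (simp add: power_mult_distrib field_simps)
      finally show ?thesis using r by (simp add: power_divide field_simps)
    qed
    have s1: "(\<lambda>k. (\<bar>x $ j\<bar> / (2 * r)) ^ k /\<^sub>R fact k * D) sums (exp (\<bar>x $ j\<bar> / (2 * r)) * D)"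
      by (intro sums_mult2 exp_converges)
    have s2: "(\<lambda>k. B * (1/2)^k) sums (B * 2)"
      using sums_mult[OF geometric_sums[of "1/2::real"], of B] by simp
    show ?thesis using sums_le[OF tm s1 s2] by simp
  qed
  obtain j where j: "norm x \<le> CARD('n) * \<bar>x $ j\<bar>"
  proof -
    have "finite (range (\<lambda>i. \<bar>x $ i\<bar>))" by simp
    then obtain j where j: "\<bar>x $ j\<bar> = Max (range (\<lambda>i. \<bar>x $ i\<bar>))"
      using Max_in[of "range (\<lambda>i. \<bar>x $ i\<bar>)"] by (metis (no_types, lifting) UNIV_not_empty imageE image_is_empty)
    have "norm x \<le> (\<Sum>i\<in>UNIV. \<bar>x $ i\<bar>)" by (rule norm_le_l1_cart)
    also have "\<dots> \<le> (\<Sum>i\<in>(UNIV::'n set). \<bar>x $ j\<bar>)" by (intro sum_mono) (simp add: j)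
    finally show ?thesis by (intro that[of j]) simp
  qed
  have "exp (norm x / (2 * r * CARD('n))) * D \<le> exp (\<bar>x $ j\<bar> / (2 * r)) * D"
    using j r D by (intro mult_right_mono) (auto simp: field_simps)
  also have "\<dots> \<le> 2 * B" by (rule comp)
  finally have "exp (- (norm x / (2 * r * CARD('n)))) * (exp (norm x / (2 * r * CARD('n))) * D) \<le> exp (- (norm x / (2 * r * CARD('n)))) * (2 * B)"
    by (intro mult_left_mono) auto
  then show ?thesis by (simp add: exp_minus field_simps)
qed

text \<open>The powers of single coordinates among the monomials supply the moments for
  \<open>exp_decay_of_moments\<close>.\<close>

lemma sigma1_bound_imp_exp_bounded:
  fixes f :: "real^'n::finite \<Rightarrow> complex"
  assumes f: "sigma1_bound r C f" "smooth_fun f" and r: "0 < r"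
  shows "exp_bounded (- (1 / (2 * r * CARD('n)))) r (2 * C) f"
  unfolding exp_bounded_def
proof (intro conjI allI f(2))
  fix ds :: "'n list" and x :: "real^'n"
  let ?d = "norm (iter_partial ds f x)" and ?B = "C * r ^ length ds * dfact ds"
  have "\<bar>x $ j\<bar> ^ k * ?d \<le> ?B * r ^ k * fact k" for j k
  proof -
    define \<alpha> :: "'n \<Rightarrow> nat" where "\<alpha> = (\<lambda>i. if i = j then k else 0)"
    have "monom \<alpha> x = (\<Prod>i\<in>UNIV. if i = j then (x $ j) ^ k else 1)"
      unfolding monom_def \<alpha>_def by (intro prod.cong) auto
    then have m: "monom \<alpha> x = (x $ j) ^ k" by simp
    have "(\<Prod>i\<in>UNIV. fact (\<alpha> i)) = (\<Prod>i\<in>UNIV. if i = j then (fact k::real) else 1)"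
      unfolding \<alpha>_def by (intro prod.cong) auto
    then have fa: "(\<Prod>i\<in>UNIV. fact (\<alpha> i)) = (fact k :: real)" by simp
    have su: "sum \<alpha> UNIV = k" by (simp add: \<alpha>_def)
    show ?thesis
      using f(1)[unfolded sigma1_bound_def, rule_format, of \<alpha> x ds]
      by (simp add: m fa su norm_mult norm_power dfact_def power_add mult_ac)
  qed
  from exp_decay_of_moments[OF this r norm_ge_zero]
  show "?d \<le> 2 * C * exp (- (1 / (2 * r * CARD('n))) * norm x) * r ^ length ds * dfact ds"
    by (simp add: mult_ac)
qed

lemma Sigma1_exp_bounded:
  fixes f :: "real^'n::finite \<Rightarrow> complex"
  assumes "f \<in> Sigma1" "0 < r" 
  obtains C where "exp_bounded (- A) r C f"
proof -
  \<comment> \<open>Small enough that the decay rate \<open>1 / (2 * s * CARD('n))\<close> obtained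
    from \<open>sigma1_bound s\<close> is at least A, and that s does not exceed r.\<close>
  define s where "s = min r (1 / (2 * (\<bar>A\<bar> + 1) * CARD('n)))"
  have s: "0 < s" "s \<le> r" "s * (2 * (\<bar>A\<bar> + 1) * CARD('n)) \<le> 1"
  proof -
    have p: "0 < 2 * (\<bar>A\<bar> + 1) * CARD('n)" by (intro mult_pos_pos) auto
    show "0 < s" using assms p by (simp add: s_def)
    have "s \<le> 1 / (2 * (\<bar>A\<bar> + 1) * CARD('n))" by (simp add: s_def)
    then show "s * (2 * (\<bar>A\<bar> + 1) * CARD('n)) \<le> 1" using p by (simp add: pos_le_divide_eq)
  qed (simp add: s_def)
  obtain C where "sigma1_bound s C f" "smooth_fun f" using assms s unfolding Sigma1_def by blast
  then have e: "exp_bounded (- (1 / (2 * s * CARD('n)))) s (2 * C) f"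
    by (rule sigma1_bound_imp_exp_bounded) (rule s)
  have "A \<le> 1 / (2 * s * CARD('n))"
  proof -
    have "A * (2 * s * CARD('n)) \<le> (\<bar>A\<bar> + 1) * (2 * s * CARD('n))"
      using s by (intro mult_right_mono) auto
    then show ?thesis using s by (simp add: field_simps)
  qed
  then show ?thesis using s by (intro that[of "2 * C"] exp_bounded_mono[OF e]) auto
qed

lemma Sigma1I:
  fixes f :: "real^'n::finite \<Rightarrow> complex"
  assumes "\<And>A r. 0 < r \<Longrightarrow> \<exists>C. exp_bounded (- A) r C f"
  shows "f \<in> Sigma1"
  unfolding Sigma1_def
proof (intro CollectI conjI allI impI)
  show "smooth_fun f" using assms[of 1] exp_bounded_smooth by fastforce
  fix r :: real assume r: "0 < r"
  then obtain C where "exp_bounded (- (CARD('n) / r)) r C f" using assms by blast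
  then show "\<exists>C. sigma1_bound r C f" using r by (intro exI, intro exp_bounded_imp_sigma1_bound) auto
qed

section \<open>Time-frequency shifts of the window: the e_X of the overview\<close>

definition atom :: "(real^'n::finite \<Rightarrow> complex) \<Rightarrow> (real^'n) \<times> (real^'n) \<Rightarrow> real^'n \<Rightarrow> complex" where
  "atom \<phi> X = (\<lambda>y. cnj (\<phi> (y - fst X)) * modul (snd X) y)"

lemma exp_bounded_atom:
  fixes \<phi> :: "real^'n::finite \<Rightarrow> complex"
  assumes "exp_bounded (- A) r C \<phi>" "0 < r" "0 \<le> A"
  shows "exp_bounded (- A) (2 * r) (C * exp ((A + CARD('n) / r) * norm X)) (atom \<phi> X)"
proof -
  have 1: "exp_bounded (- A) r (C * exp (\<bar>- A\<bar> * norm (fst X))) (\<lambda>y. cnj (\<phi> (y - fst X)))"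
    using exp_bounded_translate[OF exp_bounded_cnj[OF assms(1)]] assms(2) by simp
  have 2: "exp_bounded (- A) (2 * r) (C * exp (\<bar>- A\<bar> * norm (fst X)) * exp (CARD('n) * norm (snd X) / r)) (atom \<phi> X)"
    using exp_bounded_mult[OF 1 exp_bounded_modul[OF assms(2), of "snd X"]] assms(2) unfolding atom_def by simp
  have "A * norm (fst X) + CARD('n) * norm (snd X) / r \<le> A * norm X + CARD('n) / r * norm X"
    using assms norm_fst_le[of "fst X" "snd X"] norm_snd_le[of "snd X" "fst X"]
    by (intro add_mono) (auto intro!: mult_left_mono divide_right_mono)
  then have "C * exp (\<bar>- A\<bar> * norm (fst X)) * exp (CARD('n) * norm (snd X) / r) \<le> C * exp ((A + CARD('n) / r) * norm X)"
    using exp_bounded_nonneg[OF assms(1)] assms(3)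
    by (simp add: mult.assoc exp_add[symmetric] mult_left_mono distrib_right)
  then show ?thesis using assms by (intro exp_bounded_mono[OF 2]) auto
qed

lemma atom_in_Sigma1:
  assumes "\<phi> \<in> Sigma1" shows "atom \<phi> X \<in> Sigma1"
proof (rule Sigma1I)
  fix A r :: real assume r: "0 < r"
  obtain C where C: "exp_bounded (- \<bar>A\<bar>) (r / 2) C \<phi>" using Sigma1_exp_bounded[OF assms, of "r/2"] r by auto
  show "\<exists>C. exp_bounded (- A) r C (atom \<phi> X)"
    by (rule exI, rule exp_bounded_mono[OF exp_bounded_atom[OF C, of X]]) (use r in auto)
qed

lemma atom_lipschitz:
  fixes \<phi> :: "real^'n::finite \<Rightarrow> complex"
  assumes \<phi>: "\<phi> \<in> Sigma1" and r: "0 < r"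
  obtains C where "0 \<le> C" "\<And>X Y. norm X \<le> R \<Longrightarrow> norm Y \<le> R \<Longrightarrow> norm (X - Y) \<le> 1 \<Longrightarrow>
     exp_bounded (- A) r (C * norm (X - Y)) (\<lambda>y. atom \<phi> X y - atom \<phi> Y y)"
proof -
  \<comment> \<open>Room for two losses: the factor \<open>1 - modul\<close> costs one unit of
    decay, and a difference of translates followed by a product quadruples the radius.\<close>
  define a where "a = \<bar>A\<bar> + 1"
  define s where "s = r / 4"
  have s: "0 < s" using r by (simp add: s_def)
  obtain C0 where C0: "exp_bounded (- a) s C0 \<phi>" using Sigma1_exp_bounded[OF \<phi> s] by blast
  have C0n: "0 \<le> C0" by (rule exp_bounded_nonneg[OF C0])
  \<comment> \<open>The translation is changed first, with the modulation of X kept, and the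
    modulation second, with the translation of Y kept.\<close>
  have e: "cnj (\<phi> (y - fst X)) * modul (snd X) y - cnj (\<phi> (y - fst Y)) * modul (snd Y) y =
      (cnj (\<phi> (y - fst X)) - cnj (\<phi> (y - fst Y))) * modul (snd X) y
      + cnj (\<phi> (y - fst Y)) * modul (snd X) y * (1 - modul (snd Y - snd X) y)" for X Y y
  proof -
    have "modul (snd X) y * modul (snd Y - snd X) y = modul (snd Y) y"
      by (simp add: modul_def exp_add[symmetric] inner_diff_right algebra_simps)
    then show ?thesis by (simp add: algebra_simps)
  qed
  define d where "d = real CARD('n)"
  define K1 where "K1 = d * C0 * s * exp (a * (\<bar>R\<bar> + \<bar>R\<bar>)) * exp (d * \<bar>R\<bar> / (2 * s))"
  define K2 where "K2 = C0 * exp ((a + d / s) * (2 * \<bar>R\<bar>)) * exp (d / (2 * s))"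
  have Kn: "0 \<le> K1" "0 \<le> K2" using C0n s by (auto simp: K1_def K2_def d_def)
  show ?thesis
  proof (rule that[of "K1 + K2"])
    show "0 \<le> K1 + K2" using Kn by simp
    fix X Y :: "(real^'n) \<times> (real^'n)"
    assume X: "norm X \<le> R" and Y: "norm Y \<le> R" and XY: "norm (X - Y) \<le> 1"
    have n: "norm (fst X) \<le> \<bar>R\<bar>" "norm (snd X) \<le> \<bar>R\<bar>" "norm (fst Y) \<le> \<bar>R\<bar>" "norm X \<le> \<bar>R\<bar>"
      "norm (fst X - fst Y) \<le> norm (X - Y)" "norm (snd Y - snd X) \<le> norm (X - Y)"
      using X Y norm_fst_le[of "fst X" "snd X"] norm_snd_le[of "snd X" "fst X"] norm_fst_le[of "fst Y" "snd Y"]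
        norm_fst_le[of "fst (X - Y)" "snd (X - Y)"] norm_snd_le[of "snd (X - Y)" "fst (X - Y)"]
      by (simp_all add: norm_minus_commute[of "snd Y"] del: fst_diff snd_diff) (simp_all add: fst_diff[symmetric] snd_diff[symmetric] del: fst_diff snd_diff)
    have 1: "exp_bounded (- a) (2 * s) (d * C0 * s * exp (\<bar>- a\<bar> * (norm (fst X) + norm (fst Y))) * norm (fst X - fst Y))
        (\<lambda>y. cnj (\<phi> (y - fst X)) - cnj (\<phi> (y - fst Y)))"
      unfolding d_def by (rule exp_bounded_translate_diff[OF exp_bounded_cnj[OF C0]]) (use s in simp)
    have 2: "exp_bounded (- a + 0) (2 * (2 * s)) (d * C0 * s * exp (\<bar>- a\<bar> * (norm (fst X) + norm (fst Y))) * norm (fst X - fst Y) * exp (d * norm (snd X) / (2 * s)))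
        (\<lambda>y. (cnj (\<phi> (y - fst X)) - cnj (\<phi> (y - fst Y))) * modul (snd X) y)"
      unfolding d_def by (rule exp_bounded_mult[OF 1[unfolded d_def] exp_bounded_modul]) (use s in auto)
    have 3: "exp_bounded (- A) r (K1 * norm (X - Y)) (\<lambda>y. (cnj (\<phi> (y - fst X)) - cnj (\<phi> (y - fst Y))) * modul (snd X) y)"
    proof (rule exp_bounded_mono[OF 2])
      have ea: "exp (\<bar>- a\<bar> * (norm (fst X) + norm (fst Y))) \<le> exp (a * (\<bar>R\<bar> + \<bar>R\<bar>))"
        using mult_left_mono[OF add_mono[OF n(1,3)], of a] by (simp add: a_def add.commute)
      have eb: "exp (d * norm (snd X) / (2 * s)) \<le> exp (d * \<bar>R\<bar> / (2 * s))"
        using n s by (simp add: d_def divide_right_mono mult_left_mono)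
      have "d * C0 * s * exp (\<bar>- a\<bar> * (norm (fst X) + norm (fst Y))) * exp (d * norm (snd X) / (2 * s)) * norm (fst X - fst Y) \<le> K1 * norm (X - Y)"
        unfolding K1_def using n s C0n ea eb by (intro mult_mono) (auto simp: d_def)
      then show "d * C0 * s * exp (\<bar>- a\<bar> * (norm (fst X) + norm (fst Y))) * norm (fst X - fst Y) * exp (d * norm (snd X) / (2 * s)) \<le> K1 * norm (X - Y)"
        by (simp add: mult_ac)
    qed (use s in \<open>auto simp: a_def s_def\<close>)
    have 4: "exp_bounded (- a) (2 * s) (C0 * exp ((a + d / s) * norm (fst Y, snd X))) (\<lambda>y. cnj (\<phi> (y - fst Y)) * modul (snd X) y)"
      using exp_bounded_atom[OF C0 s, of "(fst Y, snd X)"] unfolding atom_def d_def by (simp add: a_def)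
    have 4: "exp_bounded (- a) (2 * s) (C0 * exp ((a + d / s) * (2 * \<bar>R\<bar>))) (\<lambda>y. cnj (\<phi> (y - fst Y)) * modul (snd X) y)"
    proof (rule exp_bounded_mono[OF 4])
      have "norm (fst Y, snd X) \<le> norm (fst Y) + norm (snd X)" by (rule norm_Pair_le)
      then have "norm (fst Y, snd X) \<le> 2 * \<bar>R\<bar>" using n by linarith
      then have "(a + d / s) * norm (fst Y, snd X) \<le> (a + d / s) * (2 * \<bar>R\<bar>)"
        using s by (intro mult_left_mono) (auto simp: a_def d_def)
      then show "C0 * exp ((a + d / s) * norm (fst Y, snd X)) \<le> C0 * exp ((a + d / s) * (2 * \<bar>R\<bar>))"
        using C0n by (intro mult_left_mono) auto
    qed (use s in auto)
    have 5: "exp_bounded (- a + 1) (2 * (2 * s)) (C0 * exp ((a + d / s) * (2 * \<bar>R\<bar>)) * (exp (d / (2 * s)) * norm (snd Y - snd X)))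
        (\<lambda>y. cnj (\<phi> (y - fst Y)) * modul (snd X) y * (1 - modul (snd Y - snd X) y))"
      unfolding d_def by (rule exp_bounded_mult[OF 4[unfolded d_def] exp_bounded_modul_minus_one]) (use s n XY in auto)
    have 6: "exp_bounded (- A) r (K2 * norm (X - Y))
        (\<lambda>y. cnj (\<phi> (y - fst Y)) * modul (snd X) y * (1 - modul (snd Y - snd X) y))"
    proof (rule exp_bounded_mono[OF 5])
      have "C0 * exp ((a + d / s) * (2 * \<bar>R\<bar>)) * exp (d / (2 * s)) * norm (snd Y - snd X) \<le> K2 * norm (X - Y)"
        unfolding K2_def using n C0n by (intro mult_mono) auto
      then show "C0 * exp ((a + d / s) * (2 * \<bar>R\<bar>)) * (exp (d / (2 * s)) * norm (snd Y - snd X)) \<le> K2 * norm (X - Y)"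
        by (simp add: mult_ac)
    qed (use s in \<open>auto simp: a_def s_def\<close>)
    show "exp_bounded (- A) r ((K1 + K2) * norm (X - Y)) (\<lambda>y. atom \<phi> X y - atom \<phi> Y y)"
      using exp_bounded_add[OF 3 6] unfolding atom_def e distrib_right .
  qed
qed

subsection \<open>Fourier inversion\<close>

lemma integral_lborel_affine:
  fixes f :: "'a::euclidean_space \<Rightarrow> 'b::{banach, second_countable_topology}"
  assumes [measurable]: "f \<in> borel_measurable borel" and c: "c \<noteq> 0"
  shows "integral\<^sup>L lborel f = \<bar>c\<bar> ^ DIM('a) *\<^sub>R (\<integral>x. f (t + c *\<^sub>R x) \<partial>lborel)"
proof -
  have "integral\<^sup>L lborel f = integral\<^sup>L (density (distr lborel borel (\<lambda>x. t + c *\<^sub>R x)) (\<lambda>_. ennreal (\<bar>c\<bar> ^ DIM('a)))) f"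
    using lborel_affine[OF c, of t] by simp
  also have "\<dots> = (\<integral>x. \<bar>c\<bar> ^ DIM('a) *\<^sub>R f x \<partial>distr lborel borel (\<lambda>x. t + c *\<^sub>R x))"
    by (rule integral_density) auto
  also have "\<dots> = (\<integral>x. \<bar>c\<bar> ^ DIM('a) *\<^sub>R f (t + c *\<^sub>R x) \<partial>lborel)"
    by (rule integral_distr) auto
  finally show ?thesis by simp
qed

lemma integral_lborel_translate:
  fixes f :: "'a::euclidean_space \<Rightarrow> 'b::{banach, second_countable_topology}"
  assumes "f \<in> borel_measurable borel"
  shows "(\<integral>x. f (x + t) \<partial>lborel) = integral\<^sup>L lborel f"
  using integral_lborel_affine[OF assms, of 1 t] by (simp add: add.commute)

lemma integral_lborel_reflect:
  fixes f :: "'a::euclidean_space \<Rightarrow> 'b::{banach, second_countable_topology}"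
  assumes "f \<in> borel_measurable borel"
  shows "(\<integral>x. f (t - x) \<partial>lborel) = integral\<^sup>L lborel f"
  using integral_lborel_affine[OF assms, of "-1" t] by simp

lemma integrable_lborel_affine:
  fixes f :: "'a::euclidean_space \<Rightarrow> 'b::{banach, second_countable_topology}"
  assumes f: "integrable lborel f" and c: "c \<noteq> 0"
  shows "integrable lborel (\<lambda>x. f (t + c *\<^sub>R x))"
proof -
  have [measurable]: "f \<in> borel_measurable borel" using borel_measurable_integrable[OF f] by simp
  have "integrable (density (distr lborel borel (\<lambda>x. t + c *\<^sub>R x)) (\<lambda>_. ennreal (\<bar>c\<bar> ^ DIM('a)))) f"
    using f lborel_affine[OF c, of t] by simp
  then have "integrable (distr lborel borel (\<lambda>x. t + c *\<^sub>R x)) (\<lambda>x. \<bar>c\<bar> ^ DIM('a) *\<^sub>R f x)"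
    by (subst (asm) integrable_density) auto
  then have "integrable lborel (\<lambda>x. \<bar>c\<bar> ^ DIM('a) *\<^sub>R f (t + c *\<^sub>R x))"
    by (subst (asm) integrable_distr_eq) auto
  then have "integrable lborel (\<lambda>x. inverse (\<bar>c\<bar> ^ DIM('a)) *\<^sub>R \<bar>c\<bar> ^ DIM('a) *\<^sub>R f (t + c *\<^sub>R x))"
    by (rule integrable_scaleR_right)
  then show ?thesis using c by simp
qed

text \<open>The layer on which the integer part of the norm is k lies in a ball of radius k + 1. Its
  volume grows polynomially in k, which half of the exponential decay absorbs.\<close>

lemma integrable_exp_norm:
  assumes a: "0 < a"
  shows "integrable lborel (\<lambda>x::'a::euclidean_space. exp (- a * norm x))"
proof (rule integrableI_nonneg)
  let ?n = "DIM('a)" and ?V = "unit_ball_vol (real DIM('a))"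
  define c where "c k = exp (- a * real k) * (?V * (real k + 1) ^ ?n)" for k
  have V: "0 \<le> ?V" by simp
  have c0: "0 \<le> c k" for k by (simp add: c_def)
  have "summable c"
  proof (rule summable_comparison_test)
    show "summable (\<lambda>k. ?V * fact ?n * (2 / a) ^ ?n * exp (a / 2) * exp (- a / 2) ^ k)"
      using a by (intro summable_mult summable_geometric) auto
    show "\<exists>N. \<forall>k\<ge>N. norm (c k) \<le> ?V * fact ?n * (2 / a) ^ ?n * exp (a / 2) * exp (- a / 2) ^ k"
    proof (intro exI allI impI)
      fix k
      have "(real k + 1) ^ ?n \<le> fact ?n * (2 / a) ^ ?n * exp ((real k + 1) / (2 / a))"
        by (rule power_le_fact_exp) (use a in auto)
      then have "c k \<le> exp (- a * real k) * (?V * (fact ?n * (2 / a) ^ ?n * exp ((real k + 1) / (2 / a))))"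
        unfolding c_def by (intro mult_left_mono) auto
      also have "\<dots> = ?V * fact ?n * (2 / a) ^ ?n * (exp (- a * real k) * exp ((real k + 1) / (2 / a)))" by (simp add: mult_ac)
      also have "exp (- a * real k) * exp ((real k + 1) / (2 / a)) = exp (a / 2) * exp (- a / 2) ^ k"
        by (simp add: exp_add[symmetric] exp_of_nat_mult[symmetric] field_simps)
      finally show "norm (c k) \<le> ?V * fact ?n * (2 / a) ^ ?n * exp (a / 2) * exp (- a / 2) ^ k"
        using c0[of k] by (simp add: mult_ac)
    qed
  qed
  have "(\<integral>\<^sup>+x. ennreal (exp (- a * norm (x::'a))) \<partial>lborel) \<le>
      (\<integral>\<^sup>+x. (\<Sum>k. ennreal (exp (- a * real k)) * indicator (ball 0 (real k + 1)) (x::'a)) \<partial>lborel)"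
  proof (rule nn_integral_mono)
    fix x :: 'a
    define k where "k = nat \<lfloor>norm x\<rfloor>"
    have k: "real k \<le> norm x" "norm x < real k + 1" by (auto simp: k_def)
    have "ennreal (exp (- a * norm x)) \<le> ennreal (exp (- a * real k)) * indicator (ball 0 (real k + 1)) x"
      using k a by (auto simp: indicator_def intro!: ennreal_leI)
    also have "\<dots> = (\<Sum>k\<in>{k}. ennreal (exp (- a * real k)) * indicator (ball 0 (real k + 1)) x)"
      by (simp only: sum.insert finite.emptyI empty_iff not_False_eq_True sum.empty add_0_right)
    also have "\<dots> \<le> (\<Sum>k. ennreal (exp (- a * real k)) * indicator (ball 0 (real k + 1)) x)"
      by (rule sum_le_suminf) auto
    finally show "ennreal (exp (- a * norm x)) \<le> (\<Sum>k. ennreal (exp (- a * real k)) * indicator (ball 0 (real k + 1)) x)" .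
  qed
  also have "\<dots> = (\<Sum>k. \<integral>\<^sup>+x. ennreal (exp (- a * real k)) * indicator (ball 0 (real k + 1)) (x::'a) \<partial>lborel)"
    by (rule nn_integral_suminf, rule borel_measurable_times_ennreal)
      (simp_all add: borel_measurable_indicator)
  also have "\<dots> = (\<Sum>k. ennreal (c k))"
    by (simp add: nn_integral_cmult_indicator emeasure_ball ennreal_mult[symmetric] c_def)
  also have "\<dots> < \<infinity>"
    using suminf_ennreal2[OF c0 \<open>summable c\<close>] by simp
  finally show "(\<integral>\<^sup>+x. ennreal (exp (- a * norm (x::'a))) \<partial>lborel) < \<infinity>" .
qed auto

lemma integrable_exp_decay:
  fixes f :: "'a::euclidean_space \<Rightarrow> 'b::{banach, second_countable_topology}"
  assumes "f \<in> borel_measurable borel" "\<And>x. norm (f x) \<le> C * exp (- a * norm x)" "0 < a"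
  shows "integrable lborel f"
  by (rule Bochner_Integration.integrable_bound[OF integrable_mult_right[OF integrable_exp_norm[OF assms(3)], of C]])
    (use assms in \<open>auto intro!: AE_I2 order_trans[OF assms(2)]\<close>)

lemma has_vector_derivative_0_iff:
  fixes f :: "real \<Rightarrow> 'a::real_normed_vector"
  shows "(f has_vector_derivative D) (at 0) \<longleftrightarrow> ((\<lambda>h. (f h - f 0) /\<^sub>R h) \<longlongrightarrow> D) (at 0)"
proof -
  have "(f has_vector_derivative D) (at 0) \<longleftrightarrow> ((\<lambda>h. norm (f h - f 0 - h *\<^sub>R D) / norm h) \<longlongrightarrow> 0) (at 0)"
    by (simp add: has_vector_derivative_def has_derivative_at bounded_linear_scaleR_left)
  also have "\<dots> \<longleftrightarrow> ((\<lambda>h. norm ((f h - f 0) /\<^sub>R h - D)) \<longlongrightarrow> 0) (at 0)"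
  proof (rule tendsto_cong, rule eventually_at_topological[THEN iffD2], intro exI[of _ UNIV] conjI ballI impI)
    fix h :: real assume "h \<noteq> 0"
    have "(f h - f 0) /\<^sub>R h - D = (f h - f 0 - h *\<^sub>R D) /\<^sub>R h"
      using \<open>h \<noteq> 0\<close> by (simp add: scaleR_diff_right)
    then show "norm (f h - f 0 - h *\<^sub>R D) / norm h = norm ((f h - f 0) /\<^sub>R h - D)"
      by (simp add: divide_inverse mult.commute)
  qed auto
  finally show ?thesis using LIM_zero_iff tendsto_norm_zero_iff by metis
qed

text \<open>By the mean value estimate B also dominates the difference quotients, so dominated
  convergence applies along every null sequence.\<close>

lemma has_vector_derivative_integral_0:
  fixes g g' :: "real \<Rightarrow> 'a \<Rightarrow> complex"
  assumes der: "\<And>s y. \<bar>s\<bar> \<le> 1 \<Longrightarrow> ((\<lambda>s. g s y) has_vector_derivative g' s y) (at s)"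
    and bd: "\<And>s y. \<bar>s\<bar> \<le> 1 \<Longrightarrow> norm (g' s y) \<le> B y" and B: "integrable M B"
    and int: "\<And>s. \<bar>s\<bar> \<le> 1 \<Longrightarrow> integrable M (g s)"
  shows "((\<lambda>s. \<integral>y. g s y \<partial>M) has_vector_derivative (\<integral>y. g' 0 y \<partial>M)) (at 0)"
    and "integrable M (g' 0)"
proof -
  have lip: "norm ((g s y - g 0 y) /\<^sub>R s) \<le> B y" if s: "\<bar>s\<bar> \<le> 1" for s y
  proof -
    have seg: "\<bar>t\<bar> \<le> 1" if "t \<in> closed_segment 0 s" for t
      using that s by (auto simp: closed_segment_eq_real_ivl split: if_splits)
    have hd: "((\<lambda>s. g s y) has_derivative (\<lambda>h. h *\<^sub>R g' t y)) (at t within closed_segment 0 s)"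
      if "t \<in> closed_segment 0 s" for t
      using has_derivative_at_withinI[OF der[OF seg[OF that], unfolded has_vector_derivative_def]] .
    have on: "onorm (\<lambda>h. h *\<^sub>R g' t y) \<le> B y" if "t \<in> closed_segment 0 s" for t
    proof (rule onorm_le)
      fix h :: real
      have "\<bar>h\<bar> * norm (g' t y) \<le> \<bar>h\<bar> * B y" by (intro mult_left_mono bd seg that abs_ge_zero)
      then show "norm (h *\<^sub>R g' t y) \<le> B y * norm h" by (simp only: norm_scaleR real_norm_def mult.commute)
    qed
    have "norm (g s y - g 0 y) \<le> B y * norm (s - 0)"
      using differentiable_bound[OF convex_closed_segment hd on] by (meson ends_in_segment)
    moreover have "0 \<le> B y" using order_trans[OF norm_ge_zero bd[of 0 y]] by simp
    ultimately show ?thesis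
      by (cases "s = 0") (simp_all add: divide_inverse[symmetric] mult.commute[of "inverse _"] pos_divide_le_eq)
  qed
  have lim: "(\<lambda>n. (g (X n) y - g 0 y) /\<^sub>R X n) \<longlonglongrightarrow> g' 0 y"
    if "\<And>n. X n \<noteq> 0" "X \<longlonglongrightarrow> 0" for X y
    using der[of 0 y] that unfolding has_vector_derivative_0_iff tendsto_at_iff_sequentially
    by (auto simp: comp_def)
  have meas: "(\<lambda>y. (g s y - g 0 y) /\<^sub>R s) \<in> borel_measurable M" if "\<bar>s\<bar> \<le> 1" for s
    using borel_measurable_integrable[OF int[OF that]] borel_measurable_integrable[OF int[of 0]] by auto
  \<comment> \<open>A concrete null sequence: it exhibits \<open>g' 0\<close> as a pointwise limit
    of difference quotients and thereby as measurable.\<close>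
  define X0 where "X0 n = inverse (real (Suc n))" for n
  have X0: "X0 n \<noteq> 0" "\<bar>X0 n\<bar> \<le> 1" "X0 \<longlonglongrightarrow> 0" for n
    unfolding X0_def by (simp, simp add: inverse_eq_divide, rule LIMSEQ_inverse_real_of_nat)
  have m0: "g' 0 \<in> borel_measurable M"
    by (rule borel_measurable_LIMSEQ_metric[OF meas[OF X0(2)] lim[OF X0(1) X0(3)]])
  show "integrable M (g' 0)"
    by (rule Bochner_Integration.integrable_bound[OF B m0]) (use bd[of 0] in \<open>auto intro!: AE_I2 order_trans[OF _ abs_ge_self]\<close>)
  show "((\<lambda>s. \<integral>y. g s y \<partial>M) has_vector_derivative (\<integral>y. g' 0 y \<partial>M)) (at 0)"
    unfolding has_vector_derivative_0_iff tendsto_at_iff_sequentially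
  proof (intro allI impI)
    fix X :: "nat \<Rightarrow> real" assume X: "\<forall>i. X i \<in> UNIV - {0}" "X \<longlonglongrightarrow> 0"
    from X(2) have "eventually (\<lambda>n. \<bar>X n\<bar> < 1) sequentially"
      using order_tendstoD(2)[OF tendsto_rabs[OF X(2)], of 1] by simp
    then obtain N where N: "\<And>n. n \<ge> N \<Longrightarrow> \<bar>X n\<bar> < 1" by (auto simp: eventually_sequentially)
    define Z where "Z n = X (n + N)" for n
    have Z: "\<bar>Z n\<bar> \<le> 1" "Z n \<noteq> 0" "Z \<longlonglongrightarrow> 0" for n
      using N[of "n + N"] X(1) LIMSEQ_ignore_initial_segment[OF X(2), of N] by (auto simp: Z_def[abs_def])
    have "(\<lambda>n. \<integral>y. (g (Z n) y - g 0 y) /\<^sub>R Z n \<partial>M) \<longlonglongrightarrow> (\<integral>y. g' 0 y \<partial>M)"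
      by (rule integral_dominated_convergence[OF m0 meas[OF Z(1)] B])
        (use lim[OF Z(2,3)] lip[OF Z(1)] in auto)
    moreover have "(\<integral>y. (g (Z n) y - g 0 y) /\<^sub>R Z n \<partial>M) = ((\<integral>y. g (Z n) y \<partial>M) - (\<integral>y. g 0 y \<partial>M)) /\<^sub>R Z n" for n
      using int[OF Z(1)] int[of 0] by simp
    ultimately have "(\<lambda>n. ((\<integral>y. g (X (n + N)) y \<partial>M) - (\<integral>y. g 0 y \<partial>M)) /\<^sub>R X (n + N)) \<longlonglongrightarrow> (\<integral>y. g' 0 y \<partial>M)"
      by (simp only: Z_def)
    then show "((\<lambda>h. ((\<integral>y. g h y \<partial>M) - (\<integral>y. g 0 y \<partial>M)) /\<^sub>R h) \<circ> X) \<longlonglongrightarrow> (\<integral>y. g' 0 y \<partial>M)"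
      unfolding comp_def by (rule LIMSEQ_offset)
  qed
qed

text \<open>The integral of \<open>h (x + s *\<^sub>R v)\<close> does not depend on s, by
  translation invariance of Lebesgue measure; its derivative at s = 0 is the integral in question.
  This takes the place of integration by parts.\<close>

lemma integral_directional_derivative_eq_0:
  fixes h :: "'a::euclidean_space \<Rightarrow> complex"
  assumes der: "\<And>x. (h has_derivative D x) (at x)"
    and h: "\<And>x. norm (h x) \<le> C * exp (- a * norm x)"
    and D: "\<And>x. norm (D x v) \<le> C * exp (- a * norm x)" and a: "0 < a"
  shows "(\<integral>x. D x v \<partial>lborel) = 0" "integrable lborel (\<lambda>x. D x v)"
proof -
  have C: "0 \<le> C" using order_trans[OF norm_ge_zero h[of 0]] by simp
  have "continuous_on UNIV h"
    using der by (meson continuous_at_imp_continuous_on has_derivative_continuous)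
  then have [measurable]: "h \<in> borel_measurable borel" by (rule borel_measurable_continuous_onI)
  have hint: "integrable lborel h" by (rule integrable_exp_decay[OF _ h a]) simp
  note L = has_vector_derivative_integral_0[of "\<lambda>s x. h (x + s *\<^sub>R v)" "\<lambda>s x. D (x + s *\<^sub>R v) v"
      "\<lambda>x. C * exp (a * norm v) * exp (- a * norm x)" lborel]
  have 1: "((\<lambda>s. h (y + s *\<^sub>R v)) has_vector_derivative D (y + s *\<^sub>R v) v) (at s)" for s y
    by (rule has_derivative_axis_line[OF der])
  have 2: "norm (D (y + s *\<^sub>R v) v) \<le> C * exp (a * norm v) * exp (- a * norm y)" if "\<bar>s\<bar> \<le> 1" for s y
  proof -
    have "norm y \<le> norm (y + s *\<^sub>R v) + norm v"
    proof -
      have "norm y \<le> norm (y + s *\<^sub>R v) + norm (s *\<^sub>R v)" using norm_triangle_ineq4[of "y + s *\<^sub>R v" "s *\<^sub>R v"] by simp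
      also have "norm (s *\<^sub>R v) \<le> norm v" using mult_right_mono[OF that, of "norm v"] by simp
      finally show ?thesis by simp
    qed
    then have "exp (- a * norm (y + s *\<^sub>R v)) \<le> exp (a * norm v) * exp (- a * norm y)"
      using mult_left_mono[of "norm y" "norm (y + s *\<^sub>R v) + norm v" a] a
      by (simp add: exp_add[symmetric] algebra_simps)
    then show ?thesis using D[of "y + s *\<^sub>R v"] C
      by (smt (verit, best) mult.assoc mult_left_mono)
  qed
  have 3: "integrable lborel (\<lambda>x. h (x + s *\<^sub>R v))" for s
    using integrable_lborel_affine[OF hint, of 1 "s *\<^sub>R v"] by (simp add: add.commute)
  have 4: "integrable lborel (\<lambda>x::'a. C * exp (a * norm v) * exp (- a * norm x))"
    using integrable_mult_right[OF integrable_exp_norm[OF a]] .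
  have "((\<lambda>s. \<integral>x. h (x + s *\<^sub>R v) \<partial>lborel) has_vector_derivative (\<integral>x. D (x + 0 *\<^sub>R v) v \<partial>lborel)) (at 0)"
    by (rule L(1)) (use 1 2 3 4 in auto)
  moreover have "(\<integral>x. h (x + s *\<^sub>R v) \<partial>lborel) = integral\<^sup>L lborel h" for s
    by (rule integral_lborel_translate) simp
  ultimately have "((\<lambda>s::real. integral\<^sup>L lborel h) has_vector_derivative (\<integral>x. D x v \<partial>lborel)) (at 0)" by simp
  then show "(\<integral>x. D x v \<partial>lborel) = 0"
    using vector_derivative_unique_at[OF _ has_vector_derivative_const] by blast
  have "integrable lborel (\<lambda>x. D (x + 0 *\<^sub>R v) v)"
    by (rule L(2)) (use 1 2 3 4 in auto)
  then show "integrable lborel (\<lambda>x. D x v)" by simp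
qed

section \<open>Fourier transforms of functions with exponential bounds\<close>

lemma exp_bounded_measurable [measurable_dest]: "exp_bounded A r C f \<Longrightarrow> f \<in> borel_measurable borel"
  by (intro borel_measurable_continuous_onI smooth_fun_continuous) (rule exp_bounded_smooth)

lemma integrable_exp_bounded: "exp_bounded (- a) r C f \<Longrightarrow> 0 < a \<Longrightarrow> integrable lborel f"
  using integrable_exp_decay[of f C a] exp_bounded_norm[of "-a" r C f] exp_bounded_measurable by auto

lemma integral_partial_dir_eq_0:
  fixes f :: "real^'n::finite \<Rightarrow> complex"
  assumes f: "exp_bounded (- a) r C f" and a: "0 < a" and r: "0 < r"
  shows "(\<integral>x. partial_dir i f x \<partial>lborel) = 0"
proof -
  have C: "0 \<le> C" by (rule exp_bounded_nonneg[OF f])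
  have df: "dfact [i] = 1"
    unfolding dfact_def by (rule prod.neutral) auto
  let ?D = "\<lambda>(x::real^'n) v. \<Sum>i\<in>UNIV. (v $ i) *\<^sub>R partial_dir i f x"
  have e: "?D x (axis i 1) = partial_dir i f x" for x
  proof -
    have "?D x (axis i 1) = (\<Sum>j\<in>UNIV. if j = i then partial_dir j f x else 0)"
      by (intro sum.cong) (auto simp: axis_def)
    then show ?thesis by simp
  qed
  have "(\<integral>x. ?D x (axis i 1) \<partial>lborel) = 0"
  proof (rule integral_directional_derivative_eq_0[of f ?D "C * max 1 r" a])
    show "(f has_derivative ?D x) (at x)" for x
      by (rule has_derivative_eq_sum_partial_dir[OF smooth_fun_differentiable[OF exp_bounded_smooth[OF f]]])
    fix x :: "real^'n"
    have "C * exp (- a * norm x) * 1 \<le> C * exp (- a * norm x) * max 1 r"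
      "C * exp (- a * norm x) * r \<le> C * exp (- a * norm x) * max 1 r"
      using C by (intro mult_left_mono; simp)+
    then show "norm (f x) \<le> C * max 1 r * exp (- a * norm x)"
      "norm (?D x (axis i 1)) \<le> C * max 1 r * exp (- a * norm x)"
      using exp_boundedD[OF f, of "[]" x] exp_boundedD[OF f, of "[i]" x] unfolding e by (simp_all add: df mult_ac)
  qed (rule a)
  then show ?thesis unfolding e .
qed

text \<open>Without a normalising factor; the normalisation shows up as the square of
  \<open>gauss_int\<close> in the inversion formula.\<close>

definition ft :: "(real^'n::finite \<Rightarrow> complex) \<Rightarrow> real^'n \<Rightarrow> complex" where
  "ft f \<xi> = (\<integral>y. f y * modul \<xi> y \<partial>lborel)"

lemma exp_bounded_iter_partial_replicate:
  fixes f :: "real^'n::finite \<Rightarrow> complex"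
  assumes f: "exp_bounded A r C f"
  shows "norm (iter_partial (replicate k j) f x) \<le> (C * r ^ k * fact k) * exp (A * norm x)"
proof -
  have c: "count_list (replicate k j) i = (if i = j then k else 0)" for i by (induction k) auto
  have "dfact (replicate k j) = (\<Prod>i\<in>UNIV. if i = j then fact k else 1)"
    unfolding dfact_def by (intro prod.cong) (auto simp: c)
  then have "dfact (replicate k j) = fact k" by simp
  then show ?thesis using exp_boundedD[OF f, of "replicate k j" x] by (simp add: mult_ac)
qed

lemma exp_bounded_partial_dir:
  fixes f :: "real^'n::finite \<Rightarrow> complex"
  assumes f: "exp_bounded A r C f" and r: "0 \<le> r"
  shows "exp_bounded A (2 * r) (C * r) (partial_dir i f)"
  unfolding exp_bounded_def
proof (intro conjI allI)
  show "smooth_fun (partial_dir i f)" by (rule smooth_fun_partial_dir[OF exp_bounded_smooth[OF f]])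
  fix ds :: "'n list" and x :: "real^'n"
  have "norm (iter_partial ds (partial_dir i f) x) \<le> C * exp (A * norm x) * r ^ length (ds @ [i]) * dfact (ds @ [i])"
    using exp_boundedD[OF f, of "ds @ [i]" x] by (simp add: iter_partial_append)
  also have "dfact (ds @ [i]) = dfact (i # ds)" by (rule dfact_cong) simp
  also have "C * exp (A * norm x) * r ^ length (ds @ [i]) * dfact (i # ds) \<le> C * exp (A * norm x) * r ^ length (ds @ [i]) * (2 ^ length ds * dfact ds)"
    using r exp_bounded_nonneg[OF f] by (intro mult_left_mono dfact_Cons_le) auto
  finally show "norm (iter_partial ds (partial_dir i f) x) \<le> C * r * exp (A * norm x) * (2 * r) ^ length ds * dfact ds"
    by (simp add: power_mult_distrib mult_ac)
qed

lemma ft_partial_dir: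
  fixes f :: "real^'n::finite \<Rightarrow> complex"
  assumes f: "exp_bounded (- a) r C f" and a: "0 < a" and r: "0 < r"
  shows "ft (partial_dir i f) \<xi> = \<i> * complex_of_real (\<xi> $ i) * ft f \<xi>"
proof -
  have fm: "exp_bounded (- a) (2 * r) (C * exp (CARD('n) * norm \<xi> / r)) (\<lambda>y. f y * modul \<xi> y)"
    using exp_bounded_mult[OF f exp_bounded_modul[OF r]] r by simp
  have "exp_bounded (- a) (2 * (2 * r)) (C * r * exp (CARD('n) * norm \<xi> / (2 * r))) (\<lambda>y. partial_dir i f y * modul \<xi> y)"
    using exp_bounded_mult[OF exp_bounded_partial_dir[OF f] exp_bounded_modul[of "2 * r"]] r by simp
  note int = integrable_exp_bounded[OF fm a] integrable_exp_bounded[OF this a]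
  have d: "partial_dir i (\<lambda>y. f y * modul \<xi> y) y = partial_dir i f y * modul \<xi> y - \<i> * complex_of_real (\<xi> $ i) * (f y * modul \<xi> y)" for y
  proof -
    have "partial_dir i (modul \<xi>) y = - \<i> * complex_of_real (\<xi> $ i) * modul \<xi> y"
      using fun_cong[OF iter_partial_modul[of "[i]" \<xi>], of y] by simp
    then show ?thesis
      by (simp add: partial_dir_mult[OF smooth_fun_differentiable[OF exp_bounded_smooth[OF f]] smooth_fun_differentiable[OF smooth_fun_modul]] mult_ac)
  qed
  have "0 = (\<integral>y. partial_dir i (\<lambda>y. f y * modul \<xi> y) y \<partial>lborel)"
    using integral_partial_dir_eq_0[OF fm a] r by simp
  also have "\<dots> = ft (partial_dir i f) \<xi> - \<i> * complex_of_real (\<xi> $ i) * ft f \<xi>"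
    unfolding d ft_def using int by simp
  finally show ?thesis by simp
qed

text \<open>A derivative of f multiplies the transform by a coordinate of \<xi>, so the factorial
  bounds on the derivatives of f become moment bounds on the transform. The smaller the radius r,
  the faster the decay.\<close>

lemma ft_decay:
  fixes f :: "real^'n::finite \<Rightarrow> complex"
  assumes f: "exp_bounded (- a) r C f" and a: "0 < a" and r: "0 < r"
  shows "norm (ft f \<xi>) \<le> 2 * (C * (\<integral>y. exp (- a * norm (y::real^'n)) \<partial>lborel)) * exp (- (1 / (2 * r * CARD('n))) * norm \<xi>)"
proof (rule exp_decay_of_moments)
  fix j k
  \<comment> \<open>The radius doubles with every derivative. These bounds only justify the
    integrations by parts and the integrability; the precise factor \<open>r ^ k * fact k\<close>
    comes from \<open>exp_bounded_iter_partial_replicate\<close>.\<close>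
  have it: "\<exists>r' C'. 0 < r' \<and> exp_bounded (- a) r' C' (iter_partial (replicate k j) f) \<and>
     ft (iter_partial (replicate k j) f) \<xi> = (\<i> * complex_of_real (\<xi> $ j)) ^ k * ft f \<xi>" for k
  proof (induction k)
    case 0 then show ?case using f r by auto
  next
    case (Suc k)
    then obtain r' C' where i: "0 < r'" "exp_bounded (- a) r' C' (iter_partial (replicate k j) f)"
      "ft (iter_partial (replicate k j) f) \<xi> = (\<i> * complex_of_real (\<xi> $ j)) ^ k * ft f \<xi>" by blast
    show ?case
      using exp_bounded_partial_dir[OF i(2), of j] ft_partial_dir[OF i(2) a i(1), of j \<xi>] i
      by (intro exI[of _ "2 * r'"] exI[of _ "C' * r'"]) (simp add: mult_ac)
  qed
  let ?g = "iter_partial (replicate k j) f"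
  have int: "integrable lborel (\<lambda>y. ?g y * modul \<xi> y)"
  proof -
    obtain r' C' where i: "0 < r'" "exp_bounded (- a) r' C' ?g" using it[of k] by blast
    show ?thesis using integrable_exp_bounded[OF _ a] exp_bounded_mult[OF i(2) exp_bounded_modul[OF i(1), of \<xi>]] i
      by (simp del: minus_add_distrib) blast
  qed
  have "\<bar>\<xi> $ j\<bar> ^ k * norm (ft f \<xi>) = norm (ft ?g \<xi>)" using it[of k] by (auto simp: norm_mult norm_power)
  also have "\<dots> \<le> (\<integral>y. norm (?g y * modul \<xi> y) \<partial>lborel)" unfolding ft_def by (rule integral_norm_bound)
  also have "\<dots> \<le> (\<integral>y. (C * r ^ k * fact k) * exp (- a * norm (y::real^'n)) \<partial>lborel)"
    using exp_bounded_iter_partial_replicate[OF f, of k j]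
    by (intro integral_mono integrable_norm int integrable_mult_right integrable_exp_norm a) (simp add: norm_mult)
  finally show "\<bar>\<xi> $ j\<bar> ^ k * norm (ft f \<xi>) \<le> C * (\<integral>y. exp (- a * norm (y::real^'n)) \<partial>lborel) * r ^ k * fact k"
    by (simp add: mult_ac)
qed (use r in auto)

section \<open>The Gaussian and its Fourier transform\<close>

definition gauss :: "'a::real_inner \<Rightarrow> real" where "gauss x = exp (- (norm x)\<^sup>2 / 2)"

lemma gauss_pos: "0 < gauss x" by (simp add: gauss_def)

lemma gauss_le_1: "gauss x \<le> 1" by (simp add: gauss_def)

lemma gauss_le: "gauss x \<le> exp 2 * exp (- 2 * norm x)"
proof -
  have "0 \<le> (norm x - 2)\<^sup>2" by simp
  then have "- (norm x)\<^sup>2 / 2 \<le> 2 + - 2 * norm x" by (simp add: power2_eq_square algebra_simps)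
  then show ?thesis unfolding gauss_def exp_add[symmetric] by (simp only: exp_le_cancel_iff)
qed

lemma gauss_moment_le: "gauss x \<le> exp 2 * exp (- 1 * norm x)" "norm x * gauss x \<le> exp 2 * exp (- 1 * norm x)"
proof -
  have e: "exp (- 1 * norm x) = exp (norm x) * exp (- 2 * norm x)" by (simp add: exp_add[symmetric])
  have "exp (- 2 * norm x) \<le> exp (- 1 * norm x)" by simp
  then have "exp 2 * exp (- 2 * norm x) \<le> exp 2 * exp (- 1 * norm x)" by (intro mult_left_mono) auto
  then show "gauss x \<le> exp 2 * exp (- 1 * norm x)" using gauss_le[of x] by linarith
  have "norm x \<le> exp (norm x)" using exp_ge_add_one_self[of "norm x"] by linarith
  then have "norm x * gauss x \<le> exp (norm x) * (exp 2 * exp (- 2 * norm x))"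
    using gauss_pos[of x] by (intro mult_mono gauss_le) auto
  then show "norm x * gauss x \<le> exp 2 * exp (- 1 * norm x)" by (simp only: e mult_ac)
qed

lemma continuous_on_gauss [continuous_intros]: "continuous_on S f \<Longrightarrow> continuous_on S (\<lambda>x. gauss (f x))"
  unfolding gauss_def by (intro continuous_intros) auto

lemma gauss_measurable [measurable]: "gauss \<in> borel_measurable (borel :: 'a::euclidean_space measure)"
  by (intro borel_measurable_continuous_onI continuous_intros)

lemma integrable_gauss: "integrable lborel (gauss :: 'a::euclidean_space \<Rightarrow> real)"
  by (rule integrable_exp_decay[of _ "exp 2" 1]) (use gauss_moment_le(1) in \<open>auto simp: gauss_def\<close>)

lemma continuous_on_modul [continuous_intros]:
  "continuous_on S f \<Longrightarrow> continuous_on S g \<Longrightarrow> continuous_on S (\<lambda>x. modul (f x) (g x))"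
  unfolding modul_def by (intro continuous_intros)

lemma modul_add: "modul \<xi> (x + y) = modul \<xi> x * modul \<xi> y"
  by (simp add: modul_def inner_add_left exp_add[symmetric] algebra_simps)

lemma cnj_modul: "cnj (modul \<xi> y) = modul \<xi> (- y)"
  by (simp add: modul_def exp_cnj)

lemma modul_minus: "modul (- \<xi>) y = modul \<xi> (- y)"
  by (simp add: modul_def)

text \<open>The normalising constant of the Gaussian in dimension \<open>CARD('n)\<close>, kept
  symbolic.\<close>

definition gauss_int :: "'n::finite itself \<Rightarrow> real" where
  "gauss_int _ = (\<integral>x. gauss (x::real^'n) \<partial>lborel)"

lemma gauss_int_pos: "0 < gauss_int TYPE('n::finite)"
proof -
  have "0 \<le> gauss_int TYPE('n)" unfolding gauss_int_def by (intro integral_nonneg_AE AE_I2) (simp add: gauss_pos less_imp_le)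
  moreover have "gauss_int TYPE('n) \<noteq> 0"
  proof
    assume "gauss_int TYPE('n) = 0"
    then have "AE x in lborel. gauss (x::real^'n) = 0"
    proof -
      have nn: "AE x in lborel. 0 \<le> gauss (x::real^'n)" by (rule AE_I2) (simp add: gauss_pos less_imp_le)
      show ?thesis using \<open>gauss_int TYPE('n) = 0\<close> unfolding gauss_int_def
        by (simp only: integral_nonneg_eq_0_iff_AE[OF integrable_gauss nn])
    qed
    then have "AE x in (lborel::(real^'n) measure). False"
      by (rule AE_mp) (use gauss_pos in \<open>auto intro!: AE_I2 simp: less_le\<close>)
    then have "(UNIV :: (real^'n) set) \<in> null_sets lborel"
      by (subst AE_iff_null_sets) simp_all
    then show False by (simp add: null_sets_def)
  qed
  ultimately show ?thesis by linarith
qed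

lemma has_vector_derivative_shift:
  fixes f :: "real \<Rightarrow> 'a::real_normed_vector"
  assumes "(f has_vector_derivative D) (at (a + t))"
  shows "((\<lambda>t. f (a + t)) has_vector_derivative D) (at t)"
proof -
  have "((\<lambda>t. a + t) has_derivative (\<lambda>h. h)) (at t)" by (auto intro!: derivative_eq_intros)
  from has_derivative_compose[OF this assms[unfolded has_vector_derivative_def]]
  show ?thesis unfolding has_vector_derivative_def .
qed

text \<open>Restricted to the ray through z, the transform p satisfies the differential equation
  p'(s) = - s |z|^2 p(s): differentiation under the integral produces a first moment of
  \<open>h s\<close>, and integration by parts turns it back into p.\<close>

lemma ft_gauss:
  fixes z :: "real^'n::finite"
  shows "(\<integral>\<xi>. complex_of_real (gauss \<xi>) * modul z \<xi> \<partial>lborel) = complex_of_real (gauss_int TYPE('n) * gauss z)"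
proof -
  define h where "h s \<xi> = complex_of_real (gauss \<xi>) * modul (s *\<^sub>R z) \<xi>" for s \<xi>
  define p where "p s = (\<integral>\<xi>. h s \<xi> \<partial>lborel)" for s
  have nh: "norm (h s \<xi>) = gauss \<xi>" for s \<xi> using gauss_pos[of \<xi>] by (simp add: h_def norm_mult)
  have hm [measurable]: "h s \<in> borel_measurable borel" for s
    unfolding h_def by (intro borel_measurable_continuous_onI continuous_intros)
  have hint: "integrable lborel (h s)" for s
    by (rule integrable_exp_decay[of _ "exp 2" 1]) (use gauss_moment_le(1) in \<open>auto simp: nh\<close>)
  define M where "M s = exp 2 * (1 + norm z + \<bar>s\<bar> * (norm z)\<^sup>2)" for s
  have M: "norm ((- complex_of_real (\<xi> \<bullet> z) - \<i> * complex_of_real (s * (norm z)\<^sup>2)) * h s \<xi>) \<le> M s * exp (- 1 * norm \<xi>)" for s \<xi>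
  proof -
    have "norm (- complex_of_real (\<xi> \<bullet> z) - \<i> * complex_of_real (s * (norm z)\<^sup>2)) \<le> norm (- complex_of_real (\<xi> \<bullet> z)) + norm (\<i> * complex_of_real (s * (norm z)\<^sup>2))"
      by (rule norm_triangle_ineq4)
    also have "\<dots> \<le> norm \<xi> * norm z + \<bar>s\<bar> * (norm z)\<^sup>2"
      using Cauchy_Schwarz_ineq2[of \<xi> z] by (simp add: norm_mult abs_mult norm_power)
    finally have "norm ((- complex_of_real (\<xi> \<bullet> z) - \<i> * complex_of_real (s * (norm z)\<^sup>2)) * h s \<xi>) \<le> (norm \<xi> * norm z + \<bar>s\<bar> * (norm z)\<^sup>2) * gauss \<xi>"
      unfolding norm_mult[of _ "h s \<xi>"] nh using gauss_pos[of \<xi>] by (intro mult_right_mono) auto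
    also have "\<dots> = norm z * (norm \<xi> * gauss \<xi>) + \<bar>s\<bar> * (norm z)\<^sup>2 * gauss \<xi>" by (simp add: algebra_simps)
    also have "\<dots> \<le> norm z * (exp 2 * exp (- 1 * norm \<xi>)) + \<bar>s\<bar> * (norm z)\<^sup>2 * (exp 2 * exp (- 1 * norm \<xi>))"
      by (intro add_mono mult_left_mono gauss_moment_le) auto
    also have "\<dots> = (M s - exp 2) * exp (- 1 * norm \<xi>)" by (simp add: M_def algebra_simps)
    also have "\<dots> \<le> M s * exp (- 1 * norm \<xi>)" by (intro mult_right_mono) auto
    finally show ?thesis .
  qed
  have hder: "(h s has_derivative (\<lambda>v. (- complex_of_real (\<xi> \<bullet> v) - \<i> * complex_of_real (s * (v \<bullet> z))) * h s \<xi>)) (at \<xi>)" for s \<xi>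
  proof -
    have he: "h s = (\<lambda>\<xi>. exp (complex_of_real (- (\<xi> \<bullet> \<xi>) / 2) + - \<i> * complex_of_real (s * (\<xi> \<bullet> z))))"
      by (rule ext) (simp only: h_def gauss_def modul_def exp_add exp_of_real power2_norm_eq_inner inner_scaleR_right)
    have "((\<lambda>\<xi>. complex_of_real (- (\<xi> \<bullet> \<xi>) / 2) + - \<i> * complex_of_real (s * (\<xi> \<bullet> z))) has_derivative
      (\<lambda>v. - complex_of_real (\<xi> \<bullet> v) - \<i> * complex_of_real (s * (v \<bullet> z)))) (at \<xi>)"
      by (auto intro!: derivative_eq_intros simp: inner_commute)
    from has_derivative_compose[OF this DERIV_exp[unfolded has_field_derivative_def]]
    show ?thesis unfolding he by (simp only: mult.commute)
  qed
  \<comment> \<open>The integrand is the derivative of \<open>h s\<close> in direction z, so its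
    integral is zero; this expresses the first moment of \<open>h s\<close> by the transform
    itself.\<close>
  have parts: "(\<integral>\<xi>. (- complex_of_real (\<xi> \<bullet> z) - \<i> * complex_of_real (s * (norm z)\<^sup>2)) * h s \<xi> \<partial>lborel) = 0"
    and pint: "integrable lborel (\<lambda>\<xi>. (- complex_of_real (\<xi> \<bullet> z) - \<i> * complex_of_real (s * (norm z)\<^sup>2)) * h s \<xi>)" for s
  proof -
    have "norm (h s \<xi>) \<le> M s * exp (- 1 * norm \<xi>)" for \<xi>
    proof -
      have "exp 2 * exp (- 1 * norm \<xi>) \<le> M s * exp (- 1 * norm \<xi>)"
        by (intro mult_right_mono) (auto simp: M_def)
      then show ?thesis using gauss_moment_le(1)[of \<xi>] by (simp only: nh)
    qed
    from integral_directional_derivative_eq_0[OF hder this, of z] M[of _ s]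
    show "(\<integral>\<xi>. (- complex_of_real (\<xi> \<bullet> z) - \<i> * complex_of_real (s * (norm z)\<^sup>2)) * h s \<xi> \<partial>lborel) = 0"
      "integrable lborel (\<lambda>\<xi>. (- complex_of_real (\<xi> \<bullet> z) - \<i> * complex_of_real (s * (norm z)\<^sup>2)) * h s \<xi>)"
      by (simp_all add: power2_norm_eq_inner)
  qed
  have i1: "integrable lborel (\<lambda>\<xi>. complex_of_real (\<xi> \<bullet> z) * h s \<xi>)" for s
  proof -
    have "integrable lborel (\<lambda>\<xi>. - ((- complex_of_real (\<xi> \<bullet> z) - \<i> * complex_of_real (s * (norm z)\<^sup>2)) * h s \<xi>) - \<i> * complex_of_real (s * (norm z)\<^sup>2) * h s \<xi>)"
      by (intro Bochner_Integration.integrable_diff integrable_minus pint integrable_mult_right hint)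
    then show ?thesis by (simp add: algebra_simps)
  qed
  have i2: "(\<integral>\<xi>. complex_of_real (\<xi> \<bullet> z) * h s \<xi> \<partial>lborel) = - \<i> * complex_of_real (s * (norm z)\<^sup>2) * p s" for s
  proof -
    have "(\<integral>\<xi>. (- complex_of_real (\<xi> \<bullet> z) - \<i> * complex_of_real (s * (norm z)\<^sup>2)) * h s \<xi> \<partial>lborel) =
      (\<integral>\<xi>. - (complex_of_real (\<xi> \<bullet> z) * h s \<xi>) - \<i> * complex_of_real (s * (norm z)\<^sup>2) * h s \<xi> \<partial>lborel)"
      by (simp add: algebra_simps)
    also have "\<dots> = - (\<integral>\<xi>. complex_of_real (\<xi> \<bullet> z) * h s \<xi> \<partial>lborel) - \<i> * complex_of_real (s * (norm z)\<^sup>2) * p s"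
      unfolding p_def using i1[of s] hint[of s] 
      by (subst Bochner_Integration.integral_diff) (auto simp del: of_real_mult of_real_power)
    finally show ?thesis unfolding parts by (simp add: algebra_simps)
  qed
  have hsder: "((\<lambda>s. h s \<xi>) has_vector_derivative (- \<i> * (complex_of_real (\<xi> \<bullet> z) * h s \<xi>))) (at s)" for s \<xi>
  proof -
    have e: "(\<lambda>s. h s \<xi>) = (\<lambda>s. complex_of_real (gauss \<xi>) * exp (- \<i> * complex_of_real (s * (\<xi> \<bullet> z))))"
      by (auto simp: h_def modul_def)
    have "((\<lambda>s. - \<i> * complex_of_real (s * (\<xi> \<bullet> z))) has_derivative (\<lambda>t. - \<i> * complex_of_real (t * (\<xi> \<bullet> z)))) (at s)"
      by (auto intro!: derivative_eq_intros)
    note der = has_derivative_mult_right[OF has_derivative_compose[OF this DERIV_exp[unfolded has_field_derivative_def]], of "complex_of_real (gauss \<xi>)"]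
    have "h s \<xi> = complex_of_real (gauss \<xi>) * exp (- \<i> * complex_of_real (s * (\<xi> \<bullet> z)))"
      by (rule fun_cong[OF e])
    then show ?thesis using der unfolding has_vector_derivative_def e by (simp add: scaleR_conv_of_real mult_ac)
  qed
  have pder: "(p has_vector_derivative (- complex_of_real (s * (norm z)\<^sup>2) * p s)) (at s)" for s
  proof -
    have "((\<lambda>t. \<integral>\<xi>. h (s + t) \<xi> \<partial>lborel) has_vector_derivative (\<integral>\<xi>. - \<i> * (complex_of_real (\<xi> \<bullet> z) * h (s + 0) \<xi>) \<partial>lborel)) (at 0)"
    proof (rule has_vector_derivative_integral_0(1))
      show "((\<lambda>t. h (s + t) \<xi>) has_vector_derivative (- \<i> * (complex_of_real (\<xi> \<bullet> z) * h (s + t) \<xi>))) (at t)" for t \<xi>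
        by (rule has_vector_derivative_shift[OF hsder])
      show "norm (- \<i> * (complex_of_real (\<xi> \<bullet> z) * h (s + t) \<xi>)) \<le> norm z * exp 2 * exp (- 1 * norm \<xi>)" for t \<xi>
      proof -
        have "\<bar>\<xi> \<bullet> z\<bar> * gauss \<xi> \<le> (norm \<xi> * norm z) * gauss \<xi>"
          using Cauchy_Schwarz_ineq2[of \<xi> z] gauss_pos[of \<xi>] by (intro mult_right_mono) auto
        also have "\<dots> \<le> norm z * (exp 2 * exp (- 1 * norm \<xi>))"
          using mult_left_mono[OF gauss_moment_le(2)[of \<xi>], of "norm z"] by (simp add: mult_ac)
        finally show ?thesis by (simp add: norm_mult nh mult_ac)
      qed
      show "integrable lborel (\<lambda>\<xi>::real^'n. norm z * exp 2 * exp (- 1 * norm \<xi>))"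
        by (intro integrable_mult_right integrable_exp_norm) simp
    qed (use hint in auto)
    then have "((\<lambda>t. p (s + t)) has_vector_derivative (- \<i> * (- \<i> * complex_of_real (s * (norm z)\<^sup>2) * p s))) (at 0)"
      unfolding p_def[symmetric] using i1[of s] i2[of s] by simp
    then have "((\<lambda>t. p (s + t)) has_vector_derivative (- complex_of_real (s * (norm z)\<^sup>2) * p s)) (at (- s + s))"
      by (simp add: mult.assoc[symmetric])
    from has_vector_derivative_shift[OF this] show ?thesis by simp
  qed
  \<comment> \<open>Multiplication by the integrating factor of the differential equation gives a
    function that is constant in s.\<close>
  define q where "q s = p s * complex_of_real (exp (s\<^sup>2 * (norm z)\<^sup>2 / 2))" for s
  have "(q has_vector_derivative 0) (at s)" for s
  proof -
    have "((\<lambda>s. complex_of_real (exp (s\<^sup>2 * (norm z)\<^sup>2 / 2))) has_vector_derivative complex_of_real (s * (norm z)\<^sup>2 * exp (s\<^sup>2 * (norm z)\<^sup>2 / 2))) (at s)"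
      by (rule has_vector_derivative_of_real) (auto intro!: derivative_eq_intros)
    from has_vector_derivative_mult[OF pder[of s] this]
    show ?thesis unfolding q_def by (simp add: algebra_simps)
  qed
  then have "q 1 = q 0"
    using has_vector_derivative_zero_constant[of UNIV q] by (metis UNIV_I convex_UNIV)
  then have "p 1 = p 0 * complex_of_real (gauss z)"
    by (simp add: q_def gauss_def exp_minus field_simps)
  moreover have "p 0 = complex_of_real (gauss_int TYPE('n))"
    by (simp add: p_def h_def modul_def gauss_int_def)
  ultimately show ?thesis by (simp add: p_def h_def)
qed

text \<open>The double integral behind the inversion formula does not converge absolutely. A
  Gaussian factor in the frequency makes Fubini applicable and is removed by dominated convergence
  on both sides.\<close>

lemma fourier_inversion:
  fixes h :: "real^'n::finite \<Rightarrow> complex"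
  assumes cont: "continuous_on UNIV h" and h: "\<And>y. norm (h y) \<le> C * exp (- a * norm y)" and a: "0 < a"
    and fm: "ft h \<in> borel_measurable borel" and f: "\<And>\<xi>. norm (ft h \<xi>) \<le> C' * exp (- a' * norm \<xi>)" and a': "0 < a'"
  shows "(\<integral>\<xi>. ft h \<xi> * cnj (modul \<xi> t) \<partial>lborel) = complex_of_real ((gauss_int TYPE('n))\<^sup>2) * h t"
proof -
  have C: "0 \<le> C" using order_trans[OF norm_ge_zero h[of 0]] by simp
  have hm [measurable]: "h \<in> borel_measurable borel" using cont by (rule borel_measurable_continuous_onI)
  have hint: "integrable lborel h" by (rule integrable_exp_decay[OF hm h a])
  have fint: "integrable lborel (ft h)" by (rule integrable_exp_decay[OF fm f a'])
  define e where "e n = inverse (real (Suc n))" for n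
  have e: "0 < e n" for n by (simp add: e_def)
  have e0: "e \<longlonglongrightarrow> 0" unfolding e_def by (rule LIMSEQ_inverse_real_of_nat)
  define G where "G = gauss_int TYPE('n)"
  \<comment> \<open>After Fubini the inner integral is a Gaussian of width \<open>e n\<close> around
    t, and the substitution y = t + \<open>e n\<close> z undoes the scaling. One factor
    \<open>gauss_int\<close> comes from \<open>ft_gauss\<close>, the second from the integral over z
    in the limit.\<close>
  have key: "(\<integral>\<xi>. ft h \<xi> * cnj (modul \<xi> t) * complex_of_real (gauss (e n *\<^sub>R \<xi>)) \<partial>lborel)
    = complex_of_real G * (\<integral>z. h (t + e n *\<^sub>R z) * complex_of_real (gauss z) \<partial>lborel)" for n
  proof -
    let ?e = "e n"
    let ?F = "\<lambda>\<xi> y. h y * modul \<xi> (y - t) * complex_of_real (gauss (?e *\<^sub>R \<xi>))"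
    have gi: "integrable lborel (\<lambda>\<xi>::real^'n. gauss (?e *\<^sub>R \<xi>))"
      using integrable_lborel_affine[OF integrable_gauss, of ?e 0] e[of n] by simp
    have Fm: "(\<lambda>(\<xi>, y). ?F \<xi> y) \<in> borel_measurable (lborel \<Otimes>\<^sub>M lborel)"
    proof -
      have "(\<lambda>p. ?F (fst p) (snd p)) \<in> borel_measurable borel"
        by (intro borel_measurable_continuous_onI continuous_intros continuous_on_compose2[OF cont]) auto
      then show ?thesis unfolding lborel_prod case_prod_beta by simp
    qed
    have nF: "norm (?F \<xi> y) = norm (h y) * gauss (?e *\<^sub>R \<xi>)" for \<xi> y
      using gauss_pos[of "?e *\<^sub>R \<xi>"] by (simp add: norm_mult)
    have Fi: "integrable (lborel \<Otimes>\<^sub>M lborel) (\<lambda>(\<xi>, y). ?F \<xi> y)"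
    proof (rule lborel_pair.Fubini_integrable[OF Fm])
      show "integrable lborel (\<lambda>\<xi>. \<integral>y. norm (case (\<xi>, y) of (\<xi>, y) \<Rightarrow> ?F \<xi> y) \<partial>lborel)"
        unfolding prod.case nF using gi by simp
      show "AE \<xi> in lborel. integrable lborel (\<lambda>y. case (\<xi>, y) of (\<xi>, y) \<Rightarrow> ?F \<xi> y)"
      proof (rule AE_I2)
        fix \<xi> :: "real^'n"
        have "(\<lambda>y. modul \<xi> (y - t)) \<in> borel_measurable borel"
          by (intro borel_measurable_continuous_onI continuous_intros)
        then show "integrable lborel (\<lambda>y. case (\<xi>, y) of (\<xi>, y) \<Rightarrow> ?F \<xi> y)"
          unfolding prod.case
          by (intro Bochner_Integration.integrable_bound[OF integrable_norm[OF hint]] integrable_mult_left)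
            (auto simp: norm_mult)
      qed
    qed
    have "(\<integral>\<xi>. ft h \<xi> * cnj (modul \<xi> t) * complex_of_real (gauss (?e *\<^sub>R \<xi>)) \<partial>lborel) = (\<integral>\<xi>. (\<integral>y. ?F \<xi> y \<partial>lborel) \<partial>lborel)"
    proof (rule Bochner_Integration.integral_cong[OF refl])
      fix \<xi> :: "real^'n"
      have "(\<integral>y. ?F \<xi> y \<partial>lborel) = (\<integral>y. h y * modul \<xi> y * (cnj (modul \<xi> t) * complex_of_real (gauss (?e *\<^sub>R \<xi>))) \<partial>lborel)"
        using modul_add[of \<xi> _ "- t"] by (intro Bochner_Integration.integral_cong) (simp_all add: cnj_modul mult_ac)
      then show "ft h \<xi> * cnj (modul \<xi> t) * complex_of_real (gauss (?e *\<^sub>R \<xi>)) = (\<integral>y. ?F \<xi> y \<partial>lborel)"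
        by (simp only: ft_def integral_mult_left_zero mult.assoc[symmetric])
    qed
    also have "\<dots> = (\<integral>y. (\<integral>\<xi>. ?F \<xi> y \<partial>lborel) \<partial>lborel)"
      using lborel_pair.Fubini_integral[OF Fi] by simp
    also have "\<dots> = (\<integral>y. h y * complex_of_real (inverse ?e ^ CARD('n) * (G * gauss (inverse ?e *\<^sub>R (y - t)))) \<partial>lborel)"
    proof (rule Bochner_Integration.integral_cong[OF refl])
      fix y :: "real^'n"
      have "(\<integral>\<xi>. modul \<xi> (y - t) * complex_of_real (gauss (?e *\<^sub>R \<xi>)) \<partial>lborel) =
        \<bar>inverse ?e\<bar> ^ DIM(real^'n) *\<^sub>R (\<integral>\<xi>. modul (0 + inverse ?e *\<^sub>R \<xi>) (y - t) * complex_of_real (gauss (?e *\<^sub>R (0 + inverse ?e *\<^sub>R \<xi>))) \<partial>lborel)"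
        by (rule integral_lborel_affine) (use e[of n] in \<open>auto intro!: borel_measurable_continuous_onI continuous_intros\<close>)
      also have "(\<integral>\<xi>. modul (0 + inverse ?e *\<^sub>R \<xi>) (y - t) * complex_of_real (gauss (?e *\<^sub>R (0 + inverse ?e *\<^sub>R \<xi>))) \<partial>lborel) =
        (\<integral>\<xi>. complex_of_real (gauss \<xi>) * modul (inverse ?e *\<^sub>R (y - t)) \<xi> \<partial>lborel)"
        using e[of n] by (intro Bochner_Integration.integral_cong) (auto simp: modul_def inner_commute)
      also have "\<dots> = complex_of_real (G * gauss (inverse ?e *\<^sub>R (y - t)))" unfolding G_def by (rule ft_gauss)
      finally show "(\<integral>\<xi>. ?F \<xi> y \<partial>lborel) = h y * complex_of_real (inverse ?e ^ CARD('n) * (G * gauss (inverse ?e *\<^sub>R (y - t))))"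
        using e[of n] by (simp add: mult.assoc scaleR_conv_of_real)
    qed
    also have "\<dots> = \<bar>?e\<bar> ^ DIM(real^'n) *\<^sub>R (\<integral>z. h (t + ?e *\<^sub>R z) * complex_of_real (inverse ?e ^ CARD('n) * (G * gauss (inverse ?e *\<^sub>R ((t + ?e *\<^sub>R z) - t)))) \<partial>lborel)"
      by (rule integral_lborel_affine) (use e[of n] in \<open>auto intro!: borel_measurable_continuous_onI continuous_intros cont\<close>)
    also have "(\<integral>z. h (t + ?e *\<^sub>R z) * complex_of_real (inverse ?e ^ CARD('n) * (G * gauss (inverse ?e *\<^sub>R ((t + ?e *\<^sub>R z) - t)))) \<partial>lborel) =
      (\<integral>z. complex_of_real (inverse ?e ^ CARD('n) * G) * (h (t + ?e *\<^sub>R z) * complex_of_real (gauss z)) \<partial>lborel)"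
      using e[of n] by (intro Bochner_Integration.integral_cong) (auto simp: mult_ac)
    also have "\<bar>?e\<bar> ^ DIM(real^'n) *\<^sub>R \<dots> = complex_of_real G * (\<integral>z. h (t + ?e *\<^sub>R z) * complex_of_real (gauss z) \<partial>lborel)"
    proof -
      have "\<bar>?e\<bar> ^ DIM(real^'n) * (inverse ?e ^ CARD('n) * G) = G"
        using e[of n] by (simp add: power_inverse)
      then have "\<bar>?e\<bar> ^ DIM(real^'n) *\<^sub>R (complex_of_real (inverse ?e ^ CARD('n) * G) * J) = complex_of_real G * J" for J
        by (metis mult_scaleR_left of_real_mult scaleR_conv_of_real)
      then show ?thesis by (simp only: integral_mult_right_zero)
    qed
    finally show ?thesis .
  qed
  have mc: "(\<lambda>\<xi>. cnj (modul \<xi> t)) \<in> borel_measurable borel"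
    by (intro borel_measurable_continuous_onI continuous_intros)
  have gm: "(\<lambda>\<xi>::real^'n. complex_of_real (gauss (c *\<^sub>R \<xi>))) \<in> borel_measurable borel" for c
    by (intro borel_measurable_continuous_onI continuous_intros)
  have L: "(\<lambda>n. \<integral>\<xi>. ft h \<xi> * cnj (modul \<xi> t) * complex_of_real (gauss (e n *\<^sub>R \<xi>)) \<partial>lborel) \<longlonglongrightarrow> (\<integral>\<xi>. ft h \<xi> * cnj (modul \<xi> t) \<partial>lborel)"
  proof (rule integral_dominated_convergence[OF _ _ integrable_norm[OF fint]])
    show "(\<lambda>\<xi>. ft h \<xi> * cnj (modul \<xi> t)) \<in> borel_measurable lborel"
      using fm mc by (simp add: borel_measurable_times)
    show "(\<lambda>\<xi>. ft h \<xi> * cnj (modul \<xi> t) * complex_of_real (gauss (e n *\<^sub>R \<xi>))) \<in> borel_measurable lborel" for n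
      using fm mc gm[of "e n"] by (simp add: borel_measurable_times)
    show "AE \<xi> in lborel. (\<lambda>n. ft h \<xi> * cnj (modul \<xi> t) * complex_of_real (gauss (e n *\<^sub>R \<xi>))) \<longlonglongrightarrow> ft h \<xi> * cnj (modul \<xi> t)"
    proof (rule AE_I2)
      fix \<xi> :: "real^'n"
      have "(\<lambda>n. ft h \<xi> * cnj (modul \<xi> t) * complex_of_real (gauss (e n *\<^sub>R \<xi>))) \<longlonglongrightarrow> ft h \<xi> * cnj (modul \<xi> t) * complex_of_real (gauss (0 *\<^sub>R \<xi>))"
        unfolding gauss_def by (intro tendsto_intros e0) auto
      then show "(\<lambda>n. ft h \<xi> * cnj (modul \<xi> t) * complex_of_real (gauss (e n *\<^sub>R \<xi>))) \<longlonglongrightarrow> ft h \<xi> * cnj (modul \<xi> t)"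
        by (simp add: gauss_def)
    qed
    show "AE \<xi> in lborel. norm (ft h \<xi> * cnj (modul \<xi> t) * complex_of_real (gauss (e n *\<^sub>R \<xi>))) \<le> norm (ft h \<xi>)" for n
      by (auto intro!: AE_I2 mult_left_le simp: norm_mult abs_of_pos[OF gauss_pos] gauss_le_1)
  qed
  have R: "(\<lambda>n. \<integral>z. h (t + e n *\<^sub>R z) * complex_of_real (gauss z) \<partial>lborel) \<longlonglongrightarrow> (\<integral>z. h t * complex_of_real (gauss (z::real^'n)) \<partial>lborel)"
  proof (rule integral_dominated_convergence[where w = "\<lambda>z. C * gauss z"])
    show "(\<lambda>z. h t * complex_of_real (gauss z)) \<in> borel_measurable lborel" by simp
    show "(\<lambda>z. h (t + e n *\<^sub>R z) * complex_of_real (gauss z)) \<in> borel_measurable lborel" for n by simp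
    show "integrable lborel (\<lambda>z::real^'n. C * gauss z)" using integrable_gauss by (rule integrable_mult_right)
    show "AE z in lborel. (\<lambda>n. h (t + e n *\<^sub>R z) * complex_of_real (gauss z)) \<longlonglongrightarrow> h t * complex_of_real (gauss z)"
    proof (rule AE_I2)
      fix z :: "real^'n"
      have "(\<lambda>n. t + e n *\<^sub>R z) \<longlonglongrightarrow> t + 0 *\<^sub>R z" by (intro tendsto_intros e0)
      then have "(\<lambda>n. h (t + e n *\<^sub>R z)) \<longlonglongrightarrow> h t"
        using continuous_on_tendsto_compose[OF cont, of "\<lambda>n. t + e n *\<^sub>R z" t sequentially] by simp
      then show "(\<lambda>n. h (t + e n *\<^sub>R z) * complex_of_real (gauss z)) \<longlonglongrightarrow> h t * complex_of_real (gauss z)"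
        by (intro tendsto_intros)
    qed
    have "norm (h y) \<le> C" for y
    proof -
      have "C * exp (- a * norm y) \<le> C" using a C by (intro mult_left_le) auto
      then show ?thesis using h[of y] by linarith
    qed
    then show "AE z in lborel. norm (h (t + e n *\<^sub>R z) * complex_of_real (gauss z)) \<le> C * gauss z" for n
      by (auto intro!: AE_I2 mult_right_mono simp: norm_mult abs_of_pos[OF gauss_pos] less_imp_le[OF gauss_pos])
  qed
  have "(\<integral>z. h t * complex_of_real (gauss (z::real^'n)) \<partial>lborel) = h t * complex_of_real G"
    unfolding G_def gauss_int_def by (simp only: integral_mult_right_zero integral_complex_of_real)
  then have R': "(\<lambda>n. complex_of_real G * (\<integral>z. h (t + e n *\<^sub>R z) * complex_of_real (gauss z) \<partial>lborel)) \<longlonglongrightarrow> complex_of_real G * (h t * complex_of_real G)"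
    using tendsto_mult[OF tendsto_const[of "complex_of_real G"] R] by (simp only:)
  from LIMSEQ_unique[OF L[unfolded key] R']
  show ?thesis by (simp add: G_def power2_eq_square mult_ac)
qed

subsection \<open>The reproducing formula\<close>

definition amb :: "(real^'n::finite \<Rightarrow> complex) \<Rightarrow> (real^'n \<Rightarrow> complex) \<Rightarrow> (real^'n) \<times> (real^'n) \<Rightarrow> complex" where
  "amb \<phi> \<psi> Y = (\<integral>y. \<psi> y * cnj (atom \<phi> Y y) \<partial>lborel)"

lemma amb_eq_ft: "amb \<phi> \<psi> (x, \<xi>) = ft (\<lambda>y. \<psi> y * \<phi> (y - x)) (- \<xi>)"
  by (simp add: amb_def atom_def ft_def cnj_modul modul_minus mult.assoc)

text \<open>Since |x| is at most |y| + |y - x|, decay around the shifted point can be exchanged for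
  decay in the shift x at the price of growth in y.\<close>

lemma exp_bounded_translate_decay:
  fixes f :: "real^'n::finite \<Rightarrow> complex"
  assumes f: "exp_bounded (- a) r C f" and r: "0 \<le> r" and a: "0 \<le> a"
  shows "exp_bounded a r (C * exp (- a * norm x)) (\<lambda>y. f (y - x))"
  unfolding exp_bounded_def iter_partial_translate
proof (intro conjI allI)
  show "smooth_fun (\<lambda>y. f (y - x))" by (rule smooth_fun_translate[OF exp_bounded_smooth[OF f]])
  fix ds :: "'n list" and y :: "real^'n"
  have "a * norm x \<le> a * (norm y + norm (y - x))"
    using norm_triangle_ineq4[of y "y - x"] a by (intro mult_left_mono) auto
  then have "exp (- a * norm (y - x)) \<le> exp (- a * norm x) * exp (a * norm y)"
    by (simp add: exp_add[symmetric] algebra_simps)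
  then have "C * exp (- a * norm (y - x)) * r ^ length ds * dfact ds \<le> C * (exp (- a * norm x) * exp (a * norm y)) * r ^ length ds * dfact ds"
    using r exp_bounded_nonneg[OF f] dfact_pos[of ds] by (intro mult_right_mono mult_left_mono) auto
  then show "norm (iter_partial ds f (y - x)) \<le> C * exp (- a * norm x) * exp (a * norm y) * r ^ length ds * dfact ds"
    using exp_boundedD[OF f, of ds "y - x"] by (simp add: mult.assoc)
qed

text \<open>One half of the decay rate \<open>2 * R\<close> of \<psi> cancels the growth of the
  shifted window in y, the other half remains.\<close>

lemma window_mult_bound:
  fixes \<phi> \<psi> :: "real^'n::finite \<Rightarrow> complex"
  assumes "exp_bounded (- (2 * R)) r C \<psi>" "exp_bounded (- R) r C0 \<phi>" "0 < R" "0 < r"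
  shows "exp_bounded (- R) (2 * r) (C * (C0 * exp (- R * norm x))) (\<lambda>y. \<psi> y * \<phi> (y - x))"
  using exp_bounded_mult[OF assms(1) exp_bounded_translate_decay[OF assms(2), of x]] assms by simp

lemma norm_pair_le_sum: "norm (Y :: 'a::real_normed_vector \<times> 'b::real_normed_vector) \<le> norm (fst Y) + norm (snd Y)"
  using norm_Pair_le[of "fst Y" "snd Y"] by simp

lemma card_index_ge_1: "1 \<le> real CARD('n::finite)"
  using zero_less_card_finite[where 'a='n] by linarith

text \<open>The norms of \<open>exp_bounded (- R) (1 / R) C f\<close>, \<open>R > 0\<close>, are increasing in \<open>R\<close> and generate the topology of \<open>Sigma1\<close>.\<close>

definition sbound :: "real \<Rightarrow> real \<Rightarrow> (real^'n::finite \<Rightarrow> complex) \<Rightarrow> bool" where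
  "sbound R C f \<longleftrightarrow> exp_bounded (- R) (1 / R) C f"

lemma sbound_nonneg: "sbound R C f \<Longrightarrow> 0 \<le> C"
  unfolding sbound_def by (rule exp_bounded_nonneg)

lemma sbound_mono: "sbound R C f \<Longrightarrow> 0 < R' \<Longrightarrow> R' \<le> R \<Longrightarrow> C \<le> C' \<Longrightarrow> sbound R' C' f"
  unfolding sbound_def by (erule exp_bounded_mono) (auto simp: field_simps)

lemma Sigma1_sbound:
  assumes "f \<in> Sigma1" "0 < R" obtains C where "sbound R C f"
  using Sigma1_exp_bounded[OF assms(1), of "1 / R" R] assms(2) unfolding sbound_def by auto

text \<open>Decay in the position comes from the product of \<psi> with the shifted window, decay in
  the frequency from its smoothness through \<open>ft_decay\<close>. The constant is linear in the
  norm of \<psi>, so that functionals defined by integrals against \<open>amb\<close> become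
  continuous.\<close>

lemma amb_decay:
  fixes \<phi> :: "real^'n::finite \<Rightarrow> complex" and R :: real
  assumes \<phi>: "\<phi> \<in> Sigma1" and R: "0 < R"
  obtains K where "0 \<le> K" "\<And>\<psi> C Y. sbound (4 * CARD('n) * R) C \<psi> \<Longrightarrow> norm (amb \<phi> \<psi> Y) \<le> K * C * exp (- R * norm Y)"
proof -
  \<comment> \<open>The product has radius \<open>2 * r\<close>, hence \<open>ft_decay\<close> gives
    the rate \<open>1 / (4 * r * CARD('n))\<close>, which is R.\<close>
  define r where "r = 1 / (4 * CARD('n) * R)"
  have r: "0 < r" using R by (simp add: r_def)
  obtain C0 where C0: "exp_bounded (- R) r C0 \<phi>" using Sigma1_exp_bounded[OF \<phi> r] by blast
  have C0n: "0 \<le> C0" by (rule exp_bounded_nonneg[OF C0])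
  define I where "I = (\<integral>y. exp (- R * norm (y::real^'n)) \<partial>lborel)"
  have I: "0 \<le> I" unfolding I_def by (rule integral_nonneg_AE) simp
  show ?thesis
  proof (rule that[of "2 * C0 * I"])
    show "0 \<le> 2 * C0 * I" using C0n I by simp
    fix \<psi> :: "real^'n \<Rightarrow> complex" and C and Y :: "(real^'n) \<times> (real^'n)"
    assume "sbound (4 * CARD('n) * R) C \<psi>"
    then have \<psi>: "exp_bounded (- (4 * CARD('n) * R)) r C \<psi>" by (simp add: sbound_def r_def)
    have C: "0 \<le> C" by (rule exp_bounded_nonneg[OF \<psi>])
    have "2 * R \<le> 4 * CARD('n) * R" using card_index_ge_1[where 'n='n] R by (intro mult_right_mono) linarith+
    then have \<psi>': "exp_bounded (- (2 * R)) r C \<psi>" by (intro exp_bounded_mono[OF \<psi>]) (use r in auto)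
    obtain x \<xi> where Y: "Y = (x, \<xi>)" by (cases Y)
    have "norm (amb \<phi> \<psi> Y) \<le> 2 * (C * (C0 * exp (- R * norm x)) * I) * exp (- (1 / (2 * (2 * r) * CARD('n))) * norm (- \<xi>))"
      unfolding Y amb_eq_ft I_def by (rule ft_decay[OF window_mult_bound[OF \<psi>' C0 R r] R]) (use r in simp)
    also have "1 / (2 * (2 * r) * CARD('n)) = R" using R by (simp add: r_def)
    also have "2 * (C * (C0 * exp (- R * norm x)) * I) * exp (- R * norm (- \<xi>)) = (2 * C0 * I) * C * exp (- R * (norm x + norm \<xi>))"
      by (simp add: exp_add distrib_left mult_ac exp_diff exp_minus divide_inverse)
    also have "\<dots> \<le> (2 * C0 * I) * C * exp (- R * norm Y)"
    proof -
      have "R * norm Y \<le> R * (norm x + norm \<xi>)" using norm_pair_le_sum[of Y] R by (intro mult_left_mono) (auto simp: Y)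
      then show ?thesis using C C0n I by (intro mult_left_mono) auto
    qed
    finally show "norm (amb \<phi> \<psi> Y) \<le> 2 * C0 * I * C * exp (- R * norm Y)" .
  qed
qed

lemma sbound_atom_lipschitz:
  fixes \<phi> :: "real^'n::finite \<Rightarrow> complex"
  assumes \<phi>: "\<phi> \<in> Sigma1" and R: "0 < R"
  obtains C where "0 \<le> C" "\<And>X Y. norm X \<le> B \<Longrightarrow> norm Y \<le> B \<Longrightarrow> norm (X - Y) \<le> 1 \<Longrightarrow>
     sbound R (C * norm (X - Y)) (\<lambda>y. atom \<phi> X y - atom \<phi> Y y)"
proof -
  have r: "0 < 1 / R" using R by simp
  show ?thesis
    by (rule atom_lipschitz[OF \<phi> r, of B R]) (rule that, auto simp: sbound_def)
qed

text \<open>Transforms, ambiguity functions and derivatives of atoms at a point depend on X through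
  \<open>atom\<close> and are controlled by one norm of \<open>Sigma1\<close>; the local Lipschitz
  estimate for atoms settles the continuity of all of them.\<close>

lemma continuous_on_atom_functional:
  fixes \<phi> :: "real^'n::finite \<Rightarrow> complex" and F :: "(real^'n) \<times> (real^'n) \<Rightarrow> complex"
  assumes \<phi>: "\<phi> \<in> Sigma1" and R: "0 < R"
    and F: "\<And>X Y c. sbound R c (\<lambda>y. atom \<phi> X y - atom \<phi> Y y) \<Longrightarrow> norm (F X - F Y) \<le> M * c"
  shows "continuous_on UNIV F"
proof (intro continuous_at_imp_continuous_on ballI)
  fix X :: "(real^'n) \<times> (real^'n)"
  obtain C where C: "0 \<le> C" "\<And>X' Y. norm X' \<le> norm X + 1 \<Longrightarrow> norm Y \<le> norm X + 1 \<Longrightarrow> norm (X' - Y) \<le> 1 \<Longrightarrow>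
     sbound R (C * norm (X' - Y)) (\<lambda>y. atom \<phi> X' y - atom \<phi> Y y)"
    using sbound_atom_lipschitz[OF \<phi> R] by blast
  have "\<forall>\<^sub>F Y in at X. norm (F Y - F X) \<le> (\<bar>M\<bar> * C) * norm (Y - X)"
    unfolding eventually_at
  proof (intro exI[of _ 1] conjI ballI impI)
    fix Y assume "Y \<noteq> X \<and> dist Y X < 1"
    then have d: "norm (Y - X) < 1" by (simp add: dist_norm)
    then have "norm Y \<le> norm X + 1" using norm_triangle_sub[of Y X] by simp
    then have s: "sbound R (C * norm (Y - X)) (\<lambda>y. atom \<phi> Y y - atom \<phi> X y)" using d by (intro C(2)) auto
    have "norm (F Y - F X) \<le> M * (C * norm (Y - X))" by (rule F[OF s])
    also have "\<dots> \<le> \<bar>M\<bar> * (C * norm (Y - X))" using C by (intro mult_right_mono) auto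
    finally show "norm (F Y - F X) \<le> (\<bar>M\<bar> * C) * norm (Y - X)" by (simp add: mult.assoc)
  qed simp
  moreover have "((\<lambda>Y. (\<bar>M\<bar> * C) * norm (Y - X)) \<longlongrightarrow> (\<bar>M\<bar> * C) * norm (X - X)) (at X)"
    by (intro tendsto_intros)
  then have "((\<lambda>Y. (\<bar>M\<bar> * C) * norm (Y - X)) \<longlongrightarrow> 0) (at X)" by simp
  ultimately have "((\<lambda>Y. F Y - F X) \<longlongrightarrow> 0) (at X)" by (rule Lim_null_comparison)
  then show "isCont F X" unfolding isCont_def by (rule LIM_zero_cancel)
qed

lemma integrable_mult_sbound:
  fixes f g :: "real^'n::finite \<Rightarrow> complex"
  assumes f: "f \<in> borel_measurable borel" "\<And>y. norm (f y) \<le> C" and g: "sbound R c g" "0 < R"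
  shows "integrable lborel (\<lambda>y. f y * g y)"
    "norm (\<integral>y. f y * g y \<partial>lborel) \<le> C * (\<integral>y. exp (- R * norm (y::real^'n)) \<partial>lborel) * c"
proof -
  have g': "exp_bounded (- R) (1 / R) c g" using g by (simp add: sbound_def)
  have C: "0 \<le> C" using order_trans[OF norm_ge_zero f(2)] .
  have b: "norm (f y * g y) \<le> C * c * exp (- R * norm y)" for y
    using mult_mono[OF f(2) exp_bounded_norm[OF g'] C norm_ge_zero] by (simp add: norm_mult mult_ac)
  show i: "integrable lborel (\<lambda>y. f y * g y)"
    using exp_bounded_measurable[OF g'] f by (intro integrable_exp_decay[OF _ b g(2)]) simp
  have "norm (\<integral>y. f y * g y \<partial>lborel) \<le> (\<integral>y. norm (f y * g y) \<partial>lborel)" by (rule integral_norm_bound)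
  also have "\<dots> \<le> (\<integral>y. C * c * exp (- R * norm (y::real^'n)) \<partial>lborel)"
    by (intro integral_mono integrable_norm i integrable_mult_right integrable_exp_norm g b)
  finally show "norm (\<integral>y. f y * g y \<partial>lborel) \<le> C * (\<integral>y. exp (- R * norm (y::real^'n)) \<partial>lborel) * c"
    by (simp add: mult_ac)
qed

lemma sbound_cnj: "sbound R C f \<Longrightarrow> sbound R C (\<lambda>y. cnj (f y))"
  unfolding sbound_def by (rule exp_bounded_cnj)

lemma Sigma1_measurable: "f \<in> Sigma1 \<Longrightarrow> f \<in> borel_measurable borel"
  by (meson Sigma1_exp_bounded exp_bounded_measurable zero_less_one)

lemma Sigma1_bounded:
  assumes "f \<in> Sigma1" obtains C where "\<And>y. norm (f y) \<le> C"
proof -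
  obtain C where C: "exp_bounded (- 0) 1 C f" using Sigma1_exp_bounded[OF assms, of 1 0] by auto
  show ?thesis using exp_bounded_norm[OF C] by (intro that[of C]) simp
qed

lemma continuous_on_amb:
  fixes \<phi> :: "real^'n::finite \<Rightarrow> complex"
  assumes \<phi>: "\<phi> \<in> Sigma1" and \<psi>: "\<psi> \<in> Sigma1"
  shows "continuous_on UNIV (amb \<phi> \<psi>)"
proof -
  obtain C where C: "\<And>y. norm (\<psi> y) \<le> C" using Sigma1_bounded[OF \<psi>] by blast
  have int: "integrable lborel (\<lambda>y. \<psi> y * cnj (atom \<phi> X y))" for X
  proof -
    obtain c where "sbound 1 c (atom \<phi> X)" using Sigma1_sbound[OF atom_in_Sigma1[OF \<phi>, of X]] by (metis zero_less_one)
    from integrable_mult_sbound(1)[OF Sigma1_measurable[OF \<psi>] C sbound_cnj[OF this]] show ?thesis by simp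
  qed
  show ?thesis
  proof (rule continuous_on_atom_functional[OF \<phi> zero_less_one])
    fix X Y c assume "sbound 1 c (\<lambda>y. atom \<phi> X y - atom \<phi> Y y)"
    from integrable_mult_sbound(2)[OF Sigma1_measurable[OF \<psi>] C sbound_cnj[OF this]]
    show "norm (amb \<phi> \<psi> X - amb \<phi> \<psi> Y) \<le> (C * (\<integral>y. exp (- 1 * norm (y::real^'n)) \<partial>lborel)) * c"
      using int[of X] int[of Y] by (simp add: amb_def right_diff_distrib)
  qed
qed

lemma continuous_on_iter_partial_atom:
  fixes \<phi> :: "real^'n::finite \<Rightarrow> complex"
  assumes \<phi>: "\<phi> \<in> Sigma1"
  shows "continuous_on UNIV (\<lambda>Y. iter_partial ds (atom \<phi> Y) t)"
proof (rule continuous_on_atom_functional[OF \<phi> zero_less_one])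
  fix X Y c assume s: "sbound 1 c (\<lambda>y. atom \<phi> X y - atom \<phi> Y y)"
  have sm: "smooth_fun (atom \<phi> X)" for X using atom_in_Sigma1[OF \<phi>, of X] by (simp add: Sigma1_def)
  have "iter_partial ds (\<lambda>y. atom \<phi> X y - atom \<phi> Y y) t = iter_partial ds (atom \<phi> X) t - iter_partial ds (atom \<phi> Y) t"
    using iter_partial_diff[OF sm sm] by simp
  then show "norm (iter_partial ds (atom \<phi> X) t - iter_partial ds (atom \<phi> Y) t) \<le> (exp (- 1 * norm t) * dfact ds) * c"
    using exp_boundedD[OF s[unfolded sbound_def], of ds t] by (simp add: mult_ac)
qed

lemma norm_iter_partial_atom:
  fixes \<phi> :: "real^'n::finite \<Rightarrow> complex"
  assumes \<phi>: "\<phi> \<in> Sigma1"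
  obtains C where "0 \<le> C" "\<And>Y t. norm (iter_partial ds (atom \<phi> Y) t) \<le> C * exp (CARD('n) * norm Y)"
proof -
  obtain C where C: "exp_bounded (- 0) 1 C \<phi>" using Sigma1_exp_bounded[OF \<phi>, of 1 0] by auto
  show ?thesis
  proof (rule that[of "C * 2 ^ length ds * dfact ds"])
    show "0 \<le> C * 2 ^ length ds * dfact ds" using exp_bounded_nonneg[OF C] dfact_pos[of ds] by simp
    show "norm (iter_partial ds (atom \<phi> Y) t) \<le> C * 2 ^ length ds * dfact ds * exp (CARD('n) * norm Y)" for Y t
      using exp_boundedD[OF exp_bounded_atom[OF C, of Y], of ds t] by (simp add: mult_ac)
  qed
qed

lemma amb_decay_Sigma1:
  fixes \<phi> :: "real^'n::finite \<Rightarrow> complex" and R :: real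
  assumes \<phi>: "\<phi> \<in> Sigma1" and \<psi>: "\<psi> \<in> Sigma1" and R: "0 < R"
  obtains K where "0 \<le> K" "\<And>Y. norm (amb \<phi> \<psi> Y) \<le> K * exp (- R * norm Y)"
proof -
  obtain K where K: "0 \<le> K" "\<And>\<psi> C Y. sbound (4 * CARD('n) * R) C \<psi> \<Longrightarrow> norm (amb \<phi> \<psi> Y) \<le> K * C * exp (- R * norm Y)"
    using amb_decay[OF \<phi> R] by blast
  obtain C where C: "sbound (4 * CARD('n) * R) C \<psi>" using Sigma1_sbound[OF \<psi>, of "4 * CARD('n) * R"] R by auto
  show ?thesis by (rule that[of "K * C"]) (use K sbound_nonneg[OF C] C in auto)
qed

text \<open>The constant of the reproducing formula: the constant of Fourier inversion times the
  squared L2 norm of the window.\<close>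

definition window_const :: "(real^'n::finite \<Rightarrow> complex) \<Rightarrow> real" where
  "window_const \<phi> = (gauss_int TYPE('n))\<^sup>2 * (\<integral>y. (norm (\<phi> y))\<^sup>2 \<partial>lborel)"

lemma integrable_norm_square_Sigma1:
  assumes "\<phi> \<in> Sigma1" shows "integrable lborel (\<lambda>y. (norm (\<phi> y))\<^sup>2)"
proof -
  obtain C where C: "\<And>y. norm (\<phi> y) \<le> C" using Sigma1_bounded[OF assms] by blast
  obtain c where c: "sbound 1 c \<phi>" using Sigma1_sbound[OF assms] by (metis zero_less_one)
  have "integrable lborel (\<lambda>y. norm (\<phi> y * \<phi> y))"
    by (rule integrable_norm[OF integrable_mult_sbound(1)[OF Sigma1_measurable[OF assms] C c zero_less_one]])
  then show ?thesis by (simp add: norm_mult power2_eq_square)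
qed

lemma integral_norm_square_pos:
  fixes \<phi> :: "real^'n::finite \<Rightarrow> complex"
  assumes \<phi>: "\<phi> \<in> Sigma1" "\<phi> \<noteq> (\<lambda>x. 0)"
  shows "0 < (\<integral>y. (norm (\<phi> y))\<^sup>2 \<partial>lborel)"
proof -
  have "0 \<le> (\<integral>y. (norm (\<phi> y))\<^sup>2 \<partial>lborel)" by (rule integral_nonneg_AE) simp
  moreover have "(\<integral>y. (norm (\<phi> y))\<^sup>2 \<partial>lborel) \<noteq> 0"
  proof
    assume "(\<integral>y. (norm (\<phi> y))\<^sup>2 \<partial>lborel) = 0"
    then have "AE y in lborel. \<phi> y = 0"
      using integral_nonneg_eq_0_iff_AE[OF integrable_norm_square_Sigma1[OF \<phi>(1)]] by simp
    have c: "continuous_on UNIV \<phi>" using \<phi>(1) by (intro smooth_fun_continuous) (simp add: Sigma1_def)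
    have o: "open {y. \<phi> y \<noteq> 0}"
      using open_vimage[OF _ c, of "- {0}"] by (simp add: vimage_def open_Compl)
    then have "{y. \<phi> y \<noteq> 0} \<in> sets lborel" by simp
    with \<open>AE y in lborel. \<phi> y = 0\<close> have "{y. \<phi> y \<noteq> 0} \<in> null_sets lborel"
      by (subst AE_iff_null_sets) auto
    then have "negligible {y. \<phi> y \<noteq> 0}"
      by (simp add: negligible_iff_null_sets null_sets_completionI)
    then have "{y. \<phi> y \<noteq> 0} = {}" using open_not_negligible[OF o] by blast
    then show False using \<phi>(2) by auto
  qed
  ultimately show ?thesis by linarith
qed

text \<open>For fixed position x the integral over the frequency is Fourier inversion for \<psi>
  times the window shifted by x. What remains is \<psi>(t) times the squared modulus of the window
  at t - x, and integration over x gives the L2 norm.\<close>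

lemma reproducing_formula:
  fixes \<phi> \<psi> :: "real^'n::finite \<Rightarrow> complex"
  assumes \<phi>: "\<phi> \<in> Sigma1" and \<psi>: "\<psi> \<in> Sigma1"
  shows "(\<integral>Y. amb \<phi> \<psi> Y * atom \<phi> Y t \<partial>lborel) = complex_of_real (window_const \<phi>) * \<psi> t"
proof -
  define R where "R = real CARD('n) + 1"
  have R: "0 < R" by (simp add: R_def)
  obtain K where K: "0 \<le> K" "\<And>Y. norm (amb \<phi> \<psi> Y) \<le> K * exp (- R * norm Y)"
    using amb_decay_Sigma1[OF \<phi> \<psi> R] by blast
  obtain C where C: "\<And>y. norm (\<phi> y) \<le> C" using Sigma1_bounded[OF \<phi>] by blast
  have Cn: "0 \<le> C" using order_trans[OF norm_ge_zero C] .
  let ?f = "\<lambda>Y. amb \<phi> \<psi> Y * atom \<phi> Y t"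
  have nat: "norm (atom \<phi> Y t) \<le> C" for Y using C by (simp add: atom_def norm_mult)
  have fm: "?f \<in> borel_measurable borel"
    using continuous_on_iter_partial_atom[OF \<phi>, of "[]" t]
    by (intro borel_measurable_continuous_onI continuous_intros continuous_on_amb \<phi> \<psi>) simp
  have fi: "integrable lborel ?f"
  proof (rule integrable_exp_decay[OF fm _ R])
    show "norm (?f Y) \<le> (K * C) * exp (- R * norm Y)" for Y
      using mult_mono[OF K(2)[of Y] nat[of Y]] K(1) by (simp add: norm_mult mult_ac)
  qed
  have inner: "(\<integral>\<xi>. ?f (x, \<xi>) \<partial>lborel) = complex_of_real ((gauss_int TYPE('n))\<^sup>2) * \<psi> t * complex_of_real ((norm (\<phi> (t - x)))\<^sup>2)" for x
  proof -
    let ?h = "\<lambda>y. \<psi> y * \<phi> (y - x)"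
    have "smooth_fun ?h" using \<phi> \<psi> by (intro smooth_fun_mult smooth_fun_translate) (auto simp: Sigma1_def)
    then have hc: "continuous_on UNIV ?h" by (rule smooth_fun_continuous)
    obtain c where c: "exp_bounded (- 1) 1 c \<psi>" using Sigma1_exp_bounded[OF \<psi>, of 1 1] by auto
    have hb: "norm (?h y) \<le> (c * C) * exp (- 1 * norm y)" for y
      using mult_mono[OF exp_bounded_norm[OF c, of y] C[of "y - x"]] exp_bounded_nonneg[OF c] Cn by (simp add: norm_mult mult_ac)
    have ft_eq: "ft ?h = (\<lambda>\<xi>. amb \<phi> \<psi> (x, - \<xi>))" by (simp add: amb_eq_ft fun_eq_iff)
    have ftc: "continuous_on UNIV (ft ?h)"
      unfolding ft_eq by (intro continuous_on_compose2[OF continuous_on_amb[OF \<phi> \<psi>]] continuous_intros) auto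
    have ftb: "norm (ft ?h \<xi>) \<le> K * exp (- R * norm \<xi>)" for \<xi>
    proof -
      have "norm \<xi> \<le> norm (x, - \<xi>)" using norm_snd_le[of "- \<xi>" x] by simp
      then have "K * exp (- R * norm (x, - \<xi>)) \<le> K * exp (- R * norm \<xi>)" using K R by (intro mult_left_mono) auto
      then show ?thesis using K(2)[of "(x, - \<xi>)"] by (simp add: ft_eq)
    qed
    have "(\<integral>\<xi>. ft ?h \<xi> * cnj (modul \<xi> t) \<partial>lborel) = complex_of_real ((gauss_int TYPE('n))\<^sup>2) * ?h t"
      by (rule fourier_inversion[OF hc hb zero_less_one borel_measurable_continuous_onI[OF ftc] ftb R])
    \<comment> \<open>\<open>amb\<close> evaluates the transform at the negative frequency, hence
      the reflection.\<close>
    moreover have "(\<integral>\<xi>. ft ?h (0 - \<xi>) * cnj (modul (0 - \<xi>) t) \<partial>lborel) = (\<integral>\<xi>. ft ?h \<xi> * cnj (modul \<xi> t) \<partial>lborel)"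
      by (rule integral_lborel_reflect) (intro borel_measurable_continuous_onI continuous_intros ftc)
    moreover have "?f (x, \<xi>) = cnj (\<phi> (t - x)) * (ft ?h (0 - \<xi>) * cnj (modul (0 - \<xi>) t))" for \<xi>
      by (simp add: ft_eq atom_def cnj_modul modul_minus)
    ultimately have "(\<integral>\<xi>. ?f (x, \<xi>) \<partial>lborel) = cnj (\<phi> (t - x)) * (complex_of_real ((gauss_int TYPE('n))\<^sup>2) * ?h t)"
      by simp
    also have "\<dots> = complex_of_real ((gauss_int TYPE('n))\<^sup>2) * \<psi> t * (\<phi> (t - x) * cnj (\<phi> (t - x)))" by simp
    finally show ?thesis by (simp only: complex_norm_square)
  qed
  have "integral\<^sup>L lborel ?f = (\<integral>x. \<integral>\<xi>. ?f (x, \<xi>) \<partial>lborel \<partial>lborel)"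
    using lborel_pair.integral_fst'[of ?f] fi by (simp add: lborel_prod)
  also have "\<dots> = complex_of_real ((gauss_int TYPE('n))\<^sup>2) * \<psi> t * complex_of_real (\<integral>x. (norm (\<phi> (t - x)))\<^sup>2 \<partial>lborel)"
    unfolding inner by (simp del: of_real_power)
  also have "(\<integral>x. (norm (\<phi> (t - x)))\<^sup>2 \<partial>lborel) = (\<integral>y. (norm (\<phi> y))\<^sup>2 \<partial>lborel)"
    using Sigma1_measurable[OF \<phi>] by (intro integral_lborel_reflect) simp
  finally show ?thesis by (simp add: window_const_def mult_ac)
qed

text \<open>Differentiation in t under the integral, one direction at a time. The formula is wanted
  for all derivatives because its Riemann sums have to converge in a norm of
  \<open>Sigma1\<close>.\<close>

lemma iter_partial_reproducing_formula:
  fixes \<phi> \<psi> :: "real^'n::finite \<Rightarrow> complex"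
  assumes \<phi>: "\<phi> \<in> Sigma1" and \<psi>: "\<psi> \<in> Sigma1"
  shows "(\<integral>Y. amb \<phi> \<psi> Y * iter_partial ds (atom \<phi> Y) t \<partial>lborel) = complex_of_real (window_const \<phi>) * iter_partial ds \<psi> t"
proof (induction ds arbitrary: t)
  case Nil
  then show ?case using reproducing_formula[OF \<phi> \<psi>] by simp
next
  case (Cons i ds)
  \<comment> \<open>Derivatives of atoms grow in Y at the rate \<open>CARD('n)\<close>; one more
    unit of decay leaves an integrable majorant.\<close>
  define R where "R = real CARD('n) + 1"
  have R: "0 < R" by (simp add: R_def)
  obtain K where K: "0 \<le> K" "\<And>Y. norm (amb \<phi> \<psi> Y) \<le> K * exp (- R * norm Y)"
    using amb_decay_Sigma1[OF \<phi> \<psi> R] by blast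
  have b: "\<exists>C. \<forall>Y t. norm (amb \<phi> \<psi> Y * iter_partial es (atom \<phi> Y) t) \<le> C * exp (- 1 * norm Y)" for es
  proof -
    obtain C where C: "0 \<le> C" "\<And>Y t. norm (iter_partial es (atom \<phi> Y) t) \<le> C * exp (CARD('n) * norm Y)"
      using norm_iter_partial_atom[OF \<phi>] by blast
    have "norm (amb \<phi> \<psi> Y * iter_partial es (atom \<phi> Y) t) \<le> (K * C) * exp (- 1 * norm Y)" for Y t
    proof -
      have "norm (amb \<phi> \<psi> Y * iter_partial es (atom \<phi> Y) t) \<le> (K * exp (- R * norm Y)) * (C * exp (CARD('n) * norm Y))"
        unfolding norm_mult using K C by (intro mult_mono) auto
      also have "\<dots> = (K * C) * (exp (- R * norm Y) * exp (CARD('n) * norm Y))" by simp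
      also have "exp (- R * norm Y) * exp (CARD('n) * norm Y) = exp (- 1 * norm Y)"
        by (simp add: R_def exp_add[symmetric] algebra_simps)
      finally show ?thesis .
    qed
    then show ?thesis by blast
  qed
  have int: "integrable lborel (\<lambda>Y. amb \<phi> \<psi> Y * iter_partial es (atom \<phi> Y) t)" for es t
  proof -
    obtain C where "\<And>Y. norm (amb \<phi> \<psi> Y * iter_partial es (atom \<phi> Y) t) \<le> C * exp (- 1 * norm Y)" using b by blast
    then show ?thesis
      by (intro integrable_exp_decay[OF _ _ zero_less_one] borel_measurable_continuous_onI continuous_intros
          continuous_on_amb \<phi> \<psi> continuous_on_iter_partial_atom)
  qed
  have der: "((\<lambda>s. iter_partial ds f (t + s *\<^sub>R axis i 1)) has_vector_derivative iter_partial (i # ds) f (t + s *\<^sub>R axis i 1)) (at s)"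
    if f: "f \<in> Sigma1" for f s
  proof -
    have "iter_partial ds f differentiable (at (t + s *\<^sub>R axis i 1))"
      using f by (intro smooth_funD) (simp add: Sigma1_def)
    then obtain D where D: "(iter_partial ds f has_derivative D) (at (t + s *\<^sub>R axis i 1))"
      unfolding differentiable_def by blast
    show ?thesis using has_derivative_axis_line[OF D] partial_dir_eq[OF D, of i] by simp
  qed
  obtain C where C: "\<And>Y t. norm (amb \<phi> \<psi> Y * iter_partial (i # ds) (atom \<phi> Y) t) \<le> C * exp (- 1 * norm Y)" using b by blast
  have "((\<lambda>s. \<integral>Y. amb \<phi> \<psi> Y * iter_partial ds (atom \<phi> Y) (t + s *\<^sub>R axis i 1) \<partial>lborel) has_vector_derivative
     (\<integral>Y. amb \<phi> \<psi> Y * iter_partial (i # ds) (atom \<phi> Y) (t + 0 *\<^sub>R axis i 1) \<partial>lborel)) (at 0)"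
  proof (rule has_vector_derivative_integral_0(1)[OF _ C _ int])
    show "((\<lambda>s. amb \<phi> \<psi> Y * iter_partial ds (atom \<phi> Y) (t + s *\<^sub>R axis i 1)) has_vector_derivative
        amb \<phi> \<psi> Y * iter_partial (i # ds) (atom \<phi> Y) (t + s *\<^sub>R axis i 1)) (at s)" for s Y
      by (rule has_vector_derivative_mult_right[OF der[OF atom_in_Sigma1[OF \<phi>]]])
    show "integrable lborel (\<lambda>Y::(real^'n)\<times>(real^'n). C * exp (- 1 * norm Y))"
      by (intro integrable_mult_right integrable_exp_norm) simp
  qed
  moreover have "((\<lambda>s. \<integral>Y. amb \<phi> \<psi> Y * iter_partial ds (atom \<phi> Y) (t + s *\<^sub>R axis i 1) \<partial>lborel) has_vector_derivative
     complex_of_real (window_const \<phi>) * iter_partial (i # ds) \<psi> (t + 0 *\<^sub>R axis i 1)) (at 0)"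
    unfolding Cons.IH by (rule has_vector_derivative_mult_right[OF der[OF \<psi>]])
  ultimately show ?case using vector_derivative_unique_at by fastforce
qed

text \<open>The error depends on f only through its oscillation. One division is therefore good for
  all functions with a common modulus of continuity.\<close>

lemma riemann_sum_error:
  fixes f :: "'a::euclidean_space \<Rightarrow> 'b::banach"
  assumes p: "p tagged_division_of cbox a b" and fine: "(\<lambda>x. ball x \<delta>) fine p"
    and cont: "continuous_on (cbox a b) f"
    and osc: "\<And>x y. x \<in> cbox a b \<Longrightarrow> y \<in> cbox a b \<Longrightarrow> dist x y < \<delta> \<Longrightarrow> norm (f x - f y) \<le> e"
  shows "norm ((\<Sum>(x, k)\<in>p. measure lborel k *\<^sub>R f x) - integral (cbox a b) f) \<le> e * measure lborel (cbox a b)"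
proof -
  have fin: "finite p" using p by (rule tagged_division_of_finite)
  have i: "integral (cbox a b) f = (\<Sum>(x, k)\<in>p. integral k f)"
    by (rule integral_combine_tagged_division_topdown[OF integrable_continuous[OF cont] p])
  have each: "norm (measure lborel k *\<^sub>R f x - integral k f) \<le> e * measure lborel k" if xk: "(x, k) \<in> p" for x k
  proof -
    obtain c d where k: "k = cbox c d" using tagged_division_ofD(4)[OF p xk] by blast
    have sub: "k \<subseteq> cbox a b" "x \<in> k" using tagged_division_ofD(2,3)[OF p xk] by auto
    have b: "k \<subseteq> ball x \<delta>" using fine xk by (auto simp: fine_def)
    then have "0 < \<delta>" using sub by (auto simp: dist_norm)
    then have e: "0 \<le> e" using osc[of x x] sub by (auto intro: order_trans)
    have "f integrable_on k" unfolding k using sub cont by (intro integrable_continuous) (auto simp: k intro: continuous_on_subset)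
    then have "((\<lambda>y. f x - f y) has_integral measure lborel k *\<^sub>R f x - integral k f) k"
      unfolding k by (intro has_integral_diff has_integral_const integrable_integral)
    moreover have "norm (f x - f y) \<le> e" if "y \<in> cbox c d" for y
      using that sub b by (intro osc) (auto simp: k)
    ultimately show ?thesis
      unfolding k by (rule has_integral_bound[OF e])
  qed
  have "(\<Sum>(x, k)\<in>p. measure lborel k *\<^sub>R f x) - integral (cbox a b) f = (\<Sum>q\<in>p. measure lborel (snd q) *\<^sub>R f (fst q) - integral (snd q) f)"
    unfolding i by (simp add: sum_subtractf case_prod_unfold)
  also have "norm \<dots> \<le> (\<Sum>q\<in>p. e * measure lborel (snd q))"
    by (rule sum_norm_le) (use each in auto)
  also have "\<dots> = e * measure lborel (cbox a b)"
    using additive_content_tagged_division[OF p] by (simp add: sum_distrib_left[symmetric] case_prod_unfold)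
  finally show ?thesis .
qed

lemma set_integral_cbox_continuous:
  fixes f :: "'a::euclidean_space \<Rightarrow> complex"
  assumes "continuous_on UNIV f"
  shows "integral (cbox a b) f = (\<integral>x. indicator (cbox a b) x *\<^sub>R f x \<partial>lborel)"
proof -
  have "set_integrable lborel (cbox a b) f"
    using borel_integrable_compact[OF compact_cbox continuous_on_subset[OF assms subset_UNIV]]
    by (simp add: set_integrable_def indicator_def if_distrib[of "\<lambda>c. c *\<^sub>R _"] cong: if_cong)
  from set_borel_integral_eq_integral(2)[OF this] show ?thesis by (simp add: set_lebesgue_integral_def)
qed

lemma small_tail_box:
  assumes "0 < e"
  obtains n :: nat where "(\<integral>x. indicator (- cbox (- real n *\<^sub>R One) (real n *\<^sub>R One)) x * exp (- 1 * norm (x::'a::euclidean_space)) \<partial>lborel) < e"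
proof -
  let ?K = "\<lambda>n. cbox (- real n *\<^sub>R One) (real n *\<^sub>R One) :: 'a set"
  have "(\<lambda>n. \<integral>x. indicator (- ?K n) x * exp (- 1 * norm x) \<partial>lborel) \<longlonglongrightarrow> (\<integral>x. (0::real) \<partial>(lborel :: 'a measure))"
  proof (rule integral_dominated_convergence[where w = "\<lambda>x. exp (- 1 * norm x)"])
    show "integrable lborel (\<lambda>x::'a. exp (- 1 * norm x))" by (rule integrable_exp_norm) simp
    show "AE x in lborel. (\<lambda>n. indicator (- ?K n) x * exp (- 1 * norm x)) \<longlonglongrightarrow> 0"
    proof (rule AE_I2)
      fix x :: 'a
      have "\<forall>\<^sub>F n in sequentially. indicator (- ?K n) x * exp (- 1 * norm x) = 0"
        unfolding eventually_sequentially
      proof (intro exI[of _ "nat \<lceil>norm x\<rceil>"] allI impI)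
        fix n assume "nat \<lceil>norm x\<rceil> \<le> n"
        then have "norm x \<le> real n" by linarith
        then have "x \<in> ?K n"
          unfolding mem_box using Basis_le_norm[of _ x] by (force simp: abs_le_iff)
        then show "indicator (- ?K n) x * exp (- 1 * norm x) = 0" by simp
      qed
      then show "(\<lambda>n. indicator (- ?K n) x * exp (- 1 * norm x)) \<longlonglongrightarrow> 0" by (rule tendsto_eventually)
    qed
    show "(\<lambda>x. indicator (- ?K n) x * exp (- 1 * norm x)) \<in> borel_measurable lborel" for n by simp
    show "AE x in lborel. norm (indicator (- ?K n) x * exp (- 1 * norm x)) \<le> exp (- 1 * norm x)" for n
      by (auto simp: indicator_def)
  qed simp
  from order_tendstoD(2)[OF this, of e] assms
  have "\<forall>\<^sub>F n in sequentially. (\<integral>x. indicator (- ?K n) x * exp (- 1 * norm x) \<partial>lborel) < e" by simp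
  then show ?thesis using that by (auto simp: eventually_sequentially)
qed

text \<open>The product with the modulation doubles the radius, so the window is taken with radius
  \<open>1 / (2 * R)\<close>; this is the origin of the rate \<open>2 * CARD('n) * R\<close> in the
  frequency.\<close>

lemma sbound_atom:
  fixes \<phi> :: "real^'n::finite \<Rightarrow> complex" and R :: real
  assumes \<phi>: "\<phi> \<in> Sigma1" and R: "0 < R"
  obtains C where "0 \<le> C" "\<And>X. sbound R (C * exp ((R + 2 * CARD('n) * R) * norm X)) (atom \<phi> X)"
proof -
  obtain C where C: "exp_bounded (- R) (1 / (2 * R)) C \<phi>" using Sigma1_exp_bounded[OF \<phi>, of "1 / (2 * R)" R] R by auto
  show ?thesis
  proof (rule that[of C])
    show "0 \<le> C" by (rule exp_bounded_nonneg[OF C])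
    show "sbound R (C * exp ((R + 2 * CARD('n) * R) * norm X)) (atom \<phi> X)" for X
      using exp_bounded_atom[OF C, of X] R unfolding sbound_def by (simp add: mult_ac)
  qed
qed

text \<open>One tagged division serves for all functionals \<open>L\<close> that are controlled by the \<open>R\<close>-norm:
  this lets a functional be applied under the integral sign.\<close>

lemma atom_riemann_sum:
  fixes \<phi> \<psi> :: "real^'n::finite \<Rightarrow> complex" and R :: real
  assumes \<phi>: "\<phi> \<in> Sigma1" and \<psi>: "\<psi> \<in> Sigma1" and R: "0 < R" and e: "0 < e"
  obtains p :: "(((real^'n) \<times> (real^'n)) \<times> ((real^'n) \<times> (real^'n)) set) set" where "finite p"
    "\<forall>L. (\<forall>Y c. sbound R c (atom \<phi> Y) \<longrightarrow> norm (L Y) \<le> c) \<longrightarrow>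
       (\<forall>X Y c. sbound R c (\<lambda>y. atom \<phi> X y - atom \<phi> Y y) \<longrightarrow> norm (L X - L Y) \<le> c) \<longrightarrow>
       norm ((\<integral>Y. amb \<phi> \<psi> Y * L Y \<partial>lborel) - (\<Sum>(Y, k)\<in>p. measure lborel k *\<^sub>R (amb \<phi> \<psi> Y * L Y))) \<le> e"
proof -
  define A where "A = R + 2 * CARD('n) * R"
  have A: "0 < A" using R by (simp add: A_def add_pos_nonneg)
  obtain Ca where Ca: "0 \<le> Ca" "\<And>X. sbound R (Ca * exp (A * norm X)) (atom \<phi> X)"
    using sbound_atom[OF \<phi> R] unfolding A_def by blast
  \<comment> \<open>L grows along the atoms at most at the rate A. Decay of \<open>amb\<close> at
    the rate A + 1 leaves \<open>exp (- norm Y)\<close> as a majorant of the integrand.\<close>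
  obtain K where K: "0 \<le> K" "\<And>Y. norm (amb \<phi> \<psi> Y) \<le> K * exp (- (A + 1) * norm Y)"
    using amb_decay_Sigma1[OF \<phi> \<psi>, of "A + 1"] A by auto
  have KC: "0 \<le> K * Ca" using K Ca by simp
  then have "0 < e / (2 * (K * Ca + 1))" using e by simp
  then obtain n :: nat where n: "(\<integral>x. indicator (- cbox (- real n *\<^sub>R One) (real n *\<^sub>R One)) x * exp (- 1 * norm (x::(real^'n)\<times>(real^'n))) \<partial>lborel) < e / (2 * (K * Ca + 1))"
    by (rule small_tail_box)
  define a b where "a = - real n *\<^sub>R (One :: (real^'n)\<times>(real^'n))" and "b = real n *\<^sub>R (One :: (real^'n)\<times>(real^'n))"
  define \<tau> where "\<tau> = (\<integral>x. indicator (- cbox a b) x * exp (- 1 * norm x) \<partial>lborel)"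
  have \<tau>: "K * Ca * \<tau> \<le> e / 2"
  proof -
    have "K * Ca * \<tau> \<le> K * Ca * (e / (2 * (K * Ca + 1)))"
      using n K Ca by (intro mult_left_mono) (auto simp: \<tau>_def a_def b_def)
    also have "\<dots> = (K * Ca / (K * Ca + 1)) * (e / 2)" by simp
    also have "\<dots> \<le> 1 * (e / 2)" using KC e by (intro mult_right_mono) (auto simp: divide_le_eq)
    finally show ?thesis by simp
  qed
  obtain B where B: "0 < B" "\<And>x. x \<in> cbox a b \<Longrightarrow> norm x \<le> B"
    using bounded_pos[of "cbox a b"] by auto
  obtain Lp where Lp: "0 \<le> Lp" "\<And>X Y. norm X \<le> B \<Longrightarrow> norm Y \<le> B \<Longrightarrow> norm (X - Y) \<le> 1 \<Longrightarrow>
     sbound R (Lp * norm (X - Y)) (\<lambda>y. atom \<phi> X y - atom \<phi> Y y)"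
    using sbound_atom_lipschitz[OF \<phi> R] by blast
  define V where "V = measure lborel (cbox a b) + 1"
  have V: "0 < V" using measure_nonneg[of lborel "cbox a b"] unfolding V_def by linarith
  \<comment> \<open>Half of the error e pays for the complement of the box. An oscillation of
    \<open>2 * \<eta>\<close> on a box of volume at most V contributes the other half.\<close>
  define \<eta> where "\<eta> = e / (4 * V)"
  have \<eta>: "0 < \<eta>" using e V by (simp add: \<eta>_def)
  define D where "D = Ca * exp (A * B) + 1"
  have D: "0 < D" using Ca by (simp add: D_def add_nonneg_pos)
  have "uniformly_continuous_on (cbox a b) (amb \<phi> \<psi>)"
    by (rule compact_uniformly_continuous[OF continuous_on_subset[OF continuous_on_amb[OF \<phi> \<psi>]] compact_cbox]) simp
  then obtain d0 where d0: "0 < d0" "\<And>X Y. X \<in> cbox a b \<Longrightarrow> Y \<in> cbox a b \<Longrightarrow> dist X Y < d0 \<Longrightarrow> dist (amb \<phi> \<psi> X) (amb \<phi> \<psi> Y) < \<eta> / D"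
    unfolding uniformly_continuous_on_def using divide_pos_pos[OF \<eta> D] by metis
  \<comment> \<open>The three terms ensure that \<open>amb\<close> varies by less than
    \<open>\<eta> / D\<close>, that the Lipschitz estimate for atoms applies, and that L varies by
    at most \<open>Lp * \<delta>\<close>. None of them depends on L.\<close>
  define \<delta> where "\<delta> = min (min d0 1) (\<eta> / (K * Lp + 1))"
  have KL: "0 < K * Lp + 1" using K Lp by (simp add: add_nonneg_pos)
  have \<delta>: "0 < \<delta>" "\<delta> \<le> d0" "\<delta> \<le> 1" "\<delta> \<le> \<eta> / (K * Lp + 1)" using d0 \<eta> KL by (auto simp: \<delta>_def)
  have "gauge (\<lambda>x::(real^'n)\<times>(real^'n). ball x \<delta>)" using \<delta> by (simp add: gauge_def)
  from fine_division_exists[OF this, of a b] obtain p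
    where p: "p tagged_division_of (cbox a b)" and fine: "(\<lambda>x. ball x \<delta>) fine p" by blast
  show ?thesis
  proof (rule that[of p])
    show "finite p" using p by (rule tagged_division_of_finite)
    show "\<forall>L. (\<forall>Y c. sbound R c (atom \<phi> Y) \<longrightarrow> norm (L Y) \<le> c) \<longrightarrow>
       (\<forall>X Y c. sbound R c (\<lambda>y. atom \<phi> X y - atom \<phi> Y y) \<longrightarrow> norm (L X - L Y) \<le> c) \<longrightarrow>
       norm ((\<integral>Y. amb \<phi> \<psi> Y * L Y \<partial>lborel) - (\<Sum>(Y, k)\<in>p. measure lborel k *\<^sub>R (amb \<phi> \<psi> Y * L Y))) \<le> e"
    proof (intro allI impI)
    fix L :: "(real^'n) \<times> (real^'n) \<Rightarrow> complex" assume "\<forall>Y c. sbound R c (atom \<phi> Y) \<longrightarrow> norm (L Y) \<le> c"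
      and "\<forall>X Y c. sbound R c (\<lambda>y. atom \<phi> X y - atom \<phi> Y y) \<longrightarrow> norm (L X - L Y) \<le> c"
    then have L1: "\<And>Y c. sbound R c (atom \<phi> Y) \<Longrightarrow> norm (L Y) \<le> c"
      and L2: "\<And>X Y c. sbound R c (\<lambda>y. atom \<phi> X y - atom \<phi> Y y) \<Longrightarrow> norm (L X - L Y) \<le> c" by auto
    let ?f = "\<lambda>Y. amb \<phi> \<psi> Y * L Y"
    have Lc: "continuous_on UNIV L"
      by (rule continuous_on_atom_functional[OF \<phi> R, of _ 1]) (use L2 in auto)
    have fc: "continuous_on UNIV ?f" by (intro continuous_intros continuous_on_amb \<phi> \<psi> Lc)
    have fb: "norm (?f Y) \<le> K * Ca * exp (- 1 * norm Y)" for Y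
    proof -
      have "norm (?f Y) \<le> (K * exp (- (A + 1) * norm Y)) * (Ca * exp (A * norm Y))"
        unfolding norm_mult using K by (intro mult_mono L1 Ca K) auto
      also have "\<dots> = K * Ca * (exp (- (A + 1) * norm Y) * exp (A * norm Y))" by simp
      also have "exp (- (A + 1) * norm Y) * exp (A * norm Y) = exp (- 1 * norm Y)"
        by (simp add: exp_add[symmetric] algebra_simps)
      finally show ?thesis .
    qed
    have fi: "integrable lborel ?f"
      by (rule integrable_exp_decay[OF borel_measurable_continuous_onI[OF fc] fb]) simp
    have split: "integral\<^sup>L lborel ?f - integral (cbox a b) ?f = (\<integral>Y. indicator (- cbox a b) Y *\<^sub>R ?f Y \<partial>lborel)"
    proof -
      have 1: "integrable lborel (\<lambda>Y. indicator (cbox a b) Y *\<^sub>R ?f Y)" 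
        by (rule integrable_mult_indicator[OF _ fi]) simp
      have "(\<integral>Y. indicator (- cbox a b) Y *\<^sub>R ?f Y \<partial>lborel) = (\<integral>Y. ?f Y - indicator (cbox a b) Y *\<^sub>R ?f Y \<partial>lborel)"
        by (rule Bochner_Integration.integral_cong) (auto simp: indicator_def)
      also have "\<dots> = integral\<^sup>L lborel ?f - (\<integral>Y. indicator (cbox a b) Y *\<^sub>R ?f Y \<partial>lborel)"
        by (rule Bochner_Integration.integral_diff[OF fi 1])
      finally show ?thesis by (simp add: set_integral_cbox_continuous[OF fc])
    qed
    have tail: "norm (integral\<^sup>L lborel ?f - integral (cbox a b) ?f) \<le> e / 2"
    proof -
      have i1: "integrable lborel (\<lambda>Y. indicator (- cbox a b) Y *\<^sub>R ?f Y)"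
        by (rule integrable_mult_indicator[OF _ fi]) simp
      have i2: "integrable lborel (\<lambda>Y::(real^'n)\<times>(real^'n). indicator (- cbox a b) Y *\<^sub>R exp (- 1 * norm Y))"
        by (rule integrable_mult_indicator[OF _ integrable_exp_norm]) simp_all
      have "norm (\<integral>Y. indicator (- cbox a b) Y *\<^sub>R ?f Y \<partial>lborel) \<le> (\<integral>Y. norm (indicator (- cbox a b) Y *\<^sub>R ?f Y) \<partial>lborel)"
        by (rule integral_norm_bound)
      also have "\<dots> \<le> (\<integral>Y. K * Ca * (indicator (- cbox a b) Y *\<^sub>R exp (- 1 * norm Y)) \<partial>lborel)"
        using fb by (intro integral_mono integrable_norm i1 integrable_mult_right i2) (auto simp: indicator_def)
      also have "\<dots> = K * Ca * \<tau>" by (simp add: \<tau>_def)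
      finally show ?thesis using \<tau> split by simp
    qed
    have osc: "norm (?f X - ?f Y) \<le> 2 * \<eta>" if X: "X \<in> cbox a b" and Y: "Y \<in> cbox a b" and XY: "dist X Y < \<delta>" for X Y
    proof -
      have nX: "norm X \<le> B" "norm Y \<le> B" using B X Y by auto
      have XY': "norm (X - Y) \<le> \<delta>" "norm (X - Y) \<le> 1" "dist X Y < d0" using XY \<delta> by (auto simp: dist_norm)
      have 1: "norm (L X) \<le> D"
      proof -
        have "norm (L X) \<le> Ca * exp (A * norm X)" by (rule L1[OF Ca(2)])
        also have "\<dots> \<le> Ca * exp (A * B)" using nX A Ca by (intro mult_left_mono) auto
        finally show ?thesis by (simp add: D_def)
      qed
      have 2: "norm (amb \<phi> \<psi> Y) \<le> K"
      proof -
        have "K * exp (- (A + 1) * norm Y) \<le> K * 1" using A K by (intro mult_left_mono) (auto intro!: mult_nonpos_nonneg)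
        then show ?thesis using K(2)[of Y] by linarith
      qed
      have 3: "norm (L X - L Y) \<le> Lp * \<delta>"
        using L2[OF Lp(2)[OF nX XY'(2)]] mult_left_mono[OF XY'(1) Lp(1)] by linarith
      have 4: "norm (amb \<phi> \<psi> X - amb \<phi> \<psi> Y) \<le> \<eta> / D" using d0(2)[OF X Y XY'(3)] by (simp add: dist_norm)
      have "?f X - ?f Y = (amb \<phi> \<psi> X - amb \<phi> \<psi> Y) * L X + amb \<phi> \<psi> Y * (L X - L Y)" by (simp add: algebra_simps)
      then have "norm (?f X - ?f Y) \<le> norm (amb \<phi> \<psi> X - amb \<phi> \<psi> Y) * norm (L X) + norm (amb \<phi> \<psi> Y) * norm (L X - L Y)"
        by (metis norm_mult norm_triangle_ineq)
      also have "\<dots> \<le> \<eta> / D * D + K * (Lp * \<delta>)"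
        using 1 2 3 4 D \<eta> K by (intro add_mono mult_mono) auto
      also have "\<eta> / D * D = \<eta>" using D by simp
      also have "K * (Lp * \<delta>) \<le> \<eta>"
      proof -
        have "(K * Lp) * \<delta> \<le> (K * Lp + 1) * (\<eta> / (K * Lp + 1))" using \<delta> KL K Lp by (intro mult_mono) auto
        then show ?thesis using KL by (simp add: mult.assoc)
      qed
      finally show ?thesis by simp
    qed
    have "norm ((\<Sum>(Y, k)\<in>p. measure lborel k *\<^sub>R ?f Y) - integral (cbox a b) ?f) \<le> 2 * \<eta> * measure lborel (cbox a b)"
      by (rule riemann_sum_error[OF p fine continuous_on_subset[OF fc] osc]) auto
    also have "\<dots> \<le> 2 * \<eta> * V" using \<eta> by (simp add: V_def)
    also have "\<dots> = e / 2" using V by (simp add: \<eta>_def)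
    finally have "norm ((\<Sum>(Y, k)\<in>p. measure lborel k *\<^sub>R ?f Y) - integral (cbox a b) ?f) \<le> e / 2" .
    with tail show "norm (integral\<^sup>L lborel ?f - (\<Sum>(Y, k)\<in>p. measure lborel k *\<^sub>R ?f Y)) \<le> e"
      using norm_triangle_ineq4[of "integral\<^sup>L lborel ?f - integral (cbox a b) ?f" "(\<Sum>(Y, k)\<in>p. measure lborel k *\<^sub>R ?f Y) - integral (cbox a b) ?f"]
      by simp
    qed
  qed
qed

section \<open>Linear operations on \<open>Sigma1\<close> and its dual\<close>

lemma Sigma1_add: 
  assumes "f \<in> Sigma1" "g \<in> Sigma1" shows "(\<lambda>x. f x + g x) \<in> Sigma1"
proof (rule Sigma1I)
  fix A r :: real assume r: "0 < r"
  show "\<exists>C. exp_bounded (- A) r C (\<lambda>x. f x + g x)"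
    using Sigma1_exp_bounded[OF assms(1) r, of A] Sigma1_exp_bounded[OF assms(2) r, of A] exp_bounded_add by metis
qed

lemma Sigma1_cmult: 
  assumes "f \<in> Sigma1" shows "(\<lambda>x. c * f x) \<in> Sigma1"
proof (rule Sigma1I)
  fix A r :: real assume r: "0 < r"
  show "\<exists>C. exp_bounded (- A) r C (\<lambda>x. c * f x)"
    using Sigma1_exp_bounded[OF assms r, of A] exp_bounded_cmult by metis
qed

lemma Sigma1_zero: "(\<lambda>x. 0) \<in> Sigma1"
  by (rule Sigma1I, rule exI[of _ 0]) (auto simp: exp_bounded_def smooth_fun_const iter_partial_const)

lemma Sigma1_diff: "f \<in> Sigma1 \<Longrightarrow> g \<in> Sigma1 \<Longrightarrow> (\<lambda>x. f x - g x) \<in> Sigma1"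
  using Sigma1_add[of f "\<lambda>x. (- 1) * g x"] Sigma1_cmult[of g "- 1"] by simp

lemma Sigma1_dual_add: "u \<in> Sigma1_dual \<Longrightarrow> f \<in> Sigma1 \<Longrightarrow> g \<in> Sigma1 \<Longrightarrow> u (\<lambda>x. f x + g x) = u f + u g"
  by (simp add: Sigma1_dual_def)

lemma Sigma1_dual_cmult: "u \<in> Sigma1_dual \<Longrightarrow> f \<in> Sigma1 \<Longrightarrow> u (\<lambda>x. c * f x) = c * u f"
  by (simp add: Sigma1_dual_def)

lemma Sigma1_dual_diff: "u \<in> Sigma1_dual \<Longrightarrow> f \<in> Sigma1 \<Longrightarrow> g \<in> Sigma1 \<Longrightarrow> u (\<lambda>x. f x - g x) = u f - u g"
  using Sigma1_dual_add[of u f "\<lambda>x. (- 1) * g x"] Sigma1_dual_cmult[of u g "- 1"] Sigma1_cmult[of g "- 1"] by simp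

lemma Sigma1_dual_sum:
  assumes u: "u \<in> Sigma1_dual" and f: "\<And>i. i \<in> I \<Longrightarrow> f i \<in> Sigma1" and I: "finite I"
  shows "(\<lambda>x. \<Sum>i\<in>I. c i * f i x) \<in> Sigma1 \<and> u (\<lambda>x. \<Sum>i\<in>I. c i * f i x) = (\<Sum>i\<in>I. c i * u (f i))"
  using I f
proof (induction I)
  case empty
  show ?case using Sigma1_zero Sigma1_dual_cmult[OF u Sigma1_zero, of 0] by simp
next
  case (insert i I)
  then show ?case
    using Sigma1_add[OF Sigma1_cmult[of "f i" "c i"]] Sigma1_dual_add[OF u Sigma1_cmult[of "f i" "c i"]] Sigma1_dual_cmult[OF u, of "f i" "c i"]
    by simp
qed

lemma iter_partial_sum:
  assumes f: "\<And>i. i \<in> I \<Longrightarrow> smooth_fun (f i)" and I: "finite I"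
  shows "smooth_fun (\<lambda>x. \<Sum>i\<in>I. c i * f i x) \<and>
    iter_partial ds (\<lambda>x. \<Sum>i\<in>I. c i * f i x) = (\<lambda>x. \<Sum>i\<in>I. c i * iter_partial ds (f i) x)"
  using I f
proof (induction I)
  case empty
  show ?case by (auto simp: smooth_fun_const iter_partial_const)
next
  case (insert i I)
  then show ?case
    using smooth_fun_add[OF smooth_fun_cmult[of "f i" "c i"]] iter_partial_add[OF smooth_fun_cmult[of "f i" "c i"]] iter_partial_cmult[of "f i" ds "c i"]
    by simp
qed

lemma Sigma1_dual_sbound:
  fixes u :: "(real^'n::finite \<Rightarrow> complex) \<Rightarrow> complex"
  assumes u: "u \<in> Sigma1_dual"
  shows "\<exists>R>0. \<exists>C>0. \<forall>f\<in>Sigma1. \<forall>c. sbound R c f \<longrightarrow> norm (u f) \<le> C * c"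
proof -
  obtain r C where r: "0 < r" and C: "\<And>f c. f \<in> Sigma1 \<Longrightarrow> sigma1_bound r c f \<Longrightarrow> norm (u f) \<le> C * c"
    using u unfolding Sigma1_dual_def by blast
  \<comment> \<open>Chosen so that \<open>1 / R\<close> is at most r and R is at least
    \<open>CARD('n) / r\<close>, the two conditions of
    \<open>exp_bounded_imp_sigma1_bound\<close>.\<close>
  define R where "R = (real CARD('n) + 1) / r"
  have R: "0 < R" using r by (simp add: R_def)
  show ?thesis
  proof (rule exI[of _ R], rule conjI[OF R], intro exI[of _ "\<bar>C\<bar> + 1"] conjI ballI allI impI)
    fix f :: "real^'n \<Rightarrow> complex" and c assume f: "f \<in> Sigma1" and s: "sbound R c f"
    have "1 / R \<le> r" using r by (simp add: R_def divide_le_eq)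
    then have "sigma1_bound r c f"
      using s R r unfolding sbound_def by (intro exp_bounded_imp_sigma1_bound[of R "1 / R"]) (auto simp: R_def divide_right_mono)
    then have "norm (u f) \<le> C * c" by (rule C[OF f])
    also have "\<dots> \<le> (\<bar>C\<bar> + 1) * c" using sbound_nonneg[OF s] by (intro mult_right_mono) auto
    finally show "norm (u f) \<le> (\<bar>C\<bar> + 1) * c" .
  qed simp
qed

lemma Sigma1_dualI:
  fixes u :: "(real^'n::finite \<Rightarrow> complex) \<Rightarrow> complex"
  assumes "\<And>f g. f \<in> Sigma1 \<Longrightarrow> g \<in> Sigma1 \<Longrightarrow> u (\<lambda>x. f x + g x) = u f + u g"
    and "\<And>c f. f \<in> Sigma1 \<Longrightarrow> u (\<lambda>x. c * f x) = c * u f"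
    and b: "\<And>f c. f \<in> Sigma1 \<Longrightarrow> sbound R c f \<Longrightarrow> norm (u f) \<le> C * c" and R: "0 < R" and C: "0 \<le> C"
  shows "u \<in> Sigma1_dual"
proof -
  \<comment> \<open>From \<open>sigma1_bound r\<close> one gets decay at the rate
    \<open>1 / (2 * r * CARD('n))\<close>, which is R.\<close>
  define r where "r = 1 / (2 * CARD('n) * R)"
  have d: "1 \<le> real CARD('n)" by (rule card_index_ge_1)
  have r: "0 < r" using R by (simp add: r_def)
  have "norm (u f) \<le> (2 * C) * c" if f: "f \<in> Sigma1" and s: "sigma1_bound r c f" for f c
  proof -
    have "smooth_fun f" using f by (simp add: Sigma1_def)
    from sigma1_bound_imp_exp_bounded[OF s this r]
    have eb: "exp_bounded (- R) r (2 * c) f" using R by (simp add: r_def)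
    have "r \<le> 1 / R"     proof -
      have "1 \<le> 2 * real CARD('n)" using d by linarith
      then show ?thesis using R by (simp add: r_def divide_le_eq)
    qed
    then have "sbound R (2 * c) f" unfolding sbound_def
      using exp_bounded_mono[OF eb order_refl less_imp_le[OF r] _ order_refl] by blast
    then show ?thesis using b[OF f, of "2 * c"] by simp
  qed
  then have "\<exists>r>0. \<exists>C. \<forall>f\<in>Sigma1. \<forall>c. sigma1_bound r c f \<longrightarrow> norm (u f) \<le> C * c"
    by (intro exI[of _ r] exI[of _ "2 * C"] conjI r) auto
  then show ?thesis unfolding Sigma1_dual_def using assms(1,2) by simp
qed

lemma sbound_iff_iter_partial:
  "sbound R c f \<longleftrightarrow> smooth_fun f \<and> (\<forall>ds x. norm (iter_partial ds f x) \<le> c * (exp (- R * norm x) * (1 / R) ^ length ds * dfact ds))"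
  by (simp add: sbound_def exp_bounded_def mult.assoc)

text \<open>Let S be the Riemann sum of the reproducing formula for one division p of
  \<open>atom_riemann_sum\<close>. Evaluating a derivative at a point is an admissible L there, so S
  is close to the constant times \<psi> in the R-norm; u itself is admissible after scaling, so u(S)
  is close to the integral on the left. Both estimates use the same p.\<close>

lemma reproducing_formula_dual:
  fixes \<phi> \<psi> :: "real^'n::finite \<Rightarrow> complex"
  assumes \<phi>: "\<phi> \<in> Sigma1" and \<psi>: "\<psi> \<in> Sigma1" and u: "u \<in> Sigma1_dual"
  shows "(\<integral>Y. amb \<phi> \<psi> Y * u (atom \<phi> Y) \<partial>lborel) = complex_of_real (window_const \<phi>) * u \<psi>"
proof -
  obtain R C where R: "0 < R" and C: "0 < C" and b: "\<And>f c. f \<in> Sigma1 \<Longrightarrow> sbound R c f \<Longrightarrow> norm (u f) \<le> C * c"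
    using Sigma1_dual_sbound[OF u] by blast
  note at = atom_in_Sigma1[OF \<phi>]
  have sm: "smooth_fun (atom \<phi> Y)" for Y using at[of Y] by (simp add: Sigma1_def)
  let ?\<kappa> = "complex_of_real (window_const \<phi>)"
  have "norm ((\<integral>Y. amb \<phi> \<psi> Y * u (atom \<phi> Y) \<partial>lborel) - ?\<kappa> * u \<psi>) \<le> 0 + e" if e: "0 < e" for e
  proof -
    have he: "0 < e / (2 * C)" using e C by simp
    obtain p :: "(((real^'n) \<times> (real^'n)) \<times> ((real^'n) \<times> (real^'n)) set) set"
      where p: "finite p" and pb0: "\<forall>L. (\<forall>Y c. sbound R c (atom \<phi> Y) \<longrightarrow> norm (L Y) \<le> c) \<longrightarrow>
       (\<forall>X Y c. sbound R c (\<lambda>y. atom \<phi> X y - atom \<phi> Y y) \<longrightarrow> norm (L X - L Y) \<le> c) \<longrightarrow>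
       norm ((\<integral>Y. amb \<phi> \<psi> Y * L Y \<partial>lborel) - (\<Sum>(Y, k)\<in>p. measure lborel k *\<^sub>R (amb \<phi> \<psi> Y * L Y))) \<le> e / (2 * C)"
      using atom_riemann_sum[OF \<phi> \<psi> R he] .
    have pb: "norm ((\<integral>Y. amb \<phi> \<psi> Y * L Y \<partial>lborel) - (\<Sum>(Y, k)\<in>p. measure lborel k *\<^sub>R (amb \<phi> \<psi> Y * L Y))) \<le> e / (2 * C)"
      if "\<And>Y c. sbound R c (atom \<phi> Y) \<Longrightarrow> norm (L Y) \<le> c"
        "\<And>X Y c. sbound R c (\<lambda>y. atom \<phi> X y - atom \<phi> Y y) \<Longrightarrow> norm (L X - L Y) \<le> c" for L
      using pb0[rule_format, OF that] .
    define S where "S = (\<lambda>x. \<Sum>q\<in>p. (complex_of_real (measure lborel (snd q)) * amb \<phi> \<psi> (fst q)) * atom \<phi> (fst q) x)"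
    have S: "S \<in> Sigma1" "u S = (\<Sum>q\<in>p. (complex_of_real (measure lborel (snd q)) * amb \<phi> \<psi> (fst q)) * u (atom \<phi> (fst q)))"
      using Sigma1_dual_sum[OF u at p] unfolding S_def by auto
    have sum_eq: "(\<Sum>(Y, k)\<in>p. measure lborel k *\<^sub>R (amb \<phi> \<psi> Y * L Y)) = (\<Sum>q\<in>p. (complex_of_real (measure lborel (snd q)) * amb \<phi> \<psi> (fst q)) * L (fst q))" for L
      by (simp add: case_prod_unfold scaleR_conv_of_real mult.assoc)
    have iS: "iter_partial ds S x = (\<Sum>q\<in>p. (complex_of_real (measure lborel (snd q)) * amb \<phi> \<psi> (fst q)) * iter_partial ds (atom \<phi> (fst q)) x)" for ds x
      using iter_partial_sum[OF sm p, where ds = ds] unfolding S_def by (auto simp: fun_eq_iff)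
    have smd: "smooth_fun S" "smooth_fun (\<lambda>x. ?\<kappa> * \<psi> x)" "smooth_fun \<psi>"
      using S \<psi> Sigma1_cmult[OF \<psi>] by (auto simp: Sigma1_def)
    \<comment> \<open>Division by w normalises the evaluation of the derivative at x to be bounded
      by 1 in the R-norm. Since p was fixed before \<open>ds\<close> and x, the resulting estimate
      is uniform in both.\<close>
    have sb: "sbound R (e / (2 * C)) (\<lambda>x. ?\<kappa> * \<psi> x - S x)"
      unfolding sbound_iff_iter_partial
    proof (intro conjI allI)
      show "smooth_fun (\<lambda>x. ?\<kappa> * \<psi> x - S x)" using smooth_fun_diff[OF smd(2,1)] .
      fix ds :: "'n list" and x :: "real^'n"
      define w where "w = exp (- R * norm x) * (1 / R) ^ length ds * dfact ds"
      have w: "0 < w" using R dfact_pos[of ds] by (simp add: w_def)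
      let ?L = "\<lambda>Y. iter_partial ds (atom \<phi> Y) x / complex_of_real w"
      have "norm ((\<integral>Y. amb \<phi> \<psi> Y * ?L Y \<partial>lborel) - (\<Sum>(Y, k)\<in>p. measure lborel k *\<^sub>R (amb \<phi> \<psi> Y * ?L Y))) \<le> e / (2 * C)"
      proof (rule pb)
        show "norm (?L Y) \<le> c" if "sbound R c (atom \<phi> Y)" for Y c
        proof -
          have "norm (iter_partial ds (atom \<phi> Y) x) \<le> c * w"
            using that unfolding sbound_iff_iter_partial w_def by blast
          then show ?thesis using w by (simp add: norm_divide divide_le_eq)
        qed
        show "norm (?L X - ?L Y) \<le> c" if "sbound R c (\<lambda>y. atom \<phi> X y - atom \<phi> Y y)" for X Y c
        proof -
          have "norm (iter_partial ds (atom \<phi> X) x - iter_partial ds (atom \<phi> Y) x) \<le> c * w"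
            using that unfolding sbound_iff_iter_partial iter_partial_diff[OF sm sm] w_def by blast
          then show ?thesis using w by (simp add: diff_divide_distrib[symmetric] norm_divide divide_le_eq)
        qed
      qed
      also have "(\<integral>Y. amb \<phi> \<psi> Y * ?L Y \<partial>lborel) = ?\<kappa> * iter_partial ds \<psi> x / complex_of_real w"
        using iter_partial_reproducing_formula[OF \<phi> \<psi>, of ds x] by simp
      also have "(\<Sum>(Y, k)\<in>p. measure lborel k *\<^sub>R (amb \<phi> \<psi> Y * ?L Y)) = iter_partial ds S x / complex_of_real w"
        unfolding sum_eq iS by (simp add: sum_divide_distrib)
      finally have "norm (?\<kappa> * iter_partial ds \<psi> x - iter_partial ds S x) \<le> e / (2 * C) * w"
        using w by (simp add: diff_divide_distrib[symmetric] norm_divide pos_divide_le_eq)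
      then show "norm (iter_partial ds (\<lambda>x. ?\<kappa> * \<psi> x - S x) x) \<le> e / (2 * C) * (exp (- R * norm x) * (1 / R) ^ length ds * dfact ds)"
        unfolding iter_partial_diff[OF smd(2,1)] iter_partial_cmult[OF smd(3)] w_def .
    qed
    have "norm (u (\<lambda>x. ?\<kappa> * \<psi> x - S x)) \<le> C * (e / (2 * C))"
      by (rule b[OF Sigma1_diff[OF Sigma1_cmult[OF \<psi>] S(1)] sb])
    then have 1: "norm (?\<kappa> * u \<psi> - u S) \<le> e / 2"
      using C by (simp add: Sigma1_dual_diff[OF u Sigma1_cmult[OF \<psi>] S(1)] Sigma1_dual_cmult[OF u \<psi>])
    \<comment> \<open>The same division, now applied to u divided by its bound C.\<close>
    let ?L = "\<lambda>Y. u (atom \<phi> Y) / complex_of_real C"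
    have "norm ((\<integral>Y. amb \<phi> \<psi> Y * ?L Y \<partial>lborel) - (\<Sum>(Y, k)\<in>p. measure lborel k *\<^sub>R (amb \<phi> \<psi> Y * ?L Y))) \<le> e / (2 * C)"
    proof (rule pb)
      show "norm (?L Y) \<le> c" if "sbound R c (atom \<phi> Y)" for Y c
        using b[OF at that] C by (simp add: norm_divide divide_le_eq mult.commute)
      show "norm (?L X - ?L Y) \<le> c" if "sbound R c (\<lambda>y. atom \<phi> X y - atom \<phi> Y y)" for X Y c
        using b[OF Sigma1_diff[OF at at] that] C
        by (simp add: Sigma1_dual_diff[OF u at at] diff_divide_distrib[symmetric] norm_divide divide_le_eq mult.commute)
    qed
    also have "(\<integral>Y. amb \<phi> \<psi> Y * ?L Y \<partial>lborel) = (\<integral>Y. amb \<phi> \<psi> Y * u (atom \<phi> Y) \<partial>lborel) / complex_of_real C" by simp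
    also have "(\<Sum>(Y, k)\<in>p. measure lborel k *\<^sub>R (amb \<phi> \<psi> Y * ?L Y)) = u S / complex_of_real C"
      unfolding sum_eq S(2) by (simp add: sum_divide_distrib)
    finally have 2: "norm ((\<integral>Y. amb \<phi> \<psi> Y * u (atom \<phi> Y) \<partial>lborel) - u S) \<le> e / 2"
      using C by (simp add: diff_divide_distrib[symmetric] norm_divide divide_le_eq)
    show ?thesis
      using norm_triangle_ineq4[of "(\<integral>Y. amb \<phi> \<psi> Y * u (atom \<phi> Y) \<partial>lborel) - u S" "?\<kappa> * u \<psi> - u S"] 1 2 by simp
  qed
  then have "norm ((\<integral>Y. amb \<phi> \<psi> Y * u (atom \<phi> Y) \<partial>lborel) - ?\<kappa> * u \<psi>) \<le> 0"
    by (rule field_le_epsilon)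
  then show ?thesis by simp
qed

subsection \<open>Moderate weights\<close>

lemma AE_lborel_affine:
  fixes t :: "'a::euclidean_space"
  assumes "AE x in lborel. P x" and c: "c \<noteq> 0"
  shows "AE x in lborel. P (t + c *\<^sub>R x)"
proof -
  obtain N where N: "{x. \<not> P x} \<subseteq> N" "N \<in> null_sets (lborel :: 'a measure)"
    using assms(1) by (auto elim!: AE_E simp: null_sets_def)
  then have "AE x in lborel. x \<notin> N" by (simp add: AE_not_in)
  then have "AE x in density (distr lborel borel (\<lambda>x. t + c *\<^sub>R x)) (\<lambda>_. ennreal (\<bar>c\<bar> ^ DIM('a))). x \<notin> N"
    by (subst lborel_affine[OF c, of t, symmetric])
  then have "AE x in distr lborel borel (\<lambda>x. t + c *\<^sub>R x). x \<notin> N"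
    using c by (subst (asm) AE_density) auto
  then have "AE x in lborel. t + c *\<^sub>R x \<notin> N"
    using N by (subst (asm) AE_distr_iff) (auto simp: null_sets_def)
  then show ?thesis by (rule AE_mp) (use N in \<open>auto intro!: AE_I2\<close>)
qed

lemma AE_lborel_ex_cball:
  assumes "AE x in (lborel :: 'a::euclidean_space measure). P x" and r: "0 < r"
  shows "\<exists>x\<in>cball z r. P x"
proof (rule ccontr)
  assume n: "\<not> (\<exists>x\<in>cball z r. P x)"
  have "AE x in lborel. x \<notin> cball z r" by (rule AE_mp[OF assms(1) AE_I2]) (use n in blast)
  then have "cball z r \<in> null_sets (lborel :: 'a measure)" by (subst AE_iff_null_sets) auto
  then have "emeasure lborel (cball z r) = 0" by (simp add: null_sets_def)
  moreover have "emeasure lborel (ball z r) \<le> emeasure lborel (cball z r)"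
    by (rule emeasure_mono) auto
  ultimately have "emeasure lborel (ball z r) = 0" by simp
  then have "negligible (ball z r)"
    by (simp add: negligible_iff_null_sets null_setsI null_sets_completionI)
  then show False using open_not_negligible[of "ball z r"] r by simp
qed

lemma PE_pos: "PE w \<Longrightarrow> 0 < w x" by (simp add: PE_def weight_def)

lemma PE_measurable: "PE w \<Longrightarrow> w \<in> borel_measurable borel" by (simp add: PE_def weight_def)

text \<open>The moderating function v is bounded only almost everywhere on compact sets, but a step
  y in the unit ball can be split as a + (y - a) with both summands outside the exceptional set.
  This bounds the effect of every unit step on w, and iteration gives an exponential.\<close>

lemma PE_exp_moderate:
  fixes w :: "'a::euclidean_space \<Rightarrow> real"
  assumes w: "PE w"
  obtains D R where "1 \<le> D" "0 < R" "\<And>x y. w (x + y) \<le> D * exp (R * norm y) * w x"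
proof -
  obtain v C where v: "weight v" and C: "\<And>x y. w (x + y) \<le> C * w x * v y"
    using w by (auto simp: PE_def moderate_def)
  note wp = PE_pos[OF w]
  have vp: "0 < v x" for x using v by (simp add: weight_def)
  have Cp: "0 < C"
  proof -
    have "0 < C * v 0" using C[of 0 0] wp[of 0] by simp
    then show ?thesis using vp[of 0] by (rule zero_less_mult_pos2)
  qed
  obtain M where M: "AE x in lborel. x \<in> cball 0 2 \<longrightarrow> v x \<le> M"
    using v compact_cball unfolding weight_def by blast
  define L where "L = max 1 (C * C * M * M)"
  have step: "w (x + y) \<le> L * w x" if y: "norm y \<le> 1" for x y
  proof -
    \<comment> \<open>Almost every a is good for both summands. The ball of radius 2 is needed
      because y - a may have norm up to 2.\<close>
    have "AE a in lborel. (a \<in> cball 0 2 \<longrightarrow> v a \<le> M) \<and> (y + (-1) *\<^sub>R a \<in> cball 0 2 \<longrightarrow> v (y + (-1) *\<^sub>R a) \<le> M)"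
      using M AE_lborel_affine[OF M, of "-1" y] by auto
    then obtain a where a: "norm a \<le> 1" "a \<in> cball 0 2 \<longrightarrow> v a \<le> M" "y - a \<in> cball 0 2 \<longrightarrow> v (y - a) \<le> M"
      using AE_lborel_ex_cball[of _ 1 0] by fastforce
    have "norm (y - a) \<le> 2" using norm_triangle_ineq4[of y a] a y by linarith
    then have m: "v a \<le> M" "v (y - a) \<le> M" using a by auto
    have "w (x + y) \<le> C * w (x + a) * v (y - a)" using C[of "x + a" "y - a"] by simp
    also have "\<dots> \<le> C * (C * w x * v a) * v (y - a)"
      using C[of x a] Cp vp[of "y - a"] by (intro mult_right_mono mult_left_mono) auto
    also have "\<dots> \<le> C * (C * w x * M) * M"
      using Cp wp[of x] vp[of a] vp[of "y - a"] m by (intro mult_mono mult_left_mono) (auto intro!: mult_nonneg_nonneg)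
    also have "\<dots> = (C * C * M * M) * w x" by simp
    also have "\<dots> \<le> L * w x" using wp[of x] by (intro mult_right_mono) (auto simp: L_def)
    finally show ?thesis .
  qed
  have L: "1 \<le> L" by (simp add: L_def)
  have iter: "w (x + real k *\<^sub>R z) \<le> L ^ k * w x" if z: "norm z \<le> 1" for x z k
  proof (induction k)
    case (Suc k)
    have "w (x + real (Suc k) *\<^sub>R z) = w ((x + real k *\<^sub>R z) + z)" by (simp add: algebra_simps)
    also have "\<dots> \<le> L * w (x + real k *\<^sub>R z)" by (rule step[OF z])
    also have "\<dots> \<le> L * (L ^ k * w x)" using Suc L by (intro mult_left_mono) auto
    finally show ?case by (simp add: mult.assoc)
  qed simp
  show ?thesis
  proof (rule that[of L "ln L + 1"])
    show "1 \<le> L" by (rule L)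
    show "0 < ln L + 1" using ln_ge_zero[OF L] by linarith
    fix x y :: 'a
    \<comment> \<open>The number of steps of length at most 1. For y = 0 there are no steps, and z
      is 0 as well.\<close>
    define k where "k = nat \<lceil>norm y\<rceil>"
    define z where "z = (1 / real k) *\<^sub>R y"
    have k: "norm y \<le> real k" "real k \<le> norm y + 1" using norm_ge_zero[of y] unfolding k_def by linarith+
    have z: "norm z \<le> 1" "real k *\<^sub>R z = y"
      using k by (cases "k = 0"; simp add: z_def divide_le_eq)+
    have "w (x + y) \<le> L ^ k * w x" using iter[OF z(1), of x k] z(2) by simp
    also have "L ^ k = exp (real k * ln L)" using L by (simp add: exp_of_nat_mult)
    also have "exp (real k * ln L) * w x \<le> L * exp ((ln L + 1) * norm y) * w x"
    proof (intro mult_right_mono)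
      have "real k * ln L \<le> (norm y + 1) * ln L" using k L by (intro mult_right_mono) auto
      also have "\<dots> \<le> ln L + (ln L + 1) * norm y" by (simp add: algebra_simps)
      finally have "exp (real k * ln L) \<le> exp (ln L + (ln L + 1) * norm y)" by simp
      then show "exp (real k * ln L) \<le> L * exp ((ln L + 1) * norm y)" using L by (simp add: exp_add)
    qed (use wp[of x] in simp)
    finally show "w (x + y) \<le> L * exp ((ln L + 1) * norm y) * w x" .
  qed
qed

subsection \<open>Invariant BF spaces\<close>

locale invariant_BF =
  fixes B0 :: "('a::euclidean_space \<Rightarrow> complex) set" and N0 :: "('a \<Rightarrow> complex) \<Rightarrow> real" and v :: "'a \<Rightarrow> real"
  assumes bf: "invariant_BF_space B0 N0 v"
begin

text \<open>\<open>B0\<close> is applied to r0-th powers of moduli, so the argument runs in its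
  real-valued part.\<close>

definition rspace :: "('a \<Rightarrow> real) set" where
  "rspace = {f. (\<lambda>x. complex_of_real (f x)) \<in> B0}"

definition rnorm :: "('a \<Rightarrow> real) \<Rightarrow> real" where
  "rnorm f = N0 (\<lambda>x. complex_of_real (f x))"

lemma bf_conjuncts:
  "B0 \<subseteq> borel_measurable lborel"
  "\<forall>f\<in>B0. \<forall>g\<in>B0. (\<lambda>x. f x + g x) \<in> B0"
  "\<forall>c. \<forall>f\<in>B0. (\<lambda>x. c * f x) \<in> B0"
  "\<forall>f\<in>B0. 0 \<le> N0 f"
  "\<forall>f\<in>B0. \<forall>g\<in>B0. N0 (\<lambda>x. f x + g x) \<le> N0 f + N0 g"
  "\<forall>c. \<forall>f\<in>B0. N0 (\<lambda>x. c * f x) = norm c * N0 f"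
  "\<forall>f\<in>B0. N0 f = 0 \<longleftrightarrow> (AE x in lborel. f x = 0)"
  "\<forall>F. (\<forall>n. F n \<in> B0) \<and> (\<forall>e>0. \<exists>M. \<forall>m\<ge>M. \<forall>n\<ge>M. N0 (\<lambda>x. F m x - F n x) < e)
          \<longrightarrow> (\<exists>g\<in>B0. (\<lambda>n. N0 (\<lambda>x. F n x - g x)) \<longlonglongrightarrow> 0)"
  "\<exists>C. \<forall>f g. f \<in> borel_measurable lborel \<and> g \<in> B0 \<and> (AE x in lborel. norm (f x) \<le> norm (g x))
          \<longrightarrow> f \<in> B0 \<and> N0 f \<le> C * N0 g"
  "\<forall>x. \<exists>f\<in>B0. \<exists>c>0. \<exists>S. S \<in> sets lborel \<and> convex S \<and> x \<in> S \<and> emeasure lborel S \<noteq> 0 \<and>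
          (\<forall>y\<in>S. c < norm (f y))"
  "\<exists>C. \<forall>f\<in>B0. \<forall>x. (\<lambda>y. f (y - x)) \<in> B0 \<and> N0 (\<lambda>y. f (y - x)) \<le> C * v x * N0 f"
  using bf[unfolded invariant_BF_space_def] by - (elim conjE, assumption)+

lemma B0_measurable: "f \<in> B0 \<Longrightarrow> f \<in> borel_measurable borel"
  using bf_conjuncts(1) by auto

lemma B0_add: "f \<in> B0 \<Longrightarrow> g \<in> B0 \<Longrightarrow> (\<lambda>x. f x + g x) \<in> B0"
  by (rule bf_conjuncts(2)[rule_format])

lemma B0_cmult: "f \<in> B0 \<Longrightarrow> (\<lambda>x. c * f x) \<in> B0"
  by (rule bf_conjuncts(3)[rule_format])

lemma N0_nonneg: "f \<in> B0 \<Longrightarrow> 0 \<le> N0 f"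
  by (rule bf_conjuncts(4)[rule_format])

lemma N0_add: "f \<in> B0 \<Longrightarrow> g \<in> B0 \<Longrightarrow> N0 (\<lambda>x. f x + g x) \<le> N0 f + N0 g"
  by (rule bf_conjuncts(5)[rule_format])

lemma N0_cmult: "f \<in> B0 \<Longrightarrow> N0 (\<lambda>x. c * f x) = norm c * N0 f"
  by (rule bf_conjuncts(6)[rule_format])

lemma N0_eq_0_iff: "f \<in> B0 \<Longrightarrow> N0 f = 0 \<longleftrightarrow> (AE x in lborel. f x = 0)"
  by (rule bf_conjuncts(7)[rule_format])

lemma B0_complete:
  assumes "\<And>n. F n \<in> B0" "\<And>e. 0 < e \<Longrightarrow> \<exists>M. \<forall>m\<ge>M. \<forall>n\<ge>M. N0 (\<lambda>x. F m x - F n x) < e"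
  shows "\<exists>g\<in>B0. (\<lambda>n. N0 (\<lambda>x. F n x - g x)) \<longlonglongrightarrow> 0"
  by (rule bf_conjuncts(8)[rule_format]) (use assms in auto)

lemma B0_diff: "f \<in> B0 \<Longrightarrow> g \<in> B0 \<Longrightarrow> (\<lambda>x. f x - g x) \<in> B0"
  using B0_add[of f "\<lambda>x. (-1) * g x"] B0_cmult[of g "-1"] by simp

lemma N0_diff_commute: "f \<in> B0 \<Longrightarrow> g \<in> B0 \<Longrightarrow> N0 (\<lambda>x. f x - g x) = N0 (\<lambda>x. g x - f x)"
  using N0_cmult[OF B0_diff[of f g], of "-1"] by simp

text \<open>The solidity constant is fixed once and enlarged to at least 1, which makes
  multiplication by it monotone.\<close>

definition solid_const :: real where
  "solid_const = (SOME C. 1 \<le> C \<and> (\<forall>f g. f \<in> borel_measurable borel \<and> g \<in> B0 \<and> (AE x in lborel. norm (f x) \<le> norm (g x))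
          \<longrightarrow> f \<in> B0 \<and> N0 f \<le> C * N0 g))"

lemma solid_const: "1 \<le> solid_const" 
  and B0_solid: "f \<in> borel_measurable borel \<Longrightarrow> g \<in> B0 \<Longrightarrow> AE x in lborel. norm (f x) \<le> norm (g x) \<Longrightarrow> f \<in> B0"
  and N0_solid: "f \<in> borel_measurable borel \<Longrightarrow> g \<in> B0 \<Longrightarrow> AE x in lborel. norm (f x) \<le> norm (g x) \<Longrightarrow> N0 f \<le> solid_const * N0 g"
proof -
  obtain C where C: "\<And>f g. f \<in> borel_measurable borel \<and> g \<in> B0 \<and> (AE x in lborel. norm (f x) \<le> norm (g x))
          \<longrightarrow> f \<in> B0 \<and> N0 f \<le> C * N0 g"
    using bf_conjuncts(9) by auto
  have "1 \<le> max 1 C \<and> (\<forall>f g. f \<in> borel_measurable borel \<and> g \<in> B0 \<and> (AE x in lborel. norm (f x) \<le> norm (g x))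
          \<longrightarrow> f \<in> B0 \<and> N0 f \<le> max 1 C * N0 g)"
  proof (intro conjI allI impI)
    fix f g :: "'a \<Rightarrow> complex" assume a: "f \<in> borel_measurable borel \<and> g \<in> B0 \<and> (AE x in lborel. norm (f x) \<le> norm (g x))"
    then show "f \<in> B0" using C by blast
    have "N0 f \<le> C * N0 g" using C a by blast
    also have "\<dots> \<le> max 1 C * N0 g" using a N0_nonneg[of g] by (intro mult_right_mono) auto
    finally show "N0 f \<le> max 1 C * N0 g" .
  qed simp
  then have *: "1 \<le> solid_const \<and> (\<forall>f g. f \<in> borel_measurable borel \<and> g \<in> B0 \<and> (AE x in lborel. norm (f x) \<le> norm (g x))
          \<longrightarrow> f \<in> B0 \<and> N0 f \<le> solid_const * N0 g)"
    unfolding solid_const_def by (rule someI)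
  show "1 \<le> solid_const" using * by blast
  show "f \<in> borel_measurable borel \<Longrightarrow> g \<in> B0 \<Longrightarrow> AE x in lborel. norm (f x) \<le> norm (g x) \<Longrightarrow> f \<in> B0" using * by blast
  show "f \<in> borel_measurable borel \<Longrightarrow> g \<in> B0 \<Longrightarrow> AE x in lborel. norm (f x) \<le> norm (g x) \<Longrightarrow> N0 f \<le> solid_const * N0 g" using * by blast
qed

lemma rspace_measurable: "f \<in> rspace \<Longrightarrow> f \<in> borel_measurable borel"
  using measurable_compose[OF B0_measurable[of "\<lambda>x. complex_of_real (f x)"] borel_measurable_Re]
  by (simp add: rspace_def)

lemma rspace_add: "f \<in> rspace \<Longrightarrow> g \<in> rspace \<Longrightarrow> (\<lambda>x. f x + g x) \<in> rspace"
  using B0_add[of "\<lambda>x. complex_of_real (f x)" "\<lambda>x. complex_of_real (g x)"] by (simp add: rspace_def)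

lemma rnorm_add: "f \<in> rspace \<Longrightarrow> g \<in> rspace \<Longrightarrow> rnorm (\<lambda>x. f x + g x) \<le> rnorm f + rnorm g"
  using N0_add[of "\<lambda>x. complex_of_real (f x)" "\<lambda>x. complex_of_real (g x)"] by (simp add: rspace_def rnorm_def)

lemma rspace_cmult: "f \<in> rspace \<Longrightarrow> (\<lambda>x. c * f x) \<in> rspace"
  using B0_cmult[of "\<lambda>x. complex_of_real (f x)" "complex_of_real c"] by (simp add: rspace_def)

lemma rnorm_cmult: "f \<in> rspace \<Longrightarrow> rnorm (\<lambda>x. c * f x) = \<bar>c\<bar> * rnorm f"
  using N0_cmult[of "\<lambda>x. complex_of_real (f x)" "complex_of_real c"] by (simp add: rspace_def rnorm_def)

lemma rnorm_nonneg: "f \<in> rspace \<Longrightarrow> 0 \<le> rnorm f"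
  using N0_nonneg by (simp add: rspace_def rnorm_def)

lemma rnorm_eq_0_iff: "f \<in> rspace \<Longrightarrow> rnorm f = 0 \<longleftrightarrow> (AE x in lborel. f x = 0)"
  using N0_eq_0_iff[of "\<lambda>x. complex_of_real (f x)"] by (simp add: rspace_def rnorm_def)

lemma rspace_solid:
  assumes "f \<in> borel_measurable borel" "g \<in> rspace" "AE x in lborel. \<bar>f x\<bar> \<le> \<bar>g x\<bar>"
  shows "f \<in> rspace" "rnorm f \<le> solid_const * rnorm g"
  using B0_solid[of "\<lambda>x. complex_of_real (f x)" "\<lambda>x. complex_of_real (g x)"]
    N0_solid[of "\<lambda>x. complex_of_real (f x)" "\<lambda>x. complex_of_real (g x)"] assms
  by (simp_all add: rspace_def rnorm_def)

lemma rspace_solid_all: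
  assumes "f \<in> borel_measurable borel" "g \<in> rspace" "\<And>x. \<bar>f x\<bar> \<le> g x"
  shows "f \<in> rspace" "rnorm f \<le> solid_const * rnorm g"
proof -
  have "AE x in lborel. \<bar>f x\<bar> \<le> \<bar>g x\<bar>"
    by (rule AE_I2) (use assms(3) in \<open>smt (verit)\<close>)
  from rspace_solid[OF assms(1,2) this] show "f \<in> rspace" "rnorm f \<le> solid_const * rnorm g" .
qed

text \<open>Translates are written with + x, hence v is taken at - x. The absolute value is there
  because the locale leaves the sign of v open.\<close>

lemma translate_ex:
  "\<exists>C\<ge>1. \<forall>f\<in>rspace. \<forall>x. (\<lambda>y. f (y + x)) \<in> rspace \<and> rnorm (\<lambda>y. f (y + x)) \<le> C * \<bar>v (- x)\<bar> * rnorm f"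
proof -
  obtain C where C: "\<And>f x. f \<in> B0 \<Longrightarrow> (\<lambda>y. f (y - x)) \<in> B0 \<and> N0 (\<lambda>y. f (y - x)) \<le> C * v x * N0 f"
    using bf_conjuncts(11) by blast
  show ?thesis
  proof (intro exI[of _ "\<bar>C\<bar> + 1"] conjI[of "1 \<le> _"] ballI allI)
    fix f x assume f: "f \<in> rspace"
    have *: "(\<lambda>y. f (y + x)) \<in> rspace \<and> rnorm (\<lambda>y. f (y + x)) \<le> C * v (- x) * rnorm f"
      using C[of "\<lambda>x. complex_of_real (f x)" "- x"] f by (simp add: rspace_def rnorm_def)
    have "C * v (- x) \<le> \<bar>C\<bar> * \<bar>v (- x)\<bar>" by (metis abs_ge_self abs_mult)
    also have "\<dots> \<le> (\<bar>C\<bar> + 1) * \<bar>v (- x)\<bar>" by (intro mult_right_mono) auto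
    finally have "C * v (- x) * rnorm f \<le> (\<bar>C\<bar> + 1) * \<bar>v (- x)\<bar> * rnorm f"
      using rnorm_nonneg[OF f] by (intro mult_right_mono)
    then show "(\<lambda>y. f (y + x)) \<in> rspace \<and> rnorm (\<lambda>y. f (y + x)) \<le> (\<bar>C\<bar> + 1) * \<bar>v (- x)\<bar> * rnorm f"
      using * by linarith
  qed simp
qed

definition trans_const :: real where
  "trans_const = (SOME C. 1 \<le> C \<and> (\<forall>f\<in>rspace. \<forall>x. (\<lambda>y. f (y + x)) \<in> rspace \<and> rnorm (\<lambda>y. f (y + x)) \<le> C * \<bar>v (- x)\<bar> * rnorm f))"

lemma trans_const: "1 \<le> trans_const"
  and rspace_translate: "f \<in> rspace \<Longrightarrow> (\<lambda>y. f (y + x)) \<in> rspace"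
  and rnorm_translate: "f \<in> rspace \<Longrightarrow> rnorm (\<lambda>y. f (y + x)) \<le> trans_const * \<bar>v (- x)\<bar> * rnorm f"
proof -
  have *: "1 \<le> trans_const \<and> (\<forall>f\<in>rspace. \<forall>x. (\<lambda>y. f (y + x)) \<in> rspace \<and> rnorm (\<lambda>y. f (y + x)) \<le> trans_const * \<bar>v (- x)\<bar> * rnorm f)"
    unfolding trans_const_def by (rule someI_ex[OF translate_ex])
  show "1 \<le> trans_const" using * by (rule conjunct1)
  show "(\<lambda>y. f (y + x)) \<in> rspace" if "f \<in> rspace" using bspec[OF conjunct2[OF *] that] by simp
  show "rnorm (\<lambda>y. f (y + x)) \<le> trans_const * \<bar>v (- x)\<bar> * rnorm f" if "f \<in> rspace"
    using bspec[OF conjunct2[OF *] that] by simp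
qed

lemma zero_in_B0: "(\<lambda>x. 0) \<in> B0"
proof -
  obtain f where "f \<in> B0" using bf_conjuncts(10) by blast
  from B0_cmult[OF this, of 0] show ?thesis by simp
qed

lemma zero_in_rspace: "(\<lambda>x. 0) \<in> rspace" using zero_in_B0 by (simp add: rspace_def)

lemma rnorm_zero: "rnorm (\<lambda>x. 0) = 0"
  using rnorm_eq_0_iff[OF zero_in_rspace] by simp

lemma rspace_sum:
  assumes "finite I" "\<And>i. i \<in> I \<Longrightarrow> f i \<in> rspace"
  shows "(\<lambda>x. \<Sum>i\<in>I. f i x) \<in> rspace \<and> rnorm (\<lambda>x. \<Sum>i\<in>I. f i x) \<le> (\<Sum>i\<in>I. rnorm (f i))"
  using assms
proof (induction I)
  case empty
  show ?case by (simp add: zero_in_rspace rnorm_zero)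
next
  case (insert i I)
  then have "(\<lambda>x. \<Sum>i\<in>I. f i x) \<in> rspace" "f i \<in> rspace" "rnorm (\<lambda>x. \<Sum>i\<in>I. f i x) \<le> (\<Sum>i\<in>I. rnorm (f i))" by auto
  then show ?case using rspace_add[of "f i"] rnorm_add[of "f i" "\<lambda>x. \<Sum>i\<in>I. f i x"] insert(1,2) by simp
qed

text \<open>Completeness and solidity turn the triangle inequality into a countable one: the limit of the
  partial sums in the norm dominates each of them almost everywhere.\<close>

lemma rspace_countable_sum:
  assumes f: "\<And>k. f k \<in> rspace" "\<And>k x. 0 \<le> f k x" and sm: "summable (\<lambda>k. rnorm (f k))"
    and g: "g \<in> borel_measurable borel"
    and dom: "AE x in lborel. \<forall>M. (\<forall>m. (\<Sum>k<m. f k x) \<le> M) \<longrightarrow> \<bar>g x\<bar> \<le> M"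
  shows "g \<in> rspace" "rnorm g \<le> solid_const * (\<Sum>k. rnorm (f k))"
proof -
  define P where "P m x = (\<Sum>k<m. f k x)" for m x
  have PS: "P m \<in> rspace" "rnorm (P m) \<le> (\<Sum>k<m. rnorm (f k))" for m
    using rspace_sum[of "{..<m}" f] f unfolding P_def[abs_def] by auto
  have diff: "N0 (\<lambda>x. complex_of_real (P n x) - complex_of_real (P m x)) \<le> (\<Sum>k\<in>{m..<n}. rnorm (f k))" if "m \<le> n" for m n
  proof -
    have "P n x - P m x = (\<Sum>k\<in>{m..<n}. f k x)" for x
      using that unfolding P_def by (simp add: sum_diff_nat_ivl[of 0 m n "\<lambda>k. f k x"] lessThan_atLeast0)
    then have "(\<lambda>x. complex_of_real (P n x) - complex_of_real (P m x)) = (\<lambda>x. complex_of_real (\<Sum>k\<in>{m..<n}. f k x))"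
      by (metis of_real_diff)
    then show ?thesis using rspace_sum[of "{m..<n}" f] f by (simp add: rnorm_def)
  qed
  have PB: "(\<lambda>x. complex_of_real (P m x)) \<in> B0" for m using PS by (simp add: rspace_def)
  have "\<exists>g\<in>B0. (\<lambda>n. N0 (\<lambda>x. complex_of_real (P n x) - g x)) \<longlonglongrightarrow> 0"
  proof (rule B0_complete[OF PB])
    fix e :: real assume "0 < e"
    then obtain N where N: "\<And>m n. m \<ge> N \<Longrightarrow> norm (\<Sum>k\<in>{m..<n}. rnorm (f k)) < e"
      using sm unfolding summable_Cauchy by blast
    have "N0 (\<lambda>x. complex_of_real (P m x) - complex_of_real (P n x)) < e" if "N \<le> m" "N \<le> n" for m n
    proof (cases "m \<le> n")
      case True
      then show ?thesis using diff[of m n] N[of m n] that N0_diff_commute[OF PB PB, of m n] by simp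
    next
      case False
      then show ?thesis using diff[of n m] N[of n m] that by simp
    qed
    then show "\<exists>M. \<forall>m\<ge>M. \<forall>n\<ge>M. N0 (\<lambda>x. complex_of_real (P m x) - complex_of_real (P n x)) < e" by blast
  qed
  then obtain G where G: "G \<in> B0" and lim: "(\<lambda>n. N0 (\<lambda>x. complex_of_real (P n x) - G x)) \<longlonglongrightarrow> 0" by blast
  have Gm [measurable]: "G \<in> borel_measurable borel" by (rule B0_measurable[OF G])
  have Pm [measurable]: "P m \<in> borel_measurable borel" for m by (rule rspace_measurable[OF PS(1)])
  have le: "AE x in lborel. P m x \<le> Re (G x)" for m
  proof -
    \<comment> \<open>The excess of the m-th partial sum over the limit is dominated by the distance
      of the n-th partial sum from the limit, for every n beyond m; so its norm is zero.\<close>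
    define q where "q x = max 0 (P m x - Re (G x))" for x
    have qm: "(\<lambda>x. complex_of_real (q x)) \<in> borel_measurable borel" unfolding q_def by measurable
    have qb: "AE x in lborel. norm (complex_of_real (q x)) \<le> norm (complex_of_real (P n x) - G x)" if "m \<le> n" for n
    proof (rule AE_I2)
      fix x
      have "P m x \<le> P n x" unfolding P_def using that f by (intro sum_mono2) auto
      moreover have "\<bar>P n x - Re (G x)\<bar> \<le> norm (complex_of_real (P n x) - G x)"
        using abs_Re_le_cmod[of "complex_of_real (P n x) - G x"] by simp
      ultimately show "norm (complex_of_real (q x)) \<le> norm (complex_of_real (P n x) - G x)" by (auto simp: q_def)
    qed
    have qB: "(\<lambda>x. complex_of_real (q x)) \<in> B0" by (rule B0_solid[OF qm B0_diff[OF PB G] qb[OF order_refl]])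
    have "N0 (\<lambda>x. complex_of_real (q x)) \<le> 0"
    proof (rule LIMSEQ_le_const)
      show "(\<lambda>n. solid_const * N0 (\<lambda>x. complex_of_real (P n x) - G x)) \<longlonglongrightarrow> 0"
        using tendsto_mult[OF tendsto_const[of solid_const] lim] by simp
      show "\<exists>N. \<forall>n\<ge>N. N0 (\<lambda>x. complex_of_real (q x)) \<le> solid_const * N0 (\<lambda>x. complex_of_real (P n x) - G x)"
        using N0_solid[OF qm B0_diff[OF PB G] qb] by blast
    qed
    then have "AE x in lborel. complex_of_real (q x) = 0" using N0_eq_0_iff[OF qB] N0_nonneg[OF qB] by simp
    then show ?thesis by (rule AE_mp) (auto simp: q_def intro!: AE_I2)
  qed
  have "AE x in lborel. \<forall>m. P m x \<le> Re (G x)" using le by (simp add: AE_all_countable)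
  \<comment> \<open>The real part of the limit G bounds all partial sums and is thus an admissible M
    in the hypothesis on g.\<close>
  then have gG: "AE x in lborel. norm (complex_of_real (g x)) \<le> norm (G x)"
    using dom
  proof eventually_elim
    case (elim x)
    then have "\<bar>g x\<bar> \<le> Re (G x)" by (auto simp: P_def)
    then show ?case using complex_Re_le_cmod[of "G x"] by simp
  qed
  have gm: "(\<lambda>x. complex_of_real (g x)) \<in> borel_measurable borel" using g by measurable
  show "g \<in> rspace" using B0_solid[OF gm G gG] by (simp add: rspace_def)
  have "N0 G \<le> (\<Sum>k. rnorm (f k))"
  proof (rule LIMSEQ_le_const)
    show "(\<lambda>n. N0 (\<lambda>x. complex_of_real (P n x) - G x) + (\<Sum>k. rnorm (f k))) \<longlonglongrightarrow> (\<Sum>k. rnorm (f k))"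
      using tendsto_add[OF lim tendsto_const] by simp
    have "N0 G \<le> N0 (\<lambda>x. complex_of_real (P n x) - G x) + (\<Sum>k. rnorm (f k))" for n
    proof -
      have "N0 G = N0 (\<lambda>x. (G x - complex_of_real (P n x)) + complex_of_real (P n x))" by simp
      also have "\<dots> \<le> N0 (\<lambda>x. G x - complex_of_real (P n x)) + rnorm (P n)"
        unfolding rnorm_def by (rule N0_add[OF B0_diff[OF G PB] PB])
      also have "rnorm (P n) \<le> (\<Sum>k. rnorm (f k))"
        using PS(2)[of n] sum_le_suminf[OF sm, of "{..<n}"] rnorm_nonneg[OF f(1)] by (auto intro: order_trans)
      finally show ?thesis using N0_diff_commute[OF G PB, of n] by simp
    qed
    then show "\<exists>N. \<forall>n\<ge>N. N0 G \<le> N0 (\<lambda>x. complex_of_real (P n x) - G x) + (\<Sum>k. rnorm (f k))" by blast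
  qed
  then have "solid_const * N0 G \<le> solid_const * (\<Sum>k. rnorm (f k))" using solid_const by (intro mult_left_mono) auto
  then show "rnorm g \<le> solid_const * (\<Sum>k. rnorm (f k))"
    using N0_solid[OF gm G gG] by (simp add: rnorm_def)
qed

text \<open>A convex set of positive measure has an interior point and so contains a ball;
  invariance moves this ball to the origin.\<close>

lemma indicator_small_ball:
  obtains \<epsilon> where "0 < \<epsilon>" "indicator (ball 0 \<epsilon>) \<in> rspace"
proof -
  obtain f c S where f: "f \<in> B0" "0 < c" "S \<in> sets lborel" "convex S" "emeasure lborel S \<noteq> 0"
    "\<And>y. y \<in> S \<Longrightarrow> c < norm (f y)" using bf_conjuncts(10) by metis
  have "\<not> negligible S"
    using f(3,5) by (simp add: negligible_iff_null_sets null_sets_def)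
  then have "interior S \<noteq> {}" using negligible_convex_interior[OF f(4)] by simp
  then obtain z where "z \<in> interior S" by blast
  then obtain \<epsilon> where e: "0 < \<epsilon>" "ball z \<epsilon> \<subseteq> S" by (auto simp: mem_interior)
  have [measurable]: "ball z \<epsilon> \<in> sets borel" by simp
  have m: "(\<lambda>x. complex_of_real (indicator (ball z \<epsilon>) x)) \<in> borel_measurable borel" by measurable
  have B: "(\<lambda>x. complex_of_real (1 / c) * f x) \<in> B0" by (rule B0_cmult[OF f(1)])
  have "AE x in lborel. norm (complex_of_real (indicator (ball z \<epsilon>) x)) \<le> norm (complex_of_real (1 / c) * f x)"
  proof (rule AE_I2)
    fix x show "norm (complex_of_real (indicator (ball z \<epsilon>) x)) \<le> norm (complex_of_real (1 / c) * f x)"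
      using e f(2) f(6)[of x] by (auto simp: indicator_def norm_mult norm_divide less_imp_le)
  qed
  from B0_solid[OF m B this] have r: "indicator (ball z \<epsilon>) \<in> rspace" by (simp add: rspace_def)
  have "(\<lambda>y. indicator (ball z \<epsilon>) (y + z)) \<in> rspace" by (rule rspace_translate[OF r])
  moreover have "(\<lambda>y. indicator (ball z \<epsilon>) (y + z)) = (indicator (ball 0 \<epsilon>) :: 'a \<Rightarrow> real)"
    by (auto simp: fun_eq_iff indicator_def dist_norm)
  ultimately show ?thesis using that e(1) by simp
qed

lemma indicator_bounded_in_rspace:
  assumes "bounded A" "A \<in> sets borel"
  shows "indicator A \<in> rspace"
proof -
  obtain \<epsilon> where e: "0 < \<epsilon>" "indicator (ball 0 \<epsilon>) \<in> rspace" using indicator_small_ball by blast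
  define C where "C = trans_const"
  have C: "\<And>f x. f \<in> rspace \<Longrightarrow> (\<lambda>y. f (y + x)) \<in> rspace \<and> rnorm (\<lambda>y. f (y + x)) \<le> C * \<bar>v (- x)\<bar> * rnorm f"
    using rspace_translate rnorm_translate by (auto simp: C_def)
  have ball: "indicator (ball z \<epsilon>) \<in> rspace" for z
  proof -
    have "(\<lambda>y. indicator (ball 0 \<epsilon>) (y + (- z))) = (indicator (ball z \<epsilon>) :: 'a \<Rightarrow> real)"
      by (auto simp: fun_eq_iff indicator_def dist_norm norm_minus_commute)
    then show ?thesis using C[OF e(2), of "- z"] by simp
  qed
  have "compact (closure A)" using assms by (simp add: compact_closure)
  then obtain Z where Z: "finite Z" "closure A \<subseteq> (\<Union>z\<in>Z. ball z \<epsilon>)"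
    using e(1) unfolding compact_eq_totally_bounded by blast
  have 1: "(\<lambda>x. \<Sum>z\<in>Z. indicator (ball z \<epsilon>) x) \<in> rspace" using rspace_sum[OF Z(1), of "\<lambda>z. indicator (ball z \<epsilon>)"] ball by simp
  have 2: "\<bar>indicator A x\<bar> \<le> (\<Sum>z\<in>Z. indicator (ball z \<epsilon>) x :: real)" for x
  proof (cases "x \<in> A")
    case True
    then obtain z where z: "z \<in> Z" "x \<in> ball z \<epsilon>" using Z closure_subset by blast
    have "indicator (ball z \<epsilon>) x \<le> (\<Sum>z\<in>Z. indicator (ball z \<epsilon>) x :: real)"
      by (rule member_le_sum[OF z(1)]) (use Z in auto)
    then show ?thesis using z True by simp
  qed (simp add: sum_nonneg)
  have 3: "indicator A \<in> borel_measurable borel" using assms(2) by (rule borel_measurable_indicator)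
  show ?thesis by (rule rspace_solid_all(1)[OF 3 1 2])
qed

lemma rnorm_indicator_pos:
  assumes "bounded A" "A \<in> sets borel" "interior A \<noteq> {}"
  shows "0 < rnorm (indicator A)"
proof -
  have "rnorm (indicator A) \<noteq> 0"
  proof
    assume "rnorm (indicator A) = 0"
    then have "AE x in lborel. indicator A x = (0::real)" using rnorm_eq_0_iff[OF indicator_bounded_in_rspace[OF assms(1,2)]] by simp
    moreover obtain z r where "0 < r" "cball z r \<subseteq> A" using assms(3) by (auto simp: mem_interior_cball)
    ultimately show False using AE_lborel_ex_cball[of "\<lambda>x. indicator A x = (0::real)" r z] by (auto simp: indicator_def split: if_splits)
  qed
  then show ?thesis using rnorm_nonneg[OF indicator_bounded_in_rspace[OF assms(1,2)]] by linarith
qed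

text \<open>A fixed number of translates of the ball of radius r covers the ball of radius r + 1/2,
  so the norms of indicators of balls grow at most geometrically with the radius. A fast enough
  exponential is dominated by a convergent series of such indicators.\<close>

lemma exp_decay_in_rspace:
  obtains a where "0 < a" "(\<lambda>x. exp (- a * norm x)) \<in> rspace"
proof -
  define C where "C = trans_const"
  have C: "1 \<le> C" "\<And>f x. f \<in> rspace \<Longrightarrow> (\<lambda>y. f (y + x)) \<in> rspace \<and> rnorm (\<lambda>y. f (y + x)) \<le> C * \<bar>v (- x)\<bar> * rnorm f"
    using trans_const rspace_translate rnorm_translate by (auto simp: C_def)
  let ?I = "\<lambda>r. indicator (cball 0 r) :: 'a \<Rightarrow> real"
  have I: "?I r \<in> rspace" for r by (rule indicator_bounded_in_rspace) auto
  \<comment> \<open>A point outside the unit ball moves closer to the origin by 1 when the unit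
    vector in its direction is subtracted. Replacing this vector by a neighbour in \<open>Z0\<close>
    loses less than 1/2, so a net gain of 1/2 remains.\<close>
  obtain Z0 where Z0: "finite Z0" "cball (0::'a) 1 \<subseteq> (\<Union>z\<in>Z0. ball z (1/2))"
    using compact_cball[of "0::'a" 1] unfolding compact_eq_totally_bounded by (meson half_gt_zero_iff zero_less_one)
  define Z where "Z = insert 0 Z0"
  have Z: "finite Z" using Z0 by (simp add: Z_def)
  define q where "q = solid_const * (\<Sum>z\<in>Z. C * \<bar>v z\<bar>) + 1"
  have q: "1 \<le> q" using solid_const C by (auto simp: q_def intro!: mult_nonneg_nonneg sum_nonneg)
  have step: "rnorm (?I (r + 1/2)) \<le> q * rnorm (?I r)" if r: "1 \<le> r" for r
  proof -
    have in_sum: "(\<lambda>y. \<Sum>z\<in>Z. ?I r (y + (- z))) \<in> rspace \<and> rnorm (\<lambda>y. \<Sum>z\<in>Z. ?I r (y + (- z))) \<le> (\<Sum>z\<in>Z. rnorm (\<lambda>y. ?I r (y + (- z))))"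
      by (rule rspace_sum[OF Z]) (use C(2)[OF I] in blast)
    have dom: "\<bar>?I (r + 1/2) x\<bar> \<le> (\<Sum>z\<in>Z. ?I r (x + (- z)))" for x
    proof (cases "norm x \<le> r + 1/2")
      case True
      have "\<exists>z\<in>Z. norm (x - z) \<le> r"
      proof (cases "norm x \<le> 1")
        case True then show ?thesis using r by (auto simp: Z_def)
      next
        case False
        define y where "y = (1 / norm x) *\<^sub>R x"
        have "norm y = 1" using False by (auto simp: y_def)
        then obtain z where z: "z \<in> Z0" "norm (y - z) < 1/2" using Z0 by (force simp: dist_norm norm_minus_commute)
        have "x - y = (1 - 1 / norm x) *\<^sub>R x" by (simp add: y_def algebra_simps)
        then have "norm (x - y) = \<bar>1 - 1 / norm x\<bar> * norm x" by (metis norm_scaleR)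
        also have "\<bar>1 - 1 / norm x\<bar> = 1 - 1 / norm x" using False by (intro abs_of_nonneg) (simp add: divide_le_eq)
        also have "(1 - 1 / norm x) * norm x = norm x - 1" using False by (cases "norm x = 0") (auto simp: left_diff_distrib)
        finally have "norm (x - y) = norm x - 1" .
        then have "norm (x - z) \<le> r" using norm_triangle_ineq[of "x - y" "y - z"] z True by simp
        then show ?thesis using z by (auto simp: Z_def)
      qed
      then obtain z where z: "z \<in> Z" "norm (x - z) \<le> r" by blast
      have "?I r (x + (- z)) \<le> (\<Sum>z\<in>Z. ?I r (x + (- z)))"
        by (rule member_le_sum[OF z(1)]) (use Z in auto)
      then show ?thesis using z by (simp add: indicator_def)
    qed (simp add: sum_nonneg)
    have "rnorm (?I (r + 1/2)) \<le> solid_const * rnorm (\<lambda>y. \<Sum>z\<in>Z. ?I r (y + (- z)))"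
      by (rule rspace_solid_all(2)[OF rspace_measurable[OF I] conjunct1[OF in_sum] dom])
    also have "\<dots> \<le> solid_const * (\<Sum>z\<in>Z. C * \<bar>v z\<bar> * rnorm (?I r))"
    proof -
      have "(\<Sum>z\<in>Z. rnorm (\<lambda>y. ?I r (y + (- z)))) \<le> (\<Sum>z\<in>Z. C * \<bar>v z\<bar> * rnorm (?I r))"
      proof (rule sum_mono)
        fix z show "rnorm (\<lambda>y. ?I r (y + (- z))) \<le> C * \<bar>v z\<bar> * rnorm (?I r)"
          using C(2)[OF I[of r], of "- z"] by simp
      qed
      then show ?thesis using in_sum solid_const by (intro mult_left_mono) auto
    qed
    also have "\<dots> = (q - 1) * rnorm (?I r)" by (simp add: q_def sum_distrib_right)
    also have "\<dots> \<le> q * rnorm (?I r)" using rnorm_nonneg[OF I] by (intro mult_right_mono) auto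
    finally show ?thesis .
  qed
  have grow: "rnorm (?I (1 + real k / 2)) \<le> q ^ k * rnorm (?I 1)" for k
  proof (induction k)
    case (Suc k)
    have "rnorm (?I (1 + real (Suc k) / 2)) \<le> q * rnorm (?I (1 + real k / 2))"
      using step[of "1 + real k / 2"] by (simp add: add_divide_distrib algebra_simps)
    also have "\<dots> \<le> q * (q ^ k * rnorm (?I 1))" using Suc q by (intro mult_left_mono) auto
    finally show ?case by (simp add: mult.assoc)
  qed simp
  \<comment> \<open>Makes \<open>exp (- (a / 2)) * q\<close> equal to 1/2, the ratio of the
    majorising geometric series. In \<open>f\<close> below, the extra factor \<open>exp a\<close>
    makes up for rounding twice the norm up to an integer.\<close>
  define a where "a = 2 * ln (2 * q)"
  have a: "0 < a" using q by (simp add: a_def)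
  have ea: "exp (- (a / 2)) * q = 1/2" using q by (simp add: a_def exp_minus)
  define f where "f k x = exp (- (a / 2)) ^ k * exp (a / 2 * 2) * ?I (1 + real k / 2) x" for k x
  have fS: "f k \<in> rspace" for k unfolding f_def by (rule rspace_cmult[OF I])
  have fb: "rnorm (f k) \<le> exp a * rnorm (?I 1) * (1/2) ^ k" for k
  proof -
    have "rnorm (f k) = exp (- (a / 2)) ^ k * exp a * rnorm (?I (1 + real k / 2))"
      unfolding f_def using rnorm_cmult[OF I, of "exp (- (a / 2)) ^ k * exp (a / 2 * 2)"] by simp
    also have "\<dots> \<le> exp (- (a / 2)) ^ k * exp a * (q ^ k * rnorm (?I 1))" using grow by (intro mult_left_mono) auto
    also have "\<dots> = exp a * rnorm (?I 1) * (exp (- (a / 2)) * q) ^ k" by (simp add: power_mult_distrib)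
    finally show ?thesis by (simp add: ea)
  qed
  have geo: "summable (\<lambda>k. exp a * rnorm (?I 1) * (1/2) ^ k)"
    by (rule summable_mult[OF summable_geometric]) simp
  have sm: "summable (\<lambda>k. rnorm (f k))"
    by (rule summable_comparison_test'[OF geo, of 0]) (use fb rnorm_nonneg[OF fS] in simp)
  have "(\<lambda>x::'a. exp (- a * norm x)) \<in> rspace"
  proof (rule rspace_countable_sum(1)[OF fS _ sm])
    show "0 \<le> f k x" for k x by (simp add: f_def)
    show "AE x::'a in lborel. \<forall>M. (\<forall>m. (\<Sum>k<m. f k x) \<le> M) \<longrightarrow> \<bar>exp (- a * norm x)\<bar> \<le> M"
    proof (rule AE_I2, intro allI impI)
      fix x :: 'a and M assume M: "\<forall>m. (\<Sum>k<m. f k x) \<le> M"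
      define k where "k = nat \<lceil>2 * norm x\<rceil>"
      have k: "2 * norm x \<le> real k" "real k \<le> 2 * norm x + 1" using norm_ge_zero[of x] unfolding k_def by linarith+
      have "exp (- a * norm x) \<le> exp (real k * (- (a / 2))) * exp a"
      proof -
        have "a * (real k / 2) \<le> a * (norm x + 1)" using k a by (intro mult_left_mono) auto
        then show ?thesis by (simp add: exp_add[symmetric] algebra_simps)
      qed
      also have "\<dots> = f k x" using k by (simp add: f_def exp_of_nat_mult[symmetric] indicator_def)
      also have "\<dots> \<le> (\<Sum>k<Suc k. f k x)" by (rule member_le_sum) (auto simp: f_def)
      also have "\<dots> \<le> M" using M by blast
      finally show "\<bar>exp (- a * norm x)\<bar> \<le> M" by simp
    qed
  qed simp
  with a show ?thesis by (rule that)
qed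

end

subsection \<open>Embedding into weighted L1 spaces\<close>

lemma fine_ball_division:
  fixes a b :: "'a::euclidean_space"
  assumes "0 < \<delta>"
  obtains p where "p tagged_division_of cbox a b" "(\<lambda>x. ball x \<delta>) fine p"
proof -
  have "gauge (\<lambda>x::'a. ball x \<delta>)" using assms by (simp add: gauge_def)
  from fine_division_exists[OF this, of a b] show ?thesis using that .
qed

lemma integrable_indicator_cbox_continuous:
  fixes f :: "'a::euclidean_space \<Rightarrow> real"
  assumes "continuous_on UNIV f"
  shows "integrable lborel (\<lambda>x. indicator (cbox a b) x * f x)"
    "integral (cbox a b) f = (\<integral>x. indicator (cbox a b) x * f x \<partial>lborel)"
proof -
  have "integrable lborel (\<lambda>x. indicator (cbox a b) x *\<^sub>R f x)"
    by (rule borel_integrable_compact[OF compact_cbox continuous_on_subset[OF assms subset_UNIV],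
          unfolded if_distrib, THEN Bochner_Integration.integrable_cong[THEN iffD1, rotated 2]]) (auto simp: indicator_def)
  then have s: "set_integrable lborel (cbox a b) f" by (simp add: set_integrable_def)
  then show "integrable lborel (\<lambda>x. indicator (cbox a b) x * f x)" by (simp add: set_integrable_def)
  show "integral (cbox a b) f = (\<integral>x. indicator (cbox a b) x * f x \<partial>lborel)"
    using set_borel_integral_eq_integral(2)[OF s] by (simp add: set_lebesgue_integral_def)
qed

abbreviation cube :: "nat \<Rightarrow> 'a::euclidean_space set" where
  "cube n \<equiv> cbox (- real n *\<^sub>R One) (real n *\<^sub>R One)"

lemma cube_shift:
  assumes "s \<in> cube n" "norm x \<le> 1" shows "s - x \<in> cube (Suc n)"
  unfolding mem_box
proof (intro ballI)
  fix i :: 'a assume i: "i \<in> Basis"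
  have "\<bar>x \<bullet> i\<bar> \<le> 1" using Basis_le_norm[OF i, of x] assms(2) by linarith
  moreover have "- real n \<le> s \<bullet> i" "s \<bullet> i \<le> real n" using assms(1) i by (auto simp: mem_box)
  ultimately show "(- real (Suc n) *\<^sub>R One) \<bullet> i \<le> (s - x) \<bullet> i \<and> (s - x) \<bullet> i \<le> (real (Suc n) *\<^sub>R One) \<bullet> i"
    using i by (simp add: inner_diff_left) linarith
qed

text \<open>Averaging the translates of \<open>f * W\<close> over a fine division gives a function in the space that is bounded
  below on the unit ball by a weighted integral of \<open>f\<close>: hence the space embeds into a weighted \<open>L1\<close>.\<close>

lemma (in invariant_BF) weighted_L1_cube_bound:
  fixes W :: "'a \<Rightarrow> real"
  assumes v: "\<And>x. \<bar>v x\<bar> \<le> Dv * exp (Rv * norm x)" and Dv: "0 \<le> Dv" "0 \<le> Rv"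
    and W: "\<And>x. 0 < W x" "\<And>x y. W (x + y) \<le> D * exp (R * norm y) * W x" and D: "0 < D" "0 < R"
  obtains A C where "0 < A" "0 \<le> C" "\<forall>f n. continuous_on UNIV f \<longrightarrow> (\<forall>x. 0 \<le> f x) \<longrightarrow> (\<lambda>x. f x * W x) \<in> rspace \<longrightarrow>
     (\<integral>x. indicator (cube n) x * (exp (- A * norm x) * f x) \<partial>lborel) \<le> C * rnorm (\<lambda>x. f x * W x)"
proof -
  define Ct where "Ct = trans_const"
  have Ct: "1 \<le> Ct" "\<And>f x. f \<in> rspace \<Longrightarrow> (\<lambda>y. f (y + x)) \<in> rspace \<and> rnorm (\<lambda>y. f (y + x)) \<le> Ct * \<bar>v (- x)\<bar> * rnorm f"
    using trans_const rspace_translate rnorm_translate by (auto simp: Ct_def)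
  let ?\<chi> = "indicator (cball 0 1) :: 'a \<Rightarrow> real"
  have \<chi>: "?\<chi> \<in> rspace" by (rule indicator_bounded_in_rspace) auto
  have \<chi>p: "0 < rnorm ?\<chi>" by (rule rnorm_indicator_pos) (auto simp: interior_cball)
  \<comment> \<open>A translation by t costs \<open>exp (Rv * norm t)\<close>, and one more unit
    makes the averaging weights summable. The additional R in A pays for the lower bound of W near
    t.\<close>
  define a where "a = Rv + 1"
  define A where "A = a + R"
  have A: "0 < A" using Dv D by (simp add: A_def a_def add_pos_pos)
  define c where "c = W 0 / (D * exp R)"
  have c: "0 < c" using W(1)[of 0] D by (simp add: c_def)
  define I where "I = (\<integral>x. exp (- 1 * norm (x::'a)) \<partial>lborel)"
  have I: "0 \<le> I" unfolding I_def by (rule integral_nonneg_AE) simp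
  define Q where "Q = solid_const * (Ct * Dv * (I + 1)) / rnorm ?\<chi>"
  have Q: "0 \<le> Q" using solid_const Ct Dv I \<chi>p unfolding Q_def by (intro divide_nonneg_pos mult_nonneg_nonneg) auto
  have Wl: "c * exp (- R * norm t) \<le> W (x + t)" if x: "norm x \<le> 1" for x t
  proof -
    have "W 0 \<le> D * exp (R * norm (x + t)) * W (x + t)" using W(2)[of "x + t" "- (x + t)"] by (simp only: norm_minus_cancel add.right_inverse)
    also have "\<dots> \<le> D * exp (R * (1 + norm t)) * W (x + t)"
      using norm_triangle_ineq[of x t] x D W(1)[of "x + t"] by (intro mult_right_mono mult_left_mono) auto
    also have "\<dots> = (D * exp R) * (exp (R * norm t) * W (x + t))" by (simp add: distrib_left exp_add)
    finally have "c \<le> exp (R * norm t) * W (x + t)" using D by (simp add: c_def pos_divide_le_eq mult_ac)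
    then have "c * exp (- R * norm t) \<le> (exp (R * norm t) * W (x + t)) * exp (- R * norm t)" by (intro mult_right_mono) auto
    also have "\<dots> = W (x + t)" by (simp add: exp_minus)
    finally show ?thesis .
  qed
  show ?thesis
  proof (rule that[of A "exp A * (Q / c)"])
    show "0 < A" by (rule A)
    show "0 \<le> exp A * (Q / c)" using Q c by simp
    show "\<forall>f n. continuous_on UNIV f \<longrightarrow> (\<forall>x. 0 \<le> f x) \<longrightarrow> (\<lambda>x. f x * W x) \<in> rspace \<longrightarrow>
     (\<integral>x. indicator (cube n) x * (exp (- A * norm x) * f x) \<partial>lborel) \<le> exp A * (Q / c) * rnorm (\<lambda>x. f x * W x)"
    proof (intro allI impI)
    fix f :: "'a \<Rightarrow> real" and n :: nat
    assume fc: "continuous_on UNIV f" and f0': "\<forall>x. 0 \<le> f x" and fW: "(\<lambda>x. f x * W x) \<in> rspace"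
    have f0: "0 \<le> f x" for x using f0' by blast
    let ?fW = "\<lambda>x. f x * W x"
    define T0 where "T0 = rnorm ?fW"
    have T0: "0 \<le> T0" unfolding T0_def by (rule rnorm_nonneg[OF fW])
    \<comment> \<open>The restriction to a cube makes all integrals finite while nothing is known
      about the growth of f.\<close>
    define J where "J = (\<integral>x. indicator (cube n) x * (exp (- A * norm x) * f x) \<partial>lborel)"
    define g where "g x t = exp (- A * norm t) * f (x + t)" for x t
    have gc: "continuous_on UNIV (g x)" for x
      unfolding g_def by (intro continuous_intros continuous_on_compose2[OF fc]) auto
    let ?K = "cube (Suc n) :: 'a set"
    have "exp (- A) * J \<le> Q / c * T0 + \<epsilon>" if \<epsilon>: "0 < \<epsilon>" for \<epsilon>
    proof -
      define V where "V = measure lborel ?K + 1"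
      have V: "0 < V" "measure lborel ?K \<le> V" using measure_nonneg[of lborel ?K] unfolding V_def by linarith+
      \<comment> \<open>Uniform continuity in both variables provides one division that works for
        all x in the unit ball.\<close>
      have "uniformly_continuous_on (cball 0 1 \<times> ?K) (\<lambda>q. g (fst q) (snd q))"
        unfolding g_def by (intro compact_uniformly_continuous compact_Times continuous_intros continuous_on_compose2[OF fc]) auto
      then obtain d1 where d1: "0 < d1" "\<And>q q'. q \<in> cball 0 1 \<times> ?K \<Longrightarrow> q' \<in> cball 0 1 \<times> ?K \<Longrightarrow> dist q' q < d1 \<Longrightarrow> dist (g (fst q') (snd q')) (g (fst q) (snd q)) < \<epsilon> / V"
        unfolding uniformly_continuous_on_def using divide_pos_pos[OF \<epsilon> V(1)] by metis
      have "uniformly_continuous_on ?K (\<lambda>t. exp (- 1 * norm t))"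
        by (intro compact_uniformly_continuous continuous_intros) auto
      then obtain d2 where d2: "0 < d2" "\<And>s t. s \<in> ?K \<Longrightarrow> t \<in> ?K \<Longrightarrow> dist t s < d2 \<Longrightarrow> dist (exp (- 1 * norm t)) (exp (- 1 * norm s)) < 1 / V"
        unfolding uniformly_continuous_on_def using divide_pos_pos[OF zero_less_one V(1)] by metis
      have dd: "0 < min d1 d2" using d1(1) d2(1) by simp
      obtain p where p: "p tagged_division_of ?K" and fine: "(\<lambda>x. ball x (min d1 d2)) fine p"
        using fine_ball_division[OF dd] .
      have pf: "finite p" using p by (rule tagged_division_of_finite)
      have ptag: "fst q \<in> ?K" if "q \<in> p" for q using tagged_division_ofD(2,3)[OF p, of "fst q" "snd q"] that by auto
      have r1: "(\<Sum>q\<in>p. measure lborel (snd q) * exp (- 1 * norm (fst q))) \<le> I + 1"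
      proof -
        have ec: "continuous_on UNIV (\<lambda>t::'a. exp (- 1 * norm t))" by (intro continuous_intros)
        have "norm ((\<Sum>(x, k)\<in>p. measure lborel k *\<^sub>R exp (- 1 * norm x)) - integral ?K (\<lambda>t. exp (- 1 * norm t))) \<le> 1 / V * measure lborel ?K"
        proof (rule riemann_sum_error[OF p fine continuous_on_subset[OF ec]])
          fix x y assume "x \<in> ?K" "y \<in> ?K" "dist x y < min d1 d2"
          then show "norm (exp (- 1 * norm x) - exp (- 1 * norm y)) \<le> 1 / V"
            using d2(2)[of y x] by (simp add: dist_norm)
        qed simp
        also have "1 / V * measure lborel ?K \<le> 1" using V by (simp add: divide_le_eq)
        finally have 1: "(\<Sum>q\<in>p. measure lborel (snd q) * exp (- 1 * norm (fst q))) \<le> integral ?K (\<lambda>t. exp (- 1 * norm t)) + 1"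
          by (simp add: case_prod_unfold)
        have "integral ?K (\<lambda>t. exp (- 1 * norm t)) \<le> I"
          unfolding I_def integrable_indicator_cbox_continuous(2)[OF ec]
          by (intro integral_mono integrable_indicator_cbox_continuous(1)[OF ec] integrable_exp_norm) (auto simp: indicator_def)
        with 1 show ?thesis by linarith
      qed
      \<comment> \<open>The substitution s = x + t compares the sum at x with J. Moving the weight
        by x costs \<open>exp (- A)\<close>, and the larger cube contains the shifted smaller
        one.\<close>
      have r2: "exp (- A) * J - \<epsilon> \<le> (\<Sum>q\<in>p. measure lborel (snd q) * g x (fst q))" if x: "norm x \<le> 1" for x
      proof -
        have "norm ((\<Sum>(t, k)\<in>p. measure lborel k *\<^sub>R g x t) - integral ?K (g x)) \<le> \<epsilon> / V * measure lborel ?K"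
        proof (rule riemann_sum_error[OF p fine continuous_on_subset[OF gc]])
          fix s t assume "s \<in> ?K" "t \<in> ?K" "dist s t < min d1 d2"
          then show "norm (g x s - g x t) \<le> \<epsilon> / V"
            using d1(2)[of "(x, t)" "(x, s)"] x by (simp add: dist_norm norm_Pair)
        qed simp
        also have "\<epsilon> / V * measure lborel ?K \<le> \<epsilon>" using V \<epsilon> by (simp add: divide_le_eq mult_left_mono)
        finally have 1: "integral ?K (g x) - \<epsilon> \<le> (\<Sum>q\<in>p. measure lborel (snd q) * g x (fst q))"
          by (simp add: case_prod_unfold abs_le_iff)
        have m: "(\<lambda>t. indicator ?K t * g x t) \<in> borel_measurable borel"
          using borel_measurable_continuous_onI[OF gc] by simp
        have "exp (- A) * J = (\<integral>s. exp (- A) * (indicator (cube n) s * (exp (- A * norm s) * f s)) \<partial>lborel)"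
          unfolding J_def by simp
        also have "\<dots> \<le> (\<integral>s. indicator ?K (s - x) * g x (s - x) \<partial>lborel)"
        proof (rule integral_mono)
          have "continuous_on UNIV (\<lambda>s. exp (- A * norm s) * f s)" by (intro continuous_intros fc)
          then show "integrable lborel (\<lambda>s. exp (- A) * (indicator (cube n) s * (exp (- A * norm s) * f s)))"
            by (intro integrable_mult_right integrable_indicator_cbox_continuous(1))
          have "integrable lborel (\<lambda>s. indicator ?K (- x + 1 *\<^sub>R s) * g x (- x + 1 *\<^sub>R s))"
            by (rule integrable_lborel_affine[OF integrable_indicator_cbox_continuous(1)[OF gc]]) simp
          then show "integrable lborel (\<lambda>s. indicator ?K (s - x) * g x (s - x))" by simp
          fix s :: 'a
          have e: "exp (- A) * exp (- A * norm s) \<le> exp (- A * norm (s - x))"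
          proof -
            have "A * norm (s - x) \<le> A * (norm s + 1)" using norm_triangle_ineq4[of s x] x A by (intro mult_left_mono) auto
            then show ?thesis by (simp add: exp_add[symmetric] algebra_simps)
          qed
          show "exp (- A) * (indicator (cube n) s * (exp (- A * norm s) * f s)) \<le> indicator ?K (s - x) * g x (s - x)"
          proof (cases "s \<in> cube n")
            case True
            then have "s - x \<in> ?K" by (rule cube_shift[OF _ x])
            then show ?thesis using True mult_right_mono[OF e f0[of s]] by (simp add: g_def mult.assoc)
          next
            case False
            then show ?thesis using f0 by (simp add: g_def indicator_def)
          qed
        qed
        also have "\<dots> = (\<integral>s. indicator ?K s * g x s \<partial>lborel)"
          using integral_lborel_translate[OF m, of "- x"] by simp
        also have "\<dots> = integral ?K (g x)" by (simp add: integrable_indicator_cbox_continuous(2)[OF gc])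
        finally show ?thesis using 1 by linarith
      qed
      \<comment> \<open>The average of translates of f W: a finite sum, so membership and the norm
        bound follow from the triangle inequality and invariance.\<close>
      define T where "T x = (\<Sum>q\<in>p. (measure lborel (snd q) * exp (- a * norm (fst q))) * ?fW (x + fst q))" for x
      have tr: "(\<lambda>x. ?fW (x + t)) \<in> rspace" "rnorm (\<lambda>x. ?fW (x + t)) \<le> Ct * (Dv * exp (Rv * norm t)) * T0" for t
      proof -
        have "(\<lambda>x. ?fW (x + t)) \<in> rspace \<and> rnorm (\<lambda>x. ?fW (x + t)) \<le> Ct * \<bar>v (- t)\<bar> * T0"
          using Ct(2)[OF fW, of t] unfolding T0_def .
        moreover have "Ct * \<bar>v (- t)\<bar> * T0 \<le> Ct * (Dv * exp (Rv * norm t)) * T0"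
          using v[of "- t"] Ct T0 by (intro mult_right_mono mult_left_mono) auto
        ultimately show "(\<lambda>x. ?fW (x + t)) \<in> rspace" "rnorm (\<lambda>x. ?fW (x + t)) \<le> Ct * (Dv * exp (Rv * norm t)) * T0" by auto
      qed
      have TS: "T \<in> rspace" and Tn: "rnorm T \<le> (\<Sum>q\<in>p. rnorm (\<lambda>x. (measure lborel (snd q) * exp (- a * norm (fst q))) * ?fW (x + fst q)))"
        using rspace_sum[OF pf rspace_cmult[OF tr(1)], of "\<lambda>q. measure lborel (snd q) * exp (- a * norm (fst q))" fst]
        unfolding T_def[abs_def] by auto
      note Tn
      also have "(\<Sum>q\<in>p. rnorm (\<lambda>x. (measure lborel (snd q) * exp (- a * norm (fst q))) * ?fW (x + fst q))) \<le>
         (\<Sum>q\<in>p. (measure lborel (snd q) * exp (- 1 * norm (fst q))) * (Ct * Dv * T0))"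
      proof (rule sum_mono)
        fix q assume "q \<in> p"
        have "rnorm (\<lambda>x. (measure lborel (snd q) * exp (- a * norm (fst q))) * ?fW (x + fst q)) =
          (measure lborel (snd q) * exp (- a * norm (fst q))) * rnorm (\<lambda>x. ?fW (x + fst q))"
          using rnorm_cmult[OF tr(1), of "measure lborel (snd q) * exp (- a * norm (fst q))" "fst q"] by simp
        also have "\<dots> \<le> (measure lborel (snd q) * exp (- a * norm (fst q))) * (Ct * (Dv * exp (Rv * norm (fst q))) * T0)"
          by (intro mult_left_mono tr) auto
        also have "\<dots> = (measure lborel (snd q) * (exp (- a * norm (fst q)) * exp (Rv * norm (fst q)))) * (Ct * Dv * T0)" by simp
        also have "exp (- a * norm (fst q)) * exp (Rv * norm (fst q)) = exp (- 1 * norm (fst q))"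
          by (simp add: exp_add[symmetric] a_def algebra_simps)
        finally show "rnorm (\<lambda>x. (measure lborel (snd q) * exp (- a * norm (fst q))) * ?fW (x + fst q)) \<le> (measure lborel (snd q) * exp (- 1 * norm (fst q))) * (Ct * Dv * T0)" .
      qed
      also have "\<dots> = (\<Sum>q\<in>p. measure lborel (snd q) * exp (- 1 * norm (fst q))) * (Ct * Dv * T0)"
        by (simp add: sum_distrib_right)
      also have "\<dots> \<le> (I + 1) * (Ct * Dv * T0)" using r1 Ct Dv T0 by (intro mult_right_mono) auto
      finally have Tn': "rnorm T \<le> (I + 1) * (Ct * Dv * T0)" .
      have T_nonneg: "0 \<le> T x" for x unfolding T_def using f0 W(1) by (intro sum_nonneg mult_nonneg_nonneg) (auto simp: less_imp_le)
      have Tl: "c * (exp (- A) * J - \<epsilon>) \<le> T x" if x: "norm x \<le> 1" for x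
      proof -
        have "c * (exp (- A) * J - \<epsilon>) \<le> c * (\<Sum>q\<in>p. measure lborel (snd q) * g x (fst q))"
          using r2[OF x] c by (intro mult_left_mono) auto
        also have "\<dots> = (\<Sum>q\<in>p. (measure lborel (snd q) * exp (- a * norm (fst q))) * (f (x + fst q) * (c * exp (- R * norm (fst q)))))"
        proof -
          have e: "exp (- A * s) = exp (- a * s) * exp (- R * s)" for s :: real
            by (simp add: A_def exp_add[symmetric] algebra_simps)
          show ?thesis unfolding sum_distrib_left g_def e by (simp only: mult_ac)
        qed
        also have "\<dots> \<le> T x"
          unfolding T_def using Wl[OF x] f0 by (intro sum_mono mult_left_mono) auto
        finally show ?thesis .
      qed
      \<comment> \<open>The lower bound for T on the unit ball may be negative; its positive part
        times the indicator of that ball is still dominated by T.\<close>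
      define m where "m = max 0 (c * (exp (- A) * J - \<epsilon>))"
      have mT: "\<bar>m * ?\<chi> x\<bar> \<le> T x" for x
        using Tl[of x] T_nonneg[of x] by (auto simp: m_def indicator_def)
      have "rnorm (\<lambda>x. m * ?\<chi> x) \<le> solid_const * rnorm T"
        by (rule rspace_solid_all(2)[OF rspace_measurable[OF rspace_cmult[OF \<chi>]] TS mT])
      moreover have "rnorm (\<lambda>x. m * ?\<chi> x) = m * rnorm ?\<chi>" using rnorm_cmult[OF \<chi>, of m] by (simp add: m_def)
      moreover have "solid_const * rnorm T \<le> solid_const * ((I + 1) * (Ct * Dv * T0))" using Tn' solid_const by (intro mult_left_mono) auto
      ultimately have "m * rnorm ?\<chi> \<le> solid_const * ((I + 1) * (Ct * Dv * T0))" by linarith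
      then have "m \<le> Q * T0" using \<chi>p by (simp add: Q_def pos_le_divide_eq mult_ac)
      then have "c * (exp (- A) * J - \<epsilon>) \<le> Q * T0" by (simp add: m_def)
      then show ?thesis using c by (simp add: field_simps)
    qed
    then have "exp (- A) * J \<le> Q / c * T0" by (rule field_le_epsilon)
    then have "exp A * (exp (- A) * J) \<le> exp A * (Q / c * T0)" by (intro mult_left_mono) auto
    then show "(\<integral>x. indicator (cube n) x * (exp (- A * norm x) * f x) \<partial>lborel) \<le> exp A * (Q / c) * rnorm ?fW"
      by (simp add: J_def T0_def exp_minus mult.assoc[symmetric])
    qed
  qed
qed

lemma cube_limit:
  fixes f :: "'a::euclidean_space \<Rightarrow> real"
  assumes f: "integrable lborel f"
  shows "(\<lambda>n. \<integral>x. indicator (cube n) x * f x \<partial>lborel) \<longlonglongrightarrow> integral\<^sup>L lborel f"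
proof (rule integral_dominated_convergence[OF _ _ integrable_norm[OF f]])
  show "f \<in> borel_measurable lborel" using f by auto
  then show "(\<lambda>x. indicator (cube n) x * f x) \<in> borel_measurable lborel" for n by simp
  show "AE x in lborel. norm (indicator (cube n) x * f x) \<le> norm (f x)" for n by (auto simp: indicator_def)
  show "AE x in lborel. (\<lambda>n. indicator (cube n) x * f x) \<longlonglongrightarrow> f x"
  proof (rule AE_I2)
    fix x :: 'a
    have "\<forall>\<^sub>F n in sequentially. indicator (cube n) x * f x = f x"
      unfolding eventually_sequentially
    proof (intro exI[of _ "nat \<lceil>norm x\<rceil>"] allI impI)
      fix n assume "nat \<lceil>norm x\<rceil> \<le> n"
      then have "norm x \<le> real n" by linarith
      then have "x \<in> cube n" unfolding mem_box using Basis_le_norm[of _ x] by (force simp: abs_le_iff)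
      then show "indicator (cube n) x * f x = f x" by simp
    qed
    then show "(\<lambda>n. indicator (cube n) x * f x) \<longlonglongrightarrow> f x" by (rule tendsto_eventually)
  qed
qed

text \<open>Translation by X centres the kernel at the origin, where the bound on cubes applies, and
  then the cubes exhaust the space. Invariance costs \<open>exp (Rv * norm X)\<close>, and moving W
  back costs \<open>exp (R * norm X)\<close>.\<close>

lemma (in invariant_BF) weighted_L1_bound:
  fixes W :: "'a \<Rightarrow> real"
  assumes v: "\<And>x. \<bar>v x\<bar> \<le> Dv * exp (Rv * norm x)" and Dv: "0 \<le> Dv" "0 \<le> Rv"
    and Wm: "W \<in> borel_measurable borel"
    and W: "\<And>x. 0 < W x" "\<And>x y. W (x + y) \<le> D * exp (R * norm y) * W x" and D: "0 < D" "0 < R"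
  obtains A C where "0 < A" "0 \<le> C" "\<forall>f S X. continuous_on UNIV f \<longrightarrow> (\<forall>x. 0 \<le> f x) \<longrightarrow> (\<lambda>x. f x * W x) \<in> rspace \<longrightarrow> A \<le> S \<longrightarrow>
     integrable lborel (\<lambda>Y. exp (- S * norm (X - Y)) * f Y) \<longrightarrow>
     (\<integral>Y. exp (- S * norm (X - Y)) * f Y \<partial>lborel) \<le> C * exp ((R + Rv) * norm X) * rnorm (\<lambda>x. f x * W x)"
proof -
  obtain A C where A: "0 < A" and C: "0 \<le> C" and AC0: "\<forall>f n. continuous_on UNIV f \<longrightarrow> (\<forall>x. 0 \<le> f x) \<longrightarrow> (\<lambda>x. f x * W x) \<in> rspace \<longrightarrow>
     (\<integral>x. indicator (cube n) x * (exp (- A * norm x) * f x) \<partial>lborel) \<le> C * rnorm (\<lambda>x. f x * W x)"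
    using weighted_L1_cube_bound[OF v Dv W D] .
  note AC = AC0[rule_format]
  define Ct where "Ct = trans_const"
  have Ct: "1 \<le> Ct" "\<And>f x. f \<in> rspace \<Longrightarrow> (\<lambda>y. f (y + x)) \<in> rspace \<and> rnorm (\<lambda>y. f (y + x)) \<le> Ct * \<bar>v (- x)\<bar> * rnorm f"
    using trans_const rspace_translate rnorm_translate by (auto simp: Ct_def)
  show ?thesis
  proof (rule that[OF A, of "C * (solid_const * (D * (Ct * Dv)))"])
    show "0 \<le> C * (solid_const * (D * (Ct * Dv)))" using C D Ct Dv solid_const by simp
    show "\<forall>f S X. continuous_on UNIV f \<longrightarrow> (\<forall>x. 0 \<le> f x) \<longrightarrow> (\<lambda>x. f x * W x) \<in> rspace \<longrightarrow> A \<le> S \<longrightarrow>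
     integrable lborel (\<lambda>Y. exp (- S * norm (X - Y)) * f Y) \<longrightarrow>
     (\<integral>Y. exp (- S * norm (X - Y)) * f Y \<partial>lborel) \<le> C * (solid_const * (D * (Ct * Dv))) * exp ((R + Rv) * norm X) * rnorm (\<lambda>x. f x * W x)"
    proof (intro allI impI)
    fix f :: "'a \<Rightarrow> real" and S X
    assume fc: "continuous_on UNIV f" and f0': "\<forall>x. 0 \<le> f x" and fW: "(\<lambda>x. f x * W x) \<in> rspace" and S: "A \<le> S"
      and int: "integrable lborel (\<lambda>Y. exp (- S * norm (X - Y)) * f Y)"
    have f0: "0 \<le> f x" for x using f0' by blast
    let ?g = "\<lambda>y. f (y + X)"
    have gc: "continuous_on UNIV ?g" by (intro continuous_on_compose2[OF fc] continuous_intros) auto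
    have tr: "(\<lambda>y. f (y + X) * W (y + X)) \<in> rspace" "rnorm (\<lambda>y. f (y + X) * W (y + X)) \<le> Ct * (Dv * exp (Rv * norm X)) * rnorm (\<lambda>x. f x * W x)"
    proof -
      have "Ct * \<bar>v (- X)\<bar> * rnorm (\<lambda>x. f x * W x) \<le> Ct * (Dv * exp (Rv * norm X)) * rnorm (\<lambda>x. f x * W x)"
        using v[of "- X"] Ct rnorm_nonneg[OF fW] by (intro mult_right_mono mult_left_mono) auto
      then show "(\<lambda>y. f (y + X) * W (y + X)) \<in> rspace" "rnorm (\<lambda>y. f (y + X) * W (y + X)) \<le> Ct * (Dv * exp (Rv * norm X)) * rnorm (\<lambda>x. f x * W x)"
        using Ct(2)[OF fW, of X] by auto
    qed
    have dom: "\<bar>?g y * W y\<bar> \<le> (D * exp (R * norm X)) * (f (y + X) * W (y + X))" for y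
    proof -
      have "W y \<le> D * exp (R * norm X) * W (y + X)" using W(2)[of "y + X" "- X"] by simp
      then have "f (y + X) * W y \<le> f (y + X) * (D * exp (R * norm X) * W (y + X))" using f0 by (intro mult_left_mono)
      then show ?thesis using f0[of "y + X"] W(1)[of y] by (simp add: abs_mult mult_ac)
    qed
    have gm: "(\<lambda>y. ?g y * W y) \<in> borel_measurable borel"
      using borel_measurable_continuous_onI[OF gc] Wm by simp
    have gW: "(\<lambda>y. ?g y * W y) \<in> rspace" and gn: "rnorm (\<lambda>y. ?g y * W y) \<le> solid_const * rnorm (\<lambda>y. (D * exp (R * norm X)) * (f (y + X) * W (y + X)))"
      using rspace_solid_all[OF gm rspace_cmult[OF tr(1)] dom] by auto
    note gn
    also have "rnorm (\<lambda>y. (D * exp (R * norm X)) * (f (y + X) * W (y + X))) = (D * exp (R * norm X)) * rnorm (\<lambda>y. f (y + X) * W (y + X))"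
      using rnorm_cmult[OF tr(1), of "D * exp (R * norm X)"] D by simp
    also have "solid_const * ((D * exp (R * norm X)) * rnorm (\<lambda>y. f (y + X) * W (y + X))) \<le>
       solid_const * ((D * exp (R * norm X)) * (Ct * (Dv * exp (Rv * norm X)) * rnorm (\<lambda>x. f x * W x)))"
      using solid_const D tr(2) by (intro mult_left_mono) auto
    also have "\<dots> = (solid_const * (D * (Ct * Dv))) * exp ((R + Rv) * norm X) * rnorm (\<lambda>x. f x * W x)"
    proof -
      have "exp ((R + Rv) * norm X) = exp (R * norm X) * exp (Rv * norm X)" by (simp add: distrib_right exp_add)
      then show ?thesis by (simp only: mult_ac)
    qed
    finally have gn': "rnorm (\<lambda>y. ?g y * W y) \<le> (solid_const * (D * (Ct * Dv))) * exp ((R + Rv) * norm X) * rnorm (\<lambda>x. f x * W x)" .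
    have int': "integrable lborel (\<lambda>y. exp (- S * norm y) * ?g y)"
      using integrable_lborel_affine[OF int, of 1 X] by (simp add: add.commute)
    have eq: "(\<integral>Y. exp (- S * norm (X - Y)) * f Y \<partial>lborel) = (\<integral>y. exp (- S * norm y) * ?g y \<partial>lborel)"
      using integral_lborel_translate[of "\<lambda>Y. exp (- S * norm (X - Y)) * f Y" X] borel_measurable_integrable[OF int]
      by (simp add: add.commute)
    have "(\<integral>y. exp (- S * norm y) * ?g y \<partial>lborel) \<le> C * rnorm (\<lambda>y. ?g y * W y)"
    proof (rule LIMSEQ_le_const2[OF cube_limit[OF int']], intro exI[of _ 0] allI impI)
      fix n
      have Ac: "continuous_on UNIV (\<lambda>x. exp (- A * norm x) * ?g x)" "continuous_on UNIV (\<lambda>x. exp (- S * norm x) * ?g x)"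
        by (intro continuous_intros gc)+
      have "(\<integral>x. indicator (cube n) x * (exp (- S * norm x) * ?g x) \<partial>lborel) \<le> (\<integral>x. indicator (cube n) x * (exp (- A * norm x) * ?g x) \<partial>lborel)"
      proof (intro integral_mono integrable_indicator_cbox_continuous(1)[OF Ac(1)] integrable_indicator_cbox_continuous(1)[OF Ac(2)] mult_left_mono mult_right_mono f0)
        fix x :: 'a
        show "exp (- S * norm x) \<le> exp (- A * norm x)" using S by (simp add: mult_right_mono)
      qed auto
      also have "\<dots> \<le> C * rnorm (\<lambda>y. ?g y * W y)" by (rule AC[OF gc f0 gW])
      finally show "(\<integral>x. indicator (cube n) x * (exp (- S * norm x) * ?g x) \<partial>lborel) \<le> C * rnorm (\<lambda>y. ?g y * W y)" .
    qed
    also have "\<dots> \<le> C * ((solid_const * (D * (Ct * Dv))) * exp ((R + Rv) * norm X) * rnorm (\<lambda>x. f x * W x))"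
      by (rule mult_left_mono[OF gn' C])
    finally show "(\<integral>Y. exp (- S * norm (X - Y)) * f Y \<partial>lborel) \<le> C * (solid_const * (D * (Ct * Dv))) * exp ((R + Rv) * norm X) * rnorm (\<lambda>x. f x * W x)"
      unfolding eq by (simp add: mult.assoc)
    qed
  qed
qed

subsection \<open>Growth of short-time Fourier transforms\<close>

text \<open>Peetre's trick: the maximal function \<open>H\<close> of \<open>F\<close> at \<open>X\<close> satisfies \<open>H \<le> K * H powr (1 - r) * I\<close>, where \<open>I\<close> is the integral
  on the right-hand side.\<close>

lemma peetre_bound:
  fixes F :: "'a::euclidean_space \<Rightarrow> complex"
  assumes r: "0 < r" "r \<le> 1" and R: "0 < R" and K: "0 \<le> K"
    and Fm: "F \<in> borel_measurable borel"
    and growth: "\<And>Y. norm (F Y) \<le> C * exp (R / 2 * norm Y)"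
    and rep: "\<And>Z. norm (F Z) \<le> K * (\<integral>Y. exp (- R * norm (Z - Y)) * norm (F Y) \<partial>lborel)"
  shows "norm (F X) powr r \<le> K * (\<integral>Y. exp (- (R * r) * norm (X - Y)) * norm (F Y) powr r \<partial>lborel)"
proof -
  define G where "G Y = norm (F Y) * exp (- R * norm (X - Y))" for Y
  have G0: "0 \<le> G Y" for Y by (simp add: G_def)
  have C: "0 \<le> C" using order_trans[OF norm_ge_zero growth[of 0]] by simp
  have Gb: "G Y \<le> C * exp (R * norm X) * exp (- (R / 2) * norm Y)" for Y
  proof -
    have "G Y \<le> (C * exp (R / 2 * norm Y)) * exp (- R * norm (X - Y))" unfolding G_def by (rule mult_right_mono[OF growth]) simp
    also have "\<dots> = C * (exp (R / 2 * norm Y) * exp (- R * norm (X - Y)))" by simp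
    also have "\<dots> \<le> C * (exp (R * norm X) * exp (- (R / 2) * norm Y))"
    proof (rule mult_left_mono[OF _ C])
      have "R * norm Y \<le> R * (norm X + norm (X - Y))"
        using norm_triangle_ineq4[of X "X - Y"] R by (intro mult_left_mono) auto
      then show "exp (R / 2 * norm Y) * exp (- R * norm (X - Y)) \<le> exp (R * norm X) * exp (- (R / 2) * norm Y)"
        by (simp add: exp_add[symmetric] algebra_simps)
    qed
    finally show ?thesis by (simp add: mult.assoc)
  qed
  have Gb2: "G Y \<le> C * exp (R * norm X)" for Y
  proof -
    have "C * exp (R * norm X) * exp (- (R / 2) * norm Y) \<le> C * exp (R * norm X) * 1" using C R by (intro mult_left_mono) auto
    then show ?thesis using Gb[of Y] by simp
  qed
  have Gm [measurable]: "G \<in> borel_measurable borel" unfolding G_def using Fm by measurable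
  have Gi: "integrable lborel G"
    by (rule integrable_exp_decay[OF Gm, of "C * exp (R * norm X)" "R / 2"]) (use Gb G0 R in auto)
  have Gri: "integrable lborel (\<lambda>Y. G Y powr r)"
  proof (rule integrable_exp_decay[of _ "(C * exp (R * norm X)) powr r" "R / 2 * r"])
    show "norm (G Y powr r) \<le> (C * exp (R * norm X)) powr r * exp (- (R / 2 * r) * norm Y)" for Y
    proof -
      have "G Y powr r \<le> (C * exp (R * norm X) * exp (- (R / 2) * norm Y)) powr r"
        using Gb[of Y] G0[of Y] r by (intro powr_mono2) auto
      also have "\<dots> = (C * exp (R * norm X)) powr r * exp (- (R / 2) * norm Y) powr r"
        by (rule powr_mult)
      also have "exp (- (R / 2) * norm Y) powr r = exp (- (R / 2 * r) * norm Y)"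
        by (simp add: powr_def)
      finally show ?thesis by simp
    qed
  qed (use R r in auto)
  \<comment> \<open>The growth rate \<open>R / 2\<close> of F lies below the rate R of the kernel,
    so the supremum is finite; otherwise H could not be cancelled below.\<close>
  define H where "H = (SUP Z. G Z)"
  have bdd: "bdd_above (range G)" by (rule bdd_aboveI2) (rule Gb2)
  have GH: "G Y \<le> H" for Y unfolding H_def by (rule cSUP_upper[OF _ bdd]) simp
  have H0: "0 \<le> H" using GH[of X] G0[of X] by linarith
  have Gr: "G Y powr r = exp (- (R * r) * norm (X - Y)) * norm (F Y) powr r" for Y
  proof -
    have "G Y powr r = norm (F Y) powr r * exp (- R * norm (X - Y)) powr r"
      unfolding G_def by (rule powr_mult)
    also have "exp (- R * norm (X - Y)) powr r = exp (- (R * r) * norm (X - Y))" by (simp add: powr_def mult_ac)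
    finally show ?thesis by simp
  qed
  define I where "I = (\<integral>Y. G Y powr r \<partial>lborel)"
  have I0: "0 \<le> I" unfolding I_def by (rule integral_nonneg_AE) simp
  have GG: "G Y \<le> H powr (1 - r) * G Y powr r" for Y
  proof (cases "G Y = 0")
    case False
    then have "G Y = G Y powr (1 - r) * G Y powr r" using G0[of Y] by (simp add: powr_add[symmetric])
    also have "\<dots> \<le> H powr (1 - r) * G Y powr r" using GH[of Y] G0[of Y] r by (intro mult_right_mono powr_mono2) auto
    finally show ?thesis .
  qed simp
  have "G Z \<le> K * (H powr (1 - r) * I)" for Z
  proof -
    have "G Z \<le> (K * (\<integral>Y. exp (- R * norm (Z - Y)) * norm (F Y) \<partial>lborel)) * exp (- R * norm (X - Z))"
      unfolding G_def by (rule mult_right_mono[OF rep]) simp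
    also have "\<dots> = K * (\<integral>Y. exp (- R * norm (X - Z)) * (exp (- R * norm (Z - Y)) * norm (F Y)) \<partial>lborel)"
      unfolding integral_mult_right_zero by (simp only: mult_ac)
    also have "(\<integral>Y. exp (- R * norm (X - Z)) * (exp (- R * norm (Z - Y)) * norm (F Y)) \<partial>lborel) \<le> (\<integral>Y. G Y \<partial>lborel)"
    proof (rule integral_mono_AE')
      show "AE Y in lborel. exp (- R * norm (X - Z)) * (exp (- R * norm (Z - Y)) * norm (F Y)) \<le> G Y"
      proof (rule AE_I2)
        fix Y
        have "R * norm (X - Y) \<le> R * (norm (X - Z) + norm (Z - Y))"
          using norm_triangle_ineq[of "X - Z" "Z - Y"] R by (intro mult_left_mono) auto
        then have "exp (- R * norm (X - Z)) * exp (- R * norm (Z - Y)) \<le> exp (- R * norm (X - Y))"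
          by (simp add: exp_add[symmetric] algebra_simps)
        from mult_right_mono[OF this norm_ge_zero[of "F Y"]]
        show "exp (- R * norm (X - Z)) * (exp (- R * norm (Z - Y)) * norm (F Y)) \<le> G Y" by (simp add: G_def mult_ac)
      qed
    qed (use Gi G0 in auto)
    also have "\<dots> \<le> (\<integral>Y. H powr (1 - r) * G Y powr r \<partial>lborel)" by (intro integral_mono Gi integrable_mult_right Gri GG)
    also have "\<dots> = H powr (1 - r) * I" by (simp add: I_def)
    finally show ?thesis using K by (simp add: mult_left_mono)
  qed
  then have HI: "H \<le> K * (H powr (1 - r) * I)" unfolding H_def[of ] by (intro cSUP_least) auto
  \<comment> \<open>Unless H is zero, \<open>H powr (1 - r)\<close> is a positive finite number and
    can be divided out.\<close>
  have "H powr r \<le> K * I"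
  proof (cases "H = 0")
    case True then show ?thesis using K I0 by simp
  next
    case False
    then have Hp: "0 < H" using H0 by simp
    have "H powr (1 - r) * H powr r \<le> H powr (1 - r) * (K * I)" using HI Hp by (simp add: powr_add[symmetric] mult_ac)
    then show ?thesis using Hp by simp
  qed
  moreover have "norm (F X) powr r \<le> H powr r" using GH[of X] r by (intro powr_mono2) (auto simp: G_def)
  ultimately show ?thesis unfolding I_def Gr by linarith
qed

text \<open>Covariance under time-frequency shifts: substituting y + x for y leaves a phase factor
  of modulus one, and only the difference of the two points matters.\<close>

lemma norm_amb_atom:
  fixes \<phi> :: "real^'n::finite \<Rightarrow> complex"
  assumes \<phi>: "\<phi> \<in> Sigma1"
  shows "norm (amb \<phi> (atom \<phi> Z) Y) = norm (amb \<phi> (atom \<phi> 0) (Y - Z))"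
proof -
  obtain x \<xi> where Z: "Z = (x, \<xi>)" by (cases Z)
  obtain x' \<xi>' where Y: "Y = (x', \<xi>')" by (cases Y)
  let ?g = "\<lambda>y. cnj (\<phi> y) * \<phi> (y - (x' - x)) * modul (\<xi> - \<xi>') y"
  have m: "modul \<xi> y * cnj (modul \<xi>' y) = modul (\<xi> - \<xi>') y" for y \<xi> \<xi>' :: "real^'n"
    by (simp add: modul_def exp_cnj exp_add[symmetric] inner_diff_right algebra_simps)
  have \<phi>c: "continuous_on UNIV \<phi>" using \<phi> by (intro smooth_fun_continuous) (simp add: Sigma1_def)
  have "amb \<phi> (atom \<phi> Z) Y = (\<integral>y. cnj (\<phi> (y - x)) * \<phi> (y - x') * (modul \<xi> y * cnj (modul \<xi>' y)) \<partial>lborel)"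
    by (simp add: amb_def atom_def Z Y mult_ac)
  also have "\<dots> = (\<integral>y. modul (\<xi> - \<xi>') x * ?g (y - x) \<partial>lborel)"
  proof (rule Bochner_Integration.integral_cong[OF refl])
    fix y
    have "modul (\<xi> - \<xi>') y = modul (\<xi> - \<xi>') x * modul (\<xi> - \<xi>') (y - x)" using modul_add[of "\<xi> - \<xi>'" x "y - x"] by simp
    then show "cnj (\<phi> (y - x)) * \<phi> (y - x') * (modul \<xi> y * cnj (modul \<xi>' y)) = modul (\<xi> - \<xi>') x * ?g (y - x)"
      unfolding m by simp
  qed
  also have "\<dots> = modul (\<xi> - \<xi>') x * (\<integral>y. ?g (y - x) \<partial>lborel)" by simp
  also have "(\<integral>y. ?g (y - x) \<partial>lborel) = integral\<^sup>L lborel ?g"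
  proof -
    have "?g \<in> borel_measurable borel"
      by (intro borel_measurable_continuous_onI continuous_intros continuous_on_compose2[OF \<phi>c]) auto
    from integral_lborel_translate[OF this, of "- x"] show ?thesis by simp
  qed
  also have "integral\<^sup>L lborel ?g = amb \<phi> (atom \<phi> 0) (Y - Z)"
  proof -
    have "modul (\<xi> - \<xi>') y = cnj (modul (\<xi>' - \<xi>) y)" for y by (simp add: modul_def exp_cnj inner_diff_right right_diff_distrib)
    then show ?thesis by (simp add: amb_def atom_def Z Y modul_def[of 0] mult_ac)
  qed
  finally show ?thesis by (simp add: norm_mult)
qed

lemma amb_atom_decay:
  fixes \<phi> :: "real^'n::finite \<Rightarrow> complex"
  assumes \<phi>: "\<phi> \<in> Sigma1" and R: "0 < R"
  obtains K where "0 \<le> K" "\<And>Z Y. norm (amb \<phi> (atom \<phi> Z) Y) \<le> K * exp (- R * norm (Z - Y))"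
proof -
  obtain K where K: "0 \<le> K" "\<And>Y. norm (amb \<phi> (atom \<phi> 0) Y) \<le> K * exp (- R * norm Y)"
    using amb_decay_Sigma1[OF \<phi> atom_in_Sigma1[OF \<phi>] R] by blast
  show ?thesis
  proof (rule that[OF K(1)])
    fix Z Y
    have "norm (amb \<phi> (atom \<phi> Z) Y) = norm (amb \<phi> (atom \<phi> 0) (Y - Z))" by (rule norm_amb_atom[OF \<phi>])
    also have "\<dots> \<le> K * exp (- R * norm (Y - Z))" by (rule K(2))
    finally show "norm (amb \<phi> (atom \<phi> Z) Y) \<le> K * exp (- R * norm (Z - Y))"
      unfolding norm_minus_commute[of Z] .
  qed
qed

lemma window_const_pos:
  fixes \<phi> :: "real^'n::finite \<Rightarrow> complex"
  assumes "\<phi> \<in> Sigma1" "\<phi> \<noteq> (\<lambda>x. 0)" shows "0 < window_const \<phi>"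
  unfolding window_const_def using integral_norm_square_pos[OF assms] gauss_int_pos[where 'n='n] by simp

lemma continuous_on_dual_atom:
  fixes \<phi> :: "real^'n::finite \<Rightarrow> complex"
  assumes \<phi>: "\<phi> \<in> Sigma1" and u: "u \<in> Sigma1_dual"
  shows "continuous_on UNIV (\<lambda>Y. u (atom \<phi> Y))"
proof -
  note at = atom_in_Sigma1[OF \<phi>]
  obtain R C where R: "0 < R" and b': "\<forall>f\<in>Sigma1. \<forall>c. sbound R c f \<longrightarrow> norm (u f) \<le> C * c"
    using Sigma1_dual_sbound[OF u] by blast
  note b = b'[rule_format]
  show ?thesis
  proof (rule continuous_on_atom_functional[OF \<phi> R])
    fix X Y c assume "sbound R c (\<lambda>y. atom \<phi> X y - atom \<phi> Y y)"
    from b[OF Sigma1_diff[OF at at] this]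
    show "norm (u (atom \<phi> X) - u (atom \<phi> Y)) \<le> C * c" unfolding Sigma1_dual_diff[OF u at at] .
  qed
qed

lemma dual_atom_growth:
  fixes \<phi> :: "real^'n::finite \<Rightarrow> complex"
  assumes \<phi>: "\<phi> \<in> Sigma1" and u: "u \<in> Sigma1_dual"
  obtains C G where "0 < G" "\<And>Y. norm (u (atom \<phi> Y)) \<le> C * exp (G * norm Y)"
proof -
  note at = atom_in_Sigma1[OF \<phi>]
  obtain R C where R: "0 < R" and b': "\<forall>f\<in>Sigma1. \<forall>c. sbound R c f \<longrightarrow> norm (u f) \<le> C * c"
    using Sigma1_dual_sbound[OF u] by blast
  note b = b'[rule_format]
  obtain Ca where Ca: "\<And>X. sbound R (Ca * exp ((R + 2 * CARD('n) * R) * norm X)) (atom \<phi> X)"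
    using sbound_atom[OF \<phi> R] by blast
  show ?thesis
  proof (rule that[of "R + 2 * CARD('n) * R" "C * Ca"])
    show "0 < R + 2 * CARD('n) * R" using R by (simp add: add_pos_nonneg)
    show "norm (u (atom \<phi> Y)) \<le> C * Ca * exp ((R + 2 * CARD('n) * R) * norm Y)" for Y
      using b[OF at Ca] by (simp only: mult.assoc)
  qed
qed

text \<open>This is the reproducing formula for the atom at Z. The growth rate G below R makes the
  integral converge; the constant K depends on R and on the window, but not on u.\<close>

lemma dual_atom_kernel_bound:
  fixes \<phi> :: "real^'n::finite \<Rightarrow> complex"
  assumes \<phi>: "\<phi> \<in> Sigma1" "\<phi> \<noteq> (\<lambda>x. 0)" and R: "0 < R"
  obtains K where "0 \<le> K" "\<forall>u\<in>Sigma1_dual. \<forall>C G Z. (\<forall>Y. norm (u (atom \<phi> Y)) \<le> C * exp (G * norm Y)) \<longrightarrow> G < R \<longrightarrow>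
     norm (u (atom \<phi> Z)) \<le> K * (\<integral>Y. exp (- R * norm (Z - Y)) * norm (u (atom \<phi> Y)) \<partial>lborel)"
proof -
  obtain K where K: "0 \<le> K" "\<And>Z Y. norm (amb \<phi> (atom \<phi> Z) Y) \<le> K * exp (- R * norm (Z - Y))"
    using amb_atom_decay[OF \<phi>(1) R] by blast
  note \<kappa> = window_const_pos[OF \<phi>]
  show ?thesis
  proof (rule that[of "K / window_const \<phi>"])
    show "0 \<le> K / window_const \<phi>" using K \<kappa> by simp
    show "\<forall>u\<in>Sigma1_dual. \<forall>C G Z. (\<forall>Y. norm (u (atom \<phi> Y)) \<le> C * exp (G * norm Y)) \<longrightarrow> G < R \<longrightarrow>
      norm (u (atom \<phi> Z)) \<le> K / window_const \<phi> * (\<integral>Y. exp (- R * norm (Z - Y)) * norm (u (atom \<phi> Y)) \<partial>lborel)"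
    proof (intro ballI allI impI)
    fix u C G Z assume u: "u \<in> Sigma1_dual" and g': "\<forall>Y. norm (u (atom \<phi> Y)) \<le> C * exp (G * norm Y)" and G: "G < R"
    have g: "norm (u (atom \<phi> Y)) \<le> C * exp (G * norm Y)" for Y using g' by blast
    let ?F = "\<lambda>Y. u (atom \<phi> Y)"
    have Fm [measurable]: "?F \<in> borel_measurable borel" by (rule borel_measurable_continuous_onI[OF continuous_on_dual_atom[OF \<phi>(1) u]])
    have C: "0 \<le> C" using order_trans[OF norm_ge_zero g[of 0]] by simp
    have int: "integrable lborel (\<lambda>Y. exp (- R * norm (Z - Y)) * norm (?F Y))"
    proof (rule integrable_exp_decay[of _ "C * exp (R * norm Z)" "R - G"])
      show "norm (exp (- R * norm (Z - Y)) * norm (?F Y)) \<le> C * exp (R * norm Z) * exp (- (R - G) * norm Y)" for Y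
      proof -
        have "exp (- R * norm (Z - Y)) * norm (?F Y) \<le> exp (- R * norm (Z - Y)) * (C * exp (G * norm Y))"
          by (rule mult_left_mono[OF g]) simp
        also have "\<dots> = C * (exp (- R * norm (Z - Y)) * exp (G * norm Y))" by simp
        also have "\<dots> \<le> C * (exp (R * norm Z) * exp (- (R - G) * norm Y))"
        proof (rule mult_left_mono[OF _ C])
          have "R * norm Y \<le> R * (norm Z + norm (Z - Y))"
            using norm_triangle_ineq4[of Z "Z - Y"] R by (intro mult_left_mono) auto
          then show "exp (- R * norm (Z - Y)) * exp (G * norm Y) \<le> exp (R * norm Z) * exp (- (R - G) * norm Y)"
            by (simp add: exp_add[symmetric] algebra_simps)
        qed
        finally show ?thesis by simp
      qed
    qed (use G in \<open>auto\<close>)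
    have "window_const \<phi> * norm (?F Z) = norm (\<integral>Y. amb \<phi> (atom \<phi> Z) Y * ?F Y \<partial>lborel)"
      using reproducing_formula_dual[OF \<phi>(1) atom_in_Sigma1[OF \<phi>(1)] u, of Z] \<kappa> by (simp add: norm_mult)
    also have "\<dots> \<le> (\<integral>Y. K * (exp (- R * norm (Z - Y)) * norm (?F Y)) \<partial>lborel)"
    proof (rule order_trans[OF integral_norm_bound], rule integral_mono')
      show "integrable lborel (\<lambda>Y. K * (exp (- R * norm (Z - Y)) * norm (?F Y)))" by (rule integrable_mult_right[OF int])
      show "norm (amb \<phi> (atom \<phi> Z) Y * ?F Y) \<le> K * (exp (- R * norm (Z - Y)) * norm (?F Y))" for Y
        using mult_right_mono[OF K(2)[of Z Y] norm_ge_zero[of "?F Y"]] by (simp add: norm_mult mult_ac)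
      show "0 \<le> K * (exp (- R * norm (Z - Y)) * norm (?F Y))" for Y using K by simp
    qed
    also have "\<dots> = K * (\<integral>Y. exp (- R * norm (Z - Y)) * norm (?F Y) \<partial>lborel)" by simp
    finally show "norm (?F Z) \<le> K / window_const \<phi> * (\<integral>Y. exp (- R * norm (Z - Y)) * norm (?F Y) \<partial>lborel)"
      using \<kappa> by (simp add: pos_le_divide_eq mult_ac)
    qed
  qed
qed

text \<open>In the application v is \<open>v0 powr r0\<close>, and its exponential bound comes from
  \<open>PE_exp_moderate\<close>.\<close>

locale modulation = invariant_BF B0 N0 v
  for B0 :: "((real^'n::finite) \<times> (real^'n) \<Rightarrow> complex) set" and N0 and v +
  fixes \<phi> :: "real^'n \<Rightarrow> complex" and r0 Dv Rv :: real
  assumes \<phi>: "\<phi> \<in> Sigma1" "\<phi> \<noteq> (\<lambda>x. 0)" and r0: "0 < r0" "r0 \<le> 1"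
    and v: "\<And>x. \<bar>v x\<bar> \<le> Dv * exp (Rv * norm x)" and Dv: "0 \<le> Dv" "0 \<le> Rv"
begin

text \<open>The r0-th power of the weighted transform, without the factor
  \<open>(2 * pi) powr (- d / 2)\<close> with d = \<open>CARD('n)\<close>. Its norm is, up to a
  constant, the r0-th power of the modulation norm.\<close>

definition pw :: "((real^'n) \<times> (real^'n) \<Rightarrow> real) \<Rightarrow> ((real^'n \<Rightarrow> complex) \<Rightarrow> complex) \<Rightarrow> (real^'n) \<times> (real^'n) \<Rightarrow> real" where
  "pw w u X = norm (u (atom \<phi> X)) powr r0 * w X powr r0"

lemma continuous_on_powr_atom:
  assumes "u \<in> Sigma1_dual" shows "continuous_on UNIV (\<lambda>X. norm (u (atom \<phi> X)) powr r0)"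
  using r0 by (intro continuous_on_powr' continuous_intros continuous_on_dual_atom \<phi>(1) assms) auto

text \<open>The bound is applied twice: first with a rate \<open>R\<close> depending on the functional, which yields a growth rate
  that does not, and then with a rate \<open>R\<close> that depends on this growth rate only.\<close>

lemma uniform_growth:
  assumes w: "PE w"
  obtains C R where "0 \<le> C" "0 < R" "\<forall>u\<in>Sigma1_dual. pw w u \<in> rspace \<longrightarrow>
     (\<forall>X. norm (u (atom \<phi> X)) powr r0 \<le> C * exp (R * norm X) * rnorm (pw w u))"
proof -
  obtain D Rw where D: "1 \<le> D" "0 < Rw" "\<And>x y. w (x + y) \<le> D * exp (Rw * norm y) * w x"
    using PE_exp_moderate[OF w] by blast
  let ?W = "\<lambda>X. w X powr r0"
  have W: "0 < ?W x" "?W (x + y) \<le> D powr r0 * exp (Rw * r0 * norm y) * ?W x" for x y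
  proof -
    show "0 < ?W x" using PE_pos[OF w, of x] by simp
    have "?W (x + y) \<le> (D * exp (Rw * norm y) * w x) powr r0"
      using D(3)[of x y] PE_pos[OF w, of "x + y"] r0 by (intro powr_mono2) auto
    also have "\<dots> = D powr r0 * exp (Rw * norm y) powr r0 * ?W x"
      using D PE_pos[OF w, of x] by (simp add: powr_mult less_imp_le)
    also have "exp (Rw * norm y) powr r0 = exp (Rw * r0 * norm y)" by (simp add: powr_def mult_ac)
    finally show "?W (x + y) \<le> D powr r0 * exp (Rw * r0 * norm y) * ?W x" .
  qed
  have Wm: "?W \<in> borel_measurable borel" using PE_measurable[OF w] by simp
  have Dp: "0 < D powr r0" "0 < Rw * r0" using D r0 by auto
  obtain A C where A: "0 < A" and C: "0 \<le> C" and AC: "\<forall>f S X. continuous_on UNIV f \<longrightarrow> (\<forall>x. 0 \<le> f x) \<longrightarrow> (\<lambda>x. f x * ?W x) \<in> rspace \<longrightarrow> A \<le> S \<longrightarrow>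
     integrable lborel (\<lambda>Y. exp (- S * norm (X - Y)) * f Y) \<longrightarrow>
     (\<integral>Y. exp (- S * norm (X - Y)) * f Y \<partial>lborel) \<le> C * exp ((Rw * r0 + Rv) * norm X) * rnorm (\<lambda>x. f x * ?W x)"
    using weighted_L1_bound[OF v Dv Wm W Dp] .
  define A' where "A' = Rw * r0 + Rv"
  have A': "0 < A'" using Dp Dv by (simp add: A'_def)
  \<comment> \<open>From any growth at the rate \<open>R / 2\<close> one obtains growth of the r0-th
    power at the rate A', which depends only on the weights. The constant K still depends on
    R.\<close>
  have pass: "\<exists>K\<ge>0. \<forall>u\<in>Sigma1_dual. pw w u \<in> rspace \<longrightarrow> (\<exists>Cu. \<forall>Y. norm (u (atom \<phi> Y)) \<le> Cu * exp (R / 2 * norm Y)) \<longrightarrow>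
      (\<forall>X. norm (u (atom \<phi> X)) powr r0 \<le> K * C * exp (A' * norm X) * rnorm (pw w u))"
    if R: "0 < R" "A \<le> R * r0" for R
  proof -
    obtain K where K: "0 \<le> K" "\<forall>u\<in>Sigma1_dual. \<forall>C G Z. (\<forall>Y. norm (u (atom \<phi> Y)) \<le> C * exp (G * norm Y)) \<longrightarrow> G < R \<longrightarrow>
      norm (u (atom \<phi> Z)) \<le> K * (\<integral>Y. exp (- R * norm (Z - Y)) * norm (u (atom \<phi> Y)) \<partial>lborel)"
      using dual_atom_kernel_bound[OF \<phi> R(1)] .
    show ?thesis
    proof (intro exI[of _ K] conjI K(1) ballI impI allI)
      fix u X assume u: "u \<in> Sigma1_dual" and uw: "pw w u \<in> rspace"
        and "\<exists>Cu. \<forall>Y. norm (u (atom \<phi> Y)) \<le> Cu * exp (R / 2 * norm Y)"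
      then obtain Cu where Cu: "\<forall>Y. norm (u (atom \<phi> Y)) \<le> Cu * exp (R / 2 * norm Y)" by blast
      let ?F = "\<lambda>Y. u (atom \<phi> Y)"
      let ?f = "\<lambda>Y. norm (?F Y) powr r0"
      have Cu0: "0 \<le> Cu" using order_trans[OF norm_ge_zero Cu[rule_format, of 0]] by simp
      have Fm: "?F \<in> borel_measurable borel" by (rule borel_measurable_continuous_onI[OF continuous_on_dual_atom[OF \<phi>(1) u]])
      have fc: "continuous_on UNIV ?f" by (rule continuous_on_powr_atom[OF u])
      have rep: "norm (?F Z) \<le> K * (\<integral>Y. exp (- R * norm (Z - Y)) * norm (?F Y) \<partial>lborel)" for Z
      proof (rule K(2)[rule_format, OF u, of Cu "R / 2"])
        show "norm (?F Y) \<le> Cu * exp (R / 2 * norm Y)" for Y by (rule Cu[rule_format])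
        show "R / 2 < R" using R by simp
      qed
      have "?f X \<le> K * (\<integral>Y. exp (- (R * r0) * norm (X - Y)) * ?f Y \<partial>lborel)"
        by (rule peetre_bound[OF r0 R(1) K(1) Fm Cu[rule_format] rep])
      also have "\<dots> \<le> K * (C * exp (A' * norm X) * rnorm (pw w u))"
      proof (rule mult_left_mono[OF _ K(1)])
        have int: "integrable lborel (\<lambda>Y. exp (- (R * r0) * norm (X - Y)) * ?f Y)"
        proof (rule integrable_exp_decay[of _ "Cu powr r0 * exp (R * r0 * norm X)" "R / 2 * r0"])
          show "(\<lambda>Y. exp (- (R * r0) * norm (X - Y)) * ?f Y) \<in> borel_measurable borel"
            by (intro borel_measurable_continuous_onI continuous_intros fc)
          show "norm (exp (- (R * r0) * norm (X - Y)) * ?f Y) \<le> Cu powr r0 * exp (R * r0 * norm X) * exp (- (R / 2 * r0) * norm Y)" for Y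
          proof -
            have "?f Y \<le> (Cu * exp (R / 2 * norm Y)) powr r0" by (rule powr_mono2[OF _ norm_ge_zero Cu[rule_format]]) (use r0 in simp)
            also have "\<dots> = Cu powr r0 * exp (R / 2 * norm Y) powr r0" by (rule powr_mult)
            also have "exp (R / 2 * norm Y) powr r0 = exp (R / 2 * r0 * norm Y)" by (simp add: powr_def)
            finally have "exp (- (R * r0) * norm (X - Y)) * ?f Y \<le> exp (- (R * r0) * norm (X - Y)) * (Cu powr r0 * exp (R / 2 * r0 * norm Y))"
              by (rule mult_left_mono) simp
            also have "\<dots> = Cu powr r0 * (exp (- (R * r0) * norm (X - Y)) * exp (R / 2 * r0 * norm Y))" by simp
            also have "\<dots> \<le> Cu powr r0 * (exp (R * r0 * norm X) * exp (- (R / 2 * r0) * norm Y))"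
            proof (rule mult_left_mono)
              have "R * r0 * norm Y \<le> R * r0 * (norm X + norm (X - Y))"
                using norm_triangle_ineq4[of X "X - Y"] R r0 by (intro mult_left_mono) auto
              then show "exp (- (R * r0) * norm (X - Y)) * exp (R / 2 * r0 * norm Y) \<le> exp (R * r0 * norm X) * exp (- (R / 2 * r0) * norm Y)"
                by (simp add: exp_add[symmetric] algebra_simps)
            qed simp
            finally show ?thesis by (simp add: mult.assoc)
          qed
        qed (use R r0 in auto)
        have "(\<lambda>x. ?f x * ?W x) = pw w u" by (simp add: pw_def fun_eq_iff)
        then show "(\<integral>Y. exp (- (R * r0) * norm (X - Y)) * ?f Y \<partial>lborel) \<le> C * exp (A' * norm X) * rnorm (pw w u)"
          using AC[rule_format, OF fc _ _ R(2) int] uw unfolding A'_def by simp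
      qed
      finally show "?f X \<le> K * C * exp (A' * norm X) * rnorm (pw w u)" by (simp add: mult.assoc)
    qed
  qed
  \<comment> \<open>After the first pass and an r0-th root, every functional grows at most at the
    rate \<open>A' / r0\<close>. R2 is twice this rate, enlarged if necessary so that the weighted
    L1 bound applies; it is the same for all functionals.\<close>
  define R2 where "R2 = max (2 * A' / r0) (A / r0)"
  have R2': "2 * A' / r0 \<le> R2" "A / r0 \<le> R2" unfolding R2_def by (rule max.cobounded1, rule max.cobounded2)
  have "0 < A / r0" using A r0 by simp
  then have R2: "0 < R2" "A \<le> R2 * r0" "A' / r0 \<le> R2 / 2"
    using R2' r0 by (linarith, simp add: pos_divide_le_eq, simp add: mult.commute)
  obtain K2 where K2: "0 \<le> K2" "\<forall>u\<in>Sigma1_dual. pw w u \<in> rspace \<longrightarrow> (\<exists>Cu. \<forall>Y. norm (u (atom \<phi> Y)) \<le> Cu * exp (R2 / 2 * norm Y)) \<longrightarrow>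
      (\<forall>X. norm (u (atom \<phi> X)) powr r0 \<le> K2 * C * exp (A' * norm X) * rnorm (pw w u))"
    using pass[OF R2(1,2)] by blast
  show ?thesis
  proof (rule that[of "K2 * C" A'])
    show "0 \<le> K2 * C" using K2 C by simp
    show "0 < A'" by (rule A')
    show "\<forall>u\<in>Sigma1_dual. pw w u \<in> rspace \<longrightarrow>
     (\<forall>X. norm (u (atom \<phi> X)) powr r0 \<le> K2 * C * exp (A' * norm X) * rnorm (pw w u))"
    proof (intro ballI impI)
      fix u assume u: "u \<in> Sigma1_dual" and uw: "pw w u \<in> rspace"
      have n0: "0 \<le> rnorm (pw w u)" by (rule rnorm_nonneg[OF uw])
      obtain Cg G where G: "0 < G" "\<And>Y. norm (u (atom \<phi> Y)) \<le> Cg * exp (G * norm Y)"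
        using dual_atom_growth[OF \<phi>(1) u] by blast
      have Cg: "0 \<le> Cg" using order_trans[OF norm_ge_zero G(2)[of 0]] by simp
      \<comment> \<open>The first pass, with a rate adapted to the growth G of this particular
        functional.\<close>
      define R where "R = max (2 * G) (A / r0)"
      have R: "0 < R" "G \<le> R / 2" using G by (auto simp: R_def)
      have "A / r0 \<le> R" unfolding R_def by (rule max.cobounded2)
      then have R': "A \<le> R * r0" using r0 by (simp add: pos_divide_le_eq)
      have "norm (u (atom \<phi> Y)) \<le> Cg * exp (R / 2 * norm Y)" for Y
      proof -
        have "Cg * exp (G * norm Y) \<le> Cg * exp (R / 2 * norm Y)"
          using Cg mult_right_mono[OF R(2) norm_ge_zero[of Y]] by (intro mult_left_mono) auto
        then show ?thesis using G(2)[of Y] by linarith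
      qed
      then obtain K where K: "0 \<le> K" "\<And>X. norm (u (atom \<phi> X)) powr r0 \<le> K * C * exp (A' * norm X) * rnorm (pw w u)"
        using pass[OF R(1) R'] u uw by blast
      define Q where "Q = K * C * rnorm (pw w u)"
      have Q: "0 \<le> Q" using K C n0 by (simp add: Q_def)
      have "norm (u (atom \<phi> Y)) \<le> Q powr (1 / r0) * exp (R2 / 2 * norm Y)" for Y
      proof -
        have "norm (u (atom \<phi> Y)) = (norm (u (atom \<phi> Y)) powr r0) powr (1 / r0)"
          using r0 by (simp add: powr_powr)
        also have "\<dots> \<le> (Q * exp (A' * norm Y)) powr (1 / r0)"
          using K(2)[of Y] r0 by (intro powr_mono2) (auto simp: Q_def mult_ac)
        also have "\<dots> = Q powr (1 / r0) * exp (A' * norm Y) powr (1 / r0)" by (rule powr_mult)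
        also have "exp (A' * norm Y) powr (1 / r0) = exp (A' / r0 * norm Y)" by (simp add: powr_def)
        also have "Q powr (1 / r0) * exp (A' / r0 * norm Y) \<le> Q powr (1 / r0) * exp (R2 / 2 * norm Y)"
          using mult_right_mono[OF R2(3) norm_ge_zero[of Y]] by (intro mult_left_mono) auto
        finally show ?thesis .
      qed
      then show "\<forall>X. norm (u (atom \<phi> X)) powr r0 \<le> K2 * C * exp (A' * norm X) * rnorm (pw w u)"
        using K2(2) u uw by blast
    qed
  qed
qed

text \<open>Integration against any function of growth rate R is a functional bounded by one fixed
  norm of \<open>Sigma1\<close>. In the compactness proof this covers all members of the sequence at
  once and also the limit.\<close>

lemma amb_integral_bound:
  fixes R :: real
  assumes R: "0 < R"
  obtains M where "0 \<le> M" "\<forall>G L \<psi> c. G \<in> borel_measurable borel \<longrightarrow> (\<forall>Y. norm (G Y) \<le> L * exp (R * norm Y)) \<longrightarrow> \<psi> \<in> Sigma1 \<longrightarrow>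
     sbound (4 * CARD('n) * (R + 1)) c \<psi> \<longrightarrow>
     integrable lborel (\<lambda>Y. amb \<phi> \<psi> Y * G Y) \<and> norm (\<integral>Y. amb \<phi> \<psi> Y * G Y \<partial>lborel) \<le> M * L * c"
proof -
  obtain K where K: "0 \<le> K" "\<And>\<psi> C Y. sbound (4 * CARD('n) * (R + 1)) C \<psi> \<Longrightarrow> norm (amb \<phi> \<psi> Y) \<le> K * C * exp (- (R + 1) * norm Y)"
    using amb_decay[OF \<phi>(1), of "R + 1"] R by auto
  define I where "I = (\<integral>x. exp (- 1 * norm (x::(real^'n) \<times> (real^'n))) \<partial>lborel)"
  have I: "0 \<le> I" unfolding I_def by (rule integral_nonneg_AE) simp
  show ?thesis
  proof (rule that[of "K * I"])
    show "0 \<le> K * I" using K I by simp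
    show "\<forall>G L \<psi> c. G \<in> borel_measurable borel \<longrightarrow> (\<forall>Y. norm (G Y) \<le> L * exp (R * norm Y)) \<longrightarrow> \<psi> \<in> Sigma1 \<longrightarrow>
     sbound (4 * CARD('n) * (R + 1)) c \<psi> \<longrightarrow>
     integrable lborel (\<lambda>Y. amb \<phi> \<psi> Y * G Y) \<and> norm (\<integral>Y. amb \<phi> \<psi> Y * G Y \<partial>lborel) \<le> K * I * L * c"
    proof (intro allI impI)
      fix G :: "(real^'n) \<times> (real^'n) \<Rightarrow> complex" and L c :: real and \<psi> :: "real^'n \<Rightarrow> complex"
      assume Gm [measurable]: "G \<in> borel_measurable borel" and G: "\<forall>Y. norm (G Y) \<le> L * exp (R * norm Y)" and \<psi>: "\<psi> \<in> Sigma1"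
        and s: "sbound (4 * CARD('n) * (R + 1)) c \<psi>"
      have am [measurable]: "amb \<phi> \<psi> \<in> borel_measurable borel" by (rule borel_measurable_continuous_onI[OF continuous_on_amb[OF \<phi>(1) \<psi>]])
      have c: "0 \<le> c" by (rule sbound_nonneg[OF s])
      have b: "norm (amb \<phi> \<psi> Y * G Y) \<le> (K * c * L) * exp (- 1 * norm Y)" for Y
      proof -
        have "norm (amb \<phi> \<psi> Y * G Y) \<le> (K * c * exp (- (R + 1) * norm Y)) * (L * exp (R * norm Y))"
          unfolding norm_mult using K(2)[OF s, of Y] G[rule_format, of Y] K(1) c
          by (intro mult_mono) simp_all
        also have "\<dots> = (K * c * L) * (exp (- (R + 1) * norm Y) * exp (R * norm Y))" by simp
        also have "exp (- (R + 1) * norm Y) * exp (R * norm Y) = exp (- 1 * norm Y)"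
          by (simp add: exp_add[symmetric] algebra_simps)
        finally show ?thesis .
      qed
      have i: "integrable lborel (\<lambda>Y. amb \<phi> \<psi> Y * G Y)"
        by (rule integrable_exp_decay[OF _ b]) auto
      have "norm (\<integral>Y. amb \<phi> \<psi> Y * G Y \<partial>lborel) \<le> (\<integral>Y. norm (amb \<phi> \<psi> Y * G Y) \<partial>lborel)" by (rule integral_norm_bound)
      also have "\<dots> \<le> (\<integral>Y. (K * c * L) * exp (- 1 * norm Y) \<partial>(lborel :: ((real^'n) \<times> (real^'n)) measure))"
        by (intro integral_mono integrable_norm i integrable_mult_right integrable_exp_norm b) simp
      also have "\<dots> = K * I * L * c" by (simp add: I_def mult_ac)
      finally show "integrable lborel (\<lambda>Y. amb \<phi> \<psi> Y * G Y) \<and> norm (\<integral>Y. amb \<phi> \<psi> Y * G Y \<partial>lborel) \<le> K * I * L * c"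
        using i by blast
    qed
  qed
qed

end

subsection \<open>Compactness\<close>

text \<open>A number t in [0, 1] satisfies t \<le> t^r for r \<le> 1; this is applied to the
  fractions a / (a + b) and b / (a + b), which add up to 1.\<close>

lemma powr_add_le:
  fixes a b r :: real
  assumes "0 \<le> a" "0 \<le> b" and r: "0 < r" "r \<le> 1"
  shows "(a + b) powr r \<le> a powr r + b powr r"
proof (cases "a + b = 0")
  case False
  then have s: "0 < a + b" using assms by linarith
  have le: "x / (a + b) \<le> (x / (a + b)) powr r" if "0 \<le> x" "x \<le> a + b" for x
  proof (cases "x = 0")
    case False
    then have "(x / (a + b)) powr 1 \<le> (x / (a + b)) powr r"
      using that s r by (intro powr_mono') (auto simp: divide_le_eq)
    then show ?thesis using that s by simp
  qed simp
  have "1 = a / (a + b) + b / (a + b)" using s by (simp add: add_divide_distrib[symmetric])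
  also have "\<dots> \<le> (a / (a + b)) powr r + (b / (a + b)) powr r"
    using le[of a] le[of b] assms by (intro add_mono) auto
  also have "\<dots> = (a powr r + b powr r) / (a + b) powr r"
    using assms s by (simp add: powr_divide add_divide_distrib)
  finally show ?thesis using s by (simp add: pos_le_divide_eq)
qed (use assms in auto)

lemma powr_norm_triangle:
  fixes x y :: complex
  assumes r: "0 < r" "r \<le> 1"
  shows "norm (x + y) powr r \<le> norm x powr r + norm y powr r"
proof -
  have "norm (x + y) powr r \<le> (norm x + norm y) powr r"
    using r by (intro powr_mono2 norm_triangle_ineq) auto
  also have "\<dots> \<le> norm x powr r + norm y powr r" by (rule powr_add_le) (use r in auto)
  finally show ?thesis .
qed

section \<open>Differences and multiples of functionals\<close>

lemma Sigma1_dual_diff_fun: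
  fixes u u' :: "(real^'n::finite \<Rightarrow> complex) \<Rightarrow> complex"
  assumes u: "u \<in> Sigma1_dual" and u': "u' \<in> Sigma1_dual"
  shows "(\<lambda>x. u x - u' x) \<in> Sigma1_dual"
proof -
  obtain R C where R: "0 < R" "0 < C" and b: "\<forall>f\<in>Sigma1. \<forall>c. sbound R c f \<longrightarrow> norm (u f) \<le> C * c"
    using Sigma1_dual_sbound[OF u] by blast
  obtain R' C' where R': "0 < R'" "0 < C'" and b': "\<forall>f\<in>Sigma1. \<forall>c. sbound R' c f \<longrightarrow> norm (u' f) \<le> C' * c"
    using Sigma1_dual_sbound[OF u'] by blast
  show ?thesis
  proof (rule Sigma1_dualI[where R = "max R R'" and C = "C + C'"])
    fix f :: "real^'n \<Rightarrow> complex" and c assume f: "f \<in> Sigma1" and s: "sbound (max R R') c f"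
    have 1: "sbound R c f" "sbound R' c f" using s R R' by (auto intro: sbound_mono)
    have "norm (u f - u' f) \<le> norm (u f) + norm (u' f)" by (rule norm_triangle_ineq4)
    also have "\<dots> \<le> C * c + C' * c" using b b' f 1 by (intro add_mono) auto
    finally show "norm (u f - u' f) \<le> (C + C') * c" by (simp add: distrib_right)
  next
    fix f g :: "real^'n \<Rightarrow> complex" assume "f \<in> Sigma1" "g \<in> Sigma1"
    then show "u (\<lambda>x. f x + g x) - u' (\<lambda>x. f x + g x) = u f - u' f + (u g - u' g)"
      by (simp add: Sigma1_dual_add[OF u] Sigma1_dual_add[OF u'])
  next
    fix c and f :: "real^'n \<Rightarrow> complex" assume "f \<in> Sigma1"
    then show "u (\<lambda>x. c * f x) - u' (\<lambda>x. c * f x) = c * (u f - u' f)"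
      by (simp add: Sigma1_dual_cmult[OF u] Sigma1_dual_cmult[OF u'] right_diff_distrib)
  qed (use R R' in auto)
qed

lemma Sigma1_dual_cmult_fun:
  fixes u :: "(real^'n::finite \<Rightarrow> complex) \<Rightarrow> complex"
  assumes u: "u \<in> Sigma1_dual"
  shows "(\<lambda>x. s * u x) \<in> Sigma1_dual"
proof -
  obtain R C where R: "0 < R" "0 < C" and b: "\<forall>f\<in>Sigma1. \<forall>c. sbound R c f \<longrightarrow> norm (u f) \<le> C * c"
    using Sigma1_dual_sbound[OF u] by blast
  show ?thesis
  proof (rule Sigma1_dualI[where R = R and C = "norm s * C"])
    fix f :: "real^'n \<Rightarrow> complex" and c assume f: "f \<in> Sigma1" and s: "sbound R c f"
    have "norm s * norm (u f) \<le> norm s * (C * c)" using b f s by (intro mult_left_mono) auto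
    then show "norm (s * u f) \<le> norm s * C * c" by (simp add: norm_mult mult.assoc)
  next
    fix f g :: "real^'n \<Rightarrow> complex" assume "f \<in> Sigma1" "g \<in> Sigma1"
    then show "s * u (\<lambda>x. f x + g x) = s * u f + s * u g"
      by (simp add: Sigma1_dual_add[OF u] distrib_left)
  next
    fix c and f :: "real^'n \<Rightarrow> complex" assume "f \<in> Sigma1"
    then show "s * u (\<lambda>x. c * f x) = c * (s * u f)" by (simp add: Sigma1_dual_cmult[OF u])
  qed (use R in auto)
qed

lemma integrable_amb_integrand:
  fixes \<phi> f :: "real^'n::finite \<Rightarrow> complex"
  assumes \<phi>: "\<phi> \<in> Sigma1" and f: "f \<in> Sigma1"
  shows "integrable lborel (\<lambda>y. f y * cnj (atom \<phi> X y))"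
proof -
  obtain C where C: "\<And>y. norm (f y) \<le> C" using Sigma1_bounded[OF f] by blast
  obtain c where "sbound 1 c (atom \<phi> X)" using Sigma1_sbound[OF atom_in_Sigma1[OF \<phi>] zero_less_one] by blast
  from integrable_mult_sbound(1)[OF Sigma1_measurable[OF f] C sbound_cnj[OF this] zero_less_one] show ?thesis .
qed

lemma amb_add:
  assumes "\<phi> \<in> Sigma1" "f \<in> Sigma1" "g \<in> Sigma1"
  shows "amb \<phi> (\<lambda>x. f x + g x) X = amb \<phi> f X + amb \<phi> g X"
  unfolding amb_def distrib_right
  by (rule Bochner_Integration.integral_add[OF integrable_amb_integrand[OF assms(1,2)] integrable_amb_integrand[OF assms(1,3)]])

lemma amb_cmult: "amb \<phi> (\<lambda>x. c * f x) X = c * amb \<phi> f X"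
  unfolding amb_def mult.assoc by (rule integral_mult_right_zero)

lemma amb_functional_in_dual:
  fixes \<phi> :: "real^'n::finite \<Rightarrow> complex"
  assumes \<phi>: "\<phi> \<in> Sigma1"
  shows "(\<lambda>\<psi>. amb \<phi> \<psi> X) \<in> Sigma1_dual"
proof -
  obtain K where K: "0 \<le> K" "\<And>\<psi> C Y. sbound (4 * CARD('n) * 1) C \<psi> \<Longrightarrow> norm (amb \<phi> \<psi> Y) \<le> K * C * exp (- 1 * norm Y)"
    by (rule amb_decay[OF \<phi> zero_less_one]) auto
  show ?thesis
  proof (rule Sigma1_dualI[where R = "4 * CARD('n) * 1" and C = K])
    fix f :: "real^'n \<Rightarrow> complex" and c assume s: "sbound (4 * CARD('n) * 1) c f"
    have "K * c * exp (- 1 * norm X) \<le> K * c * 1" using K sbound_nonneg[OF s] by (intro mult_left_mono) auto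
    then show "norm (amb \<phi> f X) \<le> K * c" using K(2)[OF s, of X] by simp
  next
    fix f g :: "real^'n \<Rightarrow> complex" assume "f \<in> Sigma1" "g \<in> Sigma1"
    then show "amb \<phi> (\<lambda>x. f x + g x) X = amb \<phi> f X + amb \<phi> g X" by (rule amb_add[OF \<phi>])
  next
    fix c and f :: "real^'n \<Rightarrow> complex"
    show "amb \<phi> (\<lambda>x. c * f x) X = c * amb \<phi> f X" by (rule amb_cmult)
  qed (use K in auto)
qed

context modulation
begin

section \<open>Weighted powers of transforms under solidity and change of weight\<close>

lemma pw_nonneg: "0 \<le> pw w u X" by (simp add: pw_def)

lemma pw_measurable:
  assumes "PE w" "u \<in> Sigma1_dual" shows "pw w u \<in> borel_measurable borel"
proof -
  have 1: "(\<lambda>X. norm (u (atom \<phi> X)) powr r0) \<in> borel_measurable borel"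
    by (rule borel_measurable_continuous_onI[OF continuous_on_powr_atom[OF assms(2)]])
  have 2: "(\<lambda>X. w X powr r0) \<in> borel_measurable borel" using PE_measurable[OF assms(1)] by simp
  show ?thesis unfolding pw_def[abs_def] by (rule borel_measurable_times[OF 1 2])
qed

lemma pw_solid:
  assumes w: "PE w" and u: "u \<in> Sigma1_dual" and g: "g \<in> rspace" and d: "\<And>X. pw w u X \<le> g X"
  shows "pw w u \<in> rspace" "rnorm (pw w u) \<le> solid_const * rnorm g"
  using rspace_solid_all[OF pw_measurable[OF w u] g] d pw_nonneg by auto

lemma pw_diff_le: "pw w (\<lambda>x. u x - u' x) X \<le> pw w u X + pw w u' X"
proof -
  have "norm (u (atom \<phi> X) - u' (atom \<phi> X)) powr r0 \<le> norm (u (atom \<phi> X)) powr r0 + norm (u' (atom \<phi> X)) powr r0"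
    using powr_norm_triangle[OF r0, of "u (atom \<phi> X)" "- u' (atom \<phi> X)"] by simp
  from mult_right_mono[OF this, of "w X powr r0"] show ?thesis by (simp add: pw_def distrib_right)
qed

lemma pw_diff:
  assumes w: "PE w" and u: "u \<in> Sigma1_dual" "pw w u \<in> rspace" and u': "u' \<in> Sigma1_dual" "pw w u' \<in> rspace"
  shows "pw w (\<lambda>x. u x - u' x) \<in> rspace" "rnorm (pw w (\<lambda>x. u x - u' x)) \<le> solid_const * (rnorm (pw w u) + rnorm (pw w u'))"
proof -
  note s = pw_solid[OF w Sigma1_dual_diff_fun[OF u(1) u'(1)] rspace_add[OF u(2) u'(2)] pw_diff_le]
  show "pw w (\<lambda>x. u x - u' x) \<in> rspace" by (rule s(1))
  have "solid_const * rnorm (\<lambda>X. pw w u X + pw w u' X) \<le> solid_const * (rnorm (pw w u) + rnorm (pw w u'))"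
    using rnorm_add[OF u(2) u'(2)] solid_const by (intro mult_left_mono) auto
  then show "rnorm (pw w (\<lambda>x. u x - u' x)) \<le> solid_const * (rnorm (pw w u) + rnorm (pw w u'))" using s(2) by linarith
qed

lemma pw_cmult: "pw w (\<lambda>x. s * u x) = (\<lambda>X. norm s powr r0 * pw w u X)"
  by (simp add: fun_eq_iff pw_def norm_mult powr_mult)

lemma pw_weight_mono:
  assumes w: "PE w1" "PE w2" and c: "0 \<le> c" "\<And>X. w2 X \<le> c * w1 X"
    and u: "u \<in> Sigma1_dual" "pw w1 u \<in> rspace"
  shows "pw w2 u \<in> rspace" "rnorm (pw w2 u) \<le> solid_const * c powr r0 * rnorm (pw w1 u)"
proof -
  have d: "pw w2 u X \<le> c powr r0 * pw w1 u X" for X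
  proof -
    have "w2 X powr r0 \<le> (c * w1 X) powr r0" using c(2)[of X] PE_pos[OF w(2), of X] r0 by (intro powr_mono2) auto
    also have "\<dots> = c powr r0 * w1 X powr r0" by (rule powr_mult)
    finally have "norm (u (atom \<phi> X)) powr r0 * w2 X powr r0 \<le> norm (u (atom \<phi> X)) powr r0 * (c powr r0 * w1 X powr r0)"
      by (rule mult_left_mono) simp
    then show ?thesis by (simp add: pw_def mult_ac)
  qed
  note s = pw_solid[OF w(2) u(1) rspace_cmult[OF u(2), of "c powr r0"] d]
  show "pw w2 u \<in> rspace" by (rule s(1))
  show "rnorm (pw w2 u) \<le> solid_const * c powr r0 * rnorm (pw w1 u)"
    using s(2) rnorm_cmult[OF u(2), of "c powr r0"] by simp
qed

lemma weight_bounded_on_cball: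
  fixes w :: "(real^'n) \<times> (real^'n) \<Rightarrow> real" and R :: real
  assumes w: "PE w" obtains B where "0 < B" "\<And>X. norm X \<le> R \<Longrightarrow> w X \<le> B"
proof -
  obtain D Rw where D: "1 \<le> D" "0 < Rw" "\<And>x y. w (x + y) \<le> D * exp (Rw * norm y) * w x"
    using PE_exp_moderate[OF w] by blast
  show ?thesis
  proof (rule that[of "D * exp (Rw * R) * w 0"])
    show "0 < D * exp (Rw * R) * w 0" using D PE_pos[OF w, of 0] by simp
    fix X :: "(real^'n) \<times> (real^'n)" assume X: "norm X \<le> R"
    have "w X \<le> D * exp (Rw * norm X) * w 0" using D(3)[of 0 X] by simp
    also have "\<dots> \<le> D * exp (Rw * R) * w 0"
      using X D PE_pos[OF w, of 0] by (intro mult_right_mono mult_left_mono) auto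
    finally show "w X \<le> D * exp (Rw * R) * w 0" .
  qed
qed

text \<open>Far out the ratio is below 1. On the remaining ball moderateness bounds w2 from above
  and w1 from below by positive constants.\<close>

lemma vanishing_ratio_imp_dominated:
  fixes w1 w2 :: "(real^'n) \<times> (real^'n) \<Rightarrow> real"
  assumes w: "PE w1" "PE w2" and lim: "((\<lambda>X. w2 X / w1 X) \<longlongrightarrow> 0) at_infinity"
  shows "\<exists>c\<ge>0. \<forall>X. w2 X \<le> c * w1 X"
proof -
  have "\<forall>\<^sub>F X in at_infinity. w2 X / w1 X < 1" using order_tendstoD(2)[OF lim zero_less_one] .
  then obtain R where R: "\<And>X. R \<le> norm X \<Longrightarrow> w2 X / w1 X < 1" by (auto simp: eventually_at_infinity)
  obtain D Rw where D: "1 \<le> D" "0 < Rw" "\<And>x y. w1 (x + y) \<le> D * exp (Rw * norm y) * w1 x"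
    using PE_exp_moderate[OF w(1)] by blast
  obtain B where B: "0 < B" "\<And>X. norm X \<le> R \<Longrightarrow> w2 X \<le> B" using weight_bounded_on_cball[OF w(2)] by blast
  define m where "m = w1 0 / (D * exp (Rw * R))"
  have m: "0 < m" using D PE_pos[OF w(1), of 0] by (simp add: m_def)
  have wm: "m \<le> w1 X" if "norm X \<le> R" for X
  proof -
    have "w1 0 \<le> D * exp (Rw * norm X) * w1 X" using D(3)[of X "- X"] by simp
    also have "\<dots> \<le> D * exp (Rw * R) * w1 X"
      using that D PE_pos[OF w(1), of X] by (intro mult_right_mono mult_left_mono) auto
    finally show ?thesis using D by (simp add: m_def pos_divide_le_eq mult_ac)
  qed
  show ?thesis
  proof (intro exI[of _ "1 + B / m"] conjI allI)
    show "0 \<le> 1 + B / m" using B m by simp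
    fix X
    show "w2 X \<le> (1 + B / m) * w1 X"
    proof (cases "norm X \<le> R")
      case True
      have "w2 X \<le> B / m * m" using B(2)[OF True] m by simp
      also have "\<dots> \<le> B / m * w1 X" using wm[OF True] B m by (intro mult_left_mono) auto
      also have "\<dots> \<le> (1 + B / m) * w1 X" using PE_pos[OF w(1), of X] by (simp add: distrib_right)
      finally show ?thesis .
    next
      case False
      then have "w2 X < w1 X" using R[of X] PE_pos[OF w(1), of X] by (simp add: divide_less_eq)
      moreover have "0 \<le> B / m * w1 X" using B m PE_pos[OF w(1), of X] by simp
      ultimately show ?thesis by (simp add: distrib_right)
    qed
  qed
qed

text \<open>Outside a large ball the weight ratio is small, inside it uniform convergence of the short-time Fourier transforms is
  all that is needed.\<close>

lemma pw_split_bound: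
  assumes w: "PE w1" "PE w2" and lim: "((\<lambda>X. w2 X / w1 X) \<longlongrightarrow> 0) at_infinity" and e: "0 < e" and K: "0 \<le> K"
  obtains \<rho> \<delta> where "0 < \<delta>" "\<forall>u\<in>Sigma1_dual. pw w1 u \<in> rspace \<longrightarrow> rnorm (pw w1 u) \<le> K \<longrightarrow>
     (\<forall>X\<in>cball 0 \<rho>. norm (u (atom \<phi> X)) \<le> \<delta>) \<longrightarrow> rnorm (pw w2 u) < e"
proof -
  \<comment> \<open>After multiplication by the solidity constant, the part outside the ball
    contributes at most e / 4; the same holds for q and the part inside. The added 1 keeps the
    denominator positive.\<close>
  define \<eta> where "\<eta> = e / (4 * solid_const * (K + 1))"
  have sc: "0 < solid_const" using solid_const by linarith
  have \<eta>: "0 < \<eta>" using e sc K by (simp add: \<eta>_def)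
  define \<eta>' where "\<eta>' = \<eta> powr (1 / r0)"
  have \<eta>': "0 < \<eta>'" "\<eta>' powr r0 = \<eta>" using \<eta> r0 by (auto simp: \<eta>'_def powr_powr)
  have "\<forall>\<^sub>F X in at_infinity. w2 X / w1 X < \<eta>'" using order_tendstoD(2)[OF lim \<eta>'(1)] .
  then obtain \<rho> where \<rho>: "\<And>X. \<rho> \<le> norm X \<Longrightarrow> w2 X / w1 X < \<eta>'" by (auto simp: eventually_at_infinity)
  obtain B where B: "0 < B" "\<And>X. norm X \<le> \<rho> \<Longrightarrow> w2 X \<le> B" using weight_bounded_on_cball[OF w(2)] by blast
  let ?\<chi> = "indicator (cball 0 \<rho>) :: (real^'n) \<times> (real^'n) \<Rightarrow> real"
  have \<chi>: "?\<chi> \<in> rspace" by (rule indicator_bounded_in_rspace) auto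
  define q where "q = e / (4 * solid_const * (rnorm ?\<chi> + 1))"
  have q: "0 < q" using e sc rnorm_nonneg[OF \<chi>] by (simp add: q_def)
  \<comment> \<open>On the ball w2 is at most B, so a transform bounded by \<delta> gives a weighted
    power of at most q.\<close>
  define \<delta> where "\<delta> = q powr (1 / r0) / B"
  have \<delta>: "0 < \<delta>" "(\<delta> * B) powr r0 = q" using q B r0 by (auto simp: \<delta>_def powr_powr)
  show ?thesis
  proof (rule that[of \<delta> \<rho>])
    show "0 < \<delta>" by (rule \<delta>)
    show "\<forall>u\<in>Sigma1_dual. pw w1 u \<in> rspace \<longrightarrow> rnorm (pw w1 u) \<le> K \<longrightarrow>
     (\<forall>X\<in>cball 0 \<rho>. norm (u (atom \<phi> X)) \<le> \<delta>) \<longrightarrow> rnorm (pw w2 u) < e"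
    proof (intro ballI impI)
      fix u assume u: "u \<in> Sigma1_dual" "pw w1 u \<in> rspace" "rnorm (pw w1 u) \<le> K"
        and small: "\<forall>X\<in>cball 0 \<rho>. norm (u (atom \<phi> X)) \<le> \<delta>"
      have d: "pw w2 u X \<le> q * ?\<chi> X + \<eta> * pw w1 u X" for X
      proof (cases "norm X \<le> \<rho>")
        case True
        have "pw w2 u X = (norm (u (atom \<phi> X)) * w2 X) powr r0" by (simp add: pw_def powr_mult)
        also have "\<dots> \<le> (\<delta> * B) powr r0"
          using small True B(2)[OF True] PE_pos[OF w(2), of X] \<delta>(1) r0 by (intro powr_mono2 mult_mono) auto
        finally have "pw w2 u X \<le> q" using \<delta> by simp
        moreover have "0 \<le> \<eta> * pw w1 u X" using \<eta> pw_nonneg[of w1 u X] by simp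
        ultimately show ?thesis using True by simp
      next
        case False
        then have "w2 X \<le> \<eta>' * w1 X" using \<rho>[of X] PE_pos[OF w(1), of X] by (simp add: divide_less_eq)
        then have "w2 X powr r0 \<le> (\<eta>' * w1 X) powr r0" using PE_pos[OF w(2), of X] r0 by (intro powr_mono2) auto
        also have "\<dots> = \<eta> * w1 X powr r0" by (simp add: powr_mult \<eta>')
        finally have "norm (u (atom \<phi> X)) powr r0 * w2 X powr r0 \<le> norm (u (atom \<phi> X)) powr r0 * (\<eta> * w1 X powr r0)"
          by (rule mult_left_mono) simp
        then show ?thesis using False q by (simp add: pw_def mult_ac)
      qed
      have g: "(\<lambda>X. q * ?\<chi> X + \<eta> * pw w1 u X) \<in> rspace" by (rule rspace_add[OF rspace_cmult[OF \<chi>] rspace_cmult[OF u(2)]])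
      have "rnorm (pw w2 u) \<le> solid_const * rnorm (\<lambda>X. q * ?\<chi> X + \<eta> * pw w1 u X)" by (rule pw_solid(2)[OF w(2) u(1) g d])
      also have "\<dots> \<le> solid_const * (q * rnorm ?\<chi> + \<eta> * rnorm (pw w1 u))"
        using rnorm_add[OF rspace_cmult[OF \<chi>, of q] rspace_cmult[OF u(2), of \<eta>]] rnorm_cmult[OF \<chi>, of q] rnorm_cmult[OF u(2), of \<eta>] q \<eta> sc
        by (intro mult_left_mono) auto
      also have "\<dots> \<le> solid_const * (q * (rnorm ?\<chi> + 1) + \<eta> * (K + 1))"
        using u(3) q \<eta> sc by (intro mult_left_mono add_mono) auto
      also have "\<dots> = solid_const * (q * (rnorm ?\<chi> + 1)) + solid_const * (\<eta> * (K + 1))" by (simp add: distrib_left)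
      also have "solid_const * (q * (rnorm ?\<chi> + 1)) = e / 4" using sc rnorm_nonneg[OF \<chi>] by (simp add: q_def add_nonneg_eq_0_iff)
      also have "solid_const * (\<eta> * (K + 1)) = e / 4" using sc K by (simp add: \<eta>_def add_nonneg_eq_0_iff)
      finally show "rnorm (pw w2 u) < e" using e by simp
    qed
  qed
qed

text \<open>The limit is not claimed to lie in the first space, since the norm may lack the Fatou
  property. So \<open>pw_split_bound\<close> is applied to differences of members of the sequence,
  which shows that the subsequence is Cauchy in the second norm; the limit is then reached through a
  rapidly converging subsequence and a telescoping series, to which
  \<open>rspace_countable_sum\<close> applies.\<close>

lemma compact_subsequence:
  assumes w: "PE w1" "PE w2" and lim: "((\<lambda>X. w2 X / w1 X) \<longlongrightarrow> 0) at_infinity"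
    and F: "\<And>n. F n \<in> Sigma1_dual" "\<And>n. pw w1 (F n) \<in> rspace" "\<And>n. rnorm (pw w1 (F n)) \<le> K"
  obtains h g where "strict_mono (h :: nat \<Rightarrow> nat)" "g \<in> Sigma1_dual" "pw w2 g \<in> rspace"
    "(\<lambda>n. rnorm (pw w2 (\<lambda>x. F (h n) x - g x))) \<longlonglongrightarrow> 0"
proof -
  have K: "0 \<le> K" using order_trans[OF rnorm_nonneg[OF F(2)[of 0]] F(3)] .
  define \<kappa> where "\<kappa> = window_const \<phi>"
  have \<kappa>: "0 < \<kappa>" unfolding \<kappa>_def by (rule window_const_pos[OF \<phi>])
  obtain C R where C: "0 \<le> C" "0 < R" "\<forall>u\<in>Sigma1_dual. pw w1 u \<in> rspace \<longrightarrow>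
     (\<forall>X. norm (u (atom \<phi> X)) powr r0 \<le> C * exp (R * norm X) * rnorm (pw w1 u))"
    using uniform_growth[OF w(1)] by blast
  define R1 where "R1 = R / r0"
  have R1: "0 < R1" using C r0 by (simp add: R1_def)
  define L where "L = (C * K) powr (1 / r0)"
  define f where "f n X = F n (atom \<phi> X)" for n X
  have fb: "norm (f n X) \<le> L * exp (R1 * norm X)" for n X
  proof -
    have "norm (f n X) powr r0 \<le> C * exp (R * norm X) * rnorm (pw w1 (F n))"
      using C(3) F(1,2) unfolding f_def by blast
    also have "\<dots> \<le> C * exp (R * norm X) * K" using F(3)[of n] C by (intro mult_left_mono) auto
    finally have 1: "norm (f n X) powr r0 \<le> (C * K) * exp (R * norm X)" by (simp add: mult_ac)
    have "norm (f n X) = (norm (f n X) powr r0) powr (1 / r0)" using r0 by (simp add: powr_powr)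
    also have "\<dots> \<le> ((C * K) * exp (R * norm X)) powr (1 / r0)" by (rule powr_mono2[OF _ _ 1]) (use r0 in auto)
    also have "\<dots> = L * exp (R * norm X) powr (1 / r0)" unfolding L_def by (rule powr_mult)
    also have "exp (R * norm X) powr (1 / r0) = exp (R1 * norm X)" by (simp add: powr_def R1_def)
    finally show ?thesis .
  qed
  have L: "0 \<le> L" by (simp add: L_def)
  define S where "S = 4 * CARD('n) * (R1 + 1)"
  have S: "0 < S" using R1 by (simp add: S_def)
  obtain M where M: "0 \<le> M" "\<forall>G L \<psi> c. G \<in> borel_measurable borel \<longrightarrow> (\<forall>Y. norm (G Y) \<le> L * exp (R1 * norm Y)) \<longrightarrow> \<psi> \<in> Sigma1 \<longrightarrow>
     sbound S c \<psi> \<longrightarrow>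
     integrable lborel (\<lambda>Y. amb \<phi> \<psi> Y * G Y) \<and> norm (\<integral>Y. amb \<phi> \<psi> Y * G Y \<partial>lborel) \<le> M * L * c"
    using amb_integral_bound[OF R1] unfolding S_def .
  note at = atom_in_Sigma1[OF \<phi>(1)]
  have fcont: "continuous_on UNIV (f n)" for n unfolding f_def by (rule continuous_on_dual_atom[OF \<phi>(1) F(1)])
  have fm: "f n \<in> borel_measurable borel" for n by (rule borel_measurable_continuous_onI[OF fcont])
  \<comment> \<open>One norm of \<open>Sigma1\<close> with one constant controls every
    \<open>F n\<close>; together with the Lipschitz estimate for atoms this makes the transforms
    locally equicontinuous.\<close>
  have Fb: "norm (F n \<psi>) \<le> M * L / \<kappa> * c" if \<psi>: "\<psi> \<in> Sigma1" and s: "sbound S c \<psi>" for n \<psi> c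
  proof -
    have "norm (\<integral>Y. amb \<phi> \<psi> Y * f n Y \<partial>lborel) \<le> M * L * c"
      using M(2)[rule_format, OF fm fb \<psi> s] by simp
    then have "\<kappa> * norm (F n \<psi>) \<le> M * L * c"
      using reproducing_formula_dual[OF \<phi>(1) \<psi> F(1)[of n]] \<kappa> by (simp add: f_def norm_mult \<kappa>_def)
    then show ?thesis using \<kappa> by (simp add: pos_le_divide_eq mult_ac)
  qed
  define E where "E = M * L / \<kappa>"
  have E: "0 \<le> E" using M L \<kappa> by (simp add: E_def)
  have equi: "\<exists>d>0. \<forall>n y. norm (x - y) < d \<longrightarrow> norm (f n x - f n y) < e" if e: "0 < e" for x e
  proof -
    have "\<exists>Lp\<ge>0. \<forall>X Y. norm X \<le> norm x + 1 \<longrightarrow> norm Y \<le> norm x + 1 \<longrightarrow> norm (X - Y) \<le> 1 \<longrightarrow>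
     sbound S (Lp * norm (X - Y)) (\<lambda>y. atom \<phi> X y - atom \<phi> Y y)"
    proof (rule sbound_atom_lipschitz[OF \<phi>(1) S, of "norm x + 1"])
      fix C assume "0 \<le> C" and *: "\<And>X Y. norm X \<le> norm x + 1 \<Longrightarrow> norm Y \<le> norm x + 1 \<Longrightarrow> norm (X - Y) \<le> 1 \<Longrightarrow>
        sbound S (C * norm (X - Y)) (\<lambda>y. atom \<phi> X y - atom \<phi> Y y)"
      then show ?thesis by (intro exI[of _ C] conjI allI impI *)
    qed
    then obtain Lp where Lp0: "0 \<le> Lp" and Lpo: "\<forall>X Y. norm X \<le> norm x + 1 \<longrightarrow> norm Y \<le> norm x + 1 \<longrightarrow> norm (X - Y) \<le> 1 \<longrightarrow>
     sbound S (Lp * norm (X - Y)) (\<lambda>y. atom \<phi> X y - atom \<phi> Y y)" by blast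
    note Lp = Lp0 Lpo[rule_format]
    define d where "d = min 1 (e / (E * Lp + 1))"
    have EL: "0 \<le> E * Lp" using E Lp by simp
    have d: "0 < d" "d \<le> 1" "d \<le> e / (E * Lp + 1)" using e EL by (auto simp: d_def)
    show ?thesis
    proof (intro exI[of _ d] conjI allI impI d(1))
      fix n y assume xy: "norm (x - y) < d"
      have "norm y \<le> norm x + 1" using norm_triangle_sub[of y x] xy d by (simp add: norm_minus_commute)
      then have s: "sbound S (Lp * norm (x - y)) (\<lambda>z. atom \<phi> x z - atom \<phi> y z)" using xy d by (intro Lp(2)) auto
      have "norm (f n x - f n y) \<le> E * (Lp * norm (x - y))"
        using Fb[OF Sigma1_diff[OF at at] s, of n] unfolding f_def E_def Sigma1_dual_diff[OF F(1) at at] .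
      also have "\<dots> = (E * Lp) * norm (x - y)" by simp
      also have "\<dots> \<le> (E * Lp) * d" using xy EL by (intro mult_left_mono) auto
      also have "\<dots> \<le> (E * Lp) * (e / (E * Lp + 1))" using d EL by (intro mult_left_mono) auto
      also have "\<dots> < e" using EL e by (simp add: divide_less_eq)
      finally show "norm (f n x - f n y) < e" .
    qed
  qed
  \<comment> \<open>Uniform convergence on the ball of radius i along r: a property inherited by
    subsequences and insensitive to initial segments, as diagonalisation requires.\<close>
  define P where "P i r \<longleftrightarrow> (\<exists>g. \<forall>e>0. \<exists>N. \<forall>n\<ge>N. \<forall>x\<in>cball 0 (real i). norm (f (r n) x - g x) < e)"
    for i and r :: "nat \<Rightarrow> nat"
  obtain h where h: "strict_mono (h :: nat \<Rightarrow> nat)" "\<And>i. P i (id \<circ> h)"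
  proof (rule subsequence_diagonalization_lemma[of P id])
    fix i and r :: "nat \<Rightarrow> nat"
    have b: "norm (f (r n) x) \<le> L * exp (R1 * real i)" if "x \<in> cball 0 (real i)" for n x
    proof -
      have "L * exp (R1 * norm x) \<le> L * exp (R1 * real i)" using that L R1 by (intro mult_left_mono) auto
      then show ?thesis using fb[of "r n" x] by linarith
    qed
    have q: "\<exists>d. 0 < d \<and> (\<forall>n y. y \<in> cball 0 (real i) \<and> norm (x - y) < d \<longrightarrow> norm (f (r n) x - f (r n) y) < e)" if "0 < e" for x e
      using equi[OF that, of x] by blast
    have "\<exists>g k. strict_mono (k :: nat \<Rightarrow> nat) \<and> (\<forall>e>0. \<exists>N. \<forall>n x. N \<le> n \<and> x \<in> cball 0 (real i) \<longrightarrow> norm (f (r (k n)) x - g x) < e)"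
    proof (rule Arzela_Ascoli[where \<F> = "\<lambda>n. f (r n)" and S = "cball 0 (real i)" and M = "L * exp (R1 * real i)"])
      fix g and k :: "nat \<Rightarrow> nat"
      assume k: "strict_mono k" and *: "\<And>e. 0 < e \<Longrightarrow> \<exists>N. \<forall>n x. N \<le> n \<and> x \<in> cball 0 (real i) \<longrightarrow> norm (f (r (k n)) x - g x) < e"
      show ?thesis by (intro exI[of _ g] exI[of _ k] conjI k allI impI *)
    next
      show "norm (f (r n) x) \<le> L * exp (R1 * real i)" if "x \<in> cball 0 (real i)" for n x by (rule b[OF that])
    next
      fix x and e :: real assume "0 < e"
      then show "\<exists>d>0. \<forall>n y. y \<in> cball 0 (real i) \<and> norm (x - y) < d \<longrightarrow> norm (f (r n) x - f (r n) y) < e" by (rule q)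
    qed simp
    then obtain g and k :: "nat \<Rightarrow> nat" where k1: "strict_mono k" and k2: "\<forall>e>0. \<exists>N. \<forall>n x. N \<le> n \<and> x \<in> cball 0 (real i) \<longrightarrow> norm (f (r (k n)) x - g x) < e"
      by (elim exE conjE)
    note k = k1 k2[rule_format]
    have "P i (r \<circ> k)" unfolding P_def
    proof (intro exI[of _ g] allI impI)
      fix e :: real assume "0 < e"
      then obtain N where "\<forall>n x. N \<le> n \<and> x \<in> cball 0 (real i) \<longrightarrow> norm (f (r (k n)) x - g x) < e" using k2 by blast
      then show "\<exists>N. \<forall>n\<ge>N. \<forall>x\<in>cball 0 (real i). norm (f ((r \<circ> k) n) x - g x) < e" unfolding comp_def by blast
    qed
    then show "\<exists>k. strict_mono (k :: nat \<Rightarrow> nat) \<and> P i (r \<circ> k)" using k(1) by blast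
  next
    fix i and r k1 k2 :: "nat \<Rightarrow> nat" and N
    assume P1: "P i (r \<circ> k1)" and k12: "\<And>j. N \<le> j \<Longrightarrow> \<exists>j'. j \<le> j' \<and> k2 j = k1 j'"
    then obtain g where g: "\<forall>e>0. \<exists>N. \<forall>n\<ge>N. \<forall>x\<in>cball 0 (real i). norm (f (r (k1 n)) x - g x) < e"
      unfolding P_def by auto
    show "P i (r \<circ> k2)" unfolding P_def
    proof (intro exI[of _ g] allI impI)
      fix e :: real assume "0 < e"
      then obtain N1 where N1: "\<forall>n\<ge>N1. \<forall>x\<in>cball 0 (real i). norm (f (r (k1 n)) x - g x) < e" using g by blast
      have "\<forall>x\<in>cball 0 (real i). norm (f ((r \<circ> k2) n) x - g x) < e" if n: "max N N1 \<le> n" for n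
      proof -
        obtain j' where j': "n \<le> j'" "k2 n = k1 j'" using k12[of n] n by auto
        then have "N1 \<le> j'" using n by simp
        then show ?thesis using N1 unfolding comp_def j'(2) by blast
      qed
      then show "\<exists>N. \<forall>n\<ge>N. \<forall>x\<in>cball 0 (real i). norm (f ((r \<circ> k2) n) x - g x) < e" by blast
    qed
  next
    fix k :: "nat \<Rightarrow> nat" assume "strict_mono k" "\<And>i. P i (id \<circ> k)"
    then show thesis by (rule that)
  qed
  have unif: "\<exists>g. \<forall>e>0. \<exists>N. \<forall>n\<ge>N. \<forall>x\<in>cball 0 (real i). norm (f (h n) x - g x) < e" for i
    using h(2)[of i] unfolding P_def by simp
  define G where "G X = lim (\<lambda>n. f (h n) X)" for X
  have conv: "(\<lambda>n. f (h n) X) \<longlonglongrightarrow> G X" for X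
  proof -
    obtain i where i: "norm X \<le> real i" using real_arch_simple by blast
    obtain g where g: "\<forall>e>0. \<exists>N. \<forall>n\<ge>N. \<forall>x\<in>cball 0 (real i). norm (f (h n) x - g x) < e" using unif by blast
    have "(\<lambda>n. f (h n) X) \<longlonglongrightarrow> g X"
    proof (rule LIMSEQ_I)
      fix e :: real assume "0 < e"
      then obtain N where "\<forall>n\<ge>N. \<forall>x\<in>cball 0 (real i). norm (f (h n) x - g x) < e" using g by blast
      then show "\<exists>N. \<forall>n\<ge>N. norm (f (h n) X - g X) < e" using i by (intro exI[of _ N]) auto
    qed
    then show ?thesis unfolding G_def by (simp add: limI)
  qed
  have Gb: "norm (G Y) \<le> L * exp (R1 * norm Y)" for Y
    by (rule LIMSEQ_le_const2[OF tendsto_norm[OF conv]]) (use fb in blast)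
  have Gm: "G \<in> borel_measurable borel" by (rule borel_measurable_LIMSEQ_metric[OF fm conv])
  \<comment> \<open>The functional is recovered from the limit G of the transforms by the
    reproducing integral.\<close>
  define g where "g \<psi> = (\<integral>Y. amb \<phi> \<psi> Y * G Y \<partial>lborel) / complex_of_real \<kappa>" for \<psi>
  have Gint: "integrable lborel (\<lambda>Y. amb \<phi> \<psi> Y * G Y)" if \<psi>: "\<psi> \<in> Sigma1" for \<psi>
  proof -
    obtain c where "sbound S c \<psi>" using Sigma1_sbound[OF \<psi> S] by blast
    then show ?thesis using M(2)[rule_format, OF Gm Gb \<psi>] by blast
  qed
  have gd: "g \<in> Sigma1_dual"
  proof (rule Sigma1_dualI[where R = S and C = E])
    fix \<psi> :: "real^'n \<Rightarrow> complex" and c assume "\<psi> \<in> Sigma1" "sbound S c \<psi>"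
    then have "norm (\<integral>Y. amb \<phi> \<psi> Y * G Y \<partial>lborel) \<le> M * L * c" using M(2)[rule_format, OF Gm Gb] by blast
    then have "norm (\<integral>Y. amb \<phi> \<psi> Y * G Y \<partial>lborel) / \<kappa> \<le> M * L * c / \<kappa>" using \<kappa> by (intro divide_right_mono) auto
    then show "norm (g \<psi>) \<le> E * c" using \<kappa> by (simp add: g_def E_def norm_divide)
  next
    fix \<psi> \<psi>' :: "real^'n \<Rightarrow> complex" assume a: "\<psi> \<in> Sigma1" "\<psi>' \<in> Sigma1"
    then show "g (\<lambda>x. \<psi> x + \<psi>' x) = g \<psi> + g \<psi>'"
      using Gint by (simp add: g_def amb_add[OF \<phi>(1) a] distrib_right add_divide_distrib)
  next
    fix c and \<psi> :: "real^'n \<Rightarrow> complex"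
    show "g (\<lambda>x. c * \<psi> x) = c * g \<psi>" by (simp add: g_def amb_cmult mult.assoc)
  qed (use S E in auto)
  \<comment> \<open>That G is indeed the transform of g follows by passing to the limit in the
    reproducing formula for \<open>F (h n)\<close>; the common exponential growth supplies the
    majorant.\<close>
  have gat: "g (atom \<phi> X) = G X" for X
  proof -
    obtain Ka where Ka: "0 \<le> Ka" "\<And>Y. norm (amb \<phi> (atom \<phi> X) Y) \<le> Ka * exp (- (R1 + 1) * norm Y)"
      using amb_decay_Sigma1[OF \<phi>(1) at, of "R1 + 1" X] R1 by auto
    have am: "amb \<phi> (atom \<phi> X) \<in> borel_measurable borel" by (rule borel_measurable_continuous_onI[OF continuous_on_amb[OF \<phi>(1) at]])
    have "(\<lambda>n. \<integral>Y. amb \<phi> (atom \<phi> X) Y * f (h n) Y \<partial>lborel) \<longlonglongrightarrow> (\<integral>Y. amb \<phi> (atom \<phi> X) Y * G Y \<partial>lborel)"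
    proof (rule integral_dominated_convergence[where w = "\<lambda>Y. Ka * L * exp (- 1 * norm Y)"])
      show "(\<lambda>Y. amb \<phi> (atom \<phi> X) Y * G Y) \<in> borel_measurable lborel" using am Gm by simp
      show "(\<lambda>Y. amb \<phi> (atom \<phi> X) Y * f (h n) Y) \<in> borel_measurable lborel" for n using am fm by simp
      show "integrable lborel (\<lambda>Y::(real^'n) \<times> (real^'n). Ka * L * exp (- 1 * norm Y))"
        by (intro integrable_mult_right integrable_exp_norm) simp
      show "AE Y in lborel. (\<lambda>n. amb \<phi> (atom \<phi> X) Y * f (h n) Y) \<longlonglongrightarrow> amb \<phi> (atom \<phi> X) Y * G Y"
        by (rule AE_I2) (intro tendsto_intros conv)
      show "AE Y in lborel. norm (amb \<phi> (atom \<phi> X) Y * f (h n) Y) \<le> Ka * L * exp (- 1 * norm Y)" for n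
      proof (rule AE_I2)
        fix Y
        have "norm (amb \<phi> (atom \<phi> X) Y * f (h n) Y) \<le> (Ka * exp (- (R1 + 1) * norm Y)) * (L * exp (R1 * norm Y))"
          unfolding norm_mult using Ka(2)[of Y] fb[of "h n" Y] Ka(1) by (intro mult_mono) simp_all
        also have "\<dots> = (Ka * L) * (exp (- (R1 + 1) * norm Y) * exp (R1 * norm Y))" by simp
        also have "exp (- (R1 + 1) * norm Y) * exp (R1 * norm Y) = exp (- 1 * norm Y)" by (simp add: exp_add[symmetric] algebra_simps)
        finally show "norm (amb \<phi> (atom \<phi> X) Y * f (h n) Y) \<le> Ka * L * exp (- 1 * norm Y)" .
      qed
    qed
    moreover have "(\<integral>Y. amb \<phi> (atom \<phi> X) Y * f (h n) Y \<partial>lborel) = complex_of_real \<kappa> * f (h n) X" for n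
      unfolding f_def \<kappa>_def by (rule reproducing_formula_dual[OF \<phi>(1) at F(1)])
    moreover have "(\<lambda>n. complex_of_real \<kappa> * f (h n) X) \<longlonglongrightarrow> complex_of_real \<kappa> * G X" by (intro tendsto_intros conv)
    ultimately have "(\<integral>Y. amb \<phi> (atom \<phi> X) Y * G Y \<partial>lborel) = complex_of_real \<kappa> * G X" using LIMSEQ_unique by simp
    then show ?thesis using \<kappa> by (simp add: g_def)
  qed
  \<comment> \<open>The bound that \<open>pw_diff\<close> gives for differences of two members of
    the sequence in the first norm.\<close>
  define K' where "K' = solid_const * (K + K)"
  have K': "0 \<le> K'" using solid_const K by (simp add: K'_def)
  have cauchy: "\<exists>N. \<forall>m\<ge>N. \<forall>n\<ge>N. rnorm (pw w2 (\<lambda>x. F (h m) x - F (h n) x)) < e" if e: "0 < e" for e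
  proof -
    obtain \<rho> \<delta> where \<delta>: "0 < \<delta>" and sp: "\<forall>u\<in>Sigma1_dual. pw w1 u \<in> rspace \<longrightarrow> rnorm (pw w1 u) \<le> K' \<longrightarrow>
     (\<forall>X\<in>cball 0 \<rho>. norm (u (atom \<phi> X)) \<le> \<delta>) \<longrightarrow> rnorm (pw w2 u) < e"
      using pw_split_bound[OF w lim e K'] .
    obtain i where i: "\<rho> \<le> real i" using real_arch_simple by blast
    obtain g' where g': "\<forall>e>0. \<exists>N. \<forall>n\<ge>N. \<forall>x\<in>cball 0 (real i). norm (f (h n) x - g' x) < e" using unif by blast
    obtain N where N: "\<forall>n\<ge>N. \<forall>x\<in>cball 0 (real i). norm (f (h n) x - g' x) < \<delta> / 2" using g' \<delta> by (meson half_gt_zero)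
    show ?thesis
    proof (intro exI[of _ N] allI impI)
      fix m n assume mn: "N \<le> m" "N \<le> n"
      note d = pw_diff[OF w(1) F(1)[of "h m"] F(2)[of "h m"] F(1)[of "h n"] F(2)[of "h n"]]
      have "solid_const * (rnorm (pw w1 (F (h m))) + rnorm (pw w1 (F (h n)))) \<le> K'"
        unfolding K'_def using F(3) solid_const by (intro mult_left_mono add_mono) auto
      then have k: "rnorm (pw w1 (\<lambda>x. F (h m) x - F (h n) x)) \<le> K'" using d(2) by linarith
      have sm: "norm (F (h m) (atom \<phi> X) - F (h n) (atom \<phi> X)) \<le> \<delta>" if X: "X \<in> cball 0 \<rho>" for X
      proof -
        have X': "X \<in> cball 0 (real i)" using X i by simp
        have "norm (f (h m) X - g' X) < \<delta> / 2" "norm (f (h n) X - g' X) < \<delta> / 2" using N mn X' by blast+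
        then show ?thesis using norm_triangle_ineq4[of "f (h m) X - g' X" "f (h n) X - g' X"] by (simp add: f_def)
      qed
      show "rnorm (pw w2 (\<lambda>x. F (h m) x - F (h n) x)) < e"
        using sp[rule_format, OF Sigma1_dual_diff_fun[OF F(1) F(1)] d(1) k] sm by blast
    qed
  qed
  have "\<forall>k. \<exists>N. \<forall>m\<ge>N. \<forall>n\<ge>N. rnorm (pw w2 (\<lambda>x. F (h m) x - F (h n) x)) < (1/2) ^ k"
    using cauchy by simp
  then obtain Nk where Nk: "\<And>k m n. Nk k \<le> m \<Longrightarrow> Nk k \<le> n \<Longrightarrow> rnorm (pw w2 (\<lambda>x. F (h m) x - F (h n) x)) < (1/2) ^ k"
    by metis
  \<comment> \<open>The sum of all thresholds up to k lies beyond each of them; the additional k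
    makes the sequence strictly increasing.\<close>
  define h2 where "h2 k = (\<Sum>i\<le>k. Nk i) + k" for k
  have h2: "strict_mono h2" unfolding strict_mono_Suc_iff by (simp add: h2_def)
  have h2N: "Nk k \<le> h2 m" if "k \<le> m" for k m
  proof -
    have "Nk k \<le> (\<Sum>i\<le>m. Nk i)" by (rule member_le_sum) (use that in auto)
    then show ?thesis by (simp add: h2_def)
  qed
  define U where "U k = F (h (h2 k))" for k
  have U: "U k \<in> Sigma1_dual" "pw w1 (U k) \<in> rspace" for k by (auto simp: U_def F)
  obtain c where c: "0 \<le> c" "\<And>X. w2 X \<le> c * w1 X" using vanishing_ratio_imp_dominated[OF w lim] by blast
  have U2: "pw w2 (U k) \<in> rspace" for k by (rule pw_weight_mono(1)[OF w c U])
  define D where "D k = pw w2 (\<lambda>x. U k x - U (Suc k) x)" for k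
  have DS: "D k \<in> rspace" for k unfolding D_def by (rule pw_diff(1)[OF w(2) U(1) U2 U(1) U2])
  have Dn: "rnorm (D k) \<le> (1/2) ^ k" for k
    unfolding D_def U_def using Nk[OF h2N[of k k] h2N[of k "Suc k"]] by simp
  have Ucv: "(\<lambda>k. U k (atom \<phi> X)) \<longlonglongrightarrow> G X" for X
    using LIMSEQ_subseq_LIMSEQ[OF conv h2, of X] by (simp add: U_def f_def comp_def)
  have tail: "pw w2 (\<lambda>x. U k x - g x) \<in> rspace \<and> rnorm (pw w2 (\<lambda>x. U k x - g x)) \<le> solid_const * (2 * (1/2) ^ k)" for k
  proof -
    have sd: "(\<lambda>x. U k x - g x) \<in> Sigma1_dual" by (rule Sigma1_dual_diff_fun[OF U(1) gd])
    have geo: "(\<lambda>j. (1/2::real) ^ (k + j)) sums (2 * (1/2) ^ k)"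
      using sums_mult[OF geometric_sums[of "1/2::real"], of "(1/2) ^ k"] by (simp add: power_add mult_ac)
    have sm: "summable (\<lambda>j. rnorm (D (k + j)))"
      by (rule summable_comparison_test'[OF sums_summable[OF geo], of 0]) (use Dn rnorm_nonneg[OF DS] in simp)
    have le: "(\<Sum>j. rnorm (D (k + j))) \<le> 2 * (1/2) ^ k"
      using suminf_le[OF Dn sm sums_summable[OF geo]] sums_unique[OF geo] by simp
    \<comment> \<open>By subadditivity of the r0-th power the difference of \<open>U k\<close> and
      \<open>U (k + m)\<close> is bounded by a partial sum of the D; letting m tend to infinity
      replaces \<open>U (k + m)\<close> by the limit.\<close>
    have dom: "\<forall>M. (\<forall>m. (\<Sum>j<m. D (k + j) X) \<le> M) \<longrightarrow> \<bar>pw w2 (\<lambda>x. U k x - g x) X\<bar> \<le> M" for X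
    proof (intro allI impI)
      fix M assume M: "\<forall>m. (\<Sum>j<m. D (k + j) X) \<le> M"
      have tel: "norm (U k (atom \<phi> X) - U (k + m) (atom \<phi> X)) powr r0 * w2 X powr r0 \<le> (\<Sum>j<m. D (k + j) X)" for m
      proof (induction m)
        case (Suc m)
        have "norm (U k (atom \<phi> X) - U (k + Suc m) (atom \<phi> X)) powr r0 \<le>
          norm (U k (atom \<phi> X) - U (k + m) (atom \<phi> X)) powr r0 + norm (U (k + m) (atom \<phi> X) - U (Suc (k + m)) (atom \<phi> X)) powr r0"
          using powr_norm_triangle[OF r0, of "U k (atom \<phi> X) - U (k + m) (atom \<phi> X)" "U (k + m) (atom \<phi> X) - U (Suc (k + m)) (atom \<phi> X)"] by simp
        from mult_right_mono[OF this, of "w2 X powr r0"] Suc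
        show ?case by (simp add: D_def pw_def distrib_right)
      qed simp
      have "(\<lambda>m. norm (U k (atom \<phi> X) - U (k + m) (atom \<phi> X)) powr r0 * w2 X powr r0) \<longlonglongrightarrow> norm (U k (atom \<phi> X) - G X) powr r0 * w2 X powr r0"
      proof (intro tendsto_mult tendsto_const tendsto_powr' tendsto_norm tendsto_diff)
        show "(\<lambda>m. U (k + m) (atom \<phi> X)) \<longlonglongrightarrow> G X"
          using LIMSEQ_ignore_initial_segment[OF Ucv[of X], of k] by (simp add: add.commute)
      qed (use r0 in auto)
      moreover have "norm (U k (atom \<phi> X) - U (k + m) (atom \<phi> X)) powr r0 * w2 X powr r0 \<le> M" for m
        using tel[of m] M by (meson order_trans)
      ultimately have "norm (U k (atom \<phi> X) - G X) powr r0 * w2 X powr r0 \<le> M"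
        using LIMSEQ_le_const2 by blast
      then show "\<bar>pw w2 (\<lambda>x. U k x - g x) X\<bar> \<le> M" by (simp add: pw_def gat)
    qed
    have d0: "0 \<le> D j X" for j X by (simp add: D_def pw_nonneg)
    note cs = rspace_countable_sum[OF DS d0 sm pw_measurable[OF w(2) sd] AE_I2[OF dom]]
    have "solid_const * (\<Sum>j. rnorm (D (k + j))) \<le> solid_const * (2 * (1/2) ^ k)"
      using le solid_const by (intro mult_left_mono) auto
    then show ?thesis using cs by (auto intro: order_trans)
  qed
  \<comment> \<open>Membership of g is obtained by writing it as U 0 - (U 0 - g).\<close>
  have "pw w2 (\<lambda>x. U 0 x - (U 0 x - g x)) \<in> rspace"
    by (rule pw_diff(1)[OF w(2) U(1) U2 Sigma1_dual_diff_fun[OF U(1) gd] conjunct1[OF tail]])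
  then have g2: "pw w2 g \<in> rspace" by simp
  have "(\<lambda>k. rnorm (pw w2 (\<lambda>x. U k x - g x))) \<longlonglongrightarrow> 0"
  proof (rule tendsto_sandwich[OF _ _ tendsto_const])
    show "\<forall>\<^sub>F k in sequentially. 0 \<le> rnorm (pw w2 (\<lambda>x. U k x - g x))"
      using rnorm_nonneg tail by (intro always_eventually) blast
    show "\<forall>\<^sub>F k in sequentially. rnorm (pw w2 (\<lambda>x. U k x - g x)) \<le> solid_const * (2 * (1/2) ^ k)"
      using tail by (intro always_eventually) blast
    have "(\<lambda>k. solid_const * (2 * (1/2::real) ^ k)) \<longlonglongrightarrow> solid_const * (2 * 0)"
      by (intro tendsto_intros LIMSEQ_power_zero) simp
    then show "(\<lambda>k. solid_const * (2 * (1/2::real) ^ k)) \<longlonglongrightarrow> 0" by simp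
  qed
  then show ?thesis using that[of "h \<circ> h2" g] strict_mono_o[OF h(1) h2] gd g2 by (simp add: U_def comp_def)
qed

subsection \<open>Test functionals and the necessity of the conditions\<close>

definition test_functional :: "(real^'n) \<times> (real^'n) \<Rightarrow> (real^'n \<Rightarrow> complex) \<Rightarrow> complex" where
  "test_functional X = (\<lambda>\<psi>. amb \<phi> \<psi> X)"

lemma test_functional_in_dual: "test_functional X \<in> Sigma1_dual"
  unfolding test_functional_def by (rule amb_functional_in_dual[OF \<phi>(1)])

lemma test_functional_atom_decay:
  assumes "0 < S"
  obtains K where "0 \<le> K" "\<forall>X Y. norm (test_functional X (atom \<phi> Y)) \<le> K * exp (- S * norm (X - Y))"
proof (rule amb_atom_decay[OF \<phi>(1) assms])
  fix K assume K: "0 \<le> K" "\<And>Z Y. norm (amb \<phi> (atom \<phi> Z) Y) \<le> K * exp (- S * norm (Z - Y))"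
  have "norm (test_functional X (atom \<phi> Y)) \<le> K * exp (- S * norm (X - Y))" for X Y
    using K(2)[of Y X] unfolding test_functional_def norm_minus_commute[of Y] .
  then show thesis using that K(1) by blast
qed

text \<open>At Y = X the modulus is the squared L2 norm of the window. By covariance only X - Y
  matters, so continuity at the origin gives a radius that does not depend on X.\<close>

lemma test_functional_atom_lower:
  obtains b \<delta> where "0 < b" "0 < \<delta>" "\<forall>X Y. norm (X - Y) \<le> \<delta> \<longrightarrow> b \<le> norm (test_functional X (atom \<phi> Y))"
proof -
  let ?b = "amb \<phi> (atom \<phi> 0)"
  have c: "continuous_on UNIV ?b" by (rule continuous_on_amb[OF \<phi>(1) atom_in_Sigma1[OF \<phi>(1)]])
  have m0: "modul 0 y = 1" for y :: "real^'n" by (simp add: modul_def)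
  have "?b 0 = (\<integral>y. complex_of_real ((norm (\<phi> y))\<^sup>2) \<partial>lborel)"
    unfolding amb_def atom_def complex_norm_square by (simp add: m0 mult.commute[of "cnj _"])
  then have "?b 0 = complex_of_real (\<integral>y. (norm (\<phi> y))\<^sup>2 \<partial>lborel)" by (simp only: integral_complex_of_real)
  moreover define B where "B = (\<integral>y. (norm (\<phi> y))\<^sup>2 \<partial>lborel)"
  moreover have "0 < B" unfolding B_def by (rule integral_norm_square_pos[OF \<phi>])
  ultimately have nb: "norm (?b 0) = B" "0 < B" by auto
  have "isCont ?b 0" by (rule continuous_on_interior[OF c]) simp
  then obtain d where d: "0 < d" "\<And>Z. norm (Z - 0) < d \<Longrightarrow> norm (?b Z - ?b 0) < B / 2"
    using nb(2) unfolding continuous_at_eps_delta dist_norm by (meson half_gt_zero)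
  show ?thesis
  proof (rule that[of "B / 2" "d / 2"])
    show "0 < B / 2" "0 < d / 2" using nb d by auto
    show "\<forall>X Y. norm (X - Y) \<le> d / 2 \<longrightarrow> B / 2 \<le> norm (test_functional X (atom \<phi> Y))"
    proof (intro allI impI)
      fix X Y :: "(real^'n) \<times> (real^'n)" assume XY: "norm (X - Y) \<le> d / 2"
      have "norm (test_functional X (atom \<phi> Y)) = norm (?b (X - Y))"
        unfolding test_functional_def by (rule norm_amb_atom[OF \<phi>(1)])
      moreover have "norm (?b (X - Y) - ?b 0) < B / 2" using XY d by (intro d(2)) simp
      ultimately show "B / 2 \<le> norm (test_functional X (atom \<phi> Y))"
        using norm_triangle_ineq2[of "?b 0" "?b (X - Y)"] nb(1) by (simp add: norm_minus_commute)
    qed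
  qed
qed

text \<open>The weighted power is dominated by a translate to X of one fixed exponential in the
  space, times \<open>w X powr r0\<close>; bounded v makes the norms of all these translates
  comparable.\<close>

lemma pw_test_functional_upper:
  assumes w: "PE w" and V: "\<And>x. \<bar>v x\<bar> \<le> V"
  obtains Q where "0 < Q" "\<forall>X. pw w (test_functional X) \<in> rspace \<and> rnorm (pw w (test_functional X)) \<le> Q * w X powr r0"
proof -
  obtain a where a: "0 < a" "(\<lambda>x. exp (- a * norm x)) \<in> rspace" using exp_decay_in_rspace by blast
  obtain D Rw where D: "1 \<le> D" "0 < Rw" "\<And>x y. w (x + y) \<le> D * exp (Rw * norm y) * w x"
    using PE_exp_moderate[OF w] by blast
  \<comment> \<open>Rw pays for replacing the weight at Y by the weight at X; what remains,
    \<open>a / r0\<close>, becomes the rate a after the r0-th power is taken.\<close>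
  define S where "S = Rw + a / r0"
  have S: "0 < S" using D a r0 by (simp add: S_def add_pos_pos)
  obtain K where K: "0 \<le> K" "\<forall>X Y. norm (test_functional X (atom \<phi> Y)) \<le> K * exp (- S * norm (X - Y))"
    using test_functional_atom_decay[OF S] by blast
  let ?e = "\<lambda>x::(real^'n) \<times> (real^'n). exp (- a * norm x)"
  have V0: "0 \<le> V" using V[of 0] by linarith
  define q where "q = (K * D) powr r0"
  have q: "0 \<le> q" by (simp add: q_def)
  define Q where "Q = solid_const * q * (trans_const * V * rnorm ?e) + 1"
  have Q0: "0 \<le> solid_const * q * (trans_const * V * rnorm ?e)"
    using solid_const trans_const q V0 rnorm_nonneg[OF a(2)] by (intro mult_nonneg_nonneg) auto
  show ?thesis
  proof (rule that[of Q])
    show "0 < Q" using Q0 by (simp add: Q_def)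
    show "\<forall>X. pw w (test_functional X) \<in> rspace \<and> rnorm (pw w (test_functional X)) \<le> Q * w X powr r0"
    proof
      fix X
      let ?u = "test_functional X"
      have tr: "(\<lambda>Y. ?e (Y + (- X))) \<in> rspace" "rnorm (\<lambda>Y. ?e (Y + (- X))) \<le> trans_const * V * rnorm ?e"
      proof -
        show "(\<lambda>Y. ?e (Y + (- X))) \<in> rspace" by (rule rspace_translate[OF a(2)])
        have "rnorm (\<lambda>Y. ?e (Y + (- X))) \<le> trans_const * \<bar>v (- (- X))\<bar> * rnorm ?e" by (rule rnorm_translate[OF a(2)])
        also have "\<dots> \<le> trans_const * V * rnorm ?e"
          using V trans_const rnorm_nonneg[OF a(2)] by (intro mult_right_mono mult_left_mono) auto
        finally show "rnorm (\<lambda>Y. ?e (Y + (- X))) \<le> trans_const * V * rnorm ?e" .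
      qed
      have d: "pw w ?u Y \<le> (q * w X powr r0) * ?e (Y + (- X))" for Y
      proof -
        have "w Y \<le> D * exp (Rw * norm (X - Y)) * w X" using D(3)[of X "Y - X"] by (simp add: norm_minus_commute)
        then have "norm (?u (atom \<phi> Y)) * w Y \<le> (K * exp (- S * norm (X - Y))) * (D * exp (Rw * norm (X - Y)) * w X)"
          using K(1) K(2)[rule_format, of X Y] PE_pos[OF w, of Y] by (intro mult_mono) auto
        also have "\<dots> = (K * D * w X) * (exp (- S * norm (X - Y)) * exp (Rw * norm (X - Y)))" by simp
        also have "exp (- S * norm (X - Y)) * exp (Rw * norm (X - Y)) = exp (- (a / r0) * norm (X - Y))"
          by (simp add: S_def exp_add[symmetric] algebra_simps)
        finally have "(norm (?u (atom \<phi> Y)) * w Y) powr r0 \<le> ((K * D * w X) * exp (- (a / r0) * norm (X - Y))) powr r0"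
          using PE_pos[OF w, of Y] r0 by (intro powr_mono2) auto
        also have "\<dots> = (K * D) powr r0 * w X powr r0 * exp (- (a / r0) * norm (X - Y)) powr r0"
          by (simp only: powr_mult)
        also have "exp (- (a / r0) * norm (X - Y)) powr r0 = exp (- a * norm (X - Y))" using r0 by (simp add: powr_def)
        finally show ?thesis by (simp add: pw_def powr_mult q_def norm_minus_commute[of X])
      qed
      note s = pw_solid[OF w test_functional_in_dual rspace_cmult[OF tr(1), of "q * w X powr r0"] d]
      have "rnorm (\<lambda>Y. (q * w X powr r0) * ?e (Y + (- X))) = (q * w X powr r0) * rnorm (\<lambda>Y. ?e (Y + (- X)))"
        using rnorm_cmult[OF tr(1), of "q * w X powr r0"] q by simp
      also have "\<dots> \<le> (q * w X powr r0) * (trans_const * V * rnorm ?e)" using tr(2) q by (intro mult_left_mono) auto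
      finally have "solid_const * rnorm (\<lambda>Y. (q * w X powr r0) * ?e (Y + (- X))) \<le> solid_const * ((q * w X powr r0) * (trans_const * V * rnorm ?e))"
        using solid_const by (intro mult_left_mono) auto
      also have "\<dots> = (Q - 1) * w X powr r0" by (simp add: Q_def)
      also have "\<dots> \<le> Q * w X powr r0" by (intro mult_right_mono) auto
      finally show "pw w ?u \<in> rspace \<and> rnorm (pw w ?u) \<le> Q * w X powr r0" using s by linarith
    qed
  qed
qed

text \<open>Near X the transform is bounded below and the weight is comparable to
  \<open>w X\<close>. Translated back to the origin, the weighted power thus dominates a multiple of
  the indicator of one fixed ball, and bounded v makes the translation harmless.\<close>

lemma pw_test_functional_lower:
  assumes w: "PE w" and V: "\<And>x. \<bar>v x\<bar> \<le> V"
  obtains q where "0 < q" "\<forall>X. pw w (test_functional X) \<in> rspace \<longrightarrow> q * w X powr r0 \<le> rnorm (pw w (test_functional X))"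
proof -
  obtain b \<delta> where b: "0 < b" "0 < \<delta>" "\<forall>X Y. norm (X - Y) \<le> \<delta> \<longrightarrow> b \<le> norm (test_functional X (atom \<phi> Y))"
    using test_functional_atom_lower by blast
  obtain D Rw where D: "1 \<le> D" "0 < Rw" "\<And>x y. w (x + y) \<le> D * exp (Rw * norm y) * w x"
    using PE_exp_moderate[OF w] by blast
  have V0: "0 \<le> V" using V[of 0] by linarith
  let ?\<chi> = "indicator (cball 0 \<delta>) :: (real^'n) \<times> (real^'n) \<Rightarrow> real"
  have \<chi>: "?\<chi> \<in> rspace" by (rule indicator_bounded_in_rspace) auto
  have \<chi>p: "0 < rnorm ?\<chi>" by (rule rnorm_indicator_pos) (use b in \<open>auto simp: interior_cball\<close>)
  define m where "m = (b / (D * exp (Rw * \<delta>))) powr r0"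
  have "b / (D * exp (Rw * \<delta>)) \<noteq> 0" using b D by simp
  then have m: "0 < m" unfolding m_def by (metis powr_gt_zero)
  define T where "T = solid_const * (trans_const * (V + 1))"
  have T: "0 < T" using solid_const trans_const V0 by (auto simp: T_def intro!: mult_pos_pos)
  show ?thesis
  proof (rule that[of "m * rnorm ?\<chi> / T"])
    show "0 < m * rnorm ?\<chi> / T" using m \<chi>p T by simp
    show "\<forall>X. pw w (test_functional X) \<in> rspace \<longrightarrow> m * rnorm ?\<chi> / T * w X powr r0 \<le> rnorm (pw w (test_functional X))"
    proof (intro allI impI)
      fix X assume uS: "pw w (test_functional X) \<in> rspace"
      let ?u = "test_functional X"
      have tr: "(\<lambda>Y. pw w ?u (Y + X)) \<in> rspace" "rnorm (\<lambda>Y. pw w ?u (Y + X)) \<le> trans_const * (V + 1) * rnorm (pw w ?u)"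
      proof -
        show "(\<lambda>Y. pw w ?u (Y + X)) \<in> rspace" by (rule rspace_translate[OF uS])
        have "\<bar>v (- X)\<bar> \<le> V + 1" using V[of "- X"] by linarith
        then have "trans_const * \<bar>v (- X)\<bar> * rnorm (pw w ?u) \<le> trans_const * (V + 1) * rnorm (pw w ?u)"
          using trans_const rnorm_nonneg[OF uS] by (intro mult_right_mono mult_left_mono) auto
        then show "rnorm (\<lambda>Y. pw w ?u (Y + X)) \<le> trans_const * (V + 1) * rnorm (pw w ?u)"
          using rnorm_translate[OF uS, of X] by linarith
      qed
      have d: "\<bar>(m * w X powr r0) * ?\<chi> Y\<bar> \<le> pw w ?u (Y + X)" for Y
      proof (cases "norm Y \<le> \<delta>")
        case True
        have "w X \<le> D * exp (Rw * norm Y) * w (Y + X)" using D(3)[of "Y + X" "- Y"] by simp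
        also have "\<dots> \<le> D * exp (Rw * \<delta>) * w (Y + X)"
          using True D PE_pos[OF w, of "Y + X"] by (intro mult_right_mono mult_left_mono) auto
        finally have 1: "w X / (D * exp (Rw * \<delta>)) \<le> w (Y + X)" using D by (simp add: pos_divide_le_eq mult_ac)
        have 2: "b \<le> norm (?u (atom \<phi> (Y + X)))" using b(3)[rule_format, of X "Y + X"] True by simp
        have "b * (w X / (D * exp (Rw * \<delta>))) \<le> norm (?u (atom \<phi> (Y + X))) * w (Y + X)"
          using 1 2 b(1) PE_pos[OF w, of X] D by (intro mult_mono) auto
        then have "(b / (D * exp (Rw * \<delta>)) * w X) powr r0 \<le> (norm (?u (atom \<phi> (Y + X))) * w (Y + X)) powr r0"
          using b(1) PE_pos[OF w, of X] D r0 by (intro powr_mono2) auto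
        then have "m * w X powr r0 \<le> pw w ?u (Y + X)" by (simp only: m_def pw_def powr_mult)
        then show ?thesis using True m by simp
      next
        case False
        then show ?thesis using pw_nonneg by simp
      qed
      have "rnorm (\<lambda>Y. (m * w X powr r0) * ?\<chi> Y) \<le> solid_const * rnorm (\<lambda>Y. pw w ?u (Y + X))"
        by (rule rspace_solid_all(2)[OF rspace_measurable[OF rspace_cmult[OF \<chi>]] tr(1) d])
      also have "\<dots> \<le> solid_const * (trans_const * (V + 1) * rnorm (pw w ?u))" using tr(2) solid_const by (intro mult_left_mono) auto
      finally have "(m * w X powr r0) * rnorm ?\<chi> \<le> T * rnorm (pw w ?u)"
        using rnorm_cmult[OF \<chi>, of "m * w X powr r0"] m by (simp add: T_def mult_ac)
      then show "m * rnorm ?\<chi> / T * w X powr r0 \<le> rnorm (pw w ?u)" using T by (simp add: pos_divide_le_eq mult_ac)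
    qed
  qed
qed

lemma zero_functional: "(\<lambda>\<psi>::real^'n \<Rightarrow> complex. 0) \<in> Sigma1_dual" "pw w (\<lambda>\<psi>. 0) \<in> rspace"
proof -
  show "(\<lambda>\<psi>::real^'n \<Rightarrow> complex. 0) \<in> Sigma1_dual"
    using Sigma1_dual_cmult_fun[OF test_functional_in_dual, of 0 0] by simp
  have "pw w (\<lambda>\<psi>. 0) = (\<lambda>X. 0)" by (simp add: pw_def fun_eq_iff)
  then show "pw w (\<lambda>\<psi>. 0) \<in> rspace" using zero_in_rspace by simp
qed

text \<open>The normalised test functionals stay away from zero in the second norm, but they tend to zero locally uniformly, so that
  their only possible limit is zero.\<close>

lemma vanishing_ratio_of_compactness:
  assumes w: "PE w1" "PE w2" and V: "\<And>x. \<bar>v x\<bar> \<le> V"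
    and compact: "\<forall>F K. (\<forall>n. F n \<in> Sigma1_dual \<and> pw w1 (F n) \<in> rspace \<and> rnorm (pw w1 (F n)) \<le> K) \<longrightarrow>
      (\<forall>n. pw w2 (F n) \<in> rspace) \<and>
      (\<exists>(h::nat \<Rightarrow> nat) g. strict_mono h \<and> g \<in> Sigma1_dual \<and> pw w2 g \<in> rspace \<and> (\<lambda>n. rnorm (pw w2 (\<lambda>x. F (h n) x - g x))) \<longlonglongrightarrow> 0)"
  shows "((\<lambda>X. w2 X / w1 X) \<longlongrightarrow> 0) at_infinity"
proof (rule ccontr)
  assume "\<not> ((\<lambda>X. w2 X / w1 X) \<longlongrightarrow> 0) at_infinity"
  then obtain e where e: "0 < e" "\<not> (\<forall>\<^sub>F X in at_infinity. dist (w2 X / w1 X) 0 < e)"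
    unfolding tendsto_iff by blast
  have "\<exists>X. real n \<le> norm X \<and> e \<le> w2 X / w1 X" for n
  proof (rule ccontr)
    assume "\<nexists>X. real n \<le> norm X \<and> e \<le> w2 X / w1 X"
    then have "\<forall>X. real n \<le> norm X \<longrightarrow> dist (w2 X / w1 X) 0 < e"
    proof (intro allI impI)
      fix X :: "(real^'n) \<times> (real^'n)" assume "real n \<le> norm X"
      with \<open>\<nexists>X. real n \<le> norm X \<and> e \<le> w2 X / w1 X\<close> have "w2 X / w1 X < e" by (meson not_le)
      then show "dist (w2 X / w1 X) 0 < e" using PE_pos[OF w(1), of X] PE_pos[OF w(2), of X] by simp
    qed
    then have "\<forall>\<^sub>F X in at_infinity. dist (w2 X / w1 X) 0 < e" unfolding eventually_at_infinity by blast
    with e show False by blast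
  qed
  then obtain X where X: "\<And>n. real n \<le> norm (X n)" "\<And>n. e \<le> w2 (X n) / w1 (X n)" by metis
  obtain Q where Q: "0 < Q" "\<forall>X. pw w1 (test_functional X) \<in> rspace \<and> rnorm (pw w1 (test_functional X)) \<le> Q * w1 X powr r0"
    using pw_test_functional_upper[OF w(1) V] by blast
  obtain q where q: "0 < q" "\<forall>X. pw w2 (test_functional X) \<in> rspace \<longrightarrow> q * w2 X powr r0 \<le> rnorm (pw w2 (test_functional X))"
    using pw_test_functional_lower[OF w(2) V] by blast
  have w2S: "pw w2 (test_functional X) \<in> rspace" for X
    using pw_test_functional_upper[OF w(2) V] by blast
  \<comment> \<open>Normalises the test functionals to be bounded in the first norm; the choice of
    the points \<open>X n\<close> keeps them bounded below in the second.\<close>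
  define s where "s n = complex_of_real (1 / w1 (X n))" for n
  have ns: "norm (s n) powr r0 * w1 (X n) powr r0 = 1" for n
    using PE_pos[OF w(1), of "X n"] by (simp add: s_def powr_mult[symmetric] norm_divide)
  define F where "F n = (\<lambda>\<psi>. s n * test_functional (X n) \<psi>)" for n
  have Fd: "F n \<in> Sigma1_dual" for n unfolding F_def by (rule Sigma1_dual_cmult_fun[OF test_functional_in_dual])
  have Fpw: "pw w (F n) = (\<lambda>Y. norm (s n) powr r0 * pw w (test_functional (X n)) Y)" for w n
    unfolding F_def by (rule pw_cmult)
  have F1: "pw w1 (F n) \<in> rspace" "rnorm (pw w1 (F n)) \<le> Q" for n
  proof -
    have t: "pw w1 (test_functional (X n)) \<in> rspace" using Q by blast
    show "pw w1 (F n) \<in> rspace" unfolding Fpw by (rule rspace_cmult[OF t])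
    have "rnorm (pw w1 (F n)) = norm (s n) powr r0 * rnorm (pw w1 (test_functional (X n)))"
      unfolding Fpw using rnorm_cmult[OF t, of "norm (s n) powr r0"] by simp
    also have "\<dots> \<le> norm (s n) powr r0 * (Q * w1 (X n) powr r0)"
      using Q(2)[rule_format, of "X n"] by (intro mult_left_mono) auto
    also have "\<dots> = Q * (norm (s n) powr r0 * w1 (X n) powr r0)" by simp
    finally show "rnorm (pw w1 (F n)) \<le> Q" unfolding ns by simp
  qed
  have F2: "pw w2 (F n) \<in> rspace" "q * e powr r0 \<le> rnorm (pw w2 (F n))" for n
  proof -
    show "pw w2 (F n) \<in> rspace" unfolding Fpw by (rule rspace_cmult[OF w2S])
    have "rnorm (pw w2 (F n)) = norm (s n) powr r0 * rnorm (pw w2 (test_functional (X n)))"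
      unfolding Fpw using rnorm_cmult[OF w2S, of "norm (s n) powr r0"] by simp
    moreover have "norm (s n) powr r0 * (q * w2 (X n) powr r0) \<le> norm (s n) powr r0 * rnorm (pw w2 (test_functional (X n)))"
      using q(2)[rule_format, of "X n"] w2S by (intro mult_left_mono) auto
    moreover have "norm (s n) powr r0 * (q * w2 (X n) powr r0) = q * (w2 (X n) / w1 (X n)) powr r0"
      using PE_pos[OF w(1), of "X n"] PE_pos[OF w(2), of "X n"] by (simp add: s_def norm_divide powr_divide)
    moreover have "q * e powr r0 \<le> q * (w2 (X n) / w1 (X n)) powr r0"
      using q X(2)[of n] e r0 by (intro mult_left_mono powr_mono2) auto
    ultimately show "q * e powr r0 \<le> rnorm (pw w2 (F n))" by linarith
  qed
  have "\<forall>n. F n \<in> Sigma1_dual \<and> pw w1 (F n) \<in> rspace \<and> rnorm (pw w1 (F n)) \<le> Q" using Fd F1 by blast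
  then obtain h :: "nat \<Rightarrow> nat" and g where h: "strict_mono h" and g: "g \<in> Sigma1_dual" "pw w2 g \<in> rspace"
    and lim: "(\<lambda>n. rnorm (pw w2 (\<lambda>x. F (h n) x - g x))) \<longlonglongrightarrow> 0"
    using compact[rule_format, of F Q] by blast
  have dS: "pw w2 (\<lambda>x. F (h n) x - g x) \<in> rspace" for n by (rule pw_diff(1)[OF w(2) Fd F2(1) g])
  \<comment> \<open>On a fixed ball the normalised functionals tend to zero uniformly, so the limit
    g can contribute nothing there.\<close>
  have zero: "AE Y in lborel. indicator (cball 0 (real k)) Y * pw w2 g Y = 0" for k :: nat
  proof -
    obtain D Rw where D: "1 \<le> D" "0 < Rw" "\<And>x y. w1 (x + y) \<le> D * exp (Rw * norm y) * w1 x"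
      using PE_exp_moderate[OF w(1)] by blast
    obtain B where B: "0 < B" "\<And>X. norm X \<le> real k \<Longrightarrow> w2 X \<le> B" using weight_bounded_on_cball[OF w(2)] by blast
    \<comment> \<open>The normalising factor grows at most like
      \<open>exp (Rw * norm (X n))\<close>; the decay rate Rw + 1 leaves
      \<open>exp (- norm (X n))\<close>.\<close>
    define S where "S = Rw + 1"
    have S: "0 < S" using D by (simp add: S_def)
    obtain K where K: "0 \<le> K" "\<forall>X Y. norm (test_functional X (atom \<phi> Y)) \<le> K * exp (- S * norm (X - Y))"
      using test_functional_atom_decay[OF S] by blast
    define T where "T = D / w1 0 * K * exp (S * real k) * B"
    have T: "0 \<le> T" using D PE_pos[OF w(1), of 0] K B by (simp add: T_def)
    have small: "pw w2 (F n) Y \<le> T powr r0 * exp (- r0 * real n)" if Y: "norm Y \<le> real k" for n Y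
    proof -
      have "w1 0 \<le> D * exp (Rw * norm (X n)) * w1 (X n)" using D(3)[of "X n" "- X n"] by simp
      then have 1: "norm (s n) \<le> D / w1 0 * exp (Rw * norm (X n))"
        using PE_pos[OF w(1), of 0] PE_pos[OF w(1), of "X n"] by (simp add: s_def norm_divide field_simps)
      have "norm (X n) - real k \<le> norm (X n - Y)" using norm_triangle_ineq2[of "X n" Y] Y by linarith
      then have "S * (norm (X n) - real k) \<le> S * norm (X n - Y)" using S by (intro mult_left_mono) auto
      then have "exp (- S * norm (X n - Y)) \<le> exp (S * real k) * exp (- S * norm (X n))"
        by (simp add: exp_add[symmetric] algebra_simps)
      then have "K * exp (- S * norm (X n - Y)) \<le> K * (exp (S * real k) * exp (- S * norm (X n)))" using K by (intro mult_left_mono) auto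
      then have 2: "norm (test_functional (X n) (atom \<phi> Y)) \<le> K * (exp (S * real k) * exp (- S * norm (X n)))"
        using K(2)[rule_format, of "X n" Y] by linarith
      have "norm (F n (atom \<phi> Y)) * w2 Y = norm (s n) * norm (test_functional (X n) (atom \<phi> Y)) * w2 Y" by (simp add: F_def norm_mult)
      also have "\<dots> \<le> (D / w1 0 * exp (Rw * norm (X n))) * (K * (exp (S * real k) * exp (- S * norm (X n)))) * B"
        using 1 2 B(2)[OF Y] PE_pos[OF w(2), of Y] PE_pos[OF w(1), of 0] D K by (intro mult_mono) auto
      also have "\<dots> = T * (exp (Rw * norm (X n)) * exp (- S * norm (X n)))" by (simp add: T_def)
      also have "exp (Rw * norm (X n)) * exp (- S * norm (X n)) = exp (- norm (X n))" by (simp add: S_def exp_add[symmetric] algebra_simps)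
      also have "T * exp (- norm (X n)) \<le> T * exp (- real n)" using X(1)[of n] T by (intro mult_left_mono) auto
      finally have "(norm (F n (atom \<phi> Y)) * w2 Y) powr r0 \<le> (T * exp (- real n)) powr r0"
        using PE_pos[OF w(2), of Y] r0 by (intro powr_mono2) auto
      also have "\<dots> = T powr r0 * exp (- real n) powr r0" by (rule powr_mult)
      also have "exp (- real n) powr r0 = exp (- r0 * real n)" by (simp add: powr_def)
      finally show ?thesis by (simp add: pw_def powr_mult)
    qed
    let ?\<chi> = "indicator (cball 0 (real k)) :: (real^'n) \<times> (real^'n) \<Rightarrow> real"
    have \<chi>: "?\<chi> \<in> rspace" by (rule indicator_bounded_in_rspace) auto
    have \<chi>m: "?\<chi> \<in> borel_measurable borel" by (rule rspace_measurable[OF \<chi>])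
    have m: "(\<lambda>Y. ?\<chi> Y * pw w2 g Y) \<in> borel_measurable borel" by (rule borel_measurable_times[OF \<chi>m rspace_measurable[OF g(2)]])
    have \<chi>g: "(\<lambda>Y. ?\<chi> Y * pw w2 g Y) \<in> rspace"
    proof (rule rspace_solid_all(1)[OF m g(2)])
      show "\<bar>?\<chi> Y * pw w2 g Y\<bar> \<le> pw w2 g Y" for Y using pw_nonneg by (simp add: indicator_def)
    qed
    \<comment> \<open>On the ball the transform of g is compared with those of F (h n) - g and of F
      (h n). The norm of the first tends to zero by assumption, the second is uniformly
      small.\<close>
    have bound: "rnorm (\<lambda>Y. ?\<chi> Y * pw w2 g Y) \<le> solid_const * (rnorm (pw w2 (\<lambda>x. F (h n) x - g x)) + T powr r0 * exp (- r0 * real n) * rnorm ?\<chi>)" for n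
    proof -
      let ?d = "pw w2 (\<lambda>x. F (h n) x - g x)"
      have d: "\<bar>?\<chi> Y * pw w2 g Y\<bar> \<le> ?d Y + (T powr r0 * exp (- r0 * real n)) * ?\<chi> Y" for Y
      proof (cases "norm Y \<le> real k")
        case True
        have "pw w2 g Y \<le> pw w2 (F (h n)) Y + ?d Y"
          using pw_diff_le[of w2 "F (h n)" "\<lambda>x. F (h n) x - g x" Y] by simp
        moreover have "pw w2 (F (h n)) Y \<le> T powr r0 * exp (- r0 * real n)"
        proof -
          have "n \<le> h n" by (rule seq_suble[OF h])
          then have "T powr r0 * exp (- r0 * real (h n)) \<le> T powr r0 * exp (- r0 * real n)" using r0 by (intro mult_left_mono) auto
          then show ?thesis using small[OF True, of "h n"] by linarith
        qed
        ultimately show ?thesis using True pw_nonneg[of w2 g Y] by simp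
      next
        case False
        then show ?thesis using pw_nonneg by simp
      qed
      have "rnorm (\<lambda>Y. ?\<chi> Y * pw w2 g Y) \<le> solid_const * rnorm (\<lambda>Y. ?d Y + (T powr r0 * exp (- r0 * real n)) * ?\<chi> Y)"
        by (rule rspace_solid_all(2)[OF m rspace_add[OF dS rspace_cmult[OF \<chi>]] d])
      also have "\<dots> \<le> solid_const * (rnorm ?d + T powr r0 * exp (- r0 * real n) * rnorm ?\<chi>)"
        using rnorm_add[OF dS[of n] rspace_cmult[OF \<chi>, of "T powr r0 * exp (- r0 * real n)"]] rnorm_cmult[OF \<chi>, of "T powr r0 * exp (- r0 * real n)"] solid_const
        by (intro mult_left_mono) auto
      finally show ?thesis .
    qed
    have "(\<lambda>n. exp (- r0) ^ n) \<longlonglongrightarrow> 0" using r0 by (intro LIMSEQ_power_zero) simp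
    then have "(\<lambda>n. exp (- r0 * real n)) \<longlonglongrightarrow> 0" by (simp add: exp_of_nat_mult[symmetric] mult.commute)
    then have "(\<lambda>n. solid_const * (rnorm (pw w2 (\<lambda>x. F (h n) x - g x)) + T powr r0 * exp (- r0 * real n) * rnorm ?\<chi>)) \<longlonglongrightarrow> solid_const * (0 + T powr r0 * 0 * rnorm ?\<chi>)"
      by (intro tendsto_intros lim)
    then have "rnorm (\<lambda>Y. ?\<chi> Y * pw w2 g Y) \<le> solid_const * (0 + T powr r0 * 0 * rnorm ?\<chi>)"
      by (rule LIMSEQ_le_const) (use bound in blast)
    then have "rnorm (\<lambda>Y. ?\<chi> Y * pw w2 g Y) = 0" using rnorm_nonneg[OF \<chi>g] by simp
    then show ?thesis using rnorm_eq_0_iff[OF \<chi>g] by simp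
  qed
  then have "AE Y in lborel. \<forall>k::nat. indicator (cball 0 (real k)) Y * pw w2 g Y = 0" unfolding AE_all_countable by blast
  then have g0: "AE Y in lborel. pw w2 g Y = 0"
  proof eventually_elim
    case (elim Y)
    obtain k where "norm Y \<le> real k" using real_arch_simple by blast
    then show ?case using elim[rule_format, of k] by simp
  qed
  \<comment> \<open>As the transform of g vanishes almost everywhere, solidity bounds the norm of
    \<open>F (h n)\<close> by that of the difference, in conflict with the lower bound.\<close>
  have "q * e powr r0 \<le> solid_const * rnorm (pw w2 (\<lambda>x. F (h n) x - g x))" for n
  proof -
    let ?d = "pw w2 (\<lambda>x. F (h n) x - g x)"
    have "AE Y in lborel. \<bar>pw w2 (F (h n)) Y\<bar> \<le> \<bar>?d Y\<bar>"
      using g0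
    proof eventually_elim
      case (elim Y)
      have "pw w2 (F (h n)) Y \<le> ?d Y + pw w2 (\<lambda>x. - g x) Y"
        using pw_diff_le[of w2 "\<lambda>x. F (h n) x - g x" "\<lambda>x. - g x" Y] by simp
      moreover have "pw w2 (\<lambda>x. - g x) Y = pw w2 g Y" by (simp add: pw_def)
      ultimately show ?case using elim pw_nonneg[of w2 "F (h n)" Y] pw_nonneg[of w2 "\<lambda>x. F (h n) x - g x" Y] by simp
    qed
    from rspace_solid(2)[OF rspace_measurable[OF F2(1)] dS this] F2(2)[of "h n"] show ?thesis by linarith
  qed
  moreover have "(\<lambda>n. solid_const * rnorm (pw w2 (\<lambda>x. F (h n) x - g x))) \<longlonglongrightarrow> solid_const * 0"
    by (intro tendsto_intros lim)
  ultimately have "q * e powr r0 \<le> solid_const * 0" by (intro LIMSEQ_le_const) auto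
  then show False using q e by (simp add: mult_le_0_iff)
qed

end

subsection \<open>Inclusions of modulation spaces\<close>

locale modulation_space = modulation B0 N0 v \<phi> r0 Dv Rv
  for B0 :: "((real^'n::finite) \<times> (real^'n) \<Rightarrow> complex) set" and N0 v \<phi> r0 Dv Rv +
  fixes B :: "((real^'n) \<times> (real^'n) \<Rightarrow> complex) set" and N :: "((real^'n) \<times> (real^'n) \<Rightarrow> complex) \<Rightarrow> real"
  assumes B: "B = {f. f \<in> borel_measurable lborel \<and> (\<lambda>x. complex_of_real (norm (f x) powr r0)) \<in> B0}"
    and N: "\<And>f. f \<in> B \<Longrightarrow> N f = N0 (\<lambda>x. complex_of_real (norm (f x) powr r0)) powr (1 / r0)"
begin

text \<open>The normalising factor of the short-time Fourier transform, raised to the power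
  r0.\<close>

definition c1 :: real where "c1 = ((2 * pi) powr (- real CARD('n) / 2)) powr r0"

lemma c1_pos: "0 < c1" by (simp add: c1_def)

lemma norm_stft_powr:
  assumes w: "PE w"
  shows "norm (stft u \<phi> X * complex_of_real (w X)) powr r0 = c1 * pw w u X"
proof -
  have "stft u \<phi> X = complex_of_real ((2 * pi) powr (- real CARD('n) / 2)) * u (atom \<phi> X)"
    by (simp add: stft_def atom_def modul_def[abs_def])
  then have "norm (stft u \<phi> X * complex_of_real (w X)) = (2 * pi) powr (- real CARD('n) / 2) * norm (u (atom \<phi> X)) * w X"
    using PE_pos[OF w, of X] by (simp add: norm_mult)
  then show ?thesis by (simp only: powr_mult c1_def pw_def mult.assoc)
qed

lemma modsp_iff:
  assumes w: "PE w"
  shows "u \<in> modsp \<phi> w B \<longleftrightarrow> u \<in> Sigma1_dual \<and> pw w u \<in> rspace"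
proof -
  have m: "(\<lambda>X. stft u \<phi> X * complex_of_real (w X)) \<in> borel_measurable lborel" if u: "u \<in> Sigma1_dual"
  proof -
    have "(\<lambda>X. u (atom \<phi> X)) \<in> borel_measurable borel"
      by (rule borel_measurable_continuous_onI[OF continuous_on_dual_atom[OF \<phi>(1) u]])
    moreover have "(\<lambda>X. stft u \<phi> X) = (\<lambda>X. complex_of_real ((2 * pi) powr (- real CARD('n) / 2)) * u (atom \<phi> X))"
      by (simp add: stft_def atom_def modul_def[abs_def] fun_eq_iff)
    ultimately show ?thesis using PE_measurable[OF w] by simp
  qed
  have r: "(\<lambda>X. c1 * pw w u X) \<in> rspace \<longleftrightarrow> pw w u \<in> rspace"
  proof
    assume "(\<lambda>X. c1 * pw w u X) \<in> rspace"
    from rspace_cmult[OF this, of "1 / c1"] show "pw w u \<in> rspace" using c1_pos by simp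
  qed (rule rspace_cmult)
  have "(\<lambda>X. stft u \<phi> X * complex_of_real (w X)) \<in> B \<longleftrightarrow> pw w u \<in> rspace" if u: "u \<in> Sigma1_dual"
    unfolding B mem_Collect_eq norm_stft_powr[OF w, of u] using m[OF u] r unfolding rspace_def by simp
  then show ?thesis by (auto simp: modsp_def)
qed

lemma modnorm_eq:
  assumes w: "PE w" and u: "u \<in> modsp \<phi> w B"
  shows "modnorm \<phi> w N u = (c1 * rnorm (pw w u)) powr (1 / r0)"
proof -
  have p: "pw w u \<in> rspace" using u modsp_iff[OF w] by blast
  have "(\<lambda>X. stft u \<phi> X * complex_of_real (w X)) \<in> B" using u by (simp add: modsp_def)
  from N[OF this] have "modnorm \<phi> w N u = rnorm (\<lambda>X. c1 * pw w u X) powr (1 / r0)"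
    unfolding modnorm_def norm_stft_powr[OF w, of u] rnorm_def .
  then show ?thesis using rnorm_cmult[OF p, of c1] c1_pos by simp
qed

lemma modnorm_mono:
  assumes w: "PE w" "PE w'" and u: "u \<in> modsp \<phi> w B" and u': "u' \<in> modsp \<phi> w' B" and c: "0 \<le> c"
    and le: "rnorm (pw w u) \<le> c * rnorm (pw w' u')"
  shows "modnorm \<phi> w N u \<le> c powr (1 / r0) * modnorm \<phi> w' N u'"
proof -
  have p: "pw w u \<in> rspace" using u modsp_iff[OF w(1)] by blast
  have "(c1 * rnorm (pw w u)) powr (1 / r0) \<le> (c * (c1 * rnorm (pw w' u'))) powr (1 / r0)"
    using mult_left_mono[OF le, of c1] c1_pos rnorm_nonneg[OF p] r0 by (intro powr_mono2) (auto simp: mult_ac)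
  then show ?thesis unfolding modnorm_eq[OF w(1) u] modnorm_eq[OF w(2) u'] powr_mult[of c] .
qed

lemma modsp_diff: "PE w \<Longrightarrow> u \<in> modsp \<phi> w B \<Longrightarrow> u' \<in> modsp \<phi> w B \<Longrightarrow> (\<lambda>x. u x - u' x) \<in> modsp \<phi> w B"
  unfolding modsp_iff by (elim conjE) (rule conjI, rule Sigma1_dual_diff_fun, assumption+, rule pw_diff(1))

lemma dominated_imp_subset:
  assumes w: "PE w1" "PE w2" and c: "\<And>X. w2 X \<le> c * w1 X"
  shows "modsp \<phi> w1 B \<subseteq> modsp \<phi> w2 B"
    and "u \<in> modsp \<phi> w1 B \<Longrightarrow> modnorm \<phi> w2 N u \<le> (solid_const * c powr r0) powr (1 / r0) * modnorm \<phi> w1 N u"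
proof -
  \<comment> \<open>The sign of c is not prescribed, but positivity of both weights at one point
    forces it.\<close>
  have "0 < c * w1 0" using c[of 0] PE_pos[OF w(2), of 0] by linarith
  then have c0: "0 \<le> c" using PE_pos[OF w(1), of 0] zero_less_mult_pos2 less_imp_le by blast
  have s: "u \<in> modsp \<phi> w2 B" if "u \<in> modsp \<phi> w1 B" for u
    using that pw_weight_mono(1)[OF w c0 c] by (simp add: modsp_iff w)
  then show "modsp \<phi> w1 B \<subseteq> modsp \<phi> w2 B" by blast
  assume u: "u \<in> modsp \<phi> w1 B"
  show "modnorm \<phi> w2 N u \<le> (solid_const * c powr r0) powr (1 / r0) * modnorm \<phi> w1 N u"
  proof (rule modnorm_mono[OF w(2,1) s[OF u] u])
    show "0 \<le> solid_const * c powr r0" using solid_const by simp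
    show "rnorm (pw w2 u) \<le> solid_const * c powr r0 * rnorm (pw w1 u)"
      using u pw_weight_mono(2)[OF w c0 c] by (simp add: modsp_iff w)
  qed
qed

lemma dominated_imp_continuous:
  assumes w: "PE w1" "PE w2" and c: "\<exists>c. \<forall>X. w2 X \<le> c * w1 X"
  shows "incl_continuous (modsp \<phi> w1 B) (modnorm \<phi> w1 N) (modsp \<phi> w2 B) (modnorm \<phi> w2 N)"
proof -
  obtain c where c: "\<And>X. w2 X \<le> c * w1 X" using c by blast
  note d = dominated_imp_subset[OF w c]
  define q where "q = (solid_const * c powr r0) powr (1 / r0)"
  have q: "0 \<le> q" by (simp add: q_def)
  show ?thesis unfolding incl_continuous_def
  proof (intro conjI d(1) ballI allI impI)
    fix f and e :: real assume f: "f \<in> modsp \<phi> w1 B" and e: "0 < e"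
    show "\<exists>\<delta>>0. \<forall>g\<in>modsp \<phi> w1 B. modnorm \<phi> w1 N (\<lambda>x. g x - f x) < \<delta> \<longrightarrow> modnorm \<phi> w2 N (\<lambda>x. g x - f x) < e"
    proof (intro exI[of _ "e / (q + 1)"] conjI ballI impI)
      show "0 < e / (q + 1)" using e q by simp
      fix g assume g: "g \<in> modsp \<phi> w1 B" and l: "modnorm \<phi> w1 N (\<lambda>x. g x - f x) < e / (q + 1)"
      have "modnorm \<phi> w2 N (\<lambda>x. g x - f x) \<le> q * modnorm \<phi> w1 N (\<lambda>x. g x - f x)"
        unfolding q_def by (rule d(2)[OF modsp_diff[OF w(1) g f]])
      also have "\<dots> \<le> q * (e / (q + 1))" using l q by (intro mult_left_mono) auto
      also have "\<dots> < e" using q e by (simp add: divide_less_eq)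
      finally show "modnorm \<phi> w2 N (\<lambda>x. g x - f x) < e" .
    qed
  qed
qed

lemma rnorm_le_modnorm:
  assumes w: "PE w" and u: "u \<in> modsp \<phi> w B" and K: "modnorm \<phi> w N u \<le> K"
  shows "rnorm (pw w u) \<le> K powr r0 / c1"
proof -
  have p: "0 \<le> rnorm (pw w u)" using u modsp_iff[OF w] rnorm_nonneg by blast
  have "c1 * rnorm (pw w u) = ((c1 * rnorm (pw w u)) powr (1 / r0)) powr r0"
    using p c1_pos r0 by (simp add: powr_powr)
  also have "\<dots> \<le> K powr r0" using K r0 unfolding modnorm_eq[OF w u] by (intro powr_mono2) auto
  finally show ?thesis using c1_pos by (simp add: pos_le_divide_eq mult.commute)
qed

lemma vanishing_imp_compact:
  assumes w: "PE w1" "PE w2" and lim: "((\<lambda>X. w2 X / w1 X) \<longlongrightarrow> 0) at_infinity"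
  shows "incl_compact (modsp \<phi> w1 B) (modnorm \<phi> w1 N) (modsp \<phi> w2 B) (modnorm \<phi> w2 N)"
  unfolding incl_compact_def
proof (intro conjI allI impI)
  show "modsp \<phi> w1 B \<subseteq> modsp \<phi> w2 B"
    using vanishing_ratio_imp_dominated[OF w lim] dominated_imp_subset(1)[OF w] by blast
  fix F :: "nat \<Rightarrow> (real^'n \<Rightarrow> complex) \<Rightarrow> complex"
  assume a: "(\<forall>n. F n \<in> modsp \<phi> w1 B) \<and> (\<exists>K. \<forall>n. modnorm \<phi> w1 N (F n) \<le> K)"
  then obtain K where F: "\<And>n. F n \<in> modsp \<phi> w1 B" and K: "\<And>n. modnorm \<phi> w1 N (F n) \<le> K" by blast
  have F': "F n \<in> Sigma1_dual" "pw w1 (F n) \<in> rspace" "rnorm (pw w1 (F n)) \<le> K powr r0 / c1" for n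
    using F[of n] rnorm_le_modnorm[OF w(1) F K, of n] by (auto simp: modsp_iff w)
  show "\<exists>(h::nat \<Rightarrow> nat) g. strict_mono h \<and> g \<in> modsp \<phi> w2 B \<and> (\<lambda>n. modnorm \<phi> w2 N (\<lambda>x. F (h n) x - g x)) \<longlonglongrightarrow> 0"
  proof (rule compact_subsequence[OF w lim F'])
    fix h :: "nat \<Rightarrow> nat" and g
    assume h: "strict_mono h" and g: "g \<in> Sigma1_dual" "pw w2 g \<in> rspace"
      and l: "(\<lambda>n. rnorm (pw w2 (\<lambda>x. F (h n) x - g x))) \<longlonglongrightarrow> 0"
    have gM: "g \<in> modsp \<phi> w2 B" using g by (simp add: modsp_iff w)
    have FM: "F n \<in> modsp \<phi> w2 B" for n
      using F vanishing_ratio_imp_dominated[OF w lim] dominated_imp_subset(1)[OF w] by blast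
    have dM: "(\<lambda>x. F (h n) x - g x) \<in> modsp \<phi> w2 B" for n by (rule modsp_diff[OF w(2) FM gM])
    have r: "0 \<le> rnorm (pw w2 (\<lambda>x. F (h n) x - g x))" for n using dM[of n] rnorm_nonneg by (simp add: modsp_iff w)
    have "(\<lambda>n. (c1 * rnorm (pw w2 (\<lambda>x. F (h n) x - g x))) powr (1 / r0)) \<longlonglongrightarrow> (c1 * 0) powr (1 / r0)"
      by (intro tendsto_powr' tendsto_mult tendsto_const l) (use r c1_pos r0 in auto)
    then have "(\<lambda>n. modnorm \<phi> w2 N (\<lambda>x. F (h n) x - g x)) \<longlonglongrightarrow> 0"
      unfolding modnorm_eq[OF w(2) dM] by simp
    then show ?thesis using h gM by blast
  qed
qed

text \<open>Continuity at the zero functional is tested on multiples of the test functional at X.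
  Their two norms are comparable to \<open>w1 X\<close> and \<open>w2 X\<close> with constants that
  do not depend on X.\<close>

lemma continuous_imp_dominated:
  assumes w: "PE w1" "PE w2" and V: "\<And>x. \<bar>v x\<bar> \<le> V"
    and i: "incl_continuous (modsp \<phi> w1 B) (modnorm \<phi> w1 N) (modsp \<phi> w2 B) (modnorm \<phi> w2 N)"
  shows "\<exists>c. \<forall>X. w2 X \<le> c * w1 X"
proof -
  have z: "(\<lambda>\<psi>. 0) \<in> modsp \<phi> w1 B" using zero_functional by (simp add: modsp_iff w)
  have "\<exists>\<delta>>0. \<forall>g\<in>modsp \<phi> w1 B. modnorm \<phi> w1 N (\<lambda>x. g x - 0) < \<delta> \<longrightarrow> modnorm \<phi> w2 N (\<lambda>x. g x - 0) < 1"
    using i z unfolding incl_continuous_def by (meson zero_less_one)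
  then obtain \<delta> where \<delta>: "0 < \<delta>" "\<And>g. g \<in> modsp \<phi> w1 B \<Longrightarrow> modnorm \<phi> w1 N g < \<delta> \<Longrightarrow> modnorm \<phi> w2 N g < 1"
    by auto
  have sub: "modsp \<phi> w1 B \<subseteq> modsp \<phi> w2 B" using i by (simp add: incl_continuous_def)
  obtain Q where Q: "0 < Q" "\<forall>X. pw w1 (test_functional X) \<in> rspace \<and> rnorm (pw w1 (test_functional X)) \<le> Q * w1 X powr r0"
    using pw_test_functional_upper[OF w(1) V] by blast
  obtain q where q: "0 < q" "\<forall>X. pw w2 (test_functional X) \<in> rspace \<longrightarrow> q * w2 X powr r0 \<le> rnorm (pw w2 (test_functional X))"
    using pw_test_functional_lower[OF w(2) V] by blast
  define a1 where "a1 = (c1 * Q) powr (1 / r0)"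
  define a2 where "a2 = (c1 * q) powr (1 / r0)"
  have a: "0 < a1" "0 < a2" using c1_pos Q q by (auto simp: a1_def a2_def)
  have root: "(c1 * (t powr r0 * (k * y powr r0))) powr (1 / r0) = t * (c1 * k) powr (1 / r0) * y"
    if "0 \<le> t" "0 \<le> y" for t k y
  proof -
    have "(c1 * (t powr r0 * (k * y powr r0))) powr (1 / r0) = (t powr r0) powr (1 / r0) * ((c1 * k) powr (1 / r0) * (y powr r0) powr (1 / r0))"
      by (simp only: powr_mult mult_ac)
    then show ?thesis using that r0 by (simp add: powr_powr)
  qed
  show ?thesis
  proof (intro exI[of _ "2 * a1 / (\<delta> * a2)"] allI)
    fix X
    \<comment> \<open>Scales the test functional so that its first norm, at most
      \<open>s * a1 * w1 X\<close>, does not exceed \<delta> / 2.\<close>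
    define s where "s = \<delta> / (2 * a1 * w1 X)"
    have s: "0 < s" using \<delta> a PE_pos[OF w(1), of X] by (simp add: s_def)
    define u where "u = (\<lambda>\<psi>. complex_of_real s * test_functional X \<psi>)"
    have upw: "pw w u = (\<lambda>Y. s powr r0 * pw w (test_functional X) Y)" for w
      unfolding u_def pw_cmult using s by simp
    have t1: "pw w1 (test_functional X) \<in> rspace" using Q by blast
    have uM: "u \<in> modsp \<phi> w1 B"
      unfolding modsp_iff[OF w(1)] upw using rspace_cmult[OF t1] Sigma1_dual_cmult_fun[OF test_functional_in_dual] unfolding u_def by blast
    have uM2: "u \<in> modsp \<phi> w2 B" using sub uM by blast
    have t2: "pw w2 (test_functional X) \<in> rspace" using pw_test_functional_upper[OF w(2) V] by blast
    have "modnorm \<phi> w1 N u = (c1 * (s powr r0 * rnorm (pw w1 (test_functional X)))) powr (1 / r0)"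
      unfolding modnorm_eq[OF w(1) uM] upw using rnorm_cmult[OF t1, of "s powr r0"] by simp
    also have "\<dots> \<le> (c1 * (s powr r0 * (Q * w1 X powr r0))) powr (1 / r0)"
      using Q(2)[rule_format, of X] c1_pos r0 rnorm_nonneg[OF t1] by (intro powr_mono2 mult_left_mono) auto
    also have "\<dots> = s * a1 * w1 X" unfolding a1_def by (rule root) (use s PE_pos[OF w(1), of X] in auto)
    also have "\<dots> = \<delta> / 2" using a PE_pos[OF w(1), of X] by (simp add: s_def)
    also have "\<dots> < \<delta>" using \<delta> by simp
    finally have "modnorm \<phi> w2 N u < 1" by (rule \<delta>(2)[OF uM])
    moreover have "modnorm \<phi> w2 N u = (c1 * (s powr r0 * rnorm (pw w2 (test_functional X)))) powr (1 / r0)"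
      unfolding modnorm_eq[OF w(2) uM2] upw using rnorm_cmult[OF t2, of "s powr r0"] by simp
    moreover have "(c1 * (s powr r0 * (q * w2 X powr r0))) powr (1 / r0) \<le> (c1 * (s powr r0 * rnorm (pw w2 (test_functional X)))) powr (1 / r0)"
      using q(1) q(2)[rule_format, of X] t2 c1_pos r0 by (intro powr_mono2 mult_left_mono) auto
    moreover have "(c1 * (s powr r0 * (q * w2 X powr r0))) powr (1 / r0) = s * a2 * w2 X"
      unfolding a2_def by (rule root) (use s PE_pos[OF w(2), of X] in auto)
    ultimately have "s * a2 * w2 X < 1" by linarith
    then have "w2 X \<le> 1 / (s * a2)" using s a by (simp add: pos_le_divide_eq mult_ac)
    also have "1 / (s * a2) = 2 * a1 / (\<delta> * a2) * w1 X" using a \<delta> PE_pos[OF w(1), of X] by (simp add: s_def field_simps)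
    finally show "w2 X \<le> 2 * a1 / (\<delta> * a2) * w1 X" .
  qed
qed

lemma compact_imp_vanishing:
  assumes w: "PE w1" "PE w2" and V: "\<And>x. \<bar>v x\<bar> \<le> V"
    and i: "incl_compact (modsp \<phi> w1 B) (modnorm \<phi> w1 N) (modsp \<phi> w2 B) (modnorm \<phi> w2 N)"
  shows "((\<lambda>X. w2 X / w1 X) \<longlongrightarrow> 0) at_infinity"
proof (rule vanishing_ratio_of_compactness[OF w V], intro allI impI)
  fix F :: "nat \<Rightarrow> (real^'n \<Rightarrow> complex) \<Rightarrow> complex" and K
  assume F: "\<forall>n. F n \<in> Sigma1_dual \<and> pw w1 (F n) \<in> rspace \<and> rnorm (pw w1 (F n)) \<le> K"
  have sub: "modsp \<phi> w1 B \<subseteq> modsp \<phi> w2 B" using i by (simp add: incl_compact_def)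
  have FM: "F n \<in> modsp \<phi> w1 B" for n using F by (simp add: modsp_iff w)
  have FM2: "F n \<in> modsp \<phi> w2 B" for n using FM sub by blast
  have "modnorm \<phi> w1 N (F n) \<le> (c1 * K) powr (1 / r0)" for n
    unfolding modnorm_eq[OF w(1) FM] using F c1_pos r0 rnorm_nonneg by (intro powr_mono2 mult_left_mono) auto
  then obtain h :: "nat \<Rightarrow> nat" and g where h: "strict_mono h" "g \<in> modsp \<phi> w2 B"
    and l: "(\<lambda>n. modnorm \<phi> w2 N (\<lambda>x. F (h n) x - g x)) \<longlonglongrightarrow> 0"
    using i FM unfolding incl_compact_def by meson
  have dM: "(\<lambda>x. F (h n) x - g x) \<in> modsp \<phi> w2 B" for n by (rule modsp_diff[OF w(2) FM2 h(2)])
  have r: "0 \<le> rnorm (pw w2 (\<lambda>x. F (h n) x - g x))" for n using dM[of n] rnorm_nonneg by (simp add: modsp_iff w)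
  have u: "rnorm (pw w2 (\<lambda>x. F (h n) x - g x)) \<le> modnorm \<phi> w2 N (\<lambda>x. F (h n) x - g x) powr r0 / c1" for n
    by (rule rnorm_le_modnorm[OF w(2) dM order_refl])
  have "(\<lambda>n. modnorm \<phi> w2 N (\<lambda>x. F (h n) x - g x) powr r0 / c1) \<longlonglongrightarrow> 0 powr r0 / c1"
    by (intro tendsto_divide tendsto_powr' tendsto_const l) (use r0 c1_pos modnorm_eq[OF w(2) dM] in auto)
  then have "(\<lambda>n. modnorm \<phi> w2 N (\<lambda>x. F (h n) x - g x) powr r0 / c1) \<longlonglongrightarrow> 0" by simp
  then have "(\<lambda>n. rnorm (pw w2 (\<lambda>x. F (h n) x - g x))) \<longlonglongrightarrow> 0"
    by (rule tendsto_sandwich[OF always_eventually always_eventually tendsto_const, rotated 2]) (use r u in auto)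
  then show "(\<forall>n. pw w2 (F n) \<in> rspace) \<and>
      (\<exists>(h::nat \<Rightarrow> nat) g. strict_mono h \<and> g \<in> Sigma1_dual \<and> pw w2 g \<in> rspace \<and> (\<lambda>n. rnorm (pw w2 (\<lambda>x. F (h n) x - g x))) \<longlonglongrightarrow> 0)"
    using FM2 h by (auto simp: modsp_iff w)
qed

end

theorem theorem4p8:
  fixes B :: "((real^'n::finite) \<times> (real^'n) \<Rightarrow> complex) set"
    and N :: "((real^'n) \<times> (real^'n) \<Rightarrow> complex) \<Rightarrow> real"
    and r0 :: real
    and v0 w1 w2 :: "(real^'n) \<times> (real^'n) \<Rightarrow> real"
    and \<phi> :: "real^'n \<Rightarrow> complex"
  assumes r0: "0 < r0" "r0 \<le> 1"
    and B: "normal_QBF_space B N r0 v0"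
    and v0: "PE v0" "submultiplicative v0"
    and w: "PE w1" "PE w2"
    and \<phi>: "\<phi> \<in> Sigma1" "\<phi> \<noteq> (\<lambda>x. 0)"
  shows
    "((\<exists>c. \<forall>X. w2 X \<le> c * w1 X) \<longrightarrow>
        incl_continuous (modsp \<phi> w1 B) (modnorm \<phi> w1 N) (modsp \<phi> w2 B) (modnorm \<phi> w2 N))
   \<and> ((((\<lambda>X. w2 X / w1 X) \<longlongrightarrow> 0) at_infinity) \<longrightarrow>
        incl_compact (modsp \<phi> w1 B) (modnorm \<phi> w1 N) (modsp \<phi> w2 B) (modnorm \<phi> w2 N))
   \<and> ((\<exists>M. \<forall>X. v0 X \<le> M) \<longrightarrow>
        ((\<exists>c. \<forall>X. w2 X \<le> c * w1 X) \<longleftrightarrow>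
          incl_continuous (modsp \<phi> w1 B) (modnorm \<phi> w1 N) (modsp \<phi> w2 B) (modnorm \<phi> w2 N)))
   \<and> ((\<exists>M. \<forall>X. v0 X \<le> M) \<longrightarrow>
        ((((\<lambda>X. w2 X / w1 X) \<longlongrightarrow> 0) at_infinity) \<longleftrightarrow>
          incl_compact (modsp \<phi> w1 B) (modnorm \<phi> w1 N) (modsp \<phi> w2 B) (modnorm \<phi> w2 N)))"
proof -
  obtain B0 N0 where inv: "invariant_BF_space B0 N0 (\<lambda>x. v0 x powr r0)"
    and B': "B = {f. f \<in> borel_measurable lborel \<and> (\<lambda>x. complex_of_real (norm (f x) powr r0)) \<in> B0}"
    and N': "\<forall>f\<in>B. N f = N0 (\<lambda>x. complex_of_real (norm (f x) powr r0)) powr (1 / r0)"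
    using B unfolding normal_QBF_space_def by blast
  obtain D R where D: "1 \<le> D" "0 < R" "\<And>x y. v0 (x + y) \<le> D * exp (R * norm y) * v0 x"
    using PE_exp_moderate[OF v0(1)] by blast
  \<comment> \<open>Invariance of \<open>B0\<close> holds with respect to \<open>v0 powr r0\<close>,
    so this power plays the role of v in the locale.\<close>
  have vb: "\<bar>v0 x powr r0\<bar> \<le> (D * v0 0) powr r0 * exp (R * r0 * norm x)" for x
  proof -
    have "v0 x \<le> (D * v0 0) * exp (R * norm x)" using D(3)[of 0 x] by (simp add: mult_ac)
    then have "v0 x powr r0 \<le> ((D * v0 0) * exp (R * norm x)) powr r0"
      using PE_pos[OF v0(1), of x] r0 by (intro powr_mono2) auto
    also have "\<dots> = (D * v0 0) powr r0 * exp (R * norm x) powr r0" by (rule powr_mult)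
    also have "exp (R * norm x) powr r0 = exp (R * r0 * norm x)" by (simp add: powr_def mult_ac)
    finally show ?thesis by simp
  qed
  interpret modulation_space B0 N0 "\<lambda>x. v0 x powr r0" \<phi> r0 "(D * v0 0) powr r0" "R * r0" B N
    by unfold_locales (use inv \<phi> r0 vb D B' N' in auto)
  \<comment> \<open>A bound on v0 carries over to its r0-th power; the two converse implications
    consume it.\<close>
  have V: "\<bar>v0 x powr r0\<bar> \<le> M powr r0" if "\<forall>X. v0 X \<le> M" for M x
    using that[rule_format, of x] PE_pos[OF v0(1), of x] r0 by (simp add: powr_mono2 less_imp_le)
  show ?thesis
    using dominated_imp_continuous[OF w] vanishing_imp_compact[OF w] continuous_imp_dominated[OF w V] compact_imp_vanishing[OF w V]
    by blast
qed

end
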